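(* Suppose $\kappa$ is a regular uncountable cardinal, $A$ is a set of ordinals with $\kappa\le|A|$, $\xi<\kappa$, $\alpha<|A|^+$ and $\mathcal O\in\{{\mathcal I}_\sqsubset,{\mathcal R}am_\sqsubset\}$. If $P_\kappa A\in\mathcal O^{\alpha+1}(\Pi^1_\xi(\kappa,A))^+$, then for every $\beta\le\alpha$ and every set $X\in\mathcal O^\beta(\Pi^1_\xi(\kappa,A))^+$, the set $\{x\in P_\kappa A: X\cap P_{\kappa_x}x\in\mathcal O^{f_\beta(x)}(\Pi^1_\xi(\kappa_x,x))^+\}$ belongs to the filter $\mathcal O^{\beta+1}(\Pi^1_\xi(\kappa,A))^*$.
   Context: $P_\kappa A$ is the set of subsets of $A$ of size $<\kappa$; $\kappa_x=|x\cap\kappa|$; $x\sqsubset y$ means $x\subseteq y$ and $|x|<|y\cap\kappa|$. For an ideal $J$, $J^+$ is the collection of sets not in $J$ and $J^*$ the dual filter. An $(S,\sqsubset)$-list is $\langle S_x\subseteq P_{\kappa_x}x: x\in S\rangle$; $H\subseteq S$ is homogeneous for it if $x\sqsubset y$ in $H$ implies $S_x=S_y\cap P_{\kappa_x}x$. ${\mathcal I}_\sqsubset(I)$: $S$ is positive iff every $(S,\sqsubset)$-list has a homogeneous $H\subseteq S$ in $I^+$. $[S]^m_\sqsubset$ is the set of $\sqsubset$-increasing $m$-tuples from $S$ ($m\ge1$), $[S]^{<\omega}_\sqsubset$ their union; $f:[S]^{<\omega}_\sqsubset\to P_\kappa A$ is $\sqsubset$-regressive if $f(x_1,\dots,x_m)\sqsubset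 x_1$; $H$ is homogeneous for $f$ if $f\upharpoonright[H]^m_\sqsubset$ is constant for each $m$. ${\mathcal R}am_\sqsubset(I)$: $S$ is positive iff every $\sqsubset$-regressive $f:[S]^{<\omega}_\sqsubset\to P_\kappa A$ has a homogeneous $H\subseteq S$ in $I^+$. Iterates: $\mathcal O^0(I)=I$, $\mathcal O^{\gamma+1}(I)=\mathcal O(\mathcal O^\gamma(I))$, $\mathcal O^\gamma(I)=\bigcup_{\delta<\gamma}\mathcal O^\delta(I)$ for limit $\gamma$. $\Pi^1_\xi(\kappa,A)$ is the ideal of subsets of $P_\kappa A$ that are not $\Pi^1_\xi$-indescribable: $S$ is $\Pi^1_\xi$-indescribable if whenever $R\subseteq V_\kappa(\kappa,A)$ and $\varphi$ is a $\Pi^1_\xi$ sentence (Bagaria's hierarchy: $\Pi^1_0$ = no second-order quantifiers; $\Pi^1_{\zeta+1}$ = block of universal second-order quantifiers before a $\Sigma^1_\zeta$ formula, $\Sigma^1_{\zeta+1}$ dually; at limits $\Pi^1_\zeta$ = conjunctions $\bigwedge_{\eta<\zeta}\varphi_\eta$ of $\Pi^1_\eta$ formulas, $\Sigma^1_\zeta$ = disjunctions of $\Sigma^1_\eta$ formulas, with finitely many free second-order variables) with $(V_\kappa(\kappa,A),\in,R)\models\varphi$, some $x\in S$ has $x\cap\kappa=|x\cap\kappa|$ and $(V_{\kappa_x}(\kappa_x,x),\in,R\cap V_{\kappa_x}(\kappa_x,x))\models\varphi$; here $V_0(\kappa,A)=A$, $V_{\gamma+1}(\kappa,A)=P_\kappa(V_\gamma(\kappa,A))\cup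 V_\gamma(\kappa,A)$, unions at limits. The same definitions apply with $(\kappa_x,x)$ in place of $(\kappa,A)$. Canonical functions: for ordinal-valued $f,g$ on $P_\kappa A$, $f<g$ (resp. $f\le g$) iff $\{x:f(x)<g(x)\}$ (resp. $\le$) contains a club (club: $\subseteq$-unbounded and closed under unions of $\subseteq$-chains of length $<\kappa$); $\|f\|$ is the rank of $f$ in $<$; $f$ is canonical iff $\|f\|\le\|g\|$ implies $f\le g$ for all $g$. Fixed throughout is a sequence $\langle f_\alpha:\alpha<|A|^+\rangle$ of ordinal-valued functions on $P_\kappa A$ such that for each $\alpha$: $f_\alpha$ is canonical of rank $\alpha$; whenever $x\cap\kappa$ is regular uncountable, $f_\alpha\upharpoonright P_{x\cap\kappa}x$ is canonical on $P_{x\cap\kappa}x$ of rank $f_\alpha(x)$; and $\{x: f_\alpha(x)<|x|^+\}$ is club in $P_\kappa A$.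
   Formalization: A ⊏-regressive function need not satisfy f(x_1,…,x_m) ⊏ x_1 when x_1∩κ is empty; read literally, no function is regressive on a set containing ∅, every such set is vacuously Ramsey-positive, and the claim fails for Ram. *)

theory Defs
  imports Main
begin

unbundle cardinal_syntax

section \<open>A universe of hereditarily small sets\<close>

text \<open>
  The type \<open>'k hset\<close> is the structure of all sets that hereditarily have at most
  \<open>\<aleph>\<^sub>0 + |'k|\<close> elements, i.e. \<open>H(\<lambda>\<^sup>+)\<close> for \<open>\<lambda> = \<aleph>\<^sub>0 + |'k|\<close>, presented as well-founded trees
  modulo extensional equality. Since \<open>'k\<close> is an arbitrary type, every given cardinal
  and every given set of ordinals occurs in \<open>'k hset\<close> for a suitable \<open>'k\<close>.
  Collections of sets that may be larger than \<open>\<lambda>\<close> (such as the family of all small subsets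
  of a set, or an ideal on it) are represented by HOL sets of elements of \<open>'k hset\<close>.
\<close>

datatype 'k tree = Leaf | Node "nat + 'k \<Rightarrow> 'k tree"

primrec kids :: "'k tree \<Rightarrow> 'k tree set" where
  "kids Leaf = {}"
| "kids (Node f) = range f"

inductive ext_eq :: "'k tree \<Rightarrow> 'k tree \<Rightarrow> bool" where
  "\<lbrakk>\<forall>a\<in>kids s. \<exists>b\<in>kids t. ext_eq a b; \<forall>b\<in>kids t. \<exists>a\<in>kids s. ext_eq a b\<rbrakk> \<Longrightarrow> ext_eq s t"

lemma ext_eq_iff:
  "ext_eq s t \<longleftrightarrow> (\<forall>a\<in>kids s. \<exists>b\<in>kids t. ext_eq a b) \<and> (\<forall>b\<in>kids t. \<exists>a\<in>kids s. ext_eq a b)"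
  by (subst ext_eq.simps) auto

lemma ext_eq_refl: "ext_eq t t"
proof (induction t)
  case Leaf
  show ?case by (subst ext_eq_iff) simp
next
  case (Node f)
  then show ?case by (subst ext_eq_iff) auto
qed

lemma ext_eq_sym: "ext_eq s t \<Longrightarrow> ext_eq t s"
proof (induction rule: ext_eq.induct)
  case (1 s t)
  then show ?case by (subst ext_eq_iff) blast
qed

lemma ext_eq_trans: "ext_eq s t \<Longrightarrow> ext_eq t u \<Longrightarrow> ext_eq s u"
proof (induction arbitrary: u rule: ext_eq.induct)
  case (1 s t)
  have "(\<forall>b\<in>kids t. \<exists>c\<in>kids u. ext_eq b c) \<and> (\<forall>c\<in>kids u. \<exists>b\<in>kids t. ext_eq b c)"
    using "1.prems" by (subst (asm) ext_eq_iff)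
  with "1.IH" show ?case by (subst ext_eq_iff) meson
qed

quotient_type 'k hset = "'k tree" / ext_eq
proof (rule equivpI)
  show "reflp ext_eq" by (simp add: reflpI ext_eq_refl)
  show "symp ext_eq" by (simp add: sympI ext_eq_sym)
  show "transp ext_eq" by (meson transpI ext_eq_trans)
qed

definition elts :: "'k hset \<Rightarrow> 'k hset set" where
  "elts x = abs_hset ` kids (rep_hset x)"

definition small :: "'k hset set \<Rightarrow> bool" where
  "small X \<longleftrightarrow> |X| \<le>o |UNIV :: (nat + 'k) set|"

definition set_of :: "'k hset set \<Rightarrow> 'k hset" where
  "set_of X = (THE z. elts z = X)"

lemma abs_hset_eq_iff: "abs_hset s = abs_hset t \<longleftrightarrow> ext_eq s t"
  by (metis Quotient3_hset Quotient3_rel ext_eq_refl)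

lemma abs_rep_hset: "abs_hset (rep_hset x) = x"
  by (meson Quotient3_abs_rep Quotient3_hset)

lemma elts_abs_hset: "elts (abs_hset t) = abs_hset ` kids t"
proof -
  have "ext_eq (rep_hset (abs_hset t)) t"
    by (metis abs_hset_eq_iff abs_rep_hset)
  then have *: "\<forall>a\<in>kids (rep_hset (abs_hset t)). \<exists>b\<in>kids t. abs_hset a = abs_hset b"
    "\<forall>b\<in>kids t. \<exists>a\<in>kids (rep_hset (abs_hset t)). abs_hset a = abs_hset b"
    by (subst (asm) ext_eq_iff, simp add: abs_hset_eq_iff)+
  show ?thesis
    unfolding elts_def
  proof (intro equalityI image_subsetI)
    fix a assume "a \<in> kids (rep_hset (abs_hset t))"
    then show "abs_hset a \<in> abs_hset ` kids t" using *(1) by (metis imageI)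
  next
    fix b assume "b \<in> kids t"
    then show "abs_hset b \<in> abs_hset ` kids (rep_hset (abs_hset t))" using *(2) by (metis imageI)
  qed
qed

lemma hset_ext: "elts x = elts y \<Longrightarrow> x = y"
proof -
  assume "elts x = elts y"
  then have *: "abs_hset ` kids (rep_hset x) = abs_hset ` kids (rep_hset y)"
    by (simp add: elts_def)
  have "ext_eq (rep_hset x) (rep_hset y)"
  proof (subst ext_eq_iff, intro conjI ballI)
    fix a assume "a \<in> kids (rep_hset x)"
    then have "abs_hset a \<in> abs_hset ` kids (rep_hset y)" using * by blast
    then show "\<exists>b\<in>kids (rep_hset y). ext_eq a b" by (auto simp: abs_hset_eq_iff)
  next
    fix b assume "b \<in> kids (rep_hset y)"
    then have "abs_hset b \<in> abs_hset ` kids (rep_hset x)" using * by blast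
    then show "\<exists>a\<in>kids (rep_hset x). ext_eq a b"
      by (metis (no_types, lifting) abs_hset_eq_iff ext_eq_sym imageE)
  qed
  then show "x = y" by (metis abs_hset_eq_iff abs_rep_hset)
qed

lemma hset_induct:
  assumes "\<And>x. (\<And>y. y \<in> elts x \<Longrightarrow> P y) \<Longrightarrow> P x"
  shows "P x"
proof -
  have "P (abs_hset t)" for t
  proof (induction t)
    case Leaf
    show ?case by (rule assms) (simp add: elts_abs_hset)
  next
    case (Node f)
    have "P y" if "y \<in> elts (abs_hset (Node f))" for y
      using that Node by (auto simp: elts_abs_hset)
    then show ?case by (rule assms)
  qed
  then show ?thesis by (metis abs_rep_hset)
qed

lemma wf_elts: "wf {(a, b). a \<in> elts b}"
proof (rule wfUNIVI)
  fix P :: "'a hset \<Rightarrow> bool" and x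
  assume *: "\<forall>x. (\<forall>y. (y, x) \<in> {(a, b). a \<in> elts b} \<longrightarrow> P y) \<longrightarrow> P x"
  show "P x"
  proof (rule hset_induct)
    fix x :: "'a hset"
    assume "\<And>y. y \<in> elts x \<Longrightarrow> P y"
    with * show "P x" by simp
  qed
qed

lemma small_elts: "small (elts x)"
proof -
  have "|kids t| \<le>o |UNIV :: (nat + 'a) set|" for t :: "'a tree"
    by (cases t) (simp_all add: card_of_image card_of_empty)
  then show ?thesis
    unfolding small_def elts_def by (meson card_of_image ordLeq_transitive)
qed

lemma ex_elts_eq:
  fixes X :: "'k hset set"
  assumes "small X"
  shows "\<exists>z. elts z = X"
proof (cases "X = {}")
  case True
  then show ?thesis using elts_abs_hset[of Leaf] by auto
next
  case False
  then obtain f :: "nat + 'k \<Rightarrow> 'k hset" where f: "f ` UNIV = X"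
    using assms card_of_ordLeq2[of X UNIV] unfolding small_def by metis
  have "elts (abs_hset (Node (rep_hset \<circ> f))) = X"
    using f by (auto simp: elts_abs_hset abs_rep_hset image_image)
  then show ?thesis by blast
qed

lemma elts_set_of:
  assumes "small X"
  shows "elts (set_of X) = X"
proof -
  obtain z where z: "elts z = X" using ex_elts_eq[OF assms] ..
  then have "\<exists>!z. elts z = X" by (rule ex1I) (metis hset_ext z)
  then show ?thesis unfolding set_of_def by (rule theI'[where P = "\<lambda>z. elts z = X"])
qed

lemma elts_irrefl: "x \<notin> elts x"
  using wf_not_refl[OF wf_elts, of x] by simp

lemma elts_asym: "x \<in> elts y \<Longrightarrow> y \<notin> elts x"
  using wf_asym[OF wf_elts, of x y] by simp


section \<open>Ordinals and cardinals\<close>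

definition Ord :: "'k hset \<Rightarrow> bool" where
  "Ord \<alpha> \<longleftrightarrow> (\<forall>a\<in>elts \<alpha>. elts a \<subseteq> elts \<alpha>) \<and> (\<forall>a\<in>elts \<alpha>. \<forall>b\<in>elts a. elts b \<subseteq> elts a)"

definition succ :: "'k hset \<Rightarrow> 'k hset" where
  "succ \<alpha> = set_of (insert \<alpha> (elts \<alpha>))"

definition is_limit :: "'k hset \<Rightarrow> bool" where
  "is_limit \<gamma> \<longleftrightarrow> Ord \<gamma> \<and> elts \<gamma> \<noteq> {} \<and> (\<forall>\<delta>\<in>elts \<gamma>. succ \<delta> \<in> elts \<gamma>)"

text \<open>The non-strict order of an ordinal, for comparison with the cardinals of the library.\<close>

definition ord_rel :: "'k hset \<Rightarrow> 'k hset rel" where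
  "ord_rel \<alpha> = {(a, b). a \<in> elts \<alpha> \<and> b \<in> elts \<alpha> \<and> elts a \<subseteq> elts b}"

definition Cardinal :: "'k hset \<Rightarrow> bool" where
  "Cardinal \<kappa> \<longleftrightarrow> Ord \<kappa> \<and> Card_order (ord_rel \<kappa>)"

definition regular_uncountable :: "'k hset \<Rightarrow> bool" where
  "regular_uncountable \<kappa> \<longleftrightarrow> Cardinal \<kappa> \<and> regularCard (ord_rel \<kappa>) \<and> natLeq <o ord_rel \<kappa>"

definition hcard :: "'k hset set \<Rightarrow> 'k hset" where
  "hcard X = (THE \<mu>. Cardinal \<mu> \<and> |elts \<mu>| =o |X| )"

lemma elts_succ:
  fixes \<alpha> :: "'k hset"
  shows "elts (succ \<alpha>) = insert \<alpha> (elts \<alpha>)"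
proof -
  let ?U = "UNIV :: (nat + 'k) set"
  have "infinite ?U" by (simp add: finite_Plus_UNIV_iff)
  moreover have "|{\<alpha>}| \<le>o |?U|" by (rule card_of_singl_ordLeq) simp
  moreover have "|elts \<alpha>| \<le>o |?U|" using small_elts[of \<alpha>] by (simp add: small_def)
  ultimately have "|{\<alpha>} \<union> elts \<alpha>| \<le>o |?U|"
    by (intro card_of_Un_ordLeq_infinite_Field) (simp_all add: Field_card_of card_of_card_order_on)
  then have "small (insert \<alpha> (elts \<alpha>))" by (simp add: small_def)
  then show ?thesis unfolding succ_def by (rule elts_set_of)
qed

lemma succ_inject: "succ \<alpha> = succ \<beta> \<Longrightarrow> \<alpha> = \<beta>"
  by (metis elts_asym elts_succ insert_iff)

lemma Ord_elt: "Ord \<alpha> \<Longrightarrow> a \<in> elts \<alpha> \<Longrightarrow> Ord a"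
  unfolding Ord_def by blast

lemma Field_ord_rel: "Field (ord_rel \<alpha>) = elts \<alpha>"
  unfolding ord_rel_def Field_def by auto

lemma Ord_linear: "Ord \<alpha> \<Longrightarrow> Ord \<beta> \<Longrightarrow> \<alpha> \<in> elts \<beta> \<or> \<alpha> = \<beta> \<or> \<beta> \<in> elts \<alpha>"
proof (induction \<alpha> arbitrary: \<beta> rule: hset_induct)
  case (1 \<alpha>)
  note outer = "1.IH" and \<alpha> = "1.prems"(1)
  show ?case using "1.prems"(2)
  proof (induction \<beta> rule: hset_induct)
    case (1 \<beta>)
    show ?case
    proof (rule ccontr)
      assume neg: "\<not> ?thesis"
      have "a \<in> elts \<beta>" if "a \<in> elts \<alpha>" for a
        using outer[OF that Ord_elt[OF \<alpha> that] "1.prems"] neg that \<alpha> unfolding Ord_def by blast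
      moreover have "b \<in> elts \<alpha>" if "b \<in> elts \<beta>" for b
        using "1.IH"[OF that Ord_elt[OF "1.prems" that]] neg that "1.prems" unfolding Ord_def by blast
      ultimately have "\<alpha> = \<beta>" by (intro hset_ext) blast
      with neg show False by blast
    qed
  qed
qed

lemma Ord_subset_iff: "Ord \<alpha> \<Longrightarrow> Ord \<beta> \<Longrightarrow> elts \<alpha> \<subseteq> elts \<beta> \<longleftrightarrow> \<alpha> \<in> elts \<beta> \<or> \<alpha> = \<beta>"
  using Ord_linear[of \<alpha> \<beta>] elts_irrefl[of \<beta>] by (auto simp: Ord_def)

lemma Well_order_ord_rel:
  assumes "Ord \<alpha>"
  shows "Well_order (ord_rel \<alpha>)"
  unfolding well_order_on_def linear_order_on_def partial_order_on_def preorder_on_def Field_ord_rel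
proof (intro conjI)
  show "refl_on (elts \<alpha>) (ord_rel \<alpha>)" by (auto simp: refl_on_def ord_rel_def)
  show "ord_rel \<alpha> \<subseteq> elts \<alpha> \<times> elts \<alpha>" by (auto simp: ord_rel_def)
  show "trans (ord_rel \<alpha>)" by (rule transI) (auto simp: ord_rel_def)
  show "antisym (ord_rel \<alpha>)" by (rule antisymI) (auto simp: ord_rel_def intro: hset_ext)
  show "total_on (elts \<alpha>) (ord_rel \<alpha>)"
    using Ord_linear[OF Ord_elt[OF assms] Ord_elt[OF assms]] Ord_subset_iff[OF Ord_elt[OF assms] Ord_elt[OF assms]]
    unfolding total_on_def ord_rel_def by simp blast
  have "ord_rel \<alpha> - Id \<subseteq> {(a, b). a \<in> elts b}"
    using Ord_subset_iff Ord_elt[OF assms] by (auto simp: ord_rel_def)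
  then show "wf (ord_rel \<alpha> - Id)" using wf_elts wf_subset by blast
qed

lemma Cardinal_unique:
  assumes "Cardinal \<mu>" "Cardinal \<nu>" "|elts \<mu>| =o |elts \<nu>|"
  shows "\<mu> = \<nu>"
proof -
  have iso: "ord_rel \<rho> =o |elts \<rho>|" if "Cardinal \<rho>" for \<rho> :: "'a hset"
    using that card_of_Field_ordIso[of "ord_rel \<rho>"] ordIso_symmetric
    unfolding Cardinal_def Field_ord_rel by blast
  have *: "\<rho> \<notin> elts \<sigma>" if "Cardinal \<rho>" "Cardinal \<sigma>" "|elts \<rho>| =o |elts \<sigma>|" for \<rho> \<sigma> :: "'a hset"
  proof
    assume mem: "\<rho> \<in> elts \<sigma>"
    have wo: "Well_order (ord_rel \<sigma>)" using that Well_order_ord_rel unfolding Cardinal_def by blast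
    have "Ord \<sigma>" using that unfolding Cardinal_def by blast
    then have \<rho>: "Ord \<rho>" and sub: "elts \<rho> \<subseteq> elts \<sigma>"
      using mem Ord_elt by (auto simp: Ord_def)
    have "x \<in> elts \<rho> \<longleftrightarrow> x \<noteq> \<rho> \<and> elts x \<subseteq> elts \<rho>" if "x \<in> elts \<sigma>" for x
      using Ord_subset_iff[OF Ord_elt[OF \<open>Ord \<sigma>\<close> that] \<rho>] elts_irrefl[of \<rho>] by auto
    then have "elts \<rho> = underS (ord_rel \<sigma>) \<rho>"
      using mem sub by (auto simp: underS_def ord_rel_def)
    then have "|elts \<rho>| <o |Field (ord_rel \<sigma>)|"
      using card_of_underS[of "ord_rel \<sigma>" \<rho>] that mem
      unfolding Cardinal_def by (metis Field_ord_rel card_of_Field_ordIso ordIso_symmetric ordLess_ordIso_trans)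
    then show False
      using that(3) not_ordLess_ordIso unfolding Field_ord_rel by blast
  qed
  have "Ord \<mu>" "Ord \<nu>" using assms unfolding Cardinal_def by blast+
  then show ?thesis
    using Ord_linear *[OF assms] *[OF assms(2,1) ordIso_symmetric[OF assms(3)]] by blast
qed

lemma ex_Cardinal:
  fixes X :: "'k hset set"
  assumes "small X"
  shows "\<exists>\<mu> :: 'k hset. Cardinal \<mu> \<and> |elts \<mu>| =o |X|"
proof -
  let ?r = "|X|"
  have wo: "Well_order ?r" by (rule card_of_Well_order)
  have wfr: "wf (?r - Id)" using wo by (simp add: well_order_on_def)
  have fld: "Field ?r = X" by (rule Field_card_of)
  have wor: "wo_rel ?r" using wo by (simp add: wo_rel_def)
  have tr: "trans ?r" and asym: "antisym ?r"
    using wo_rel.TRANS[OF wor] wo_rel.ANTISYM[OF wor] .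
  have tot: "(a, b) \<in> ?r \<or> (b, a) \<in> ?r" if "a \<in> X" "b \<in> X" for a b
    using wo_rel.TOTALS[OF wor] that fld by simp
  define F :: "'k hset \<Rightarrow> 'k hset" where "F = wfrec (?r - Id) (\<lambda>F x. set_of (F ` underS ?r x))"
  have F0: "F x = set_of (F ` underS ?r x)" for x
  proof -
    have "F x = set_of (cut F (?r - Id) x ` underS ?r x)"
      unfolding F_def by (subst wfrec[OF wfr]) simp
    also have "cut F (?r - Id) x ` underS ?r x = F ` underS ?r x"
      by (rule image_cong) (auto simp: cut_def underS_def)
    finally show ?thesis .
  qed
  have sub: "underS ?r x \<subseteq> X" for x using fld by (auto simp: underS_def Field_def)
  have sm: "small (F ` Y)" if "Y \<subseteq> X" for Y
    unfolding small_def
    by (rule ordLeq_transitive[OF card_of_image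
          ordLeq_transitive[OF card_of_mono1[OF that] assms[unfolded small_def]]])
  have F: "elts (F x) = F ` underS ?r x" for x
    by (subst F0) (rule elts_set_of[OF sm[OF sub]])
  have uS: "underS ?r y \<subseteq> underS ?r x" if "y \<in> underS ?r x" for x y
    using that by (auto simp: underS_def intro: transD[OF tr] dest: antisymD[OF asym])
  have trF: "elts a \<subseteq> elts (F x)" if a: "a \<in> elts (F x)" for x a
  proof -
    obtain y where y: "y \<in> underS ?r x" "a = F y"
      using a unfolding F by (rule imageE)
    then show ?thesis using F[of x] F[of y] image_mono[OF uS[OF y(1)], of F] by simp
  qed
  define \<mu> where "\<mu> = set_of (F ` X)"
  have \<mu>: "elts \<mu> = F ` X" unfolding \<mu>_def by (rule elts_set_of[OF sm[OF order_refl]])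
  have ord: "Ord \<mu>"
    unfolding Ord_def \<mu>
  proof (intro conjI ballI)
    fix a assume "a \<in> F ` X"
    then obtain x where x: "a = F x" by blast
    show "elts a \<subseteq> F ` X" unfolding x F using sub by (rule image_mono)
    fix b assume "b \<in> elts a"
    then show "elts b \<subseteq> elts a" using trF x by simp
  qed
  have lt: "F a \<in> elts (F b)" if "a \<noteq> b" "(a, b) \<in> ?r" for a b
    using that F[of b] by (auto simp: underS_def)
  have inj: "inj_on F X"
  proof (rule inj_onI)
    fix a b assume "a \<in> X" "b \<in> X" and eq: "F a = F b"
    then show "a = b" using tot[of a b] lt[of a b] lt[of b a] elts_irrefl[of "F a"] by auto
  qed
  have iff: "(a, b) \<in> ?r \<longleftrightarrow> elts (F a) \<subseteq> elts (F b)" if "a \<in> X" "b \<in> X" for a b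
  proof
    assume "(a, b) \<in> ?r"
    then show "elts (F a) \<subseteq> elts (F b)" using lt[of a b] trF by (cases "a = b") auto
  next
    assume "elts (F a) \<subseteq> elts (F b)"
    then have "F b \<notin> elts (F a)" using elts_irrefl by auto
    then show "(a, b) \<in> ?r" using tot[OF that] lt[of b a] by auto
  qed
  have rX: "a \<in> X \<and> b \<in> X" if "(a, b) \<in> ?r" for a b
    using that fld by (auto simp: Field_def)
  have card: "|elts \<mu>| =o |X|"
    unfolding \<mu> by (rule ordIso_symmetric, rule card_of_ordIsoI[of F]) (simp add: inj bij_betw_def)
  have "ord_rel \<mu> = dir_image ?r F"
  proof (rule set_eqI, clarify)
    fix u v
    show "(u, v) \<in> ord_rel \<mu> \<longleftrightarrow> (u, v) \<in> dir_image ?r F"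
    proof
      assume "(u, v) \<in> ord_rel \<mu>"
      then obtain a b where "a \<in> X" "b \<in> X" "u = F a" "v = F b" "elts u \<subseteq> elts v"
        by (auto simp: ord_rel_def \<mu>)
      then show "(u, v) \<in> dir_image ?r F" using iff unfolding dir_image_def by blast
    next
      assume "(u, v) \<in> dir_image ?r F"
      then obtain a b where ab: "u = F a" "v = F b" "(a, b) \<in> ?r" by (auto simp: dir_image_def)
      then show "(u, v) \<in> ord_rel \<mu>" using iff[of a b] rX[OF ab(3)] by (auto simp: ord_rel_def \<mu>)
    qed
  qed
  moreover have "?r =o dir_image ?r F"
    by (rule dir_image_ordIso[OF wo]) (simp add: fld inj)
  ultimately have "Card_order (ord_rel \<mu>)"
    using Card_order_ordIso2[OF card_of_Card_order] by simp
  with ord card show ?thesis by (intro exI[of _ \<mu>]) (simp add: Cardinal_def)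
qed

lemma hcard:
  fixes X :: "'k hset set"
  assumes "small X"
  shows "Cardinal (hcard X)" "|elts (hcard X)| =o |X|"
proof -
  obtain \<mu> :: "'k hset" where \<mu>: "Cardinal \<mu>" "|elts \<mu>| =o |X|" using ex_Cardinal[OF assms] by blast
  have "hcard X = \<mu>"
    unfolding hcard_def
  proof (rule the_equality)
    show "Cardinal \<mu> \<and> |elts \<mu>| =o |X|" using \<mu> ..
    fix \<nu> :: "'k hset" assume "Cardinal \<nu> \<and> |elts \<nu>| =o |X|"
    then show "\<nu> = \<mu>"
      using Cardinal_unique \<mu>(1) ordIso_transitive[OF _ ordIso_symmetric[OF \<mu>(2)]] by blast
  qed
  with \<mu> show "Cardinal (hcard X)" "|elts (hcard X)| =o |X|" by auto
qed

text \<open>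
  Transfinite iteration of an operator on sets, with unions at limits. (At arguments that are
  not ordinals the value is irrelevant.)
\<close>

function iterate :: "'b set \<Rightarrow> ('b set \<Rightarrow> 'b set) \<Rightarrow> 'k hset \<Rightarrow> 'b set" where
  "iterate I F \<gamma> =
     (if elts \<gamma> = {} then I
      else if \<exists>\<delta>. \<gamma> = succ \<delta> then F (iterate I F (THE \<delta>. \<gamma> = succ \<delta>))
      else (\<Union>\<delta>\<in>elts \<gamma>. iterate I F \<delta>))"
  by auto
termination
proof (relation "inv_image {(a, b). a \<in> elts b} (\<lambda>(I, F, \<gamma>). \<gamma>)", goal_cases)
  case 1
  show ?case by (simp add: wf_elts)
next
  case (2 I F \<gamma>)
  then obtain \<delta> where "\<gamma> = succ \<delta>" by blast
  moreover from this have "(THE \<delta>. \<gamma> = succ \<delta>) = \<delta>"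
    by (intro the_equality) (auto dest: succ_inject)
  ultimately show ?case by (simp add: elts_succ)
next
  case (3 I F \<gamma> \<delta>)
  then show ?case by simp
qed

declare iterate.simps [simp del]

lemma iterate_0: "elts \<gamma> = {} \<Longrightarrow> iterate I F \<gamma> = I"
  by (subst iterate.simps) simp

lemma iterate_succ: "iterate I F (succ \<delta>) = F (iterate I F \<delta>)"
proof -
  have "(THE \<delta>'. succ \<delta> = succ \<delta>') = \<delta>"
    by (intro the_equality) (auto dest: succ_inject)
  then show ?thesis by (subst iterate.simps) (auto simp: elts_succ)
qed

lemma iterate_limit: "is_limit \<gamma> \<Longrightarrow> iterate I F \<gamma> = (\<Union>\<delta>\<in>elts \<gamma>. iterate I F \<delta>)"
  by (subst iterate.simps) (metis elts_irrefl elts_succ insertI1 is_limit_def)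


section \<open>Small subsets, clubs and canonical functions\<close>

definition Psub :: "'k hset \<Rightarrow> 'k hset set \<Rightarrow> 'k hset set" where
  "Psub \<kappa> X = {y. elts y \<subseteq> X \<and> |elts y| <o |elts \<kappa>| }"

abbreviation PP :: "'k hset \<Rightarrow> 'k hset \<Rightarrow> 'k hset set" where
  "PP \<kappa> A \<equiv> Psub \<kappa> (elts A)"

definition kap :: "'k hset \<Rightarrow> 'k hset \<Rightarrow> 'k hset" where
  "kap \<kappa> x = hcard (elts x \<inter> elts \<kappa>)"

definition sq_less :: "'k hset \<Rightarrow> 'k hset \<Rightarrow> 'k hset \<Rightarrow> bool" where
  "sq_less \<kappa> x y \<longleftrightarrow> elts x \<subseteq> elts y \<and> |elts x| <o |elts y \<inter> elts \<kappa>|"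

text \<open>Chains of length \<open>\<delta> < \<kappa>\<close> are increasing \<open>\<delta>\<close>-sequences, with \<open>\<delta> \<noteq> 0\<close>.\<close>

definition club :: "'k hset \<Rightarrow> 'k hset \<Rightarrow> 'k hset set \<Rightarrow> bool" where
  "club \<kappa> A C \<longleftrightarrow> C \<subseteq> PP \<kappa> A
     \<and> (\<forall>y\<in>PP \<kappa> A. \<exists>x\<in>C. elts y \<subseteq> elts x)
     \<and> (\<forall>\<delta>\<in>elts \<kappa>. \<forall>s. elts \<delta> \<noteq> {} \<and> (\<forall>i\<in>elts \<delta>. s i \<in> C)
           \<and> (\<forall>j\<in>elts \<delta>. \<forall>i\<in>elts j. elts (s i) \<subseteq> elts (s j))
           \<longrightarrow> set_of (\<Union>i\<in>elts \<delta>. elts (s i)) \<in> C)"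

definition ord_valued :: "'k hset \<Rightarrow> 'k hset \<Rightarrow> ('k hset \<Rightarrow> 'k hset) \<Rightarrow> bool" where
  "ord_valued \<kappa> A f \<longleftrightarrow> (\<forall>x\<in>PP \<kappa> A. Ord (f x))"

definition fun_less :: "'k hset \<Rightarrow> 'k hset \<Rightarrow> ('k hset \<Rightarrow> 'k hset) rel" where
  "fun_less \<kappa> A = {(f, g). ord_valued \<kappa> A f \<and> ord_valued \<kappa> A g
     \<and> (\<exists>C. club \<kappa> A C \<and> C \<subseteq> {x \<in> PP \<kappa> A. f x \<in> elts (g x)})}"

definition fun_le :: "'k hset \<Rightarrow> 'k hset \<Rightarrow> ('k hset \<Rightarrow> 'k hset) rel" where
  "fun_le \<kappa> A = {(f, g). ord_valued \<kappa> A f \<and> ord_valued \<kappa> A g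
     \<and> (\<exists>C. club \<kappa> A C \<and> C \<subseteq> {x \<in> PP \<kappa> A. elts (f x) \<subseteq> elts (g x)})}"

text \<open>
  The rank of \<open>x\<close> in a well-founded relation \<open>r\<close> on a type \<open>'a\<close> is the least ordinal above
  the ranks of all \<open>r\<close>-predecessors of \<open>x\<close>. All these ranks are below \<open>|'a|\<^sup>+\<close>, so they
  are represented in the well-order \<open>rank_ord = cardSuc |UNIV :: 'a set|\<close>, an element of it
  standing for the order type of the set of its strict predecessors.
\<close>

abbreviation rank_ord :: "'a set rel" where
  "rank_ord \<equiv> cardSuc |UNIV :: 'a set|"

definition rank :: "'a rel \<Rightarrow> 'a \<Rightarrow> 'a set" where
  "rank r = wfrec r (\<lambda>\<rho> x. wo_rel.suc rank_ord (\<rho> ` {y. (y, x) \<in> r}))"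

definition has_rank :: "'a rel \<Rightarrow> 'a \<Rightarrow> 'k hset \<Rightarrow> bool" where
  "has_rank r x \<alpha> \<longleftrightarrow> Ord \<alpha> \<and> Restr rank_ord (underS rank_ord (rank r x)) =o ord_rel \<alpha>"

text \<open>
  The competitors \<open>g\<close> take their values in the ordinals of \<open>'k hset\<close>. For functions \<open>f\<close> whose
  rank \<open>\<alpha>\<close> occurs in \<open>'k hset\<close> larger values make no difference: they can be truncated
  to \<open>\<alpha> + 1\<close>, without affecting \<open>\<parallel>f\<parallel> \<le> \<parallel>g\<parallel>\<close> or \<open>f \<le> g\<close>.
\<close>

definition canonical :: "'k hset \<Rightarrow> 'k hset \<Rightarrow> ('k hset \<Rightarrow> 'k hset) \<Rightarrow> bool" where
  "canonical \<kappa> A f \<longleftrightarrow> ord_valued \<kappa> A f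
     \<and> (\<forall>g. ord_valued \<kappa> A g
          \<and> (rank (fun_less \<kappa> A) f, rank (fun_less \<kappa> A) g) \<in> rank_ord
          \<longrightarrow> (f, g) \<in> fun_le \<kappa> A)"

definition lt_card_suc :: "'k hset \<Rightarrow> 'k hset \<Rightarrow> bool" where
  "lt_card_suc \<alpha> A \<longleftrightarrow> Ord \<alpha> \<and> ord_rel \<alpha> <o cardSuc |elts A|"

text \<open>
  The order and rank of functions on \<open>PP \<mu> x\<close> only depend on their values there,
  so restricting \<open>f \<alpha>\<close> to \<open>PP \<mu> x\<close> need not be made explicit.
\<close>

definition canonical_sequence :: "'k hset \<Rightarrow> 'k hset \<Rightarrow> ('k hset \<Rightarrow> 'k hset \<Rightarrow> 'k hset) \<Rightarrow> bool" where
  "canonical_sequence \<kappa> A f \<longleftrightarrow> (\<forall>\<alpha>. lt_card_suc \<alpha> A \<longrightarrow>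
     canonical \<kappa> A (f \<alpha>) \<and> has_rank (fun_less \<kappa> A) (f \<alpha>) \<alpha>
     \<and> (\<forall>x\<in>PP \<kappa> A. \<forall>\<mu>. regular_uncountable \<mu> \<and> elts \<mu> = elts x \<inter> elts \<kappa> \<longrightarrow>
          canonical \<mu> x (f \<alpha>) \<and> has_rank (fun_less \<mu> x) (f \<alpha>) (f \<alpha> x))
     \<and> club \<kappa> A {x \<in> PP \<kappa> A. lt_card_suc (f \<alpha> x) x})"


section \<open>Ideals and ideal operators\<close>

definition positive :: "'k hset \<Rightarrow> 'k hset \<Rightarrow> 'k hset set set \<Rightarrow> 'k hset set set" where
  "positive \<kappa> A J = {S. S \<subseteq> PP \<kappa> A \<and> S \<notin> J}"

definition dual :: "'k hset \<Rightarrow> 'k hset \<Rightarrow> 'k hset set set \<Rightarrow> 'k hset set set" where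
  "dual \<kappa> A J = {S. S \<subseteq> PP \<kappa> A \<and> PP \<kappa> A - S \<in> J}"

definition is_list :: "'k hset \<Rightarrow> 'k hset set \<Rightarrow> ('k hset \<Rightarrow> 'k hset set) \<Rightarrow> bool" where
  "is_list \<kappa> S L \<longleftrightarrow> (\<forall>x\<in>S. L x \<subseteq> PP (kap \<kappa> x) x)"

definition homogeneous_list :: "'k hset \<Rightarrow> ('k hset \<Rightarrow> 'k hset set) \<Rightarrow> 'k hset set \<Rightarrow> bool" where
  "homogeneous_list \<kappa> L H \<longleftrightarrow>
     (\<forall>x\<in>H. \<forall>y\<in>H. sq_less \<kappa> x y \<longrightarrow> L x = L y \<inter> PP (kap \<kappa> x) x)"

definition ineff_op :: "'k hset \<Rightarrow> 'k hset \<Rightarrow> 'k hset set set \<Rightarrow> 'k hset set set" where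
  "ineff_op \<kappa> A I = {S. S \<subseteq> PP \<kappa> A \<and>
     \<not> (\<forall>L. is_list \<kappa> S L \<longrightarrow> (\<exists>H\<in>positive \<kappa> A I. H \<subseteq> S \<and> homogeneous_list \<kappa> L H))}"

definition tuples :: "'k hset \<Rightarrow> 'k hset set \<Rightarrow> nat \<Rightarrow> 'k hset list set" where
  "tuples \<kappa> S m = {xs. length xs = m \<and> set xs \<subseteq> S \<and> sorted_wrt (sq_less \<kappa>) xs}"

text \<open>
  As usual for regressive functions, nothing is demanded of \<open>f\<close> at tuples whose first
  entry \<open>x\<^sub>1\<close> has no predecessor at all, i.e. satisfies \<open>x\<^sub>1 \<inter> \<kappa> = {}\<close>. Otherwise no
  set containing the empty set would carry a regressive function, and all these sets would be
  positive for trivial reasons.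
\<close>

definition regressive ::
    "'k hset \<Rightarrow> 'k hset \<Rightarrow> 'k hset set \<Rightarrow> ('k hset list \<Rightarrow> 'k hset) \<Rightarrow> bool" where
  "regressive \<kappa> A S f \<longleftrightarrow> (\<forall>m\<ge>1. \<forall>xs\<in>tuples \<kappa> S m.
     f xs \<in> PP \<kappa> A \<and> (elts (hd xs) \<inter> elts \<kappa> \<noteq> {} \<longrightarrow> sq_less \<kappa> (f xs) (hd xs)))"

definition homogeneous_fun :: "'k hset \<Rightarrow> ('k hset list \<Rightarrow> 'k hset) \<Rightarrow> 'k hset set \<Rightarrow> bool" where
  "homogeneous_fun \<kappa> f H \<longleftrightarrow> (\<forall>m\<ge>1. \<forall>xs\<in>tuples \<kappa> H m. \<forall>ys\<in>tuples \<kappa> H m. f xs = f ys)"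

definition ramsey_op :: "'k hset \<Rightarrow> 'k hset \<Rightarrow> 'k hset set set \<Rightarrow> 'k hset set set" where
  "ramsey_op \<kappa> A I = {S. S \<subseteq> PP \<kappa> A \<and>
     \<not> (\<forall>f. regressive \<kappa> A S f \<longrightarrow> (\<exists>H\<in>positive \<kappa> A I. H \<subseteq> S \<and> homogeneous_fun \<kappa> f H))}"


section \<open>Infinitary second-order formulas and indescribability\<close>

text \<open>First-order variables and (unary) second-order variables are both named by natural numbers.\<close>

datatype fo =
    Mem nat nat
  | Eq nat nat
  | Pred nat \<comment> \<open>the distinguished unary predicate \<open>R\<close>\<close>
  | In nat nat \<comment> \<open>\<open>In i j\<close>: the first-order variable \<open>i\<close> belongs to the second-order variable \<open>j\<close>\<close>
  | Neg fo
  | And fo fo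
  | All nat fo

datatype 'k so =
    FO fo
  | AllS nat "'k so"
  | ExS nat "'k so"
  | Conj "'k hset" "'k hset \<Rightarrow> 'k so" \<comment> \<open>\<open>Conj \<zeta> \<phi>\<close> is the conjunction of the \<open>\<phi> \<eta>\<close> for \<open>\<eta> \<in> elts \<zeta>\<close>\<close>
  | Disj "'k hset" "'k hset \<Rightarrow> 'k so"

primrec fo_fv :: "fo \<Rightarrow> nat set" where
  "fo_fv (Mem i j) = {i, j}"
| "fo_fv (Eq i j) = {i, j}"
| "fo_fv (Pred i) = {i}"
| "fo_fv (In i j) = {i}"
| "fo_fv (Neg \<phi>) = fo_fv \<phi>"
| "fo_fv (And \<phi> \<psi>) = fo_fv \<phi> \<union> fo_fv \<psi>"
| "fo_fv (All i \<phi>) = fo_fv \<phi> - {i}"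

primrec fo_fsv :: "fo \<Rightarrow> nat set" where
  "fo_fsv (Mem i j) = {}"
| "fo_fsv (Eq i j) = {}"
| "fo_fsv (Pred i) = {}"
| "fo_fsv (In i j) = {j}"
| "fo_fsv (Neg \<phi>) = fo_fsv \<phi>"
| "fo_fsv (And \<phi> \<psi>) = fo_fsv \<phi> \<union> fo_fsv \<psi>"
| "fo_fsv (All i \<phi>) = fo_fsv \<phi>"

primrec fv :: "'k so \<Rightarrow> nat set" where
  "fv (FO \<phi>) = fo_fv \<phi>"
| "fv (AllS j \<phi>) = fv \<phi>"
| "fv (ExS j \<phi>) = fv \<phi>"
| "fv (Conj \<zeta> \<phi>) = (\<Union>\<eta>\<in>elts \<zeta>. fv (\<phi> \<eta>))"
| "fv (Disj \<zeta> \<phi>) = (\<Union>\<eta>\<in>elts \<zeta>. fv (\<phi> \<eta>))"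

primrec fsv :: "'k so \<Rightarrow> nat set" where
  "fsv (FO \<phi>) = fo_fsv \<phi>"
| "fsv (AllS j \<phi>) = fsv \<phi> - {j}"
| "fsv (ExS j \<phi>) = fsv \<phi> - {j}"
| "fsv (Conj \<zeta> \<phi>) = (\<Union>\<eta>\<in>elts \<zeta>. fsv (\<phi> \<eta>))"
| "fsv (Disj \<zeta> \<phi>) = (\<Union>\<eta>\<in>elts \<zeta>. fsv (\<phi> \<eta>))"

definition sentence :: "'k so \<Rightarrow> bool" where
  "sentence \<phi> \<longleftrightarrow> fv \<phi> = {} \<and> fsv \<phi> = {}"

text \<open>Blocks \<open>js\<close> of quantifiers may be empty; vacuous quantifiers make this immaterial.\<close>

inductive is_Pi :: "'k hset \<Rightarrow> 'k so \<Rightarrow> bool" and is_Sigma :: "'k hset \<Rightarrow> 'k so \<Rightarrow> bool" where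
  Pi_0: "elts \<zeta> = {} \<Longrightarrow> is_Pi \<zeta> (FO \<phi>)"
| Sigma_0: "elts \<zeta> = {} \<Longrightarrow> is_Sigma \<zeta> (FO \<phi>)"
| Pi_succ: "is_Sigma \<zeta> \<phi> \<Longrightarrow> is_Pi (succ \<zeta>) (foldr AllS js \<phi>)"
| Sigma_succ: "is_Pi \<zeta> \<phi> \<Longrightarrow> is_Sigma (succ \<zeta>) (foldr ExS js \<phi>)"
| Pi_limit: "\<lbrakk>is_limit \<zeta>; \<forall>\<eta>\<in>elts \<zeta>. is_Pi \<eta> (\<phi> \<eta>); finite (fsv (Conj \<zeta> \<phi>))\<rbrakk>
    \<Longrightarrow> is_Pi \<zeta> (Conj \<zeta> \<phi>)"
| Sigma_limit: "\<lbrakk>is_limit \<zeta>; \<forall>\<eta>\<in>elts \<zeta>. is_Sigma \<eta> (\<phi> \<eta>); finite (fsv (Disj \<zeta> \<phi>))\<rbrakk>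
    \<Longrightarrow> is_Sigma \<zeta> (Disj \<zeta> \<phi>)"

primrec fo_sat ::
    "'k hset set \<Rightarrow> 'k hset set \<Rightarrow> (nat \<Rightarrow> 'k hset) \<Rightarrow> (nat \<Rightarrow> 'k hset set) \<Rightarrow> fo \<Rightarrow> bool" where
  "fo_sat M R e s (Mem i j) \<longleftrightarrow> e i \<in> elts (e j)"
| "fo_sat M R e s (Eq i j) \<longleftrightarrow> e i = e j"
| "fo_sat M R e s (Pred i) \<longleftrightarrow> e i \<in> R"
| "fo_sat M R e s (In i j) \<longleftrightarrow> e i \<in> s j"
| "fo_sat M R e s (Neg \<phi>) \<longleftrightarrow> \<not> fo_sat M R e s \<phi>"
| "fo_sat M R e s (And \<phi> \<psi>) \<longleftrightarrow> fo_sat M R e s \<phi> \<and> fo_sat M R e s \<psi>"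
| "fo_sat M R e s (All i \<phi>) \<longleftrightarrow> (\<forall>a\<in>M. fo_sat M R (e(i := a)) s \<phi>)"

primrec sat ::
    "'k hset set \<Rightarrow> 'k hset set \<Rightarrow> (nat \<Rightarrow> 'k hset) \<Rightarrow> 'k so \<Rightarrow> (nat \<Rightarrow> 'k hset set) \<Rightarrow> bool" where
  "sat M R e (FO \<phi>) = (\<lambda>s. fo_sat M R e s \<phi>)"
| "sat M R e (AllS j \<phi>) = (\<lambda>s. \<forall>X. X \<subseteq> M \<longrightarrow> sat M R e \<phi> (s(j := X)))"
| "sat M R e (ExS j \<phi>) = (\<lambda>s. \<exists>X. X \<subseteq> M \<and> sat M R e \<phi> (s(j := X)))"
| "sat M R e (Conj \<zeta> \<phi>) = (\<lambda>s. \<forall>\<eta>\<in>elts \<zeta>. sat M R e (\<phi> \<eta>) s)"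
| "sat M R e (Disj \<zeta> \<phi>) = (\<lambda>s. \<exists>\<eta>\<in>elts \<zeta>. sat M R e (\<phi> \<eta>) s)"

text \<open>Only used for sentences, whose truth value does not depend on the assignments.\<close>

definition models :: "'k hset set \<Rightarrow> 'k hset set \<Rightarrow> 'k so \<Rightarrow> bool" where
  "models M R \<phi> \<longleftrightarrow> (\<forall>e s. sat M R e \<phi> s)"

text \<open>\<open>VV \<kappa> A \<gamma>\<close> is \<open>V\<^sub>\<gamma>(\<kappa>, A)\<close>.\<close>

definition VV :: "'k hset \<Rightarrow> 'k hset \<Rightarrow> 'k hset \<Rightarrow> 'k hset set" where
  "VV \<kappa> A \<gamma> = iterate (elts A) (\<lambda>X. Psub \<kappa> X \<union> X) \<gamma>"

definition indescribable :: "'k hset \<Rightarrow> 'k hset \<Rightarrow> 'k hset \<Rightarrow> 'k hset set \<Rightarrow> bool" where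
  "indescribable \<xi> \<kappa> A S \<longleftrightarrow>
     (\<forall>R \<phi>. R \<subseteq> VV \<kappa> A \<kappa> \<and> is_Pi \<xi> \<phi> \<and> sentence \<phi> \<and> models (VV \<kappa> A \<kappa>) R \<phi> \<longrightarrow>
        (\<exists>x\<in>S. elts x \<inter> elts \<kappa> = elts (kap \<kappa> x) \<and>
           models (VV (kap \<kappa> x) x (kap \<kappa> x)) (R \<inter> VV (kap \<kappa> x) x (kap \<kappa> x)) \<phi>))"

definition Pi_ideal :: "'k hset \<Rightarrow> 'k hset \<Rightarrow> 'k hset \<Rightarrow> 'k hset set set" where
  "Pi_ideal \<xi> \<kappa> A = {S. S \<subseteq> PP \<kappa> A \<and> \<not> indescribable \<xi> \<kappa> A S}"

end

theory Submission
  imports Defs "HOL-Library.Nat_Bijection"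
begin

text \<open>
  A counterexample at every point \<open>x\<close> of a positive set \<open>S\<close> is an object living on the structure
  \<open>V\<^bsub>\<kappa>\<^sub>x\<^esub>(\<kappa>\<^sub>x, x)\<close>. Positivity of \<open>S\<close> for the operator makes these objects cohere on a smaller
  positive set \<open>H\<close>, so that they glue to one object on \<open>P\<^sub>\<kappa> A\<close>, whose behaviour contradicts
  the hypothesis on \<open>X\<close>. The theorem is proved by induction on \<open>\<beta>\<close>, always assuming that the set of
  \<open>x\<close> for which \<open>X\<close> fails to be positive at \<open>x\<close> is itself positive.

  For \<open>\<beta> = 0\<close> the objects are a predicate and a sentence failing to reflect in \<open>X\<close> below \<open>x\<close>. A
  sentence matters only through its meaning, and there are fewer than \<open>\<kappa>\<close> meanings, so it can be
  made constant. If the glued sentence holds on \<open>P\<^sub>\<kappa> A\<close> it reflects to a point of \<open>X\<close>; otherwise its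
  \<open>\<Sigma>\<close> negation reflects to a point of \<open>H\<close>. The latter uses that \<open>\<Pi>\<close> formulas of level \<open>\<zeta>\<close> embed into
  level \<open>\<zeta> + 1\<close>, which above limit levels holds only relative to extra parameters.

  At a successor the objects are lists (or regressive functions), the glued one has a homogeneous set
  \<open>Y \<subseteq> X\<close>, and the induction hypothesis makes \<open>Y\<close> positive at some \<open>x \<in> H\<close>.
  At a limit, canonicity gives \<open>f\<^sub>\<beta>(x) \<le> sup {f\<^bsub>e(a)\<^esub>(x) + 1 | a \<in> x}\<close> for any surjection \<open>e\<close> of \<open>A\<close> onto \<open>\<beta>\<close>;
  the ordinal \<open>a\<close> can be made constant, which reduces the claim to \<open>e(a) + 1 < \<beta>\<close>.
\<close>

section \<open>Ordinals and cardinals\<close>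

text \<open>Two obstacles shape the proof. The elements of \<open>A\<close> are atoms and ordinals
  at the same time, so the structures are not transitive: an ordinal of \<open>A\<close> may have
  elements outside. Only sets of size below \<kappa> are read correctly at a point, and the
  first-order coding works with finite sets. Moreover, indescribability speaks of one predicate and
  of sentences of one exact level. The data to be reflected (an assignment, a function, an infinite
  ordinal) are therefore packed into a single predicate, and first-order side conditions are pushed
  into the leaves of formulas.

  Closure of the local structure at \<open>x\<close> under a function on the whole structure is the
  uniform substitute for clubs: every club contains all points with a suitable closure, and
  regularity of \<open>kap \<kappa> x\<close> or the presence of a given element at \<open>x\<close>
  have the same form. Such conditions on \<open>x\<close> can be imposed at every stage of the
  iteration.

  Positivity of \<open>PP \<kappa> A\<close> implies its indescribability, from which the inclusion
  of \<kappa> in \<open>A\<close> and the well-foundedness of the order of functions on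
  \<open>PP \<kappa> A\<close> are derived.\<close>

lemma small_mono: "small Y \<Longrightarrow> X \<subseteq> Y \<Longrightarrow> small X"
  unfolding small_def by (rule ordLeq_transitive[OF card_of_mono1])

lemma infinite_UNIV_sum: "infinite (UNIV :: (nat + 'k) set)"
  by (simp add: finite_Plus_UNIV_iff)

lemma small_UN:
  fixes f :: "'k hset \<Rightarrow> 'k hset set"
  assumes "small I" "\<And>i. i \<in> I \<Longrightarrow> small (f i)"
  shows "small (\<Union>i\<in>I. f i)"
  unfolding small_def
  by (rule card_of_UNION_ordLeq_infinite[OF infinite_UNIV_sum]) (use assms in \<open>auto simp: small_def\<close>)

lemma small_countable: "small (range (f :: nat \<Rightarrow> 'k hset))"
proof -
  have "|range f| \<le>o |UNIV :: nat set|" by (rule card_of_image)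
  also have "|UNIV :: nat set| \<le>o |UNIV :: (nat + 'k) set|"
    by (rule card_of_ordLeqI[of Inl]) auto
  finally show ?thesis unfolding small_def .
qed

lemma finite_less_card:
  assumes "infinite B" "finite A" shows "|A| <o |B|"
  by (rule finite_ordLess_infinite) (use assms card_of_Well_order in \<open>auto simp: Field_card_of\<close>)

lemma small_finite: "finite X \<Longrightarrow> small (X :: 'k hset set)"
  unfolding small_def by (rule ordLess_imp_ordLeq[OF finite_less_card[OF infinite_UNIV_sum]])

lemma small_ordLeq: "|X| \<le>o |elts (a::'k hset)| \<Longrightarrow> small (X :: 'k hset set)"
  unfolding small_def by (rule ordLeq_transitive[OF _ small_elts[of a, unfolded small_def]])

lemma set_of_elts [simp]: "set_of (elts x) = x"
  by (rule hset_ext) (rule elts_set_of[OF small_elts])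

definition zero :: "'k hset" where "zero = set_of {}"

lemma elts_zero [simp]: "elts (zero :: 'k hset) = {}"
  unfolding zero_def by (rule elts_set_of) (simp add: small_finite)

lemma eq_zero: "elts x = {} \<Longrightarrow> x = zero"
  by (rule hset_ext) simp

lemma Ord_zero [simp]: "Ord zero" by (simp add: Ord_def)

lemma Ord_succ [simp]: "Ord \<alpha> \<Longrightarrow> Ord (succ \<alpha>)"
  unfolding Ord_def by (auto simp: elts_succ)

lemma Ord_succD: "Ord (succ \<alpha>) \<Longrightarrow> Ord \<alpha>"
  by (rule Ord_elt[of "succ \<alpha>"]) (auto simp: elts_succ)

lemma Ord_trans: "Ord c \<Longrightarrow> a \<in> elts b \<Longrightarrow> b \<in> elts c \<Longrightarrow> a \<in> elts c"
  unfolding Ord_def by blast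

lemma succ_neq_zero [simp]: "succ \<alpha> \<noteq> zero"
  by (metis elts_succ elts_zero insert_not_empty)

lemma zero_in_Ord: "Ord \<alpha> \<Longrightarrow> \<alpha> \<noteq> zero \<Longrightarrow> zero \<in> elts \<alpha>"
  using Ord_linear[of \<alpha> zero] by auto

lemma Ord_succ_mem: "Ord \<alpha> \<Longrightarrow> \<delta> \<in> elts \<alpha> \<Longrightarrow> succ \<delta> \<in> elts \<alpha> \<or> succ \<delta> = \<alpha>"
proof -
  assume a: "Ord \<alpha>" and d: "\<delta> \<in> elts \<alpha>"
  have "\<alpha> \<notin> elts (succ \<delta>)" using d elts_asym[OF d] elts_irrefl by (auto simp: elts_succ)
  then show ?thesis using Ord_linear[OF a Ord_succ[OF Ord_elt[OF a d]]] by auto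
qed

lemma is_limit_Ord: "is_limit \<gamma> \<Longrightarrow> Ord \<gamma>" by (simp add: is_limit_def)

lemma is_limit_not_zero: "is_limit \<gamma> \<Longrightarrow> \<gamma> \<noteq> zero" by (auto simp: is_limit_def)

lemma is_limit_not_succ: "is_limit \<gamma> \<Longrightarrow> \<gamma> \<noteq> succ \<delta>"
  by (metis elts_irrefl elts_succ insertI1 is_limit_def)

lemma is_limit_zero_in: "is_limit \<gamma> \<Longrightarrow> zero \<in> elts \<gamma>"
  using zero_in_Ord is_limit_Ord is_limit_not_zero by blast

lemma Ord_cases:
  assumes "Ord \<gamma>"
  obtains (0) "\<gamma> = zero" | (succ) \<delta> where "\<gamma> = succ \<delta>" "Ord \<delta>" | (limit) "is_limit \<gamma>"
proof -
  have "is_limit \<gamma>" if "\<gamma> \<noteq> zero" "\<nexists>\<delta>. \<gamma> = succ \<delta>"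
    unfolding is_limit_def
    using assms that Ord_succ_mem eq_zero by blast
  then show thesis using that assms Ord_succD by blast
qed

lemma Ord_induct3 [consumes 1, case_names 0 succ limit]:
  assumes "Ord \<gamma>"
    and "P zero" "\<And>\<delta>. Ord \<delta> \<Longrightarrow> P \<delta> \<Longrightarrow> P (succ \<delta>)"
    and "\<And>\<gamma>. is_limit \<gamma> \<Longrightarrow> (\<And>\<delta>. \<delta> \<in> elts \<gamma> \<Longrightarrow> P \<delta>) \<Longrightarrow> P \<gamma>"
  shows "P \<gamma>"
  using assms(1)
proof (induction \<gamma> rule: hset_induct)
  case (1 x)
  note IH = "1.IH"
  show ?case using "1.prems"
  proof (cases rule: Ord_cases)
    case (succ \<delta>)
    then show ?thesis using IH assms(3)[of \<delta>] by (auto simp: elts_succ)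
  next
    case limit
    then show ?thesis using IH assms(4)[of x] Ord_elt is_limit_Ord by blast
  qed (use assms(2) in simp)
qed

lemma Card_of_Cardinal: "Cardinal \<mu> \<Longrightarrow> ord_rel \<mu> =o |elts \<mu>|"
  using card_of_Field_ordIso[of "ord_rel \<mu>"] ordIso_symmetric
  unfolding Cardinal_def Field_ord_rel by blast

lemma underS_ord_rel:
  assumes "Ord \<sigma>" "\<rho> \<in> elts \<sigma>"
  shows "underS (ord_rel \<sigma>) \<rho> = elts \<rho>"
proof -
  have \<rho>: "Ord \<rho>" and sub: "elts \<rho> \<subseteq> elts \<sigma>"
    using assms Ord_elt by (auto simp: Ord_def)
  have "x \<in> elts \<rho> \<longleftrightarrow> x \<noteq> \<rho> \<and> elts x \<subseteq> elts \<rho>" if "x \<in> elts \<sigma>" for x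
    using Ord_subset_iff[OF Ord_elt[OF \<open>Ord \<sigma>\<close> that] \<rho>] elts_irrefl[of \<rho>] by auto
  then show ?thesis
    using assms(2) sub by (auto simp: underS_def ord_rel_def)
qed

lemma Cardinal_lessI:
  assumes "Cardinal \<mu>" "a \<in> elts \<mu>"
  shows "|elts a| <o |elts \<mu>|"
proof -
  have "|elts a| <o ord_rel \<mu>"
    using card_of_underS[of "ord_rel \<mu>" a] assms underS_ord_rel[of \<mu> a]
    unfolding Cardinal_def by (simp add: Field_ord_rel)
  then show ?thesis using Card_of_Cardinal[OF assms(1)] by (rule ordLess_ordIso_trans)
qed

lemma Cardinal_lessD:
  assumes "Cardinal \<mu>" "Ord u" "|elts u| <o |elts \<mu>|"
  shows "u \<in> elts \<mu>"
proof (rule ccontr)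
  assume "u \<notin> elts \<mu>"
  then have "elts \<mu> \<subseteq> elts u"
    using Ord_linear[of u \<mu>] assms unfolding Cardinal_def Ord_def by blast
  then show False using assms(3) card_of_mono1 not_ordLess_ordLeq by blast
qed

lemma Cardinal_Ord: "Cardinal \<mu> \<Longrightarrow> Ord \<mu>" by (simp add: Cardinal_def)

lemma Cardinal_is_limit:
  assumes "Cardinal \<mu>" "infinite (elts \<mu>)"
  shows "is_limit \<mu>"
proof -
  have "succ a \<in> elts \<mu>" if "a \<in> elts \<mu>" for a
  proof (rule Cardinal_lessD[OF assms(1)])
    show "Ord (succ a)" using that assms Cardinal_Ord Ord_elt Ord_succ by blast
    have "|{a} \<union> elts a| <o |elts \<mu>|"
      by (rule card_of_Un_ordLess_infinite[OF assms(2)])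
        (simp_all add: finite_less_card assms Cardinal_lessI that)
    then show "|elts (succ a)| <o |elts \<mu>|" by (simp add: elts_succ)
  qed
  then show ?thesis unfolding is_limit_def using assms Cardinal_Ord by auto
qed

lemma Cardinal_kap: "Cardinal (kap \<kappa> x)" "|elts (kap \<kappa> x)| =o |elts x \<inter> elts \<kappa>|"
  unfolding kap_def by (rule hcard, rule small_mono[OF small_elts[of x]], simp)+

lemma regularCard_bounded:
  assumes "Cardinal \<mu>" "regularCard (ord_rel \<mu>)" "u \<subseteq> elts \<mu>" "|u| <o |elts \<mu>|"
    and "infinite (elts \<mu>)"
  shows "\<exists>b\<in>elts \<mu>. u \<subseteq> elts b"
proof -
  have O: "Ord \<mu>" using assms Cardinal_Ord by blast
  have "\<not> |u| =o ord_rel \<mu>"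
    using not_ordLess_ordIso[OF assms(4)] ordIso_transitive[OF _ Card_of_Cardinal[OF assms(1)], of "|u|"] by blast
  then have "\<not> cofinal u (ord_rel \<mu>)" using assms unfolding regularCard_def by (auto simp: Field_ord_rel)
  then obtain a where a: "a \<in> elts \<mu>" "\<And>b. b \<in> u \<Longrightarrow> a = b \<or> (a, b) \<notin> ord_rel \<mu>"
    unfolding cofinal_def Field_ord_rel by blast
  have "b \<in> elts (succ a)" if "b \<in> u" for b
  proof -
    have b: "b \<in> elts \<mu>" using that assms by blast
    have "a \<notin> elts b"
    proof
      assume "a \<in> elts b"
      then have "(a, b) \<in> ord_rel \<mu>" "a \<noteq> b" using a(1) b Ord_elt[OF O b] elts_irrefl[of b] 
        unfolding ord_rel_def Ord_def by auto
      then show False using a(2)[OF that] by blast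
    qed
    then show ?thesis using Ord_linear[OF Ord_elt[OF O a(1)] Ord_elt[OF O b]] by (auto simp: elts_succ)
  qed
  moreover have "succ a \<in> elts \<mu>"
    using Cardinal_is_limit[OF assms(1) assms(5)] a(1) by (simp add: is_limit_def)
  ultimately show ?thesis by blast
qed

lemma regularCardI:
  assumes "Cardinal \<mu>" "\<And>u. u \<subseteq> elts \<mu> \<Longrightarrow> |u| <o |elts \<mu>| \<Longrightarrow> \<exists>b\<in>elts \<mu>. u \<subseteq> elts b"
  shows "regularCard (ord_rel \<mu>)"
  unfolding regularCard_def Field_ord_rel
proof (intro allI impI)
  fix K assume K: "K \<subseteq> elts \<mu> \<and> cofinal K (ord_rel \<mu>)"
  have "\<not> |K| <o |elts \<mu>|"
  proof
    assume "|K| <o |elts \<mu>|"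
    then obtain b where b: "b \<in> elts \<mu>" "K \<subseteq> elts b" using assms(2)[of K] K by blast
    then obtain c where c: "c \<in> K" "(b, c) \<in> ord_rel \<mu>"
      using K unfolding cofinal_def Field_ord_rel by blast
    then have "elts b \<subseteq> elts c" "c \<in> elts b" using b by (auto simp: ord_rel_def)
    then show False using elts_irrefl by blast
  qed
  moreover have "|K| \<le>o |elts \<mu>|" using K card_of_mono1 by blast
  ultimately have "|K| =o |elts \<mu>|" using ordLeq_iff_ordLess_or_ordIso by blast
  then show "|K| =o ord_rel \<mu>"
    by (rule ordIso_transitive[OF _ ordIso_symmetric[OF Card_of_Cardinal[OF assms(1)]]])
qed

section \<open>The cumulative hierarchy over a set of ordinals\<close>

lemma VV_zero: "VV \<mu> B zero = elts B"
  unfolding VV_def by (rule iterate_0) simp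

lemma VV_succ: "VV \<mu> B (succ \<delta>) = Psub \<mu> (VV \<mu> B \<delta>) \<union> VV \<mu> B \<delta>"
  unfolding VV_def by (rule iterate_succ)

lemma VV_limit: "is_limit \<gamma> \<Longrightarrow> VV \<mu> B \<gamma> = (\<Union>\<delta>\<in>elts \<gamma>. VV \<mu> B \<delta>)"
  unfolding VV_def by (rule iterate_limit)

text \<open>The hierarchy is cumulative with the elements of \<open>B\<close> at the bottom, so
  membership reduces to one strictly smaller stage. This replaces the three-way recursion by
  inductions along \<open>elts \<gamma>\<close>.\<close>

lemma VV_iff:
  "Ord \<gamma> \<Longrightarrow> u \<in> VV \<mu> B \<gamma> \<longleftrightarrow> u \<in> elts B \<or> (\<exists>\<delta>\<in>elts \<gamma>. u \<in> Psub \<mu> (VV \<mu> B \<delta>))"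
proof (induction \<gamma> rule: Ord_induct3)
  case (limit \<gamma>)
  show ?case
  proof
    assume "u \<in> VV \<mu> B \<gamma>"
    then obtain \<delta> where d: "\<delta> \<in> elts \<gamma>" "u \<in> VV \<mu> B \<delta>" using VV_limit[OF limit(1)] by blast
    then show "u \<in> elts B \<or> (\<exists>\<delta>\<in>elts \<gamma>. u \<in> Psub \<mu> (VV \<mu> B \<delta>))"
      using limit(2)[OF d(1)] Ord_trans[OF is_limit_Ord[OF limit(1)] _ d(1)] by blast
  next
    assume "u \<in> elts B \<or> (\<exists>\<delta>\<in>elts \<gamma>. u \<in> Psub \<mu> (VV \<mu> B \<delta>))"
    then show "u \<in> VV \<mu> B \<gamma>"
    proof
      assume "u \<in> elts B"
      then show ?thesis using VV_limit[OF limit(1)] is_limit_zero_in[OF limit(1)] VV_zero by blast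
    next
      assume "\<exists>\<delta>\<in>elts \<gamma>. u \<in> Psub \<mu> (VV \<mu> B \<delta>)"
      then obtain \<delta> where d: "\<delta> \<in> elts \<gamma>" "u \<in> Psub \<mu> (VV \<mu> B \<delta>)" by blast
      then have "u \<in> VV \<mu> B (succ \<delta>)" by (simp add: VV_succ)
      moreover have "succ \<delta> \<in> elts \<gamma>" using limit(1) d(1) by (simp add: is_limit_def)
      ultimately show ?thesis using VV_limit[OF limit(1)] by blast
    qed
  qed
qed (auto simp: VV_zero VV_succ elts_succ)

lemma Psub_mono:
  assumes "X \<subseteq> Y" "|elts \<mu>| \<le>o |elts \<mu>'|"
  shows "Psub \<mu> X \<subseteq> Psub \<mu>' Y"
  unfolding Psub_def by (auto intro: subsetD[OF assms(1)] ordLess_ordLeq_trans[OF _ assms(2)])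

text \<open>All three parameters grow at once, because the passage from a point to a larger one
  changes the base, the cardinal and the height of the local structure together.\<close>

lemma VV_mono:
  assumes "elts B \<subseteq> elts B'" "|elts \<mu>| \<le>o |elts \<mu>'|"
  shows "Ord \<gamma> \<Longrightarrow> Ord \<gamma>' \<Longrightarrow> elts \<gamma> \<subseteq> elts \<gamma>' \<Longrightarrow> VV \<mu> B \<gamma> \<subseteq> VV \<mu>' B' \<gamma>'"
proof (induction \<gamma> arbitrary: \<gamma>' rule: hset_induct)
  case (1 \<gamma>)
  show ?case
  proof
    fix u assume "u \<in> VV \<mu> B \<gamma>"
    then consider "u \<in> elts B" | \<delta> where "\<delta> \<in> elts \<gamma>" "u \<in> Psub \<mu> (VV \<mu> B \<delta>)"
      using VV_iff[OF 1(2)] by blast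
    then show "u \<in> VV \<mu>' B' \<gamma>'"
    proof cases
      case 1
      then show ?thesis using VV_iff[OF \<open>Ord \<gamma>'\<close>] assms(1) by blast
    next
      case 2
      then have "\<delta> \<in> elts \<gamma>'" "Ord \<delta>" using 1 Ord_elt by blast+
      then show ?thesis using VV_iff[OF \<open>Ord \<gamma>'\<close>] 2(2) 1(1)[OF 2(1) \<open>Ord \<delta>\<close> \<open>Ord \<delta>\<close>] 
          Psub_mono[OF _ assms(2)] by blast
    qed
  qed
qed

text \<open>The conditions on \<open>(\<kappa>, A)\<close> that pass to
  \<open>(kap \<kappa> x, x)\<close> at every point with \<open>gd \<kappa> A x\<close> (see
  \<open>gd_world\<close>). Regularity is left to \<open>nice\<close>, since for
  \<open>kap \<kappa> x\<close> it takes a further reflection.\<close>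

definition world :: "'k hset \<Rightarrow> 'k hset \<Rightarrow> bool" where
  "world \<mu> B \<longleftrightarrow> Cardinal \<mu> \<and> |UNIV :: nat set| <o |elts \<mu>| \<and> elts \<mu> \<subseteq> elts B \<and> (\<forall>a\<in>elts B. Ord a)"

abbreviation WW :: "'k hset \<Rightarrow> 'k hset \<Rightarrow> 'k hset set" where
  "WW \<mu> B \<equiv> VV \<mu> B \<mu>"

lemma infinite_if_uncountable: "|UNIV :: nat set| <o |X| \<Longrightarrow> infinite X"
  unfolding infinite_iff_card_of_nat by (rule ordLess_imp_ordLeq)

lemma world_inf: "world \<mu> B \<Longrightarrow> infinite (elts \<mu>)"
  unfolding world_def using infinite_if_uncountable by blast

lemma world_limit: "world \<mu> B \<Longrightarrow> is_limit \<mu>"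
  using world_inf Cardinal_is_limit unfolding world_def by blast

lemma world_Ord: "world \<mu> B \<Longrightarrow> Ord \<mu>"
  by (simp add: world_def Cardinal_Ord)

lemma WW_iff: "world \<mu> B \<Longrightarrow> u \<in> WW \<mu> B \<longleftrightarrow> u \<in> elts B \<or> (\<exists>\<delta>\<in>elts \<mu>. u \<in> Psub \<mu> (VV \<mu> B \<delta>))"
  by (rule VV_iff[OF world_Ord])

lemma VV_stage_mono: "Ord \<gamma> \<Longrightarrow> \<delta> \<in> elts \<gamma> \<Longrightarrow> VV \<mu> B \<delta> \<subseteq> VV \<mu> B \<gamma>"
  by (rule VV_mono[OF order_refl ordIso_imp_ordLeq[OF card_of_refl]]) (simp_all add: Ord_elt, simp add: Ord_def)

lemma WW_subI: "world \<mu> B \<Longrightarrow> \<delta> \<in> elts \<mu> \<Longrightarrow> u \<in> Psub \<mu> (VV \<mu> B \<delta>) \<Longrightarrow> u \<in> WW \<mu> B"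
  by (subst WW_iff) auto

lemma WW_PP: "world \<mu> B \<Longrightarrow> PP \<mu> B \<subseteq> WW \<mu> B"
  using WW_subI[OF _ is_limit_zero_in[OF world_limit], of \<mu> B B] by (auto simp: VV_zero)

lemma WW_base: "world \<mu> B \<Longrightarrow> elts B \<subseteq> WW \<mu> B"
  by (auto simp: WW_iff)

text \<open>An element of \<open>B\<close> is an ordinal used as an atom, and its own elements may
  lie outside the structure. Arguments by transitivity have to treat the two kinds of elements
  separately.\<close>

lemma WW_cases:
  assumes "world \<mu> B" "u \<in> WW \<mu> B"
  obtains "u \<in> elts B" "Ord u" | "elts u \<subseteq> WW \<mu> B" "|elts u| <o |elts \<mu>|"
proof (cases "u \<in> elts B")
  case True
  then show ?thesis using that assms unfolding world_def by blast
next
  case False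
  then obtain \<delta> where d: "\<delta> \<in> elts \<mu>" "u \<in> Psub \<mu> (VV \<mu> B \<delta>)" using WW_iff[OF assms(1), of u] assms(2) by blast
  then show ?thesis using that(2) VV_stage_mono[OF world_Ord[OF assms(1)] d(1)] unfolding Psub_def by blast
qed

lemma WW_stage:
  assumes "world \<mu> B" "v \<in> WW \<mu> B"
  shows "\<exists>\<delta>\<in>elts \<mu>. v \<in> VV \<mu> B \<delta>"
  using VV_limit[OF world_limit[OF assms(1)]] assms(2) by blast

lemma WW_finite_stage:
  assumes "world \<mu> B"
  shows "finite X \<Longrightarrow> X \<subseteq> WW \<mu> B \<Longrightarrow> \<exists>\<delta>\<in>elts \<mu>. X \<subseteq> VV \<mu> B \<delta>"
proof (induction X rule: finite_induct)
  case empty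
  then show ?case using world_inf[OF assms] by (metis empty_subsetI ex_in_conv finite.emptyI)
next
  case (insert v X)
  note O = world_Ord[OF assms]
  obtain a b where ab: "a \<in> elts \<mu>" "X \<subseteq> VV \<mu> B a" "b \<in> elts \<mu>" "v \<in> VV \<mu> B b"
    using insert WW_stage[OF assms, of v] by auto
  have "a \<in> elts b \<or> a = b \<or> b \<in> elts a" using Ord_linear Ord_elt[OF O] ab by blast
  then have "insert v X \<subseteq> VV \<mu> B a \<or> insert v X \<subseteq> VV \<mu> B b"
    using ab VV_stage_mono[OF Ord_elt[OF O ab(1)], of b] VV_stage_mono[OF Ord_elt[OF O ab(3)], of a] by blast
  then show ?case using ab by blast
qed

lemma WW_finite:
  assumes "world \<mu> B" "finite X" "X \<subseteq> WW \<mu> B"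
  shows "set_of X \<in> WW \<mu> B" "elts (set_of X) = X"
proof -
  show e: "elts (set_of X) = X" by (rule elts_set_of[OF small_finite[OF assms(2)]])
  obtain \<delta> where d: "\<delta> \<in> elts \<mu>" "X \<subseteq> VV \<mu> B \<delta>" using WW_finite_stage[OF assms] by blast
  then have "set_of X \<in> Psub \<mu> (VV \<mu> B \<delta>)"
    unfolding Psub_def using e finite_less_card[OF world_inf[OF assms(1)] assms(2)] by simp
  then show "set_of X \<in> WW \<mu> B" by (rule WW_subI[OF assms(1) d(1)])
qed

lemma world_trans: "world \<mu> B \<Longrightarrow> u \<in> elts \<mu> \<Longrightarrow> elts u \<subseteq> elts \<mu>"
  using world_Ord unfolding Ord_def by blast

lemma WW_small_sub:
  assumes "world \<mu> B" "u \<in> WW \<mu> B" "|elts u| <o |elts \<mu>|"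
  shows "elts u \<subseteq> WW \<mu> B"
  using assms(1,2)
proof (cases rule: WW_cases)
  case 1
  then have "u \<in> elts \<mu>" using Cardinal_lessD assms unfolding world_def by blast
  then have "elts u \<subseteq> elts B" using world_trans[OF assms(1)] assms(1) unfolding world_def by blast
  then show ?thesis using WW_base[OF assms(1)] by blast
qed

text \<open>An ordinal of \<open>B\<close> that is not below \<mu> contains all of \<mu>, hence
  infinitely many elements of the structure. If only finitely many of its elements are visible, it
  is below \<mu>, and then all its elements are in \<open>B\<close>. So finite sets are recognised
  correctly in spite of the missing transitivity.\<close>

lemma WW_fin:
  assumes "world \<mu> B" "u \<in> WW \<mu> B" "finite (elts u \<inter> WW \<mu> B)"
  shows "elts u \<subseteq> WW \<mu> B"
  using assms(1,2)
proof (cases rule: WW_cases)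
  case 1
  have "\<not> elts \<mu> \<subseteq> elts u"
  proof
    assume "elts \<mu> \<subseteq> elts u"
    then have "elts \<mu> \<subseteq> elts u \<inter> WW \<mu> B" using WW_base[OF assms(1)] assms(1) unfolding world_def by blast
    then show False using assms(3) world_inf[OF assms(1)] finite_subset by blast
  qed
  then have "u \<in> elts \<mu>" using Ord_linear[OF 1(2) world_Ord[OF assms(1)]] 1(2) unfolding Ord_def by blast
  then have "elts u \<subseteq> elts B" using world_trans[OF assms(1)] assms(1) unfolding world_def by blast
  then show ?thesis using WW_base[OF assms(1)] by blast
qed

lemma WW_regular:
  assumes "world \<mu> B" "regularCard (ord_rel \<mu>)" "elts u \<subseteq> WW \<mu> B" "|elts u| <o |elts \<mu>|"
  shows "u \<in> WW \<mu> B"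
proof -
  have "\<forall>v\<in>elts u. \<exists>\<delta>\<in>elts \<mu>. v \<in> VV \<mu> B \<delta>" using WW_stage[OF assms(1)] assms(3) by blast
  then obtain d where d: "\<And>v. v \<in> elts u \<Longrightarrow> d v \<in> elts \<mu> \<and> v \<in> VV \<mu> B (d v)" by metis
  have "|d ` elts u| <o |elts \<mu>|" by (rule ordLeq_ordLess_trans[OF card_of_image assms(4)])
  then obtain b where b: "b \<in> elts \<mu>" "d ` elts u \<subseteq> elts b"
    using regularCard_bounded[OF _ assms(2), of "d ` elts u"] d world_inf[OF assms(1)] assms(1)
    unfolding world_def by blast
  have "elts u \<subseteq> VV \<mu> B b"
    using d b VV_stage_mono[OF Ord_elt[OF world_Ord[OF assms(1)] b(1)]] by blast
  then show ?thesis by (intro WW_subI[OF assms(1) b(1)]) (simp add: Psub_def assms(4))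
qed

section \<open>The local structure at a point\<close>

abbreviation MM :: "'k hset \<Rightarrow> 'k hset \<Rightarrow> 'k hset set" where
  "MM \<kappa> x \<equiv> VV (kap \<kappa> x) x (kap \<kappa> x)"

text \<open>Uncountability of \<open>kap \<kappa> x\<close> is included so that the local structure
  at \<open>x\<close> is again a \<open>world\<close>.\<close>

definition gd :: "'k hset \<Rightarrow> 'k hset \<Rightarrow> 'k hset \<Rightarrow> bool" where
  "gd \<kappa> A x \<longleftrightarrow> x \<in> PP \<kappa> A \<and> elts x \<inter> elts \<kappa> = elts (kap \<kappa> x) \<and> |UNIV :: nat set| <o |elts (kap \<kappa> x)|"

lemma kap_le: "|elts (kap \<kappa> x)| \<le>o |elts x|"
  by (rule ordIso_ordLeq_trans[OF Cardinal_kap(2) card_of_mono1]) simp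

lemma kap_mem:
  assumes "Cardinal \<kappa>" "x \<in> PP \<kappa> A"
  shows "kap \<kappa> x \<in> elts \<kappa>"
proof (rule Cardinal_lessD[OF assms(1) Cardinal_Ord[OF Cardinal_kap(1)]])
  show "|elts (kap \<kappa> x)| <o |elts \<kappa>|"
    by (rule ordLeq_ordLess_trans[OF kap_le]) (use assms(2) in \<open>simp add: Psub_def\<close>)
qed

lemma gd_world:
  assumes "world \<kappa> A" "gd \<kappa> A x"
  shows "world (kap \<kappa> x) x"
  using assms Cardinal_kap(1) unfolding world_def gd_def Psub_def by blast

lemma Cardinal_mono:
  assumes "Cardinal \<mu>" "Cardinal \<nu>" "|elts \<mu>| \<le>o |elts \<nu>|"
  shows "elts \<mu> \<subseteq> elts \<nu>"
proof (rule ccontr)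
  assume "\<not> elts \<mu> \<subseteq> elts \<nu>"
  then have "\<nu> \<in> elts \<mu>"
    using Ord_linear[OF Cardinal_Ord[OF assms(1)] Cardinal_Ord[OF assms(2)]] Cardinal_Ord[OF assms(2)]
    unfolding Ord_def by blast
  then show False using Cardinal_lessI[OF assms(1)] assms(3) not_ordLess_ordLeq by blast
qed

lemma kap_mono: "elts y \<subseteq> elts x \<Longrightarrow> |elts (kap \<kappa> y)| \<le>o |elts (kap \<kappa> x)|"
proof -
  assume "elts y \<subseteq> elts x"
  then have "|elts y \<inter> elts \<kappa>| \<le>o |elts x \<inter> elts \<kappa>|" by (intro card_of_mono1) blast
  then show ?thesis
    by (meson Cardinal_kap(2) ordIso_ordLeq_trans ordIso_symmetric ordLeq_ordIso_trans)
qed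

lemma MM_mono: "elts y \<subseteq> elts x \<Longrightarrow> MM \<kappa> y \<subseteq> MM \<kappa> x"
  by (rule VV_mono[OF _ kap_mono])
    (auto intro: Cardinal_Ord[OF Cardinal_kap(1)] dest: Cardinal_mono[OF Cardinal_kap(1) Cardinal_kap(1) kap_mono])

lemma MM_sub_WW:
  assumes "Cardinal \<kappa>" "x \<in> PP \<kappa> A"
  shows "MM \<kappa> x \<subseteq> WW \<kappa> A"
proof (rule VV_mono)
  have k: "kap \<kappa> x \<in> elts \<kappa>" by (rule kap_mem[OF assms])
  then show "elts (kap \<kappa> x) \<subseteq> elts \<kappa>" using Cardinal_Ord[OF assms(1)] unfolding Ord_def by blast
  then show "|elts (kap \<kappa> x)| \<le>o |elts \<kappa>|" by (rule card_of_mono1)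
qed (use assms Cardinal_Ord Cardinal_kap(1) in \<open>auto simp: Psub_def\<close>)

lemma gd_lt_kap:
  assumes "world \<kappa> A" "gd \<kappa> A x" "Ord u" "u \<in> elts x" "|elts u| <o |elts \<kappa>|"
  shows "u \<in> elts (kap \<kappa> x)"
  using Cardinal_lessD[of \<kappa> u] assms unfolding world_def gd_def by blast

lemma gd_Ord_in:
  assumes "world \<kappa> A" "gd \<kappa> A x" "Ord a" "a \<in> MM \<kappa> x"
  shows "a \<in> elts x"
  using gd_world[OF assms(1,2)] assms(4)
proof (cases rule: WW_cases)
  case 2
  have "a \<in> elts (kap \<kappa> x)" by (rule Cardinal_lessD[OF Cardinal_kap(1) assms(3) 2(2)])
  then show ?thesis using assms(2) unfolding gd_def by blast
qed

lemma MM_Int_A: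
  assumes "world \<kappa> A" "gd \<kappa> A x"
  shows "MM \<kappa> x \<inter> elts A = elts x"
  using gd_Ord_in[OF assms] WW_base[OF gd_world[OF assms]] assms unfolding world_def gd_def Psub_def by blast

text \<open>An element that is not an ordinal of \<open>x\<close> has size below
  \<open>kap \<kappa> x\<close> by construction. An ordinal of \<open>x\<close> of size below
  \<kappa> lies in \<kappa>, hence in the intersection of \<open>x\<close> with \<kappa>, which is
  \<open>kap \<kappa> x\<close>. The failure of transitivity is thus confined to ordinals of size at
  least \<kappa>.\<close>

lemma MM_trans:
  assumes "world \<kappa> A" "gd \<kappa> A x" "u \<in> MM \<kappa> x" "|elts u| <o |elts \<kappa>|"
  shows "elts u \<subseteq> MM \<kappa> x" "|elts u| <o |elts (kap \<kappa> x)|"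
proof -
  note w = gd_world[OF assms(1,2)]
  show l: "|elts u| <o |elts (kap \<kappa> x)|" using w assms(3)
  proof (cases rule: WW_cases)
    case 1
    show ?thesis using gd_lt_kap[OF assms(1,2) 1(2,1) assms(4)] Cardinal_lessI[OF Cardinal_kap(1)] by blast
  qed
  show "elts u \<subseteq> MM \<kappa> x" by (rule WW_small_sub[OF w assms(3) l])
qed

text \<open>Together with \<open>sq_less_iff\<close> this turns the order of points into membership:
  the points below \<open>x\<close> are exactly the points of \<open>PP \<kappa> A\<close> that the
  local structure at \<open>x\<close> contains.\<close>

lemma MM_PP:
  assumes "world \<kappa> A" "gd \<kappa> A x"
  shows "MM \<kappa> x \<inter> PP \<kappa> A = PP (kap \<kappa> x) x"
proof
  show "MM \<kappa> x \<inter> PP \<kappa> A \<subseteq> PP (kap \<kappa> x) x"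
    using MM_trans[OF assms] MM_Int_A[OF assms] unfolding Psub_def by blast
  have "PP (kap \<kappa> x) x \<subseteq> PP \<kappa> A"
  proof (rule Psub_mono)
    show "elts x \<subseteq> elts A" using assms(2) by (auto simp: gd_def Psub_def)
    show "|elts (kap \<kappa> x)| \<le>o |elts \<kappa>|"
      by (rule ordLess_imp_ordLeq[OF ordLeq_ordLess_trans[OF kap_le]]) (use assms(2) in \<open>simp add: gd_def Psub_def\<close>)
  qed
  then show "PP (kap \<kappa> x) x \<subseteq> MM \<kappa> x \<inter> PP \<kappa> A" using WW_PP[OF gd_world[OF assms]] by blast
qed

lemma sq_less_iff: "sq_less \<kappa> y x \<longleftrightarrow> y \<in> PP (kap \<kappa> x) x"
  unfolding sq_less_def Psub_def
  using ordLess_ordIso_trans[OF _ Cardinal_kap(2)[of \<kappa> x], of "|elts y|"]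
    ordLess_ordIso_trans[OF _ ordIso_symmetric[OF Cardinal_kap(2)[of \<kappa> x]], of "|elts y|"] by blast

text \<open>For \<open>y\<close> below \<open>x\<close>, the local structure at \<open>y\<close> is
  therefore the same whether it is computed from \<open>(\<kappa>, A)\<close> or from
  \<open>(kap \<kappa> x, x)\<close>. Statements about ideals on
  \<open>PP (kap \<kappa> x) x\<close> become statements about \<kappa>.\<close>

lemma kap_kap:
  assumes "elts x \<inter> elts \<kappa> = elts (kap \<kappa> x)" "elts y \<subseteq> elts x"
  shows "kap (kap \<kappa> x) y = kap \<kappa> y"
proof -
  have "elts y \<inter> elts (kap \<kappa> x) = elts y \<inter> elts \<kappa>" using assms by blast
  then show ?thesis unfolding kap_def by simp
qed

section \<open>Operations on second-order formulas\<close>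

lemma fo_sat_cong:
  "(\<And>i. i \<in> fo_fv \<theta> \<Longrightarrow> e i = e' i) \<Longrightarrow> (\<And>j. j \<in> fo_fsv \<theta> \<Longrightarrow> s j = s' j)
    \<Longrightarrow> fo_sat M R e s \<theta> = fo_sat M R e' s' \<theta>"
proof (induction \<theta> arbitrary: e e')
  case (And \<phi> \<psi>)
  show ?case using And(1)[of e e'] And(2)[of e e'] And(3,4) by auto
next
  case (Neg \<phi>)
  show ?case using Neg(1)[of e e'] Neg(2,3) by auto
next
  case (All i \<phi>)
  have "fo_sat M R (e(i := a)) s \<phi> = fo_sat M R (e'(i := a)) s' \<phi>" for a
    by (rule All(1)) (use All(2,3) in auto)
  then show ?case by simp
qed auto

lemma sat_cong:
  "(\<And>i. i \<in> fv \<phi> \<Longrightarrow> e i = e' i) \<Longrightarrow> (\<And>j. j \<in> fsv \<phi> \<Longrightarrow> s j = s' j)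
    \<Longrightarrow> sat M R e \<phi> s = sat M R e' \<phi> s'"
proof (induction \<phi> arbitrary: s s')
  case (FO \<theta>)
  show ?case using fo_sat_cong[of \<theta> e e' s s'] FO by auto
next
  case (AllS j \<phi>)
  have "sat M R e \<phi> (s(j := X)) = sat M R e' \<phi> (s'(j := X))" for X
    by (rule AllS(1)) (use AllS(2,3) in auto)
  then show ?case by simp
next
  case (ExS j \<phi>)
  have "sat M R e \<phi> (s(j := X)) = sat M R e' \<phi> (s'(j := X))" for X
    by (rule ExS(1)) (use ExS(2,3) in auto)
  then show ?case by simp
next
  case (Conj \<zeta> \<phi>)
  have "sat M R e (\<phi> \<eta>) s = sat M R e' (\<phi> \<eta>) s'" if "\<eta> \<in> elts \<zeta>" for \<eta>
    using Conj(1)[of "\<phi> \<eta>" s s'] Conj(2,3) that by auto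
  then show ?case by simp
next
  case (Disj \<zeta> \<phi>)
  have "sat M R e (\<phi> \<eta>) s = sat M R e' (\<phi> \<eta>) s'" if "\<eta> \<in> elts \<zeta>" for \<eta>
    using Disj(1)[of "\<phi> \<eta>" s s'] Disj(2,3) that by auto
  then show ?case by simp
qed

lemma models_iff: "sentence \<phi> \<Longrightarrow> models M R \<phi> \<longleftrightarrow> sat M R e \<phi> s"
  unfolding models_def sentence_def by (metis empty_iff sat_cong)

lemma finite_fo_fsv [simp]: "finite (fo_fsv \<theta>)"
  by (induction \<theta>) auto

lemma fv_foldr [simp]: "fv (foldr AllS js \<phi>) = fv \<phi>" "fv (foldr ExS js \<phi>) = fv \<phi>"
  by (induction js) auto

lemma fsv_foldr [simp]: "fsv (foldr AllS js \<phi>) = fsv \<phi> - set js" "fsv (foldr ExS js \<phi>) = fsv \<phi> - set js"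
  by (induction js) auto

lemma is_Pi_finite_fsv: "is_Pi \<zeta> \<phi> \<Longrightarrow> finite (fsv \<phi>)" "is_Sigma \<zeta> \<phi> \<Longrightarrow> finite (fsv \<phi>)"
  by (induction rule: is_Pi_is_Sigma.inducts) auto

lemma is_Pi_Ord: "is_Pi \<zeta> \<phi> \<Longrightarrow> Ord \<zeta>" "is_Sigma \<zeta> \<phi> \<Longrightarrow> Ord \<zeta>"
  by (induction rule: is_Pi_is_Sigma.inducts) (auto simp: is_limit_def eq_zero dest!: eq_zero)

text \<open>Second-order formulas have no negation of their own; it is pushed down to the
  first-order leaves and exchanges the two hierarchies level by level.\<close>

primrec neg :: "'k so \<Rightarrow> 'k so" where
  "neg (FO \<theta>) = FO (Neg \<theta>)"
| "neg (AllS j \<phi>) = ExS j (neg \<phi>)"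
| "neg (ExS j \<phi>) = AllS j (neg \<phi>)"
| "neg (Conj \<zeta> \<phi>) = Disj \<zeta> (\<lambda>\<eta>. neg (\<phi> \<eta>))"
| "neg (Disj \<zeta> \<phi>) = Conj \<zeta> (\<lambda>\<eta>. neg (\<phi> \<eta>))"

lemma sat_neg [simp]: "sat M R e (neg \<phi>) s \<longleftrightarrow> \<not> sat M R e \<phi> s"
  by (induction \<phi> arbitrary: s) auto

lemma fv_neg [simp]: "fv (neg \<phi>) = fv \<phi>" "fsv (neg \<phi>) = fsv \<phi>"
  by (induction \<phi>) auto

lemma neg_foldr [simp]: "neg (foldr AllS js \<phi>) = foldr ExS js (neg \<phi>)"
    "neg (foldr ExS js \<phi>) = foldr AllS js (neg \<phi>)"
  by (induction js) auto

lemma is_Pi_neg: "is_Pi \<zeta> \<phi> \<Longrightarrow> is_Sigma \<zeta> (neg \<phi>)" "is_Sigma \<zeta> \<phi> \<Longrightarrow> is_Pi \<zeta> (neg \<phi>)"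
  by (induction rule: is_Pi_is_Sigma.inducts) (auto intro: is_Pi_is_Sigma.intros)

text \<open>A conjunction of limit level is indexed by exactly that level and leaves no place for
  one more conjunct. A first-order side condition is therefore combined with every first-order leaf,
  which keeps the level of the formula.\<close>

primrec map_fo :: "(fo \<Rightarrow> fo) \<Rightarrow> 'k so \<Rightarrow> 'k so" where
  "map_fo g (FO \<theta>) = FO (g \<theta>)"
| "map_fo g (AllS j \<phi>) = AllS j (map_fo g \<phi>)"
| "map_fo g (ExS j \<phi>) = ExS j (map_fo g \<phi>)"
| "map_fo g (Conj \<zeta> \<phi>) = Conj \<zeta> (\<lambda>\<eta>. map_fo g (\<phi> \<eta>))"
| "map_fo g (Disj \<zeta> \<phi>) = Disj \<zeta> (\<lambda>\<eta>. map_fo g (\<phi> \<eta>))"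

lemma map_fo_foldr [simp]: "map_fo g (foldr AllS js \<phi>) = foldr AllS js (map_fo g \<phi>)"
    "map_fo g (foldr ExS js \<phi>) = foldr ExS js (map_fo g \<phi>)"
  by (induction js) auto

lemma fsv_map_fo:
  assumes "\<And>\<theta>. fo_fsv (g \<theta>) \<subseteq> fo_fsv \<theta> \<union> N"
  shows "fsv (map_fo g \<phi>) \<subseteq> fsv \<phi> \<union> N"
proof (induction \<phi>)
  case (Conj \<zeta> \<phi>)
  have "fsv (map_fo g (\<phi> \<eta>)) \<subseteq> fsv (\<phi> \<eta>) \<union> N" for \<eta> using Conj by auto
  then show ?case by simp blast
next
  case (Disj \<zeta> \<phi>)
  have "fsv (map_fo g (\<phi> \<eta>)) \<subseteq> fsv (\<phi> \<eta>) \<union> N" for \<eta> using Disj by auto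
  then show ?case by simp blast
qed (use assms in auto)

lemma fv_map_fo:
  assumes "\<And>\<theta>. fo_fv (g \<theta>) \<subseteq> fo_fv \<theta> \<union> N"
  shows "fv (map_fo g \<phi>) \<subseteq> fv \<phi> \<union> N"
proof (induction \<phi>)
  case (Conj \<zeta> \<phi>)
  have "fv (map_fo g (\<phi> \<eta>)) \<subseteq> fv (\<phi> \<eta>) \<union> N" for \<eta> using Conj by auto
  then show ?case by simp blast
next
  case (Disj \<zeta> \<phi>)
  have "fv (map_fo g (\<phi> \<eta>)) \<subseteq> fv (\<phi> \<eta>) \<union> N" for \<eta> using Disj by auto
  then show ?case by simp blast
qed (use assms in auto)

text \<open>The variables that are quantified somewhere; a guard that avoids them is not captured
  when it is moved to the leaves.\<close>

primrec bsv :: "'k so \<Rightarrow> nat set" where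
  "bsv (FO \<theta>) = {}"
| "bsv (AllS j \<phi>) = insert j (bsv \<phi>)"
| "bsv (ExS j \<phi>) = insert j (bsv \<phi>)"
| "bsv (Conj \<zeta> \<phi>) = (\<Union>\<eta>\<in>elts \<zeta>. bsv (\<phi> \<eta>))"
| "bsv (Disj \<zeta> \<phi>) = (\<Union>\<eta>\<in>elts \<zeta>. bsv (\<phi> \<eta>))"

lemma bsv_foldr [simp]: "bsv (foldr AllS js \<phi>) = set js \<union> bsv \<phi>" "bsv (foldr ExS js \<phi>) = set js \<union> bsv \<phi>"
  by (induction js) auto

lemma bsv_map_fo [simp]: "bsv (map_fo g \<phi>) = bsv \<phi>"
  by (induction \<phi>) auto

lemma is_Pi_map_fo:
  assumes "\<And>\<theta>. fo_fsv (g \<theta>) \<subseteq> fo_fsv \<theta> \<union> N" "finite N"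
  shows "is_Pi \<zeta> \<phi> \<Longrightarrow> is_Pi \<zeta> (map_fo g \<phi>)" "is_Sigma \<zeta> \<phi> \<Longrightarrow> is_Sigma \<zeta> (map_fo g \<phi>)"
proof (induction rule: is_Pi_is_Sigma.inducts)
  case (Pi_limit \<zeta> \<phi>)
  have "finite (fsv (map_fo g (Conj \<zeta> \<phi>)))"
    by (rule finite_subset[OF fsv_map_fo[OF assms(1)]]) (use Pi_limit assms(2) in simp)
  then show ?case using Pi_limit by (auto intro!: is_Pi_is_Sigma.intros)
next
  case (Sigma_limit \<zeta> \<phi>)
  have "finite (fsv (map_fo g (Disj \<zeta> \<phi>)))"
    by (rule finite_subset[OF fsv_map_fo[OF assms(1)]]) (use Sigma_limit assms(2) in simp)
  then show ?case using Sigma_limit by (auto intro!: is_Pi_is_Sigma.intros)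
qed (auto intro: is_Pi_is_Sigma.intros)

abbreviation FOr :: "fo \<Rightarrow> fo \<Rightarrow> fo" where "FOr \<phi> \<psi> \<equiv> Neg (And (Neg \<phi>) (Neg \<psi>))"
abbreviation FIff :: "fo \<Rightarrow> fo \<Rightarrow> fo" where
  "FIff \<phi> \<psi> \<equiv> And (Neg (And \<phi> (Neg \<psi>))) (Neg (And \<psi> (Neg \<phi>)))"
abbreviation FEx :: "nat \<Rightarrow> fo \<Rightarrow> fo" where "FEx i \<phi> \<equiv> Neg (All i (Neg \<phi>))"

text \<open>The connective \<open>c\<close> stands for conjunction or disjunction, so that one proof
  serves both kinds of guards. Guard and quantifiers commute because the guard does not mention the
  quantified variables and because the range of the quantifiers is never empty.\<close>

lemma sat_guard_foldr:
  assumes "\<And>s. sat M R e \<phi>' s \<longleftrightarrow> c (fo_sat M R e s \<theta>) (sat M R e \<phi> s)"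
    and "\<And>b P. (\<forall>X. X \<subseteq> M \<longrightarrow> c b (P X)) \<longleftrightarrow> c b (\<forall>X. X \<subseteq> M \<longrightarrow> P X)"
    and "\<And>b P. (\<exists>X. X \<subseteq> M \<and> c b (P X)) \<longleftrightarrow> c b (\<exists>X. X \<subseteq> M \<and> P X)"
  shows "set js \<inter> fo_fsv \<theta> = {} \<Longrightarrow> 
    sat M R e (foldr AllS js \<phi>') s \<longleftrightarrow> c (fo_sat M R e s \<theta>) (sat M R e (foldr AllS js \<phi>) s)"
   "set js \<inter> fo_fsv \<theta> = {} \<Longrightarrow> 
    sat M R e (foldr ExS js \<phi>') s \<longleftrightarrow> c (fo_sat M R e s \<theta>) (sat M R e (foldr ExS js \<phi>) s)"
proof (induction js arbitrary: s)
  case (Cons j js)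
  have *: "fo_sat M R e (s(j := X)) \<theta> = fo_sat M R e s \<theta>" if "set (j # js) \<inter> fo_fsv \<theta> = {}" for X s
    by (rule fo_sat_cong) (use that in auto)
  {
    case 1
    then show ?case using Cons(1) *[OF 1] by (simp add: assms(2))
  next
    case 2
    then show ?case using Cons(2) *[OF 2] by (simp add: assms(3))
  }
qed (use assms(1) in auto)

lemma sat_andF:
  shows "is_Pi \<zeta> \<phi> \<Longrightarrow> bsv \<phi> \<inter> fo_fsv \<theta> = {} \<Longrightarrow>
      sat M R e (map_fo (And \<theta>) \<phi>) s \<longleftrightarrow> fo_sat M R e s \<theta> \<and> sat M R e \<phi> s"
    "is_Sigma \<zeta> \<phi> \<Longrightarrow> bsv \<phi> \<inter> fo_fsv \<theta> = {} \<Longrightarrow>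
      sat M R e (map_fo (And \<theta>) \<phi>) s \<longleftrightarrow> fo_sat M R e s \<theta> \<and> sat M R e \<phi> s"
proof (induction arbitrary: s and s rule: is_Pi_is_Sigma.inducts)
  case (Pi_succ \<zeta> \<phi> js)
  show ?case unfolding map_fo_foldr
    by (rule sat_guard_foldr(1)[where c = "(\<and>)"]) (use Pi_succ in auto)
next
  case (Sigma_succ \<zeta> \<phi> js)
  show ?case unfolding map_fo_foldr
    by (rule sat_guard_foldr(2)[where c = "(\<and>)"]) (use Sigma_succ in auto)
next
  case (Pi_limit \<zeta> \<phi>)
  have "sat M R e (map_fo (And \<theta>) (\<phi> \<eta>)) s \<longleftrightarrow> fo_sat M R e s \<theta> \<and> sat M R e (\<phi> \<eta>) s" if "\<eta> \<in> elts \<zeta>" for \<eta>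
    using Pi_limit that by auto
  \<comment> \<open>A conjunction over no indices would lose the guard; a limit has the index
    0.\<close>
  then show ?case using is_limit_zero_in[OF Pi_limit(1)] by auto
next
  case (Sigma_limit \<zeta> \<phi>)
  have "sat M R e (map_fo (And \<theta>) (\<phi> \<eta>)) s \<longleftrightarrow> fo_sat M R e s \<theta> \<and> sat M R e (\<phi> \<eta>) s" if "\<eta> \<in> elts \<zeta>" for \<eta>
    using Sigma_limit that by auto
  then show ?case by auto
qed auto

lemma sat_orF:
  shows "is_Pi \<zeta> \<phi> \<Longrightarrow> bsv \<phi> \<inter> fo_fsv \<theta> = {} \<Longrightarrow>
      sat M R e (map_fo (FOr \<theta>) \<phi>) s \<longleftrightarrow> fo_sat M R e s \<theta> \<or> sat M R e \<phi> s"
    "is_Sigma \<zeta> \<phi> \<Longrightarrow> bsv \<phi> \<inter> fo_fsv \<theta> = {} \<Longrightarrow>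
      sat M R e (map_fo (FOr \<theta>) \<phi>) s \<longleftrightarrow> fo_sat M R e s \<theta> \<or> sat M R e \<phi> s"
proof (induction arbitrary: s and s rule: is_Pi_is_Sigma.inducts)
  case (Pi_succ \<zeta> \<phi> js)
  show ?case unfolding map_fo_foldr
    by (rule sat_guard_foldr(1)[where c = "(\<or>)"]) (use Pi_succ in auto)
next
  case (Sigma_succ \<zeta> \<phi> js)
  show ?case unfolding map_fo_foldr
    by (rule sat_guard_foldr(2)[where c = "(\<or>)"]) (use Sigma_succ in auto)
next
  case (Pi_limit \<zeta> \<phi>)
  have "sat M R e (map_fo (FOr \<theta>) (\<phi> \<eta>)) s \<longleftrightarrow> fo_sat M R e s \<theta> \<or> sat M R e (\<phi> \<eta>) s" if "\<eta> \<in> elts \<zeta>" for \<eta>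
    using Pi_limit that by auto
  then show ?case by auto
next
  case (Sigma_limit \<zeta> \<phi>)
  have "sat M R e (map_fo (FOr \<theta>) (\<phi> \<eta>)) s \<longleftrightarrow> fo_sat M R e s \<theta> \<or> sat M R e (\<phi> \<eta>) s" if "\<eta> \<in> elts \<zeta>" for \<eta>
    using Sigma_limit that by auto
  then show ?case using is_limit_zero_in[OF Sigma_limit(1)] by auto
qed auto

lemma is_Pi_andF: "is_Pi \<zeta> \<phi> \<Longrightarrow> is_Pi \<zeta> (map_fo (And \<theta>) \<phi>)" "is_Sigma \<zeta> \<phi> \<Longrightarrow> is_Sigma \<zeta> (map_fo (And \<theta>) \<phi>)"
  by (rule is_Pi_map_fo[where N = "fo_fsv \<theta>"]; auto)+

lemma is_Pi_orF: "is_Pi \<zeta> \<phi> \<Longrightarrow> is_Pi \<zeta> (map_fo (FOr \<theta>) \<phi>)" "is_Sigma \<zeta> \<phi> \<Longrightarrow> is_Sigma \<zeta> (map_fo (FOr \<theta>) \<phi>)"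
  by (rule is_Pi_map_fo[where N = "fo_fsv \<theta>"]; auto)+

text \<open>Shifting all second-order variables, bound ones included, by 1, 2 or 3 frees the lowest
  variables for parameters.\<close>

primrec ren_fo :: "(nat \<Rightarrow> nat) \<Rightarrow> fo \<Rightarrow> fo" where
  "ren_fo r (Mem i j) = Mem i j"
| "ren_fo r (Eq i j) = Eq i j"
| "ren_fo r (Pred i) = Pred i"
| "ren_fo r (In i j) = In i (r j)"
| "ren_fo r (Neg \<phi>) = Neg (ren_fo r \<phi>)"
| "ren_fo r (And \<phi> \<psi>) = And (ren_fo r \<phi>) (ren_fo r \<psi>)"
| "ren_fo r (All i \<phi>) = All i (ren_fo r \<phi>)"

primrec ren :: "(nat \<Rightarrow> nat) \<Rightarrow> 'k so \<Rightarrow> 'k so" where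
  "ren r (FO \<theta>) = FO (ren_fo r \<theta>)"
| "ren r (AllS j \<phi>) = AllS (r j) (ren r \<phi>)"
| "ren r (ExS j \<phi>) = ExS (r j) (ren r \<phi>)"
| "ren r (Conj \<zeta> \<phi>) = Conj \<zeta> (\<lambda>\<eta>. ren r (\<phi> \<eta>))"
| "ren r (Disj \<zeta> \<phi>) = Disj \<zeta> (\<lambda>\<eta>. ren r (\<phi> \<eta>))"

lemma ren_fo_simps [simp]: "fo_fsv (ren_fo r \<theta>) = r ` fo_fsv \<theta>" "fo_fv (ren_fo r \<theta>) = fo_fv \<theta>"
  by (induction \<theta>) auto

lemma ren_foldr [simp]: "ren r (foldr AllS js \<phi>) = foldr AllS (map r js) (ren r \<phi>)"
    "ren r (foldr ExS js \<phi>) = foldr ExS (map r js) (ren r \<phi>)"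
  by (induction js) auto

lemma fv_ren [simp]: "fv (ren r \<phi>) = fv \<phi>" "bsv (ren r \<phi>) = r ` bsv \<phi>"
  by (induction \<phi>) auto

lemma fsv_ren: "inj r \<Longrightarrow> fsv (ren r \<phi>) = r ` fsv \<phi>"
  by (induction \<phi>) (auto simp: inj_def)

lemma fo_sat_ren [simp]: "fo_sat M R e s (ren_fo r \<theta>) = fo_sat M R e (s \<circ> r) \<theta>"
  by (induction \<theta> arbitrary: e) auto

lemma sat_ren:
  assumes "inj r"
  shows "sat M R e (ren r \<phi>) s = sat M R e \<phi> (s \<circ> r)"
proof (induction \<phi> arbitrary: s)
  case (AllS j \<phi>)
  have "(s(r j := X)) \<circ> r = (s \<circ> r)(j := X)" for X by (rule ext) (simp add: inj_eq[OF assms])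
  then show ?case by (simp only: sat.simps ren.simps AllS)
next
  case (ExS j \<phi>)
  have "(s(r j := X)) \<circ> r = (s \<circ> r)(j := X)" for X by (rule ext) (simp add: inj_eq[OF assms])
  then show ?case by (simp only: sat.simps ren.simps ExS)
qed auto

lemma is_Pi_ren: 
  assumes "inj r"
  shows "is_Pi \<zeta> \<phi> \<Longrightarrow> is_Pi \<zeta> (ren r \<phi>)" "is_Sigma \<zeta> \<phi> \<Longrightarrow> is_Sigma \<zeta> (ren r \<phi>)"
proof (induction rule: is_Pi_is_Sigma.inducts)
  case (Pi_limit \<zeta> \<phi>)
  have "finite (fsv (ren r (Conj \<zeta> \<phi>)))"
    by (subst fsv_ren[OF assms]) (use Pi_limit in simp)
  then show ?case using Pi_limit by (auto intro!: is_Pi_is_Sigma.intros)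
next
  case (Sigma_limit \<zeta> \<phi>)
  have "finite (fsv (ren r (Disj \<zeta> \<phi>)))"
    by (subst fsv_ren[OF assms]) (use Sigma_limit in simp)
  then show ?case using Sigma_limit by (auto intro!: is_Pi_is_Sigma.intros)
qed (auto intro: is_Pi_is_Sigma.intros)

text \<open>At a limit, a formula of level \<eta> is required at every index \<eta>. This supplies
  fillers for the indices that carry no content, and it makes first-order sentences available at any
  prescribed level.\<close>

lemma lift_FO:
  assumes "Ord \<zeta>"
  shows "(\<exists>\<phi> :: 'k so. is_Pi \<zeta> \<phi> \<and> fsv \<phi> \<subseteq> fo_fsv \<theta> \<and> fv \<phi> \<subseteq> fo_fv \<theta> \<and> bsv \<phi> = {} \<and>
      (\<forall>M R e s. sat M R e \<phi> s = fo_sat M R e s \<theta>)) \<and>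
    (\<exists>\<phi> :: 'k so. is_Sigma \<zeta> \<phi> \<and> fsv \<phi> \<subseteq> fo_fsv \<theta> \<and> fv \<phi> \<subseteq> fo_fv \<theta> \<and> bsv \<phi> = {} \<and>
      (\<forall>M R e s. sat M R e \<phi> s = fo_sat M R e s \<theta>))" (is "?P \<zeta> \<and> ?S \<zeta>")
  using assms
proof (induction \<zeta> rule: Ord_induct3)
  case 0
  show ?case
    by (intro conjI exI[of _ "FO \<theta>"] is_Pi_is_Sigma.intros) auto
next
  case (succ \<delta>)
  obtain \<phi> \<psi> :: "'k so" where "is_Pi \<delta> \<phi> \<and> fsv \<phi> \<subseteq> fo_fsv \<theta> \<and> fv \<phi> \<subseteq> fo_fv \<theta> \<and> bsv \<phi> = {} \<and>
      (\<forall>M R e s. sat M R e \<phi> s = fo_sat M R e s \<theta>)" 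
      "is_Sigma \<delta> \<psi> \<and> fsv \<psi> \<subseteq> fo_fsv \<theta> \<and> fv \<psi> \<subseteq> fo_fv \<theta> \<and> bsv \<psi> = {} \<and>
      (\<forall>M R e s. sat M R e \<psi> s = fo_sat M R e s \<theta>)"
    using succ(2) by blast
  then show ?case using Pi_succ[of \<delta> \<psi> "[]"] Sigma_succ[of \<delta> \<phi> "[]"] by auto
next
  case (limit \<gamma>)
  have "\<forall>\<eta>\<in>elts \<gamma>. \<exists>\<phi> :: 'k so. is_Pi \<eta> \<phi> \<and> fsv \<phi> \<subseteq> fo_fsv \<theta> \<and> fv \<phi> \<subseteq> fo_fv \<theta> \<and> bsv \<phi> = {} \<and>
      (\<forall>M R e s. sat M R e \<phi> s = fo_sat M R e s \<theta>)" using limit(2) by blast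
  then obtain \<phi> :: "'k hset \<Rightarrow> 'k so" where p: "\<And>\<eta>. \<eta> \<in> elts \<gamma> \<Longrightarrow> is_Pi \<eta> (\<phi> \<eta>)" "\<And>\<eta>. \<eta> \<in> elts \<gamma> \<Longrightarrow> fsv (\<phi> \<eta>) \<subseteq> fo_fsv \<theta>"
     "\<And>\<eta>. \<eta> \<in> elts \<gamma> \<Longrightarrow> fv (\<phi> \<eta>) \<subseteq> fo_fv \<theta>" "\<And>\<eta>. \<eta> \<in> elts \<gamma> \<Longrightarrow> bsv (\<phi> \<eta>) = {}"
     "\<And>\<eta> M R e s. \<eta> \<in> elts \<gamma> \<Longrightarrow> sat M R e (\<phi> \<eta>) s = fo_sat M R e s \<theta>" by metis
  have "\<forall>\<eta>\<in>elts \<gamma>. \<exists>\<phi> :: 'k so. is_Sigma \<eta> \<phi> \<and> fsv \<phi> \<subseteq> fo_fsv \<theta> \<and> fv \<phi> \<subseteq> fo_fv \<theta> \<and> bsv \<phi> = {} \<and>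
      (\<forall>M R e s. sat M R e \<phi> s = fo_sat M R e s \<theta>)" using limit(2) by blast
  then obtain \<psi> :: "'k hset \<Rightarrow> 'k so" where q: "\<And>\<eta>. \<eta> \<in> elts \<gamma> \<Longrightarrow> is_Sigma \<eta> (\<psi> \<eta>)" "\<And>\<eta>. \<eta> \<in> elts \<gamma> \<Longrightarrow> fsv (\<psi> \<eta>) \<subseteq> fo_fsv \<theta>"
     "\<And>\<eta>. \<eta> \<in> elts \<gamma> \<Longrightarrow> fv (\<psi> \<eta>) \<subseteq> fo_fv \<theta>" "\<And>\<eta>. \<eta> \<in> elts \<gamma> \<Longrightarrow> bsv (\<psi> \<eta>) = {}"
     "\<And>\<eta> M R e s. \<eta> \<in> elts \<gamma> \<Longrightarrow> sat M R e (\<psi> \<eta>) s = fo_sat M R e s \<theta>" by metis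
  have ne: "zero \<in> elts \<gamma>" by (rule is_limit_zero_in[OF limit(1)])
  have 1: "fsv (Conj \<gamma> \<phi>) \<subseteq> fo_fsv \<theta>" "fsv (Disj \<gamma> \<psi>) \<subseteq> fo_fsv \<theta>" using p(2) q(2) by auto
  have 2: "is_Pi \<gamma> (Conj \<gamma> \<phi>)" by (rule Pi_limit[OF limit(1) _ finite_subset[OF 1(1)]]) (use p(1) in auto)
  have 3: "is_Sigma \<gamma> (Disj \<gamma> \<psi>)" by (rule Sigma_limit[OF limit(1) _ finite_subset[OF 1(2)]]) (use q(1) in auto)
  have 4: "fv (Conj \<gamma> \<phi>) \<subseteq> fo_fv \<theta>" "fv (Disj \<gamma> \<psi>) \<subseteq> fo_fv \<theta>" using p(3) q(3) by auto
  have 5: "bsv (Conj \<gamma> \<phi>) = {}" "bsv (Disj \<gamma> \<psi>) = {}" using p(4) q(4) by auto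
  have 6: "sat M R e (Conj \<gamma> \<phi>) s = fo_sat M R e s \<theta>" "sat M R e (Disj \<gamma> \<psi>) s = fo_sat M R e s \<theta>" for M R e s
    using p(5) q(5) ne by auto
  show ?case using 1 2 3 4 5 6 by blast
qed

section \<open>Coding several predicates in one\<close>

definition upair :: "'k hset \<Rightarrow> 'k hset \<Rightarrow> 'k hset" where "upair a b = set_of {a, b}"

lemma elts_upair [simp]: "elts (upair a b) = {a, b}"
  unfolding upair_def by (rule elts_set_of[OF small_finite]) simp

lemma upair_eq: "upair a b = upair c d \<longleftrightarrow> {a, b} = {c, d}"
  by (metis elts_upair hset_ext)

definition sg :: "'k hset \<Rightarrow> 'k hset" where "sg a = upair a a"

lemma elts_sg [simp]: "elts (sg a) = {a}"
  by (simp add: sg_def)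

lemma eq_sg: "x = sg a \<longleftrightarrow> elts x = {a}"
  by (metis elts_sg hset_ext)

lemma sg_inject [simp]: "sg a = sg b \<longleftrightarrow> a = b"
  by (simp add: eq_sg)

lemma sg_neq_zero [simp]: "sg a \<noteq> zero" "zero \<noteq> sg a"
  by (metis elts_sg elts_zero insert_not_empty)+

definition kp :: "'k hset \<Rightarrow> 'k hset \<Rightarrow> 'k hset" where "kp a b = upair (sg a) (upair a b)"

lemma kp_inject [simp]: "kp a b = kp c d \<longleftrightarrow> a = c \<and> b = d"
  unfolding kp_def sg_def by (auto simp: upair_eq doubleton_eq_iff)

lemma kp_neq_zero [simp]: "kp a b \<noteq> zero" "zero \<noteq> kp a b"
  unfolding kp_def by (metis elts_upair elts_zero insert_not_empty)+

text \<open>The tag \<open>n\<close> of \<open>cd n v\<close> lets one predicate carry countably many.\<close>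

definition cd :: "nat \<Rightarrow> 'k hset \<Rightarrow> 'k hset" where
  "cd n v = (sg ^^ n) (upair zero (sg v))"

lemma cd_0: "cd 0 v = upair zero (sg v)" and cd_Suc: "cd (Suc n) v = sg (cd n v)"
  by (simp_all add: cd_def)

lemma cd_0_neq_sg: "cd 0 v \<noteq> sg u"
  unfolding cd_0 sg_def using sg_neq_zero[of v] by (auto simp: upair_eq sg_def)

lemma cd_inject: "cd n v = cd m w \<longleftrightarrow> n = m \<and> v = w"
proof (induction n arbitrary: m)
  case 0
  show ?case
  proof (cases m)
    case 0
    then show ?thesis by (auto simp: cd_0 upair_eq doubleton_eq_iff)
  qed (simp add: cd_Suc cd_0_neq_sg)
next
  case (Suc n)
  then show ?case by (cases m) (simp_all add: cd_Suc cd_0_neq_sg cd_0_neq_sg[symmetric])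
qed

lemma cd_two: "\<exists>a b. elts (cd n v) = {a, b}"
  by (cases n) (auto simp: cd_0 cd_Suc)

text \<open>The last clause is the substitute for transitivity provided by \<open>WW_fin\<close>;
  with it, singletons and unordered pairs are defined correctly by first-order formulas evaluated in
  \<open>M\<close>.\<close>

definition codable :: "'k hset set \<Rightarrow> bool" where
  "codable M \<longleftrightarrow> zero \<in> M \<and> (\<forall>a\<in>M. \<forall>b\<in>M. upair a b \<in> M) \<and>
     (\<forall>u\<in>M. finite (elts u \<inter> M) \<longrightarrow> elts u \<subseteq> M)"

lemma codable_WW: "world \<mu> B \<Longrightarrow> codable (WW \<mu> B)"
  unfolding codable_def
proof (intro conjI ballI impI)
  assume w: "world \<mu> B"
  show "zero \<in> WW \<mu> B" using WW_finite[OF w, of "{}"] by (simp add: zero_def)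
  show "upair a b \<in> WW \<mu> B" if "a \<in> WW \<mu> B" "b \<in> WW \<mu> B" for a b
    using WW_finite[OF w, of "{a, b}"] that by (simp add: upair_def)
  show "elts u \<subseteq> WW \<mu> B" if "u \<in> WW \<mu> B" "finite (elts u \<inter> WW \<mu> B)" for u
    by (rule WW_fin[OF w that])
qed

lemma codable_sg: "codable M \<Longrightarrow> a \<in> M \<Longrightarrow> sg a \<in> M"
  by (simp add: codable_def sg_def)

lemma codable_sgn: "codable M \<Longrightarrow> a \<in> M \<Longrightarrow> (sg ^^ n) a \<in> M"
  by (induction n) (auto simp: codable_sg)

lemma codable_cd: "codable M \<Longrightarrow> a \<in> M \<Longrightarrow> cd n a \<in> M"
  unfolding cd_def using codable_sg[of M a] by (intro codable_sgn) (auto simp: codable_def)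

lemma codable_elts_eq:
  assumes "codable M" "u \<in> M" "finite X" "X \<subseteq> M"
  shows "(\<forall>w\<in>M. w \<in> elts u \<longleftrightarrow> w \<in> X) \<longleftrightarrow> elts u = X"
proof
  assume a: "\<forall>w\<in>M. w \<in> elts u \<longleftrightarrow> w \<in> X"
  then have "elts u \<inter> M = X" using assms(4) by blast
  then show "elts u = X" using assms unfolding codable_def by blast
qed auto

text \<open>The bound variable \<open>i + j + 1\<close> differs from both \<open>i\<close> and
  \<open>j\<close>.\<close>

definition isSing :: "nat \<Rightarrow> nat \<Rightarrow> fo" where
  "isSing i j = All (i + j + 1) (FIff (Mem (i + j + 1) i) (Eq (i + j + 1) j))"

definition isC :: "nat \<Rightarrow> nat \<Rightarrow> fo" where
  "isC i j = All (i + j + 1) (FIff (Mem (i + j + 1) i)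
     (FOr (Eq (i + j + 1) j) (All (i + j + 2) (Neg (Mem (i + j + 2) (i + j + 1))))))"

primrec rsing :: "nat \<Rightarrow> nat \<Rightarrow> fo" where
  "rsing 0 i = Pred i"
| "rsing (Suc n) i = FEx (i + 1) (And (isSing (i + 1) i) (rsing n (i + 1)))"

definition code :: "nat \<Rightarrow> nat \<Rightarrow> fo" where
  "code n i = FEx (i + 1) (And (isSing (i + 1) i) (FEx (i + 2) (And (isC (i + 2) (i + 1)) (rsing n (i + 2)))))"

lemma fv_isSing [simp]: "fo_fv (isSing i j) = {i, j}" "fo_fsv (isSing i j) = {}"
  by (auto simp: isSing_def)

lemma fv_isC [simp]: "fo_fv (isC i j) = {i, j}" "fo_fsv (isC i j) = {}"
  by (auto simp: isC_def)

lemma fv_rsing [simp]: "fo_fv (rsing n i) = {i}" "fo_fsv (rsing n i) = {}"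
  by (induction n arbitrary: i) auto

lemma fv_code [simp]: "fo_fv (code n i) = {i}" "fo_fsv (code n i) = {}"
  by (auto simp: code_def)

lemma sat_isSing:
  assumes "codable M" "e i \<in> M" "e j \<in> M"
  shows "fo_sat M R e s (isSing i j) \<longleftrightarrow> e i = sg (e j)"
  using codable_elts_eq[OF assms(1,2), of "{e j}"] assms(3) by (simp add: isSing_def eq_sg) blast

lemma sat_isC:
  assumes "codable M" "e i \<in> M" "e j \<in> M"
  shows "fo_sat M R e s (isC i j) \<longleftrightarrow> e i = upair zero (e j)"
proof -
  have z: "(\<forall>w\<in>M. w \<notin> elts u) \<longleftrightarrow> u = zero" if "u \<in> M" for u
    using codable_elts_eq[OF assms(1) that, of "{}"] eq_zero[of u] by auto
  have "fo_sat M R e s (isC i j) \<longleftrightarrow> (\<forall>w\<in>M. w \<in> elts (e i) \<longleftrightarrow> w = e j \<or> (\<forall>v\<in>M. v \<notin> elts w))"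
    by (simp add: isC_def) blast
  also have "\<dots> \<longleftrightarrow> (\<forall>w\<in>M. w \<in> elts (e i) \<longleftrightarrow> w \<in> {zero, e j})" using z by auto
  also have "\<dots> \<longleftrightarrow> elts (e i) = {zero, e j}"
    by (rule codable_elts_eq) (use assms in \<open>auto simp: codable_def\<close>)
  also have "\<dots> \<longleftrightarrow> e i = upair zero (e j)" using hset_ext[of "e i" "upair zero (e j)"] by auto
  finally show ?thesis .
qed

lemma sat_rsing:
  "codable M \<Longrightarrow> e i \<in> M \<Longrightarrow> fo_sat M R e s (rsing n i) \<longleftrightarrow> (sg ^^ n) (e i) \<in> R"
proof (induction n arbitrary: e i)
  case (Suc n)
  have "fo_sat M R e s (rsing (Suc n) i) \<longleftrightarrow>
     (\<exists>a\<in>M. a = sg (e i) \<and> (sg ^^ n) a \<in> R)"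
    using Suc by (simp add: sat_isSing)
  also have "\<dots> \<longleftrightarrow> (sg ^^ n) (sg (e i)) \<in> R" using codable_sg[OF Suc(2,3)] by auto
  finally show ?case by (simp only: funpow_Suc_right o_apply)
qed simp

lemma sat_code:
  assumes "codable M" "e i \<in> M"
  shows "fo_sat M R e s (code n i) \<longleftrightarrow> cd n (e i) \<in> R"
proof -
  have "fo_sat M R e s (code n i) \<longleftrightarrow>
     (\<exists>a\<in>M. a = sg (e i) \<and> (\<exists>b\<in>M. b = upair zero a \<and> (sg ^^ n) b \<in> R))"
    using assms by (simp add: code_def sat_isSing sat_isC sat_rsing)
  also have "\<dots> \<longleftrightarrow> cd n (e i) \<in> R"
    using codable_sg[OF assms] assms(1) by (auto simp: codable_def cd_def)
  finally show ?thesis .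
qed

text \<open>Tag 1 holds the original predicate and tag \<open>j + 2\<close> the value of the
  second-order variable \<open>j\<close>; tag 0 is kept for the graph of a function. The set
  \<open>D\<close> consists of the variables read off from the predicate, and a variable leaves
  \<open>D\<close> when it is quantified.\<close>

primrec tr_fo :: "nat set \<Rightarrow> fo \<Rightarrow> fo" where
  "tr_fo D (Mem i j) = Mem i j"
| "tr_fo D (Eq i j) = Eq i j"
| "tr_fo D (Pred i) = code 1 i"
| "tr_fo D (In i j) = (if j \<in> D then code (j + 2) i else In i j)"
| "tr_fo D (Neg \<phi>) = Neg (tr_fo D \<phi>)"
| "tr_fo D (And \<phi> \<psi>) = And (tr_fo D \<phi>) (tr_fo D \<psi>)"
| "tr_fo D (All i \<phi>) = All i (tr_fo D \<phi>)"

primrec tr :: "'k so \<Rightarrow> nat set \<Rightarrow> 'k so" where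
  "tr (FO \<theta>) = (\<lambda>D. FO (tr_fo D \<theta>))"
| "tr (AllS j \<phi>) = (\<lambda>D. AllS j (tr \<phi> (D - {j})))"
| "tr (ExS j \<phi>) = (\<lambda>D. ExS j (tr \<phi> (D - {j})))"
| "tr (Conj \<zeta> \<phi>) = (\<lambda>D. Conj \<zeta> (\<lambda>\<eta>. tr (\<phi> \<eta>) D))"
| "tr (Disj \<zeta> \<phi>) = (\<lambda>D. Disj \<zeta> (\<lambda>\<eta>. tr (\<phi> \<eta>) D))"

lemma tr_fo_fv [simp]: "fo_fv (tr_fo D \<theta>) = fo_fv \<theta>" "fo_fsv (tr_fo D \<theta>) = fo_fsv \<theta> - D"
  by (induction \<theta>) auto

lemma fv_tr [simp]: "fv (tr \<phi> D) = fv \<phi>"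
  by (induction \<phi> arbitrary: D) auto

lemma fsv_tr [simp]: "fsv (tr \<phi> D) = fsv \<phi> - D"
  by (induction \<phi> arbitrary: D) auto

lemma tr_foldr: "tr (foldr AllS js \<phi>) D = foldr AllS js (tr \<phi> (D - set js))"
    "tr (foldr ExS js \<phi>) D = foldr ExS js (tr \<phi> (D - set js))"
  by (induction js arbitrary: D) (simp_all add: Diff_insert2[symmetric])

lemma is_Pi_tr: "is_Pi \<zeta> \<phi> \<Longrightarrow> is_Pi \<zeta> (tr \<phi> D)" "is_Sigma \<zeta> \<phi> \<Longrightarrow> is_Sigma \<zeta> (tr \<phi> D)"
proof (induction arbitrary: D and D rule: is_Pi_is_Sigma.inducts)
  case (Pi_limit \<zeta> \<phi>)
  have "finite (fsv (tr (Conj \<zeta> \<phi>) D))" unfolding fsv_tr using Pi_limit by simp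
  then show ?case using Pi_limit by (auto intro!: is_Pi_is_Sigma.intros simp del: fsv_tr)
next
  case (Sigma_limit \<zeta> \<phi>)
  have "finite (fsv (tr (Disj \<zeta> \<phi>) D))" unfolding fsv_tr using Sigma_limit by simp
  then show ?case using Sigma_limit by (auto intro!: is_Pi_is_Sigma.intros simp del: fsv_tr)
qed (auto simp: tr_foldr intro: is_Pi_is_Sigma.intros)

lemma fo_sat_tr:
  assumes "codable M" "\<And>n v. v \<in> M \<Longrightarrow> cd n v \<in> R' \<longleftrightarrow> v \<in> Z n"
  shows "range e \<subseteq> M \<Longrightarrow> fo_sat M R' e s (tr_fo D \<theta>) =
    fo_sat M (Z 1) e (\<lambda>j. if j \<in> D then Z (j + 2) else s j) \<theta>"
proof (induction \<theta> arbitrary: e)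
  case (All i \<theta>)
  have "range (e(i := a)) \<subseteq> M" if "a \<in> M" for a using that All(2) by auto
  then show ?case by (simp only: tr_fo.simps fo_sat.simps All(1) cong: ball_cong)
next
  case (Pred i)
  have "e i \<in> M" using Pred by auto
  then show ?case using assms by (simp add: sat_code)
next
  case (In i j)
  have "e i \<in> M" using In by auto
  then show ?case using assms by (simp add: sat_code)
qed auto

lemma sat_tr:
  assumes "codable M" "\<And>n v. v \<in> M \<Longrightarrow> cd n v \<in> R' \<longleftrightarrow> v \<in> Z n" "range e \<subseteq> M"
  shows "sat M R' e (tr \<phi> D) s = sat M (Z 1) e \<phi> (\<lambda>j. if j \<in> D then Z (j + 2) else s j)"
proof (induction \<phi> arbitrary: D s)
  case (FO \<theta>)
  show ?case using fo_sat_tr[OF assms(1,2,3)] by simp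
next
  case (AllS j \<phi>)
  have "(\<lambda>k. if k \<in> D - {j} then Z (k + 2) else (s(j := X)) k) = (\<lambda>k. if k \<in> D then Z (k + 2) else s k)(j := X)" for X
    by (rule ext) auto
  then show ?case by (simp only: sat.simps tr.simps AllS)
next
  case (ExS j \<phi>)
  have "(\<lambda>k. if k \<in> D - {j} then Z (k + 2) else (s(j := X)) k) = (\<lambda>k. if k \<in> D then Z (k + 2) else s k)(j := X)" for X
    by (rule ext) auto
  then show ?case by (simp only: sat.simps tr.simps ExS)
qed auto

text \<open>Tagged elements have at most two elements (\<open>cd_two\<close>), so a member of the
  predicate with three of them can only be the infinite ordinal that \<open>reflection\<close> adds
  without a tag. The sentence forces that ordinal into the local structure.\<close>

definition has3 :: fo where
  "has3 = FEx 0 (And (Pred 0) (FEx 1 (And (Mem 1 0) (FEx 2 (And (Mem 2 0) (And (Neg (Eq 1 2))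
     (FEx 3 (And (Mem 3 0) (And (Neg (Eq 1 3)) (Neg (Eq 2 3)))))))))))"

lemma sat_has3: "fo_sat M R e s has3 \<longleftrightarrow> (\<exists>v\<in>M. v \<in> R \<and> (\<exists>a\<in>M. a \<in> elts v \<and> (\<exists>b\<in>M. b \<in> elts v \<and> a \<noteq> b \<and>
    (\<exists>c\<in>M. c \<in> elts v \<and> a \<noteq> c \<and> b \<noteq> c))))"
  by (simp add: has3_def)

lemma fv_has3 [simp]: "fo_fv has3 = {}" "fo_fsv has3 = {}"
  by (auto simp: has3_def)

text \<open>The members with tag 0 are the pairs \<open>kp v (F v)\<close>. Such a pair with the
  singleton of \<open>v\<close> as an element has first component \<open>v\<close>. Since it and its
  elements are finite sets, \<open>F v\<close> is then in the structure as well.\<close>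

definition closF :: fo where
  "closF = All 0 (FEx 1 (And (code 0 1) (FEx 2 (And (Mem 2 1) (isSing 2 0)))))"

lemma fv_closF [simp]: "fo_fv closF = {}" "fo_fsv closF = {}"
  by (auto simp: closF_def)

lemma sat_closF:
  assumes "codable M"
  shows "fo_sat M R e s closF \<longleftrightarrow> (\<forall>v\<in>M. \<exists>p\<in>M. cd 0 p \<in> R \<and> (\<exists>u\<in>M. u \<in> elts p \<and> u = sg v))"
  using assms by (auto simp: closF_def sat_code sat_isSing)

section \<open>Reflection with parameters\<close>

lemma regular_uncountable_nat:
  assumes "regular_uncountable \<kappa>"
  shows "|UNIV :: nat set| <o |elts \<kappa>|"
proof -
  have "|UNIV :: nat set| <o ord_rel \<kappa>"
    using assms card_of_nat ordIso_ordLess_trans unfolding regular_uncountable_def by metis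
  then show ?thesis
    using Card_of_Cardinal assms ordLess_ordIso_trans unfolding regular_uncountable_def by metis
qed

lemma regular_uncountableI:
  assumes "Cardinal \<mu>" "|UNIV :: nat set| <o |elts \<mu>|"
    "\<And>u. u \<subseteq> elts \<mu> \<Longrightarrow> |u| <o |elts \<mu>| \<Longrightarrow> \<exists>b\<in>elts \<mu>. u \<subseteq> elts b"
  shows "regular_uncountable \<mu>"
proof -
  have "natLeq <o |elts \<mu>|"
    by (rule ordIso_ordLess_trans[OF ordIso_symmetric[OF card_of_nat] assms(2)])
  then have "natLeq <o ord_rel \<mu>"
    by (rule ordLess_ordIso_trans[OF _ ordIso_symmetric[OF Card_of_Cardinal[OF assms(1)]]])
  then show ?thesis unfolding regular_uncountable_def
    using assms(1) regularCardI[OF assms(1,3)] by blast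
qed

lemma Ord_in_stage:
  assumes "Cardinal \<kappa>"
  shows "u \<in> elts \<kappa> \<Longrightarrow> u \<in> Psub \<kappa> (VV \<kappa> A u)"
proof (induction u rule: hset_induct)
  case (1 u)
  note O = Cardinal_Ord[OF assms]
  have "v \<in> VV \<kappa> A u" if v: "v \<in> elts u" for v
    using 1(1)[OF v Ord_trans[OF O v 1(2)]] v VV_iff[OF Ord_elt[OF O 1(2)], of v \<kappa> A] by blast
  then show ?case unfolding Psub_def using Cardinal_lessI[OF assms 1(2)] by blast
qed

lemma indescribableD:
  assumes "indescribable \<xi> \<kappa> A S" "R \<subseteq> WW \<kappa> A" "is_Pi \<xi> \<phi>" "sentence \<phi>" "models (WW \<kappa> A) R \<phi>"
  shows "\<exists>x\<in>S. elts x \<inter> elts \<kappa> = elts (kap \<kappa> x) \<and> models (MM \<kappa> x) (R \<inter> MM \<kappa> x) \<phi>"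
  using assms(1)[unfolded indescribable_def, rule_format, of R \<phi>] assms(2-) by simp

text \<open>For an ordinal \<delta> below \<kappa> and outside \<open>A\<close>, the statement that
  the predicate is non-empty holds with the predicate \<open>{\<delta>}\<close>. At a reflection
  point \<open>x\<close> this \<delta> is in the local structure without being an atom. So it has
  size below \<open>kap \<kappa> x\<close> and lies in the intersection of \<open>x\<close> with
  \<kappa>, a contradiction.\<close>

lemma indescribable_sub:
  fixes \<kappa> A \<xi> :: "'k hset"
  assumes "Cardinal \<kappa>" "S \<subseteq> PP \<kappa> A" "indescribable \<xi> \<kappa> A S" "Ord \<xi>"
  shows "elts \<kappa> \<subseteq> elts A"
proof
  fix \<delta> assume d: "\<delta> \<in> elts \<kappa>"
  note O = Cardinal_Ord[OF assms(1)]
  show "\<delta> \<in> elts A"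
  proof (rule ccontr)
    assume nd: "\<delta> \<notin> elts A"
    define \<theta> where "\<theta> = FEx 0 (Pred 0)"
    obtain \<phi> :: "'k so" where p: "is_Pi \<xi> \<phi>" "fsv \<phi> \<subseteq> fo_fsv \<theta>" "fv \<phi> \<subseteq> fo_fv \<theta>" "\<And>M R e s. sat M R e \<phi> s = fo_sat M R e s \<theta>"
      using lift_FO[OF assms(4), of \<theta>] by metis
    have sen: "sentence \<phi>" using p(2,3) by (auto simp: sentence_def \<theta>_def)
    have mod: "models M R \<phi> \<longleftrightarrow> (\<exists>v\<in>M. v \<in> R)" for M R
      unfolding models_def p(4) \<theta>_def by simp
    have "\<delta> \<in> VV \<kappa> A \<kappa>" by (subst VV_iff[OF O]) (use Ord_in_stage[OF assms(1) d, of A] d in blast)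
    then have "models (VV \<kappa> A \<kappa>) {\<delta>} \<phi>" "{\<delta>} \<subseteq> VV \<kappa> A \<kappa>" unfolding mod by blast+
    then obtain x where x: "x \<in> S" "elts x \<inter> elts \<kappa> = elts (kap \<kappa> x)" 
       "models (MM \<kappa> x) ({\<delta>} \<inter> MM \<kappa> x) \<phi>"
      using indescribableD[OF assms(3) _ p(1) sen] by metis
    then have "\<delta> \<in> MM \<kappa> x" unfolding mod by blast
    moreover have nx: "\<delta> \<notin> elts x" using nd x(1) assms(2) unfolding Psub_def by blast
    ultimately obtain \<gamma> where "\<delta> \<in> Psub (kap \<kappa> x) (VV (kap \<kappa> x) x \<gamma>)"
      using VV_iff[OF Cardinal_Ord[OF Cardinal_kap(1)[of \<kappa> x]], of \<delta> "kap \<kappa> x" x] by blast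
    then have "|elts \<delta>| <o |elts (kap \<kappa> x)|" by (simp add: Psub_def)
    then have "\<delta> \<in> elts (kap \<kappa> x)" by (rule Cardinal_lessD[OF Cardinal_kap(1) Ord_elt[OF O d]])
    then show False using x(2) nx by blast
  qed
qed

lemma ex_countable_ord:
  assumes "world \<kappa> A"
  shows "\<exists>w\<in>elts \<kappa>. infinite (elts w)"
proof -
  obtain f :: "nat \<Rightarrow> 'a hset" where f: "inj f" using infinite_countable_subset[OF world_inf[OF assms]] by blast
  define N where "N = hcard (range f)"
  have N: "Cardinal N" "|elts N| =o |range f|" unfolding N_def by (rule hcard[OF small_countable])+
  have "|elts N| <o |elts \<kappa>|"
    by (rule ordLeq_ordLess_trans[OF ordIso_ordLeq_trans[OF N(2) card_of_image]])
      (use assms in \<open>simp add: world_def\<close>)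
  then have "N \<in> elts \<kappa>" using Cardinal_lessD Cardinal_Ord N(1) assms unfolding world_def by metis
  moreover have "infinite (elts N)"
    using card_of_ordIso_finite[OF N(2)] f finite_imageD by auto
  ultimately show ?thesis by blast
qed

definition closed_under :: "('k hset \<Rightarrow> 'k hset) \<Rightarrow> 'k hset set \<Rightarrow> bool" where
  "closed_under F M \<longleftrightarrow> (\<forall>v\<in>M. F v \<in> M)"

text \<open>One predicate carries an infinite ordinal \<open>v0\<close>, the graph of
  \<open>F\<close>, the predicate \<open>R\<close> and the whole assignment \<open>P\<close>; one
  sentence combines \<open>has3\<close>, \<open>closF\<close> and the translation of \<phi>. Local
  structures are closed under the coding, so the predicate cut down to \<open>x\<close> decodes to
  the parts cut down to \<open>x\<close>.\<close>

proposition reflection: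
  fixes \<kappa> A \<xi> :: "'k hset"
  assumes w: "world \<kappa> A" and S: "S \<subseteq> PP \<kappa> A" "indescribable \<xi> \<kappa> A S" 
    and F: "closed_under F (WW \<kappa> A)" and \<phi>: "is_Pi \<xi> \<phi>" "fv \<phi> = {}"
    and RP: "R \<subseteq> WW \<kappa> A" "\<And>j. P j \<subseteq> WW \<kappa> A" and sat: "sat (WW \<kappa> A) R e \<phi> P"
  shows "\<exists>x\<in>S. gd \<kappa> A x \<and> closed_under F (MM \<kappa> x) \<and>
     sat (MM \<kappa> x) (R \<inter> MM \<kappa> x) e \<phi> (\<lambda>j. P j \<inter> MM \<kappa> x)"
proof -
  let ?W = "WW \<kappa> A"
  have C: "Cardinal \<kappa>" using w by (simp add: world_def)
  note cod = codable_WW[OF w]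
  obtain v0 where v0: "v0 \<in> elts \<kappa>" "infinite (elts v0)" using ex_countable_ord[OF w] by blast
  have v0W: "v0 \<in> ?W" "elts v0 \<subseteq> ?W"
    using v0(1) w WW_base[OF w] world_trans[OF w v0(1)] unfolding world_def by blast+
  define Z where "Z n = (if n = 0 then {kp v (F v) | v. v \<in> ?W} else if n = 1 then R else P (n - 2))" for n
  have kpW: "kp a b \<in> ?W" if "a \<in> ?W" "b \<in> ?W" for a b
    using that cod unfolding kp_def codable_def sg_def by blast
  have ZW: "Z n \<subseteq> ?W" for n
    using RP F kpW unfolding Z_def closed_under_def by auto
  define R' where "R' = insert v0 (\<Union>n. cd n ` Z n)"
  have R'W: "R' \<subseteq> ?W" using v0W(1) ZW codable_cd[OF cod] unfolding R'_def by blast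
  have R'cd: "cd n v \<in> R' \<longleftrightarrow> v \<in> Z n" for n v
  proof -
    have "cd n v \<noteq> v0" using cd_two[of n v] v0(2) by (metis finite.emptyI finite_insert)
    then show ?thesis unfolding R'_def by (auto simp: cd_inject)
  qed
  define \<Phi> where "\<Phi> = map_fo (And (And has3 closF)) (tr \<phi> UNIV)"
  have P\<Phi>: "is_Pi \<xi> \<Phi>" unfolding \<Phi>_def by (intro is_Pi_andF is_Pi_tr \<phi>(1))
  have "fsv \<Phi> \<subseteq> fsv (tr \<phi> UNIV) \<union> {}" unfolding \<Phi>_def by (rule fsv_map_fo) simp
  moreover have "fv \<Phi> \<subseteq> fv (tr \<phi> UNIV) \<union> {}" unfolding \<Phi>_def by (rule fv_map_fo) simp
  ultimately have sen: "sentence \<Phi>" using \<phi>(2) by (simp add: sentence_def)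
  have sat\<Phi>: "sat M Q e' \<Phi> s \<longleftrightarrow> fo_sat M Q e' s has3 \<and> fo_sat M Q e' s closF \<and> sat M Q e' (tr \<phi> UNIV) s" for M Q e' s
    unfolding \<Phi>_def by (subst sat_andF(1)[OF is_Pi_tr(1)[OF \<phi>(1)]]) auto
  have dec: "sat M Q (\<lambda>_. v0) (tr \<phi> UNIV) s \<longleftrightarrow> sat M (Y 1) e \<phi> (\<lambda>j. Y (j + 2))"
    if "codable M" "\<And>n v. v \<in> M \<Longrightarrow> cd n v \<in> Q \<longleftrightarrow> v \<in> Y n" "v0 \<in> M" for M Q Y s
    using sat_tr[OF that(1,2), where e = "\<lambda>_. v0" and \<phi> = \<phi> and D = UNIV and s = s] that(3)
      sat_cong[of \<phi> "\<lambda>_. v0" e] \<phi>(2) by auto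
  have ZP: "Z 1 = R" "(\<lambda>j. Z (j + 2)) = P" unfolding Z_def by auto
  have "models ?W R' \<Phi>"
    unfolding models_iff[OF sen, where e = "\<lambda>_. v0" and s = P] sat\<Phi>
  proof (intro conjI)
    obtain X where X: "X \<subseteq> elts v0" "card X = 3" "finite X"
      using infinite_arbitrarily_large[OF v0(2), of 3] by blast
    then obtain a b c where "X = {a, b, c}" "a \<noteq> b" "a \<noteq> c" "b \<noteq> c"
      by (auto simp: card_Suc_eq numeral_3_eq_3)
    then show "fo_sat ?W R' (\<lambda>_. v0) P has3"
      unfolding sat_has3 using X v0W by (intro bexI[of _ v0]) (auto simp: R'_def)
    show "fo_sat ?W R' (\<lambda>_. v0) P closF"
      unfolding sat_closF[OF cod]
    proof
      fix v assume v: "v \<in> ?W"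
      then have "F v \<in> ?W" using F by (simp add: closed_under_def)
      then show "\<exists>p\<in>?W. cd 0 p \<in> R' \<and> (\<exists>u\<in>?W. u \<in> elts p \<and> u = sg v)"
        using v kpW codable_sg[OF cod] unfolding R'cd by (intro bexI[of _ "kp v (F v)"]) (auto simp: Z_def kp_def)
    qed
    show "sat ?W R' (\<lambda>_. v0) (tr \<phi> UNIV) P"
      using dec[OF cod R'cd v0W(1), of P] sat ZP by simp
  qed
  then obtain x where x: "x \<in> S" "elts x \<inter> elts \<kappa> = elts (kap \<kappa> x)" 
       "models (MM \<kappa> x) (R' \<inter> MM \<kappa> x) \<Phi>"
    using indescribableD[OF S(2) R'W P\<Phi> sen] by metis
  let ?M = "MM \<kappa> x"
  have xP: "x \<in> PP \<kappa> A" using x(1) S(1) by blast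
  have sx: "sat ?M (R' \<inter> ?M) (\<lambda>_. v0) \<Phi> P"
    using x(3) unfolding models_iff[OF sen, where e = "\<lambda>_. v0" and s = P] .
  then obtain v a b c where v: "v \<in> R' \<inter> ?M" "a \<in> elts v" "b \<in> elts v" "c \<in> elts v" "a \<noteq> b" "a \<noteq> c" "b \<noteq> c"
    unfolding sat\<Phi> sat_has3 by blast
  have "v = v0"
  proof (rule ccontr)
    assume "v \<noteq> v0"
    then obtain n u where "v = cd n u" using v(1) unfolding R'_def by blast
    then obtain p q where "elts v = {p, q}" using cd_two by blast
    then show False using v by auto
  qed
  then have v0M: "v0 \<in> ?M" using v(1) by blast
  \<comment> \<open>An infinite set smaller than \<open>kap \<kappa> x\<close> makes
    \<open>kap \<kappa> x\<close> uncountable, which is the missing part of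
    \<open>gd\<close>.\<close>
  have "|elts v0| <o |elts (kap \<kappa> x)|"
  proof (cases "v0 \<in> elts x")
    case True
    then have "v0 \<in> elts (kap \<kappa> x)" using x(2) v0(1) by blast
    then show ?thesis by (rule Cardinal_lessI[OF Cardinal_kap(1)])
  next
    case False
    then show ?thesis using v0M VV_iff[OF Cardinal_Ord[OF Cardinal_kap(1)[of \<kappa> x]], of v0 "kap \<kappa> x" x] unfolding Psub_def by blast
  qed
  then have "|UNIV :: nat set| <o |elts (kap \<kappa> x)|"
    by (rule ordLeq_ordLess_trans[OF v0(2)[unfolded infinite_iff_card_of_nat]])
  then have gd: "gd \<kappa> A x" using xP x(2) by (simp add: gd_def)
  note cx = codable_WW[OF gd_world[OF w gd]]
  have R'x: "cd n v \<in> R' \<inter> ?M \<longleftrightarrow> v \<in> Z n \<inter> ?M" if "v \<in> ?M" for n v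
    using that R'cd codable_cd[OF cx that] by blast
  have "F v \<in> ?M" if vM: "v \<in> ?M" for v
  proof -
    obtain p where p: "p \<in> ?M" "cd 0 p \<in> R' \<inter> ?M" "sg v \<in> elts p"
      using sx vM unfolding sat\<Phi> sat_closF[OF cx] by blast
    then have "p \<in> Z 0" using R'x by blast
    then obtain v' where v': "p = kp v' (F v')" unfolding Z_def by auto
    then have "v' = v" using p(3) by (auto simp: kp_def sg_def upair_eq)
    have t: "elts u \<subseteq> ?M" if "u \<in> ?M" "finite (elts u)" for u
      by (rule MM_trans(1)[OF w gd that(1) finite_less_card[OF world_inf[OF w] that(2)]])
    have "upair v (F v) \<in> ?M" using t[OF p(1)] \<open>v' = v\<close> v' by (auto simp: kp_def)
    then show ?thesis using t[of "upair v (F v)"] by auto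
  qed
  then have cl: "closed_under F ?M" by (simp add: closed_under_def)
  have "sat ?M (R' \<inter> ?M) (\<lambda>_. v0) (tr \<phi> UNIV) P" using sx unfolding sat\<Phi> by blast
  then have "sat ?M (R \<inter> ?M) e \<phi> (\<lambda>j. P j \<inter> ?M)"
    using dec[OF cx R'x v0M, of P] ZP by (auto simp: fun_eq_iff)
  then show ?thesis using x(1) gd cl by blast
qed

section \<open>Cumulativity of the formula hierarchy\<close>

lemma Ord_decomp: "Ord \<eta> \<Longrightarrow> \<exists>n \<delta>. \<eta> = (succ ^^ n) \<delta> \<and> (\<delta> = zero \<or> is_limit \<delta>)"
proof (induction \<eta> rule: Ord_induct3)
  case 0
  show ?case by (rule exI[of _ 0]) auto
next
  case (succ \<delta>)
  then obtain n \<delta>' where "\<delta> = (succ ^^ n) \<delta>'" "\<delta>' = zero \<or> is_limit \<delta>'" by blast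
  then show ?case by (intro exI[of _ "Suc n"] exI[of _ \<delta>']) simp
next
  case (limit \<gamma>)
  then show ?case by (intro exI[of _ 0] exI[of _ \<gamma>]) simp
qed

lemma limit_succn: "is_limit \<gamma> \<Longrightarrow> \<delta> \<in> elts \<gamma> \<Longrightarrow> (succ ^^ n) \<delta> \<in> elts \<gamma>"
  by (induction n) (auto simp: is_limit_def)

lemma succn_less: "n < m \<Longrightarrow> (succ ^^ n) \<delta> \<in> elts ((succ ^^ m) \<delta>)"
  by (induction m) (auto simp: elts_succ less_Suc_eq)

lemma succn_inject: "(succ ^^ n) \<delta> = (succ ^^ m) \<delta> \<longleftrightarrow> n = m"
  by (metis elts_irrefl nat_neq_iff succn_less)

lemma elts_succn_zero: "elts ((succ ^^ n) zero) = (\<lambda>k. (succ ^^ k) zero) ` {..<n}"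
  by (induction n) (auto simp: elts_succ lessThan_Suc)

text \<open>If some index below \<gamma> has no limit strictly between it and \<gamma>, then
  \<gamma> is \<delta> + \<omega> for the limit part \<delta> of that index. The two cases need
  different ways of addressing conjuncts: by natural numbers past \<delta>, or by ordinals lying in
  blocks between consecutive limits.\<close>

lemma limit_cases:
  assumes "is_limit \<gamma>"
  obtains (A) \<delta> where "\<delta> = zero \<or> is_limit \<delta>" "elts \<gamma> = elts \<delta> \<union> range (\<lambda>n. (succ ^^ n) \<delta>)"
  | (B) "\<forall>\<eta>\<in>elts \<gamma>. \<exists>\<mu>\<in>elts \<gamma>. is_limit \<mu> \<and> \<eta> \<in> elts \<mu>"
proof (cases "\<forall>\<eta>\<in>elts \<gamma>. \<exists>\<mu>\<in>elts \<gamma>. is_limit \<mu> \<and> \<eta> \<in> elts \<mu>")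
  case False
  note O = is_limit_Ord[OF assms]
  obtain \<eta>0 where n: "\<eta>0 \<in> elts \<gamma>" "\<And>\<mu>. \<mu> \<in> elts \<gamma> \<Longrightarrow> is_limit \<mu> \<Longrightarrow> \<eta>0 \<notin> elts \<mu>" using False by blast
  obtain k \<delta> where d: "\<eta>0 = (succ ^^ k) \<delta>" "\<delta> = zero \<or> is_limit \<delta>"
    using Ord_decomp[OF Ord_elt[OF O n(1)]] by blast
  have Od: "Ord \<delta>" using d(2) is_limit_Ord by auto
  have dl: "\<delta> \<in> elts \<gamma>"
    using n(1) d(1) succn_less[of 0 k \<delta>] Ord_trans[OF O, of \<delta> \<eta>0] by (cases k) auto
  have "\<eta> \<in> elts \<delta> \<union> range (\<lambda>n. (succ ^^ n) \<delta>)" if e: "\<eta> \<in> elts \<gamma>" for \<eta>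
  proof -
    obtain m \<delta>' where m: "\<eta> = (succ ^^ m) \<delta>'" "\<delta>' = zero \<or> is_limit \<delta>'"
      using Ord_decomp[OF Ord_elt[OF O e]] by blast
    have Od': "Ord \<delta>'" using m(2) is_limit_Ord by auto
    have d'l: "\<delta>' \<in> elts \<gamma>"
      using e m(1) succn_less[of 0 m \<delta>'] Ord_trans[OF O, of \<delta>' \<eta>] by (cases m) auto
    consider "\<delta>' \<in> elts \<delta>" | "\<delta>' = \<delta>" | "\<delta> \<in> elts \<delta>'" using Ord_linear[OF Od' Od] by blast
    then show ?thesis
    proof cases
      case 1
      then have "is_limit \<delta>" using d(2) by auto
      then show ?thesis using limit_succn[OF _ 1] m(1) by blast
    next
      case 2
      then show ?thesis using m(1) by blast
    next
      case 3
      then have "is_limit \<delta>'" using m(2) by auto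
      then show ?thesis using limit_succn[OF _ 3, of k] n(2)[OF d'l] d(1) by blast
    qed
  qed
  moreover have "elts \<delta> \<subseteq> elts \<gamma>" "range (\<lambda>n. (succ ^^ n) \<delta>) \<subseteq> elts \<gamma>"
    using Ord_trans[OF O _ dl] limit_succn[OF assms dl] by blast+
  ultimately have "elts \<gamma> = elts \<delta> \<union> range (\<lambda>n. (succ ^^ n) \<delta>)" by blast
  then show ?thesis using A d(2) by blast
qed (rule B)

lemma Pi_Sigma: "is_Pi \<zeta> \<phi> \<Longrightarrow> is_Sigma (succ \<zeta>) \<phi>" and Sigma_Pi: "is_Sigma \<zeta> \<phi> \<Longrightarrow> is_Pi (succ \<zeta>) \<phi>"
  using Sigma_succ[of \<zeta> \<phi> "[]"] Pi_succ[of \<zeta> \<phi> "[]"] by auto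

section \<open>Limit levels of the form \<delta> + \<omega>\<close>

definition Nat0 :: "'k hset set" where "Nat0 = range (\<lambda>n. (succ ^^ n) zero)"

text \<open>A descending membership chain of length \<open>n\<close> from the value of
  \<open>i\<close>; for a finite ordinal this says that it is at least \<open>n\<close>.\<close>

primrec ge :: "nat \<Rightarrow> nat \<Rightarrow> fo" where
  "ge 0 i = Eq i i"
| "ge (Suc n) i = FEx (i + 1) (And (Mem (i + 1) i) (ge n (i + 1)))"

lemma fv_ge [simp]: "fo_fv (ge n i) = {i}" "fo_fsv (ge n i) = {}"
  by (induction n arbitrary: i) auto

lemma sat_ge:
  assumes "Nat0 \<subseteq> M"
  shows "e i = (succ ^^ m) zero \<Longrightarrow> fo_sat M R e s (ge n i) \<longleftrightarrow> n \<le> m"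
proof (induction n arbitrary: e i m)
  case (Suc n)
  have "fo_sat M R e s (ge (Suc n) i) \<longleftrightarrow>
      (\<exists>a\<in>M. a \<in> elts ((succ ^^ m) zero) \<and> fo_sat M R (e(i + 1 := a)) s (ge n (i + 1)))"
    using Suc(2) by simp
  also have "\<dots> \<longleftrightarrow> (\<exists>k<m. fo_sat M R (e(i + 1 := (succ ^^ k) zero)) s (ge n (i + 1)))"
    using assms unfolding elts_succn_zero Nat0_def by blast
  also have "\<dots> \<longleftrightarrow> (\<exists>k<m. n \<le> k)" using Suc(1) by simp
  also have "\<dots> \<longleftrightarrow> Suc n \<le> m" by (auto intro!: exI[of _ n])
  finally show ?case .
qed simp

text \<open>The second-order variable 2 is the singleton of an element of the variable \<open>q\<close>.\<close>

definition ptr :: "nat \<Rightarrow> fo" where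
  "ptr q = FEx 0 (And (In 0 q) (All 1 (FIff (In 1 2) (Eq 1 0))))"

lemma fv_ptr [simp]: "fo_fv (ptr q) = {}" "fo_fsv (ptr q) = {q, 2}"
  by (auto simp: ptr_def)

lemma sat_ptr: "s q \<subseteq> M \<Longrightarrow> s 2 \<subseteq> M \<Longrightarrow> fo_sat M R e s (ptr q) \<longleftrightarrow> (\<exists>a\<in>s q. s 2 = {a})"
  unfolding ptr_def by simp blast

definition num :: "nat \<Rightarrow> fo" where
  "num n = FEx 0 (And (In 0 2) (And (ge n 0) (Neg (ge (Suc n) 0))))"

lemma fv_num [simp]: "fo_fv (num n) = {}" "fo_fsv (num n) = {2}"
  by (auto simp: num_def)

lemma sat_num:
  assumes "Nat0 \<subseteq> M" "s 2 = {(succ ^^ m) zero}"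
  shows "fo_sat M R e s (num n) \<longleftrightarrow> n = m"
proof -
  have "(succ ^^ m) zero \<in> M" using assms(1) by (auto simp: Nat0_def)
  then have "fo_sat M R e s (num n) \<longleftrightarrow> (let e' = e(0 := (succ ^^ m) zero) in
      fo_sat M R e' s (ge n 0) \<and> \<not> fo_sat M R e' s (ge (Suc n) 0))"
    unfolding num_def fo_sat.simps Let_def using assms(2) by auto
  then show ?thesis using sat_ge[OF assms(1), of "e(0 := (succ ^^ m) zero)" 0 m] by (auto simp: Let_def simp del: ge.simps)
qed

text \<open>
  A \<open>\<Pi>\<close> formula of limit level \<open>\<gamma>\<close> (or finitely many levels above) embeds into the next level of the hierarchy only relative to parameters:
  the variable 0 is to be interpreted by \<open>\<gamma>\<close>, the variable 1 by the
  natural numbers, and the variable 2 is reserved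
  for a singleton pointing to the conjunct under consideration.
\<close>

definition embeds :: "'k hset \<Rightarrow> 'k so \<Rightarrow> 'k so \<Rightarrow> bool" where
  "embeds \<gamma> \<phi> \<phi>' \<longleftrightarrow> fv \<phi>' = {} \<and> (\<forall>M R e s. elts \<gamma> \<subseteq> M \<longrightarrow> Nat0 \<subseteq> M \<longrightarrow> s 0 = elts \<gamma> \<longrightarrow> s 1 = Nat0 \<longrightarrow>
     sat M R e \<phi>' s = sat M R e \<phi> (\<lambda>j. s (j + 3)))"

abbreviation sh3 :: "'k so \<Rightarrow> 'k so" where "sh3 \<equiv> ren (\<lambda>j. j + 3)"

lemma inj3: "inj (\<lambda>j::nat. j + 3)" by (auto simp: inj_def)

lemma sat_sh3: "sat M R e (sh3 \<phi>) s = sat M R e \<phi> (\<lambda>j. s (j + 3))"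
  by (simp add: sat_ren[OF inj3] o_def)

lemma fsv_sh3: "fsv (sh3 \<phi>) = (\<lambda>j. j + 3) ` fsv \<phi>"
  by (rule fsv_ren[OF inj3])

lemmas is_Pi_sh3 = is_Pi_ren[OF inj3]

text \<open>The conjunction over \<delta> + \<omega> is read as: for every natural number
  \<open>m\<close>, piece \<open>m\<close> holds. Piece 0 is the conjunction over \<delta>, and
  piece \<open>n + 1\<close> is the conjunct at \<delta> + n. The choice of the piece is a
  disjunction over \<gamma>, and the quantifier over the singleton of \<open>m\<close> adds one
  universal block.\<close>

lemma embed_limit_plus_omega:
  fixes \<phi> :: "'k hset \<Rightarrow> 'k so"
  assumes lim: "is_limit \<gamma>" and d: "\<delta> = zero \<or> is_limit \<delta>" "elts \<gamma> = elts \<delta> \<union> range (\<lambda>n. (succ ^^ n) \<delta>)"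
    and \<phi>: "\<And>\<eta>. \<eta> \<in> elts \<gamma> \<Longrightarrow> is_Pi \<eta> (\<phi> \<eta>)" "finite (fsv (Conj \<gamma> \<phi>))" "fv (Conj \<gamma> \<phi>) = {}"
  shows "\<exists>\<phi>'. is_Pi (succ \<gamma>) \<phi>' \<and> embeds \<gamma> (Conj \<gamma> \<phi>) \<phi>'"
proof -
  let ?F = "fsv (Conj \<gamma> \<phi>)"
  have dl: "\<delta> \<in> elts \<gamma>" using d(2) by (metis UnCI funpow_0 rangeI)
  have fF: "fsv (\<phi> \<eta>) \<subseteq> ?F" "fv (\<phi> \<eta>) = {}" if "\<eta> \<in> elts \<gamma>" for \<eta> using that \<phi>(3) by auto
  obtain tr0 :: "'k so" where tr0: "is_Pi zero tr0" "fsv tr0 = {}" "fv tr0 = {}" "\<And>M R e s. sat M R e tr0 s"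
    using Pi_0[of zero "All 0 (Eq 0 0)"] by (intro that[of "FO (All 0 (Eq 0 0))"]) auto
  obtain \<psi>0 where p0: "is_Pi \<delta> \<psi>0" "fsv \<psi>0 \<subseteq> ?F" "fv \<psi>0 = {}"
     "\<And>M R e s. sat M R e \<psi>0 s \<longleftrightarrow> (\<forall>\<eta>\<in>elts \<delta>. sat M R e (\<phi> \<eta>) s)"
  proof (cases "\<delta> = zero")
    case True
    then show ?thesis using tr0 that[of tr0] by simp
  next
    case False
    then have l: "is_limit \<delta>" using d(1) by blast
    have sub: "fsv (Conj \<delta> \<phi>) \<subseteq> ?F" "fv (Conj \<delta> \<phi>) = {}" using d(2) \<phi>(3) by auto
    have "is_Pi \<delta> (Conj \<delta> \<phi>)"
      by (rule Pi_limit[OF l _ finite_subset[OF sub(1) \<phi>(2)]]) (use \<phi>(1) d(2) in auto)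
    then show ?thesis using that[of "Conj \<delta> \<phi>"] sub by simp
  qed
  let ?N = "(\<lambda>j. j + 3) ` ?F \<union> {2}"
  \<comment> \<open>Piece 0 is put at the index \<delta> + 1 and piece \<open>n + 1\<close> at
    \<delta> + n + 3. Each step upwards exchanges Pi and Sigma, so an odd shift is required to make
    a Sigma formula of a Pi formula; the shift by 1 would collide with \<delta> + 1 at
    \<open>n = 0\<close>.\<close>
  have ex: "\<exists>\<chi>. is_Sigma \<sigma> \<chi> \<and> bsv \<chi> \<subseteq> {3..} \<and> fsv \<chi> \<subseteq> ?N \<and> fv \<chi> = {} \<and>
     (\<forall>M R e s. sat M R e \<chi> s \<longleftrightarrow> (\<sigma> = succ \<delta> \<and> fo_sat M R e s (num 0) \<and> sat M R e \<psi>0 (\<lambda>j. s (j + 3))) \<or>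
        (\<exists>n. \<sigma> = (succ ^^ (n + 3)) \<delta> \<and> fo_sat M R e s (num (Suc n)) \<and> sat M R e (\<phi> ((succ ^^ n) \<delta>)) (\<lambda>j. s (j + 3))))"
    (is "\<exists>\<chi>. ?C \<sigma> \<chi>") if s: "\<sigma> \<in> elts \<gamma>" for \<sigma>
  proof -
    have guard: "bsv (map_fo (And (num n)) (sh3 \<psi>)) \<subseteq> {3..}" "fsv (map_fo (And (num n)) (sh3 \<psi>)) \<subseteq> ?N"
        "fv (map_fo (And (num n)) (sh3 \<psi>)) = {}"
        "is_Sigma \<tau> (map_fo (And (num n)) (sh3 \<psi>))"
        "sat M R e (map_fo (And (num n)) (sh3 \<psi>)) s \<longleftrightarrow> fo_sat M R e s (num n) \<and> sat M R e \<psi> (\<lambda>j. s (j + 3))"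
      if "is_Sigma \<tau> \<psi>" "fsv \<psi> \<subseteq> ?F" "fv \<psi> = {}" for n \<psi> \<tau> M R e s
    proof -
      show "bsv (map_fo (And (num n)) (sh3 \<psi>)) \<subseteq> {3..}" by auto
      have "fsv (map_fo (And (num n)) (sh3 \<psi>)) \<subseteq> fsv (sh3 \<psi>) \<union> {2}" by (rule fsv_map_fo) auto
      then show "fsv (map_fo (And (num n)) (sh3 \<psi>)) \<subseteq> ?N" unfolding fsv_sh3 using that(2) by blast
      have "fv (map_fo (And (num n)) (sh3 \<psi>)) \<subseteq> fv (sh3 \<psi>) \<union> {}" by (rule fv_map_fo) auto
      then show "fv (map_fo (And (num n)) (sh3 \<psi>)) = {}" using that(3) by simp
      have S: "is_Sigma \<tau> (sh3 \<psi>)" by (rule is_Pi_sh3(2)[OF that(1)])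
      then show "is_Sigma \<tau> (map_fo (And (num n)) (sh3 \<psi>))" by (rule is_Pi_andF)
      show "sat M R e (map_fo (And (num n)) (sh3 \<psi>)) s \<longleftrightarrow> fo_sat M R e s (num n) \<and> sat M R e \<psi> (\<lambda>j. s (j + 3))"
        by (subst sat_andF(2)[OF S]) (auto simp: sat_sh3)
    qed
    consider (a) "\<sigma> = succ \<delta>" | (b) n where "\<sigma> = (succ ^^ (n + 3)) \<delta>" | (c) "\<sigma> \<noteq> succ \<delta>" "\<nexists>n. \<sigma> = (succ ^^ (n + 3)) \<delta>"
      by blast
    then show ?thesis
    proof cases
      case a
      have "is_Sigma \<sigma> \<psi>0" unfolding a by (rule Pi_Sigma[OF p0(1)])
      moreover have "succ \<delta> \<noteq> (succ ^^ (n + 3)) \<delta>" for n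
        using succn_inject[of 1 \<delta> "n + 3"] by simp
      ultimately show ?thesis
        by (intro exI[of _ "map_fo (And (num 0)) (sh3 \<psi>0)"]) (use guard[of \<sigma> \<psi>0] p0 a in simp)
    next
      case b
      let ?\<psi> = "\<phi> ((succ ^^ n) \<delta>)"
      have l: "(succ ^^ n) \<delta> \<in> elts \<gamma>" using d(2) by blast
      have "is_Pi ((succ ^^ n) \<delta>) ?\<psi>" by (rule \<phi>(1)[OF l])
      then have "is_Sigma (succ (succ (succ ((succ ^^ n) \<delta>)))) ?\<psi>" by (intro Pi_Sigma Sigma_Pi)
      then have S: "is_Sigma \<sigma> ?\<psi>" using b by (simp add: numeral_3_eq_3)
      have u: "\<sigma> \<noteq> succ \<delta>" "\<sigma> = (succ ^^ (m + 3)) \<delta> \<longleftrightarrow> m = n" for m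
        using succn_inject[of 1 \<delta> "n + 3"] succn_inject[of "n + 3" \<delta> "m + 3"] b by auto
      show ?thesis
        by (intro exI[of _ "map_fo (And (num (Suc n))) (sh3 ?\<psi>)"]) (use guard[OF S fF[OF l]] u in simp)
    next
      case c
      have Os: "Ord \<sigma>" using s Ord_elt is_limit_Ord[OF lim] by blast
      obtain \<chi> :: "'k so" where "is_Sigma \<sigma> \<chi> \<and> fsv \<chi> \<subseteq> {} \<and> fv \<chi> \<subseteq> {} \<and> bsv \<chi> = {} \<and>
        (\<forall>M R e s. sat M R e \<chi> s = (\<exists>v\<in>M. v \<noteq> v))"
        using lift_FO[OF Os, of "FEx 0 (Neg (Eq 0 0))"] by auto
      then show ?thesis using c by (intro exI[of _ \<chi>]) auto
    qed
  qed
  have "\<forall>\<sigma>\<in>elts \<gamma>. \<exists>\<chi>. ?C \<sigma> \<chi>" by (rule ballI) (rule ex)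
  from bchoice[OF this] obtain \<chi> where \<chi>: "\<forall>\<sigma>\<in>elts \<gamma>. ?C \<sigma> (\<chi> \<sigma>)" ..
  have cS: "is_Sigma \<sigma> (\<chi> \<sigma>)" if "\<sigma> \<in> elts \<gamma>" for \<sigma>
    by (rule conjunct1[OF bspec[OF \<chi> that]])
  have cB: "bsv (\<chi> \<sigma>) \<subseteq> {3..}" if "\<sigma> \<in> elts \<gamma>" for \<sigma>
    by (rule conjunct1[OF conjunct2[OF bspec[OF \<chi> that]]])
  have cF: "fsv (\<chi> \<sigma>) \<subseteq> ?N" if "\<sigma> \<in> elts \<gamma>" for \<sigma>
    by (rule conjunct1[OF conjunct2[OF conjunct2[OF bspec[OF \<chi> that]]]])
  have cV: "fv (\<chi> \<sigma>) = {}" if "\<sigma> \<in> elts \<gamma>" for \<sigma>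
    by (rule conjunct1[OF conjunct2[OF conjunct2[OF conjunct2[OF bspec[OF \<chi> that]]]]])
  have cX: "sat M R e (\<chi> \<sigma>) s \<longleftrightarrow> (\<sigma> = succ \<delta> \<and> fo_sat M R e s (num 0) \<and> sat M R e \<psi>0 (\<lambda>j. s (j + 3))) \<or>
        (\<exists>n. \<sigma> = (succ ^^ (n + 3)) \<delta> \<and> fo_sat M R e s (num (Suc n)) \<and> sat M R e (\<phi> ((succ ^^ n) \<delta>)) (\<lambda>j. s (j + 3)))"
    if "\<sigma> \<in> elts \<gamma>" for \<sigma> M R e s
    by (rule conjunct2[OF conjunct2[OF conjunct2[OF conjunct2[OF bspec[OF \<chi> that]]]], rule_format])
  have 1: "fsv (Disj \<gamma> \<chi>) \<subseteq> ?N" "fv (Disj \<gamma> \<chi>) = {}" "bsv (Disj \<gamma> \<chi>) \<subseteq> {3..}"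
    using cF cV cB by (simp_all add: UN_least)
  have fN: "finite ?N" using \<phi>(2) by simp
  have S: "is_Sigma \<gamma> (Disj \<gamma> \<chi>)"
    by (rule Sigma_limit[OF lim _ finite_subset[OF 1(1) fN]]) (use cS in blast)
  define \<Psi> where "\<Psi> = AllS 2 (map_fo (FOr (Neg (ptr 1))) (Disj \<gamma> \<chi>))"
  have "is_Pi (succ \<gamma>) \<Psi>" unfolding \<Psi>_def using Pi_succ[OF is_Pi_orF(2)[OF S], of "[2]"] by simp
  moreover have "embeds \<gamma> (Conj \<gamma> \<phi>) \<Psi>"
    unfolding embeds_def
  proof (intro conjI allI impI)
    have "fv (map_fo (FOr (Neg (ptr 1))) (Disj \<gamma> \<chi>)) \<subseteq> fv (Disj \<gamma> \<chi>) \<union> {}" by (rule fv_map_fo) auto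
    then show "fv \<Psi> = {}" unfolding \<Psi>_def using 1(2) by simp
    fix M R e and s :: "nat \<Rightarrow> 'k hset set" assume M: "elts \<gamma> \<subseteq> M" "Nat0 \<subseteq> M" "s 0 = elts \<gamma>" "s 1 = (Nat0 :: 'k hset set)"
    have e0: "sat M R e (Disj \<gamma> \<chi>) (s(2 := {(succ ^^ m) zero})) \<longleftrightarrow>
        (m = 0 \<and> sat M R e \<psi>0 (\<lambda>j. s (j + 3))) \<or> (\<exists>n. m = Suc n \<and> sat M R e (\<phi> ((succ ^^ n) \<delta>)) (\<lambda>j. s (j + 3)))" for m
    proof -
      have n: "fo_sat M R e (s(2 := {(succ ^^ m) zero})) (num n) \<longleftrightarrow> n = m" for n
        by (rule sat_num[OF M(2)]) simp
      have "succ \<delta> \<in> elts \<gamma>" "(succ ^^ (n + 3)) \<delta> \<in> elts \<gamma>" for n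
        using limit_succn[OF lim dl, of 1] limit_succn[OF lim dl, of "n + 3"] by auto
      moreover have "(\<lambda>j. (s(2 := {(succ ^^ m) zero})) (j + 3)) = (\<lambda>j. s (j + 3))" by (rule ext) simp
      ultimately show ?thesis
        unfolding sat.simps using cX n by (simp del: funpow.simps) metis
    qed
    have "sat M R e \<Psi> s \<longleftrightarrow> (\<forall>X. X \<subseteq> M \<longrightarrow> (\<exists>a\<in>Nat0. X = {a}) \<longrightarrow> sat M R e (Disj \<gamma> \<chi>) (s(2 := X)))"
    proof -
      have "sat M R e (map_fo (FOr (Neg (ptr 1))) (Disj \<gamma> \<chi>)) (s(2 := X)) \<longleftrightarrow>
         ((\<exists>a\<in>Nat0. X = {a}) \<longrightarrow> sat M R e (Disj \<gamma> \<chi>) (s(2 := X)))" if "X \<subseteq> M" for X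
      proof -
        have "bsv (Disj \<gamma> \<chi>) \<inter> {1, 2} = {}" using 1(3) by auto
        then show ?thesis using sat_orF(2)[OF S, of "Neg (ptr 1)" M R e "s(2 := X)"] sat_ptr[of "s(2 := X)" 1 M R e] that M
          by auto
      qed
      then show ?thesis unfolding \<Psi>_def by simp
    qed
    also have "\<dots> \<longleftrightarrow> (\<forall>m. sat M R e (Disj \<gamma> \<chi>) (s(2 := {(succ ^^ m) zero})))"
    proof -
      have "{(succ ^^ m) zero} \<subseteq> M" for m using M(2) by (auto simp: Nat0_def)
      then show ?thesis unfolding Nat0_def by blast
    qed
    also have "\<dots> \<longleftrightarrow> sat M R e \<psi>0 (\<lambda>j. s (j + 3)) \<and> (\<forall>n. sat M R e (\<phi> ((succ ^^ n) \<delta>)) (\<lambda>j. s (j + 3)))"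
      unfolding e0 by (metis nat.distinct(1) nat.inject not0_implies_Suc)
    also have "\<dots> \<longleftrightarrow> sat M R e (Conj \<gamma> \<phi>) (\<lambda>j. s (j + 3))"
      unfolding p0(4) using d(2) by auto
    finally show "sat M R e \<Psi> s = sat M R e (Conj \<gamma> \<phi>) (\<lambda>j. s (j + 3))" .
  qed
  ultimately show ?thesis by blast
qed

text \<open>
  \<open>Sv \<sigma> a\<close> is the meaning, at the singleton of the ordinal \<open>a\<close>, of a certain \<open>\<Sigma>\<close>-formula of
  level \<open>\<sigma>\<close>; at limits it says \<open>a < \<sigma>\<close>.
\<close>

inductive Sv :: "'k hset \<Rightarrow> 'k hset \<Rightarrow> bool" and Pv :: "'k hset \<Rightarrow> 'k hset \<Rightarrow> bool" where
  Sv_zero: "Sv zero zero"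
| Sv_succ: "Pv \<sigma> a \<Longrightarrow> Sv (succ \<sigma>) a"
| Sv_limit: "is_limit \<gamma> \<Longrightarrow> \<sigma> \<in> elts \<gamma> \<Longrightarrow> Sv \<sigma> a \<Longrightarrow> Sv \<gamma> a"
| Pv_zero: "Pv zero zero"
| Pv_succ: "\<forall>b\<in>elts a. Sv \<sigma> b \<Longrightarrow> Pv (succ \<sigma>) a"
| Pv_limit: "is_limit \<gamma> \<Longrightarrow> Pv \<gamma> zero"

lemma Sv_simps:
  "Sv zero a \<longleftrightarrow> a = zero" "Sv (succ \<sigma>) a \<longleftrightarrow> Pv \<sigma> a"
  "is_limit \<gamma> \<Longrightarrow> Sv \<gamma> a \<longleftrightarrow> (\<exists>\<sigma>\<in>elts \<gamma>. Sv \<sigma> a)"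
  "Pv zero a \<longleftrightarrow> a = zero" "Pv (succ \<sigma>) a \<longleftrightarrow> (\<forall>b\<in>elts a. Sv \<sigma> b)"
  "is_limit \<gamma> \<Longrightarrow> Pv \<gamma> a \<longleftrightarrow> a = zero" for a \<sigma> \<gamma> :: "'a hset"
proof -
  have [simp]: "\<not> is_limit (zero :: 'a hset)" "\<not> is_limit (succ x)" "succ x = succ y \<longleftrightarrow> x = y" "zero \<noteq> succ x" for x y :: "'a hset"
    using is_limit_not_zero is_limit_not_succ succ_inject succ_neq_zero by metis+
  show "Sv zero a \<longleftrightarrow> a = zero" by (subst Sv.simps) auto
  show "Sv (succ \<sigma>) a \<longleftrightarrow> Pv \<sigma> a" by (subst Sv.simps) auto
  show "is_limit \<gamma> \<Longrightarrow> Sv \<gamma> a \<longleftrightarrow> (\<exists>\<sigma>\<in>elts \<gamma>. Sv \<sigma> a)" by (subst Sv.simps) auto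
  show "Pv zero a \<longleftrightarrow> a = zero" by (subst Pv.simps) auto
  show "Pv (succ \<sigma>) a \<longleftrightarrow> (\<forall>b\<in>elts a. Sv \<sigma> b)" by (subst Pv.simps) auto
  show "is_limit \<gamma> \<Longrightarrow> Pv \<gamma> a \<longleftrightarrow> a = zero" by (subst Pv.simps) auto
qed

text \<open>With \<open>Sv_complete\<close> this determines the limit levels
  (\<open>Sv_limit_iff\<close>): a level below a limit accepts no ordinal beyond itself, while every
  ordinal below the limit is accepted at some level below the limit.\<close>

lemma Sv_sound: "Ord \<sigma> \<Longrightarrow> (\<forall>a. Ord a \<longrightarrow> Sv \<sigma> a \<longrightarrow> a \<in> elts (succ \<sigma>)) \<and> (\<forall>a. Ord a \<longrightarrow> Pv \<sigma> a \<longrightarrow> a \<in> elts (succ \<sigma>))"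
proof (induction \<sigma> rule: Ord_induct3)
  case 0
  show ?case by (simp add: Sv_simps elts_succ)
next
  case (succ \<sigma>)
  show ?case
  proof (intro conjI allI impI)
    fix a assume a: "Ord a" "Sv (succ \<sigma>) a"
    then show "a \<in> elts (succ (succ \<sigma>))" using succ(2) by (simp add: Sv_simps elts_succ)
  next
    fix a assume a: "Ord a" "Pv (succ \<sigma>) a"
    then have "elts a \<subseteq> elts (succ \<sigma>)" using succ(2) Ord_elt[OF a(1)] by (auto simp: Sv_simps)
    then show "a \<in> elts (succ (succ \<sigma>))"
      using Ord_subset_iff[OF a(1) Ord_succ[OF succ(1)]] by (auto simp: elts_succ)
  qed
next
  case (limit \<gamma>)
  show ?case
  proof (intro conjI allI impI)
    fix a assume a: "Ord a" "Sv \<gamma> a"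
    then obtain \<sigma> where s: "\<sigma> \<in> elts \<gamma>" "Sv \<sigma> a" using Sv_simps(3)[OF limit(1)] by blast
    then have "a \<in> elts (succ \<sigma>)" using limit(2) a(1) by blast
    then have "a \<in> elts \<gamma>" using s(1) Ord_trans[OF is_limit_Ord[OF limit(1)]] by (auto simp: elts_succ)
    then show "a \<in> elts (succ \<gamma>)" by (simp add: elts_succ)
  next
    fix a assume a: "Ord a" "Pv \<gamma> a"
    then show "a \<in> elts (succ \<gamma>)" using is_limit_zero_in[OF limit(1)] Sv_simps(6)[OF limit(1)] by (auto simp: elts_succ)
  qed
qed

lemma Sv_down: "Ord \<sigma> \<Longrightarrow> (\<forall>a b. Ord a \<longrightarrow> b \<in> elts a \<longrightarrow> Sv \<sigma> a \<longrightarrow> Sv \<sigma> b) \<and> (\<forall>a b. Ord a \<longrightarrow> b \<in> elts a \<longrightarrow> Pv \<sigma> a \<longrightarrow> Pv \<sigma> b)"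
proof (induction \<sigma> rule: Ord_induct3)
  case 0
  show ?case by (auto simp: Sv_simps)
next
  case (succ \<sigma>)
  then show ?case unfolding Sv_simps by (meson Ord_trans)
next
  case (limit \<gamma>)
  then show ?case unfolding Sv_simps(3,6)[OF limit(1)] by auto
qed

text \<open>Two levels are spent per step, one for the quantifier over the smaller ordinals and one
  for the return to Sigma. At a limit ordinal \<open>a\<close>, the level \<open>a\<close> already
  accepts everything below \<open>a\<close>, so again two more levels suffice. Finitely many levels
  never lead past a limit.\<close>

lemma Sv_complete: "Ord a \<Longrightarrow> \<exists>\<sigma>. Ord \<sigma> \<and> Sv \<sigma> a \<and> (\<forall>\<gamma>. is_limit \<gamma> \<longrightarrow> a \<in> elts \<gamma> \<longrightarrow> \<sigma> \<in> elts \<gamma>)"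
proof (induction a rule: Ord_induct3)
  case 0
  show ?case by (intro exI[of _ zero]) (simp add: Sv_simps)
next
  case (succ a)
  then obtain \<sigma> where s: "Ord \<sigma>" "Sv \<sigma> a" "\<And>\<gamma>. is_limit \<gamma> \<Longrightarrow> a \<in> elts \<gamma> \<Longrightarrow> \<sigma> \<in> elts \<gamma>" by blast
  have "Sv (succ (succ \<sigma>)) (succ a)"
    using s(2) Sv_down[OF s(1)] succ(1) by (auto simp: Sv_simps elts_succ)
  moreover have "succ (succ \<sigma>) \<in> elts \<gamma>" if "is_limit \<gamma>" "succ a \<in> elts \<gamma>" for \<gamma>
  proof -
    have "a \<in> elts \<gamma>" using that Ord_trans[OF is_limit_Ord[OF that(1)], of a "succ a"] by (simp add: elts_succ)
    then show ?thesis using s(3)[OF that(1)] that(1) by (simp add: is_limit_def)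
  qed
  ultimately show ?case using s(1) by (intro exI[of _ "succ (succ \<sigma>)"]) simp
next
  case (limit a)
  have "Sv (succ (succ a)) a"
    using limit by (fastforce simp: Sv_simps)
  moreover have "succ (succ a) \<in> elts \<gamma>" if "is_limit \<gamma>" "a \<in> elts \<gamma>" for \<gamma>
    using that by (simp add: is_limit_def)
  ultimately show ?case using is_limit_Ord[OF limit(1)] by (intro exI[of _ "succ (succ a)"]) simp
qed

lemma Sv_limit_iff:
  assumes "is_limit \<gamma>" "Ord a"
  shows "Sv \<gamma> a \<longleftrightarrow> a \<in> elts \<gamma>"
proof
  assume "Sv \<gamma> a"
  then obtain \<sigma> where s: "\<sigma> \<in> elts \<gamma>" "Sv \<sigma> a" using Sv_simps(3)[OF assms(1)] by blast
  then have "a \<in> elts (succ \<sigma>)" using Sv_sound[OF Ord_elt[OF is_limit_Ord[OF assms(1)] s(1)]] assms(2) by blast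
  moreover have "succ \<sigma> \<in> elts \<gamma>" using assms(1) s(1) by (simp add: is_limit_def)
  ultimately show "a \<in> elts \<gamma>" using Ord_trans[OF is_limit_Ord[OF assms(1)]] by blast
next
  assume "a \<in> elts \<gamma>"
  then show "Sv \<gamma> a" using Sv_complete[OF assms(2)] Sv_simps(3)[OF assms(1)] assms(1) by blast
qed

text \<open>Ordinals are passed on as singletons, because only second-order quantifiers can be
  placed in front of a Sigma formula of positive level. Variable 0 is the singleton of an ordinal,
  variable 1 that of one of its elements.\<close>

definition below :: fo where
  "below = FEx 0 (FEx 1 (And (In 0 0) (And (Mem 1 0) (All 2 (FIff (In 2 1) (Eq 2 1))))))"

lemma fv_below [simp]: "fo_fv below = {}" "fo_fsv below = {0, 1}"
  by (auto simp: below_def)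

lemma sat_below:
  "s 0 = {a} \<Longrightarrow> a \<in> M \<Longrightarrow> elts a \<subseteq> M \<Longrightarrow> s 1 \<subseteq> M \<Longrightarrow> fo_sat M R e s below \<longleftrightarrow> (\<exists>b\<in>elts a. s 1 = {b})"
  unfolding below_def by simp blast

definition emp :: fo where
  "emp = All 0 (Neg (And (In 0 0) (FEx 1 (Mem 1 0))))"

lemma fv_emp [simp]: "fo_fv emp = {}" "fo_fsv emp = {0}"
  by (auto simp: emp_def)

lemma sat_emp: "s 0 = {a} \<Longrightarrow> a \<in> M \<Longrightarrow> elts a \<subseteq> M \<Longrightarrow> fo_sat M R e s emp \<longleftrightarrow> a = zero"
  unfolding emp_def using eq_zero[of a] by auto

definition ordsem :: "('k hset \<Rightarrow> bool) \<Rightarrow> 'k so \<Rightarrow> bool" where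
  "ordsem V \<phi> \<longleftrightarrow> fsv \<phi> \<subseteq> {0} \<and> bsv \<phi> \<subseteq> {1..} \<and> fv \<phi> = {} \<and>
     (\<forall>M R e s a. s 0 = {a} \<longrightarrow> Ord a \<longrightarrow> a \<in> M \<longrightarrow> elts a \<subseteq> M \<longrightarrow> sat M R e \<phi> s = V a)"

text \<open>The clauses of \<open>Sv\<close> and \<open>Pv\<close> follow the formation rules of the
  hierarchy, so each can be written at its own level. At a successor the assignment is shifted by
  one: the singleton of an element becomes variable 0 of the formula one level down.\<close>

lemma ordsem_formulas:
  assumes "Ord \<sigma>"
  shows "(\<exists>\<phi>. is_Sigma \<sigma> \<phi> \<and> ordsem (Sv \<sigma>) \<phi>) \<and> (\<exists>\<phi>. is_Pi \<sigma> \<phi> \<and> ordsem (Pv \<sigma>) \<phi>)"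
  using assms
proof (induction \<sigma> rule: Ord_induct3)
  case 0
  have "ordsem (\<lambda>a. a = zero) (FO emp)" by (auto simp: ordsem_def sat_emp)
  then show ?case unfolding Sv_simps using Sigma_0[of zero emp] Pi_0[of zero emp] elts_zero by blast
next
  case (succ \<sigma>)
  obtain \<phi> \<psi> where p: "is_Sigma \<sigma> \<phi>" "ordsem (Sv \<sigma>) \<phi>" "is_Pi \<sigma> \<psi>" "ordsem (Pv \<sigma>) \<psi>" using succ(2) by blast
  have i: "inj Suc" by simp
  let ?\<phi> = "map_fo (FOr (Neg below)) (ren Suc \<phi>)"
  have S: "is_Sigma \<sigma> (ren Suc \<phi>)" by (rule is_Pi_ren(2)[OF i p(1)])
  have "is_Pi (succ \<sigma>) (AllS 1 ?\<phi>)" using Pi_succ[OF is_Pi_orF(2)[OF S], of "[1]"] by simp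
  moreover have "ordsem (Pv (succ \<sigma>)) (AllS 1 ?\<phi>)"
    unfolding ordsem_def
  proof (intro conjI allI impI)
    have "fsv ?\<phi> \<subseteq> fsv (ren Suc \<phi>) \<union> {0, 1}" by (rule fsv_map_fo) auto
    then show "fsv (AllS 1 ?\<phi>) \<subseteq> {0}" using p(2) fsv_ren[OF i, of \<phi>] unfolding ordsem_def by auto
    show "bsv (AllS 1 ?\<phi>) \<subseteq> {1..}" using p(2) by (auto simp: ordsem_def)
    have "fv ?\<phi> \<subseteq> fv (ren Suc \<phi>) \<union> {}" by (rule fv_map_fo) auto
    then show "fv (AllS 1 ?\<phi>) = {}" using p(2) by (simp add: ordsem_def)
    fix M R e and s :: "nat \<Rightarrow> 'a hset set" and a assume a: "s 0 = {a}" "Ord a" "a \<in> M" "elts a \<subseteq> M"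
    have Y: "sat M R e ?\<phi> (s(1 := Y)) \<longleftrightarrow> ((\<exists>b\<in>elts a. Y = {b}) \<longrightarrow> sat M R e \<phi> ((s(1 := Y)) \<circ> Suc))" if "Y \<subseteq> M" for Y
    proof -
      have "bsv (ren Suc \<phi>) \<inter> fo_fsv (Neg below) = {}" using p(2) by (auto simp: ordsem_def)
      then show ?thesis
        using sat_orF(2)[OF S, of "Neg below" M R e "s(1 := Y)"] sat_below[of "s(1 := Y)" a M R e] a that
        by (simp add: sat_ren[OF i])
    qed
    have b: "sat M R e \<phi> ((s(1 := {b})) \<circ> Suc) \<longleftrightarrow> Sv \<sigma> b" if b: "b \<in> elts a" for b
    proof -
      have "Ord b" by (rule Ord_elt[OF a(2) b])
      moreover have "b \<in> M" using b a(4) by blast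
      moreover have "elts b \<subseteq> M" using a(2,4) b unfolding Ord_def by blast
      ultimately show ?thesis using p(2) unfolding ordsem_def by simp
    qed
    have "sat M R e (AllS 1 ?\<phi>) s \<longleftrightarrow> (\<forall>X. X \<subseteq> M \<longrightarrow> (\<exists>b\<in>elts a. X = {b}) \<longrightarrow> sat M R e \<phi> ((s(1 := X)) \<circ> Suc))"
      unfolding sat.simps by (simp only: Y cong: imp_cong)
    also have "\<dots> \<longleftrightarrow> (\<forall>b\<in>elts a. sat M R e \<phi> ((s(1 := {b})) \<circ> Suc))" using a(4) by blast
    also have "\<dots> \<longleftrightarrow> Pv (succ \<sigma>) a" using b by (simp add: Sv_simps)
    finally show "sat M R e (AllS 1 ?\<phi>) s = Pv (succ \<sigma>) a" .
  qed
  moreover have "is_Sigma (succ \<sigma>) \<psi>" by (rule Pi_Sigma[OF p(3)])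
  moreover have "ordsem (Sv (succ \<sigma>)) \<psi>" using p(4) by (simp add: ordsem_def Sv_simps)
  ultimately show ?case by blast
next
  case (limit \<gamma>)
  have "\<forall>\<sigma>\<in>elts \<gamma>. \<exists>\<phi>. is_Sigma \<sigma> \<phi> \<and> ordsem (Sv \<sigma>) \<phi>" using limit(2) by blast
  from bchoice[OF this] obtain \<phi> where p: "\<forall>\<sigma>\<in>elts \<gamma>. is_Sigma \<sigma> (\<phi> \<sigma>) \<and> ordsem (Sv \<sigma>) (\<phi> \<sigma>)" ..
  have f: "fsv (Disj \<gamma> \<phi>) \<subseteq> {0}" using p by (auto simp: ordsem_def)
  have "is_Sigma \<gamma> (Disj \<gamma> \<phi>)" by (rule Sigma_limit[OF limit(1) _ finite_subset[OF f]]) (use p in auto)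
  moreover have "ordsem (Sv \<gamma>) (Disj \<gamma> \<phi>)"
    unfolding ordsem_def Sv_simps(3)[OF limit(1)]
  proof (intro conjI allI impI)
    show "fsv (Disj \<gamma> \<phi>) \<subseteq> {0}" by (rule f)
    show "bsv (Disj \<gamma> \<phi>) \<subseteq> {1..}" "fv (Disj \<gamma> \<phi>) = {}" using p by (auto simp: ordsem_def)
    fix M R e and s :: "nat \<Rightarrow> 'a hset set" and a assume "s 0 = {a}" "Ord a" "a \<in> M" "elts a \<subseteq> M"
    then show "sat M R e (Disj \<gamma> \<phi>) s = (\<exists>\<sigma>\<in>elts \<gamma>. Sv \<sigma> a)" using p by (simp add: ordsem_def)
  qed
  moreover have "\<exists>\<phi>. is_Pi \<gamma> \<phi> \<and> ordsem (Pv \<gamma>) \<phi>"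
  proof -
    obtain \<psi> :: "'a so" where "is_Pi \<gamma> \<psi> \<and> fsv \<psi> \<subseteq> {0} \<and> fv \<psi> \<subseteq> {} \<and> bsv \<psi> = {} \<and>
        (\<forall>M R e s. sat M R e \<psi> s = fo_sat M R e s emp)"
      using lift_FO[OF is_limit_Ord[OF limit(1)], of emp] by auto
    then have "is_Pi \<gamma> \<psi>" "ordsem (Pv \<gamma>) \<psi>" by (auto simp: ordsem_def sat_emp Sv_simps(6)[OF limit(1)])
    then show ?thesis by blast
  qed
  ultimately show ?case by blast
qed

text \<open>Consecutive limit ordinals. As \<nu> determines \<eta>, an index of a disjunction
  derived from \<nu> can stand for the initial segment \<eta> of a conjunction.\<close>

definition next_limit :: "'k hset \<Rightarrow> 'k hset \<Rightarrow> bool" where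
  "next_limit \<eta> \<nu> \<longleftrightarrow> is_limit \<eta> \<and> is_limit \<nu> \<and> \<eta> \<in> elts \<nu> \<and> (\<forall>\<mu>\<in>elts \<nu>. is_limit \<mu> \<longrightarrow> \<mu> \<in> elts \<eta> \<or> \<mu> = \<eta>)"

lemma next_limit_unique: "next_limit \<eta> \<nu> \<Longrightarrow> next_limit \<eta>' \<nu> \<Longrightarrow> \<eta> = \<eta>'"
  unfolding next_limit_def using elts_asym by blast

lemma next_limit_exists:
  assumes "is_limit \<eta>" "is_limit \<mu>" "\<eta> \<in> elts \<mu>"
  shows "\<exists>\<nu>. next_limit \<eta> \<nu> \<and> (\<nu> \<in> elts \<mu> \<or> \<nu> = \<mu>)"
proof -
  let ?Q = "{\<nu>. is_limit \<nu> \<and> \<eta> \<in> elts \<nu>}"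
  obtain \<nu> where n: "\<nu> \<in> ?Q" "\<And>\<rho>. \<rho> \<in> elts \<nu> \<Longrightarrow> \<rho> \<notin> ?Q"
    using wfE_min[OF wf_elts, of \<mu> ?Q] assms by auto
  have "\<rho> \<in> elts \<eta> \<or> \<rho> = \<eta>" if "\<rho> \<in> elts \<nu>" "is_limit \<rho>" for \<rho>
    using n(2)[OF that(1)] that(2) Ord_linear[OF is_limit_Ord[OF that(2)] is_limit_Ord[OF assms(1)]] by blast
  then have "next_limit \<eta> \<nu>" using n(1) assms(1) by (simp add: next_limit_def)
  moreover have "\<nu> \<in> elts \<mu> \<or> \<nu> = \<mu>"
    using n(2)[of \<mu>] assms n(1) Ord_linear[of \<nu> \<mu>] is_limit_Ord by blast
  ultimately show ?thesis by blast
qed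

lemma inj2: "inj (\<lambda>j::nat. j + 2)" by (auto simp: inj_def)

text \<open>The conjunction over \<gamma> is read as: for every \<open>a\<close> below \<gamma>
  there is a limit \<eta> above \<open>a\<close> such that the conjunction over \<eta> holds. Let
  \<nu> be the limit after \<eta>. The conjunction over \<eta> has Pi level \<eta>, and the
  statement that \<open>a\<close> is below \<eta> has Sigma level \<eta>, hence Pi level \<eta> + 1.
  Both are conjuncts of a formula of Pi level \<nu>, which serves as the Sigma formula at the index
  \<nu> + 1 of a disjunction over \<gamma>.\<close>

lemma embed_limit_of_limits:
  fixes \<phi> :: "'k hset \<Rightarrow> 'k so"
  assumes lim: "is_limit \<gamma>" and lims: "\<forall>\<eta>\<in>elts \<gamma>. \<exists>\<mu>\<in>elts \<gamma>. is_limit \<mu> \<and> \<eta> \<in> elts \<mu>"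
    and \<phi>: "\<And>\<eta>. \<eta> \<in> elts \<gamma> \<Longrightarrow> is_Pi \<eta> (\<phi> \<eta>)" "finite (fsv (Conj \<gamma> \<phi>))" "fv (Conj \<gamma> \<phi>) = {}"
  shows "\<exists>\<phi>'. is_Pi (succ \<gamma>) \<phi>' \<and> embeds \<gamma> (Conj \<gamma> \<phi>) \<phi>'"
proof -
  let ?F = "fsv (Conj \<gamma> \<phi>)"
  let ?N = "(\<lambda>j. j + 3) ` ?F \<union> {2}"
  note O = is_limit_Ord[OF lim]
  have fN: "finite ?N" using \<phi>(2) by simp
  define T where "T \<sigma> a M R e s \<longleftrightarrow> (\<exists>\<eta> \<nu>. \<sigma> = succ \<nu> \<and> next_limit \<eta> \<nu> \<and> a \<in> elts \<eta> \<and>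
      (\<forall>\<epsilon>\<in>elts \<eta>. sat M R e (\<phi> \<epsilon>) (\<lambda>j. s (j + 3))))" for \<sigma> a M R e and s :: "nat \<Rightarrow> 'k hset set"
  have ex: "\<exists>\<chi>. is_Sigma \<sigma> \<chi> \<and> bsv \<chi> \<subseteq> {3..} \<and> fsv \<chi> \<subseteq> ?N \<and> fv \<chi> = {} \<and>
     (\<forall>M R e s a. s 2 = {a} \<longrightarrow> Ord a \<longrightarrow> a \<in> M \<longrightarrow> elts a \<subseteq> M \<longrightarrow> sat M R e \<chi> s = T \<sigma> a M R e s)"
    (is "\<exists>\<chi>. ?C \<sigma> \<chi>") if s: "\<sigma> \<in> elts \<gamma>" for \<sigma>
  proof (cases "\<exists>\<eta> \<nu>. \<sigma> = succ \<nu> \<and> next_limit \<eta> \<nu>")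
    case False
    obtain \<chi> :: "'k so" where "is_Sigma \<sigma> \<chi> \<and> fsv \<chi> \<subseteq> {} \<and> fv \<chi> \<subseteq> {} \<and> bsv \<chi> = {} \<and>
        (\<forall>M R e s. sat M R e \<chi> s = (\<exists>v\<in>M. v \<noteq> v))"
      using lift_FO[OF Ord_elt[OF O s], of "FEx 0 (Neg (Eq 0 0))"] by auto
    moreover have "\<not> T \<sigma> a M R e s" for a M R e s using False unfolding T_def by blast
    ultimately show ?thesis by (intro exI[of _ \<chi>]) auto
  next
    case True
    then obtain \<eta> \<nu> where n: "\<sigma> = succ \<nu>" "next_limit \<eta> \<nu>" by blast
    have lims: "is_limit \<eta>" "is_limit \<nu>" "\<eta> \<in> elts \<nu>" using n(2) by (auto simp: next_limit_def)
    have nu: "\<nu> \<in> elts \<gamma>" using Ord_trans[OF O, of \<nu> \<sigma>] s n(1) by (simp add: elts_succ)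
    then have eta: "\<eta> \<in> elts \<gamma>" using Ord_trans[OF O lims(3)] by blast
    have eg: "elts \<eta> \<subseteq> elts \<gamma>" using O eta unfolding Ord_def by blast
    have sub: "fsv (Conj \<eta> \<phi>) \<subseteq> ?F" "fv (Conj \<eta> \<phi>) = {}" using eg \<phi>(3) by auto
    have P: "is_Pi \<eta> (Conj \<eta> \<phi>)"
      by (rule Pi_limit[OF lims(1) _ finite_subset[OF sub(1) \<phi>(2)]]) (use \<phi>(1) eg in blast)
    obtain \<theta> :: "'k so" where th: "is_Sigma \<eta> \<theta>" "ordsem (Sv \<eta>) \<theta>" using ordsem_formulas[OF is_limit_Ord[OF lims(1)]] by blast
    have "\<forall>\<rho>\<in>elts \<nu>. \<exists>\<chi> :: 'k so. is_Pi \<rho> \<chi> \<and> fsv \<chi> \<subseteq> fo_fsv (All 0 (Eq 0 0)) \<and>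
        fv \<chi> \<subseteq> fo_fv (All 0 (Eq 0 0)) \<and> bsv \<chi> = {} \<and> (\<forall>M R e s. sat M R e \<chi> s = fo_sat M R e s (All 0 (Eq 0 0)))"
      by (rule ballI) (rule conjunct1[OF lift_FO[OF Ord_elt[OF is_limit_Ord[OF lims(2)]]]])
    from bchoice[OF this] obtain tt :: "'k hset \<Rightarrow> 'k so" where 
      tt: "\<forall>\<rho>\<in>elts \<nu>. is_Pi \<rho> (tt \<rho>) \<and> fsv (tt \<rho>) \<subseteq> fo_fsv (All 0 (Eq 0 0)) \<and>
        fv (tt \<rho>) \<subseteq> fo_fv (All 0 (Eq 0 0)) \<and> bsv (tt \<rho>) = {} \<and> (\<forall>M R e s. sat M R e (tt \<rho>) s = fo_sat M R e s (All 0 (Eq 0 0)))" ..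
    let ?\<theta> = "ren (\<lambda>j. j + 2) \<theta>"
    define slot where "slot \<rho> = (if \<rho> = \<eta> then sh3 (Conj \<eta> \<phi>) else if \<rho> = succ \<eta> then ?\<theta> else tt \<rho>)" for \<rho>
    have se: "succ \<eta> \<in> elts \<nu>" "succ \<eta> \<noteq> \<eta>"
      using lims is_limit_not_succ[of \<eta> \<eta>] by (auto simp: is_limit_def)
    have slotP: "is_Pi \<rho> (slot \<rho>)" if "\<rho> \<in> elts \<nu>" for \<rho>
      using tt that P is_Pi_sh3(1)[OF P] Sigma_Pi[OF is_Pi_ren(2)[OF inj2 th(1)]] unfolding slot_def by auto
    have th2: "fsv ?\<theta> \<subseteq> {2}" "bsv ?\<theta> \<subseteq> {3..}" "fv ?\<theta> = {}"
      using th(2) fsv_ren[OF inj2, of \<theta>] unfolding ordsem_def by auto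
    have sl: "fsv (slot \<rho>) \<subseteq> ?N" "bsv (slot \<rho>) \<subseteq> {3..}" "fv (slot \<rho>) = {}" if r: "\<rho> \<in> elts \<nu>" for \<rho>
    proof -
      have a: "fsv (sh3 (Conj \<eta> \<phi>)) \<subseteq> ?N" "bsv (sh3 (Conj \<eta> \<phi>)) \<subseteq> {3..}" "fv (sh3 (Conj \<eta> \<phi>)) = {}"
        using sub unfolding fsv_sh3 fv_ren by (blast, auto)
      have b: "fsv (tt \<rho>) = {}" "fv (tt \<rho>) = {}" "bsv (tt \<rho>) = {}" using tt r by auto
      show "fsv (slot \<rho>) \<subseteq> ?N" "bsv (slot \<rho>) \<subseteq> {3..}" "fv (slot \<rho>) = {}"
        using a b th2 unfolding slot_def by (auto simp del: fv_ren ren.simps)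
    qed
    have "fsv (Conj \<nu> slot) \<subseteq> ?N" unfolding fsv.simps(4)[of \<nu> slot] by (rule UN_least) (rule sl(1))
    moreover have "bsv (Conj \<nu> slot) \<subseteq> {3..}" unfolding bsv.simps by (rule UN_least) (rule sl(2))
    moreover have "fv (Conj \<nu> slot) = {}" using sl(3) by simp
    moreover have "is_Pi \<nu> (Conj \<nu> slot)"
      by (rule Pi_limit[OF lims(2) _ finite_subset[OF \<open>fsv (Conj \<nu> slot) \<subseteq> ?N\<close> fN]]) (use slotP in blast)
    then have "is_Sigma \<sigma> (Conj \<nu> slot)" unfolding n(1) by (rule Pi_Sigma)
    moreover have "sat M R e (Conj \<nu> slot) s = T \<sigma> a M R e s"
      if a: "s 2 = {a}" "Ord a" "a \<in> M" "elts a \<subseteq> M" for M R e a and s :: "nat \<Rightarrow> 'k hset set"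
    proof -
      have "sat M R e (Conj \<nu> slot) s \<longleftrightarrow> sat M R e (slot \<eta>) s \<and> sat M R e (slot (succ \<eta>)) s"
      proof -
        have "sat M R e (slot \<rho>) s" if "\<rho> \<in> elts \<nu>" "\<rho> \<noteq> \<eta>" "\<rho> \<noteq> succ \<eta>" for \<rho>
          using that tt unfolding slot_def by simp
        then show ?thesis using lims(3) se(1) by auto
      qed
      also have "sat M R e (slot \<eta>) s \<longleftrightarrow> (\<forall>\<epsilon>\<in>elts \<eta>. sat M R e (\<phi> \<epsilon>) (\<lambda>j. s (j + 3)))"
        unfolding slot_def by (simp add: sat_sh3)
      also have "sat M R e (slot (succ \<eta>)) s \<longleftrightarrow> Sv \<eta> a"
      proof -
        have "(s \<circ> (\<lambda>j. j + 2)) 0 = {a}" using a(1) by (simp only: o_apply add_0)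
        then have "sat M R e \<theta> (s \<circ> (\<lambda>j. j + 2)) = Sv \<eta> a" using th(2) a(2-) unfolding ordsem_def by blast
        then show ?thesis using se(2) unfolding slot_def by (simp only: sat_ren[OF inj2] if_False if_True simp_thms)
      qed
      also have "\<dots> \<longleftrightarrow> a \<in> elts \<eta>" by (rule Sv_limit_iff[OF lims(1) a(2)])
      finally show ?thesis
        unfolding T_def n(1) using n(2) next_limit_unique by (metis succ_inject)
    qed
    ultimately show ?thesis by blast
  qed
  have "\<forall>\<sigma>\<in>elts \<gamma>. \<exists>\<chi>. ?C \<sigma> \<chi>" by (rule ballI) (rule ex)
  from bchoice[OF this] obtain \<chi> where \<chi>: "\<forall>\<sigma>\<in>elts \<gamma>. ?C \<sigma> (\<chi> \<sigma>)" ..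
  have cS: "is_Sigma \<sigma> (\<chi> \<sigma>)" if "\<sigma> \<in> elts \<gamma>" for \<sigma>
    by (rule conjunct1[OF bspec[OF \<chi> that]])
  have cB: "bsv (\<chi> \<sigma>) \<subseteq> {3..}" if "\<sigma> \<in> elts \<gamma>" for \<sigma>
    by (rule conjunct1[OF conjunct2[OF bspec[OF \<chi> that]]])
  have cF: "fsv (\<chi> \<sigma>) \<subseteq> ?N" if "\<sigma> \<in> elts \<gamma>" for \<sigma>
    by (rule conjunct1[OF conjunct2[OF conjunct2[OF bspec[OF \<chi> that]]]])
  have cV: "fv (\<chi> \<sigma>) = {}" if "\<sigma> \<in> elts \<gamma>" for \<sigma>
    by (rule conjunct1[OF conjunct2[OF conjunct2[OF conjunct2[OF bspec[OF \<chi> that]]]]])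
  have cX: "sat M R e (\<chi> \<sigma>) s = T \<sigma> a M R e s" if "\<sigma> \<in> elts \<gamma>" "s 2 = {a}" "Ord a" "a \<in> M" "elts a \<subseteq> M" for \<sigma> M R e s a
    using conjunct2[OF conjunct2[OF conjunct2[OF conjunct2[OF bspec[OF \<chi> that(1)]]]], rule_format, of s a M R e] that by blast
  have 1: "fsv (Disj \<gamma> \<chi>) \<subseteq> ?N" "fv (Disj \<gamma> \<chi>) = {}" "bsv (Disj \<gamma> \<chi>) \<subseteq> {3..}"
    using cF cV cB by (simp_all add: UN_least)
  have S: "is_Sigma \<gamma> (Disj \<gamma> \<chi>)"
    by (rule Sigma_limit[OF lim _ finite_subset[OF 1(1) fN]]) (use cS in blast)
  define \<Psi> where "\<Psi> = AllS 2 (map_fo (FOr (Neg (ptr 0))) (Disj \<gamma> \<chi>))"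
  have "is_Pi (succ \<gamma>) \<Psi>" unfolding \<Psi>_def using Pi_succ[OF is_Pi_orF(2)[OF S], of "[2]"] by simp
  moreover have "embeds \<gamma> (Conj \<gamma> \<phi>) \<Psi>"
    unfolding embeds_def
  proof (intro conjI allI impI)
    have "fv (map_fo (FOr (Neg (ptr 0))) (Disj \<gamma> \<chi>)) \<subseteq> fv (Disj \<gamma> \<chi>) \<union> {}" by (rule fv_map_fo) auto
    then show "fv \<Psi> = {}" unfolding \<Psi>_def using 1(2) by simp
    fix M R e and s :: "nat \<Rightarrow> 'k hset set" assume M: "elts \<gamma> \<subseteq> M" "Nat0 \<subseteq> M" "s 0 = elts \<gamma>" "s 1 = (Nat0 :: 'k hset set)"
    have e0: "sat M R e (Disj \<gamma> \<chi>) (s(2 := {a})) \<longleftrightarrow> (\<exists>\<sigma>\<in>elts \<gamma>. T \<sigma> a M R e s)" if a: "a \<in> elts \<gamma>" for a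
    proof -
      have "elts a \<subseteq> M" using O a M(1) unfolding Ord_def by blast
      then have "sat M R e (\<chi> \<sigma>) (s(2 := {a})) = T \<sigma> a M R e (s(2 := {a}))" if "\<sigma> \<in> elts \<gamma>" for \<sigma>
        using cX[OF that, of "s(2 := {a})" a M R e] Ord_elt[OF O a] a M(1) by auto
      moreover have "T \<sigma> a M R e (s(2 := {a})) = T \<sigma> a M R e s" for \<sigma> unfolding T_def by simp
      ultimately show ?thesis by simp
    qed
    have "sat M R e \<Psi> s \<longleftrightarrow> (\<forall>X. X \<subseteq> M \<longrightarrow> (\<exists>a\<in>elts \<gamma>. X = {a}) \<longrightarrow> sat M R e (Disj \<gamma> \<chi>) (s(2 := X)))"
    proof -
      have "sat M R e (map_fo (FOr (Neg (ptr 0))) (Disj \<gamma> \<chi>)) (s(2 := X)) \<longleftrightarrow>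
         ((\<exists>a\<in>elts \<gamma>. X = {a}) \<longrightarrow> sat M R e (Disj \<gamma> \<chi>) (s(2 := X)))" if "X \<subseteq> M" for X
      proof -
        have "bsv (Disj \<gamma> \<chi>) \<inter> {0, 2} = {}" using 1(3) by auto
        then show ?thesis using sat_orF(2)[OF S, of "Neg (ptr 0)" M R e "s(2 := X)"] sat_ptr[of "s(2 := X)" 0 M R e] that M
          by auto
      qed
      then show ?thesis unfolding \<Psi>_def by simp
    qed
    also have "\<dots> \<longleftrightarrow> (\<forall>a\<in>elts \<gamma>. sat M R e (Disj \<gamma> \<chi>) (s(2 := {a})))"
      using M(1) by blast
    also have "\<dots> \<longleftrightarrow> (\<forall>a\<in>elts \<gamma>. \<exists>\<sigma>\<in>elts \<gamma>. T \<sigma> a M R e s)" using e0 by blast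
    also have "\<dots> \<longleftrightarrow> (\<forall>\<epsilon>\<in>elts \<gamma>. sat M R e (\<phi> \<epsilon>) (\<lambda>j. s (j + 3)))"
    proof
      assume "\<forall>a\<in>elts \<gamma>. \<exists>\<sigma>\<in>elts \<gamma>. T \<sigma> a M R e s"
      then show "\<forall>\<epsilon>\<in>elts \<gamma>. sat M R e (\<phi> \<epsilon>) (\<lambda>j. s (j + 3))" unfolding T_def by meson
    next
      assume h: "\<forall>\<epsilon>\<in>elts \<gamma>. sat M R e (\<phi> \<epsilon>) (\<lambda>j. s (j + 3))"
      show "\<forall>a\<in>elts \<gamma>. \<exists>\<sigma>\<in>elts \<gamma>. T \<sigma> a M R e s"
      proof
        fix a assume "a \<in> elts \<gamma>"
        then obtain \<eta> where e: "\<eta> \<in> elts \<gamma>" "is_limit \<eta>" "a \<in> elts \<eta>" using lims by blast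
        obtain \<mu> where m: "\<mu> \<in> elts \<gamma>" "is_limit \<mu>" "\<eta> \<in> elts \<mu>" using lims e(1) by blast
        \<comment> \<open>The limit after \<eta> is still below \<gamma>, because a further limit
          \<mu> below \<gamma> lies above \<eta>.\<close>
        obtain \<nu> where n: "next_limit \<eta> \<nu>" "\<nu> \<in> elts \<mu> \<or> \<nu> = \<mu>"
          using next_limit_exists[OF e(2) m(2,3)] by blast
        have "\<nu> \<in> elts \<gamma>" using n(2) m(1) Ord_trans[OF O] by blast
        then have "succ \<nu> \<in> elts \<gamma>" using lim by (simp add: is_limit_def)
        moreover have "elts \<eta> \<subseteq> elts \<gamma>" using O e(1) unfolding Ord_def by blast
        ultimately show "\<exists>\<sigma>\<in>elts \<gamma>. T \<sigma> a M R e s" unfolding T_def using n(1) e(3) h by blast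
      qed
    qed
    finally show "sat M R e \<Psi> s = sat M R e (Conj \<gamma> \<phi>) (\<lambda>j. s (j + 3))" by simp
  qed
  ultimately show ?thesis by blast
qed

section \<open>Inversion of the formation rules and the embedding of each level into the
  next\<close>

lemma is_Pi_zeroD: "is_Pi zero \<phi> \<Longrightarrow> \<exists>\<theta>. \<phi> = FO \<theta>" "is_Sigma zero \<phi> \<Longrightarrow> \<exists>\<theta>. \<phi> = FO \<theta>"
  by (erule is_Pi.cases is_Sigma.cases; use succ_neq_zero is_limit_not_zero in metis)+

lemma is_Pi_succD: "is_Pi (succ \<zeta>) \<phi> \<Longrightarrow> \<exists>js \<psi>. \<phi> = foldr AllS js \<psi> \<and> is_Sigma \<zeta> \<psi>"
    "is_Sigma (succ \<zeta>) \<phi> \<Longrightarrow> \<exists>js \<psi>. \<phi> = foldr ExS js \<psi> \<and> is_Pi \<zeta> \<psi>"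
  by (erule is_Pi.cases is_Sigma.cases; use succ_neq_zero is_limit_not_succ succ_inject eq_zero in metis)+

lemma is_Pi_limitD: 
  assumes "is_limit \<zeta>"
  shows "is_Pi \<zeta> \<phi> \<Longrightarrow> \<exists>\<psi>. \<phi> = Conj \<zeta> \<psi> \<and> (\<forall>\<eta>\<in>elts \<zeta>. is_Pi \<eta> (\<psi> \<eta>)) \<and> finite (fsv (Conj \<zeta> \<psi>))"
    "is_Sigma \<zeta> \<phi> \<Longrightarrow> \<exists>\<psi>. \<phi> = Disj \<zeta> \<psi> \<and> (\<forall>\<eta>\<in>elts \<zeta>. is_Sigma \<eta> (\<psi> \<eta>)) \<and> finite (fsv (Disj \<zeta> \<psi>))"
  by - (erule is_Pi.cases is_Sigma.cases; use assms is_limit_not_zero is_limit_not_succ eq_zero in metis)+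

text \<open>The parameters are needed for the limit part \<gamma> of the level. The finitely many
  successor levels above it are handled by applying the induction hypothesis to the negated matrix,
  negating back and restoring the quantifier block. The block is shifted by 3, so it leaves the
  parameters alone.\<close>

lemma embed:
  assumes "\<gamma> = zero \<or> is_limit \<gamma>"
  shows "is_Pi ((succ ^^ n) \<gamma>) \<phi> \<Longrightarrow> fv \<phi> = {} \<Longrightarrow> \<exists>\<phi>'. is_Pi (succ ((succ ^^ n) \<gamma>)) \<phi>' \<and> embeds \<gamma> \<phi> \<phi>'"
proof (induction n arbitrary: \<phi>)
  case 0
  show ?case
  proof (cases "\<gamma> = zero")
    case True
    then obtain \<theta> where t: "\<phi> = FO \<theta>" using 0 is_Pi_zeroD by auto
    have "is_Pi (succ zero) (sh3 \<phi>)" unfolding t by (rule Sigma_Pi) (simp add: Sigma_0)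
    moreover have "embeds \<gamma> \<phi> (sh3 \<phi>)" unfolding embeds_def using 0(2) by (simp add: sat_sh3)
    ultimately show ?thesis using True by auto
  next
    case False
    then have l: "is_limit \<gamma>" using assms by blast
    obtain \<psi> where p: "\<phi> = Conj \<gamma> \<psi>" "\<forall>\<eta>\<in>elts \<gamma>. is_Pi \<eta> (\<psi> \<eta>)" "finite (fsv (Conj \<gamma> \<psi>))"
      using is_Pi_limitD(1)[OF l] 0(1) by auto
    have f: "fv (Conj \<gamma> \<psi>) = {}" using 0(2) p(1) by simp
    show ?thesis using l
    proof (cases rule: limit_cases)
      case (A \<delta>)
      then show ?thesis using embed_limit_plus_omega[OF l A, of \<psi>] p f by auto
    next
      case B
      then show ?thesis using embed_limit_of_limits[OF l B, of \<psi>] p f by auto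
    qed
  qed
next
  case (Suc n)
  obtain js \<psi> where p: "\<phi> = foldr AllS js \<psi>" "is_Sigma ((succ ^^ n) \<gamma>) \<psi>"
    using is_Pi_succD(1)[of "(succ ^^ n) \<gamma>" \<phi>] Suc(2) by auto
  have "fv (neg \<psi>) = {}" using Suc(3) p(1) by simp
  from Suc(1)[OF is_Pi_neg(2)[OF p(2)] this]
  obtain \<psi>' where q: "is_Pi (succ ((succ ^^ n) \<gamma>)) \<psi>'" "embeds \<gamma> (neg \<psi>) \<psi>'" by blast
  let ?\<phi> = "foldr AllS (map (\<lambda>j. j + 3) js) (neg \<psi>')"
  have "is_Pi (succ ((succ ^^ Suc n) \<gamma>)) ?\<phi>"
    using Pi_succ[OF is_Pi_neg(1)[OF q(1)]] by simp
  moreover have "embeds \<gamma> \<phi> ?\<phi>"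
    unfolding embeds_def
  proof (intro conjI allI impI)
    show "fv ?\<phi> = {}" using q(2) by (simp add: embeds_def)
    fix M R e and s :: "nat \<Rightarrow> 'a hset set" assume M: "elts \<gamma> \<subseteq> M" "Nat0 \<subseteq> M" "s 0 = elts \<gamma>" "s 1 = (Nat0 :: 'a hset set)"
    show "sat M R e ?\<phi> s = sat M R e \<phi> (\<lambda>j. s (j + 3))"
      unfolding p(1) using M(3,4)
    proof (induction js arbitrary: s)
      case Nil
      then show ?case using q(2) M(1,2) unfolding embeds_def by simp
    next
      case (Cons j js)
      have "(\<lambda>k. (s(j + 3 := X)) (k + 3)) = (\<lambda>k. s (k + 3))(j := X)" for X by (rule ext) simp
      moreover have "sat M R e (foldr AllS (map (\<lambda>j. j + 3) js) (neg \<psi>')) (s(j + 3 := X)) =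
          sat M R e (foldr AllS js \<psi>) (\<lambda>k. (s(j + 3 := X)) (k + 3))" for X
        by (rule Cons(1)) (use Cons(2,3) in auto)
      ultimately show ?case by (simp only: list.map foldr.simps o_apply sat.simps)
    qed
  qed
  ultimately show ?case by blast
qed

section \<open>Reflection of sigma formulas\<close>

definition reflects :: "'k hset \<Rightarrow> 'k hset \<Rightarrow> 'k hset set \<Rightarrow> 'k so \<Rightarrow> bool" where
  "reflects \<kappa> A S \<phi> \<longleftrightarrow> (\<forall>R P e. R \<subseteq> WW \<kappa> A \<longrightarrow> (\<forall>j. P j \<subseteq> WW \<kappa> A) \<longrightarrow> sat (WW \<kappa> A) R e \<phi> P \<longrightarrow>
     (\<exists>x\<in>S. sat (MM \<kappa> x) (R \<inter> MM \<kappa> x) e \<phi> (\<lambda>j. P j \<inter> MM \<kappa> x)))"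

lemma reflectsD:
  "reflects \<kappa> A S \<phi> \<Longrightarrow> R \<subseteq> WW \<kappa> A \<Longrightarrow> (\<And>j. P j \<subseteq> WW \<kappa> A) \<Longrightarrow> sat (WW \<kappa> A) R e \<phi> P \<Longrightarrow>
     \<exists>x\<in>S. sat (MM \<kappa> x) (R \<inter> MM \<kappa> x) e \<phi> (\<lambda>j. P j \<inter> MM \<kappa> x)"
  unfolding reflects_def by simp

lemma reflects_Pi:
  assumes "world \<kappa> A" "S \<subseteq> PP \<kappa> A" "indescribable \<xi> \<kappa> A S" "is_Pi \<xi> \<phi>" "fv \<phi> = {}"
  shows "reflects \<kappa> A S \<phi>"
  unfolding reflects_def
proof (intro allI impI)
  fix R P e assume "R \<subseteq> WW \<kappa> A" "\<forall>j. P j \<subseteq> WW \<kappa> A" "sat (WW \<kappa> A) R e \<phi> P"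
  then show "\<exists>x\<in>S. sat (MM \<kappa> x) (R \<inter> MM \<kappa> x) e \<phi> (\<lambda>j. P j \<inter> MM \<kappa> x)"
    using reflection[OF assms(1-3), of id \<phi> R P e] assms(4,5) by (auto simp: closed_under_def)
qed

text \<open>The formula is replaced by its embedding at level \<zeta> + 1, with the limit part of
  \<zeta> and the natural numbers as values of the variables 0 and 1. The local structures contain
  both sets, so these two parameters are not cut down at the reflection point.\<close>

lemma reflects_lower:
  assumes "\<And>\<psi>. is_Pi (succ \<zeta>) \<psi> \<Longrightarrow> fv \<psi> = {} \<Longrightarrow> reflects \<kappa> A S \<psi>"
    and \<zeta>: "elts \<zeta> \<subseteq> WW \<kappa> A" "Nat0 \<subseteq> WW \<kappa> A"
    and S: "\<And>x. x \<in> S \<Longrightarrow> elts \<zeta> \<subseteq> MM \<kappa> x" "\<And>x. x \<in> S \<Longrightarrow> Nat0 \<subseteq> MM \<kappa> x"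
    and \<phi>: "is_Pi \<zeta> \<phi>" "fv \<phi> = {}"
  shows "reflects \<kappa> A S \<phi>"
  unfolding reflects_def
proof (intro allI impI)
  fix R P e assume h: "R \<subseteq> WW \<kappa> A" "\<forall>j. P j \<subseteq> WW \<kappa> A" "sat (WW \<kappa> A) R e \<phi> P"
  obtain n \<gamma> where g: "\<zeta> = (succ ^^ n) \<gamma>" "\<gamma> = zero \<or> is_limit \<gamma>" using Ord_decomp is_Pi_Ord(1)[OF \<phi>(1)] by blast
  have "elts \<gamma> \<subseteq> elts ((succ ^^ n) \<gamma>)" by (induction n) (auto simp: elts_succ)
  then have gz: "elts \<gamma> \<subseteq> elts \<zeta>" using g(1) by simp
  obtain \<phi>' where p: "is_Pi (succ \<zeta>) \<phi>'" "embeds \<gamma> \<phi> \<phi>'" using embed[OF g(2), of n \<phi>] \<phi> g(1) by blast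
  define P' where "P' j = (if j = 0 then elts \<gamma> else if j = 1 then Nat0 else P (j - 3))" for j
  have emb: "sat M Q e \<phi>' s = sat M Q e \<phi> (\<lambda>j. s (j + 3))" if "elts \<gamma> \<subseteq> M" "Nat0 \<subseteq> M" "s 0 = elts \<gamma>" "s 1 = Nat0" for M Q s
    using p(2) that unfolding embeds_def by blast
  have P'3: "(\<lambda>j. P' (j + 3)) = P" by (rule ext) (simp add: P'_def)
  have sW: "sat (WW \<kappa> A) R e \<phi>' P'"
    by (subst emb) (use gz \<zeta> h(3) P'3 in \<open>auto simp: P'_def\<close>)
  have "fv \<phi>' = {}" using p(2) by (simp add: embeds_def)
  moreover have "P' j \<subseteq> WW \<kappa> A" for j using gz \<zeta> h(2) by (auto simp: P'_def)
  ultimately obtain x where x: "x \<in> S" "sat (MM \<kappa> x) (R \<inter> MM \<kappa> x) e \<phi>' (\<lambda>j. P' j \<inter> MM \<kappa> x)"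
    using reflectsD[OF assms(1)[OF p(1)] h(1) _ sW] by blast
  have "P' 0 \<inter> MM \<kappa> x = elts \<gamma>" "P' 1 \<inter> MM \<kappa> x = Nat0" using S[OF x(1)] gz by (auto simp: P'_def)
  then have "sat (MM \<kappa> x) (R \<inter> MM \<kappa> x) e \<phi> (\<lambda>j. P' (j + 3) \<inter> MM \<kappa> x)"
    using emb[of "MM \<kappa> x" "\<lambda>j. P' j \<inter> MM \<kappa> x" "R \<inter> MM \<kappa> x"] S[OF x(1)] gz x(2) by auto
  moreover have "(\<lambda>j. P' (j + 3) \<inter> MM \<kappa> x) = (\<lambda>j. P j \<inter> MM \<kappa> x)" by (rule ext) (simp add: P'_def)
  ultimately show "\<exists>x\<in>S. sat (MM \<kappa> x) (R \<inter> MM \<kappa> x) e \<phi> (\<lambda>j. P j \<inter> MM \<kappa> x)" using x(1) by auto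
qed

lemma sat_foldr_ExS:
  "sat M R e (foldr ExS js \<phi>) s \<longleftrightarrow>
    (\<exists>s'. (\<forall>j. j \<notin> set js \<longrightarrow> s' j = s j) \<and> (\<forall>j\<in>set js. s' j \<subseteq> M) \<and> sat M R e \<phi> s')"
proof (induction js arbitrary: s)
  case Nil
  show ?case by (auto simp: fun_eq_iff[symmetric])
next
  case (Cons j js)
  show ?case
  proof
    assume "sat M R e (foldr ExS (j # js) \<phi>) s"
    then obtain X where X: "X \<subseteq> M" "sat M R e (foldr ExS js \<phi>) (s(j := X))" by auto
    then obtain s' where s': "\<forall>k. k \<notin> set js \<longrightarrow> s' k = (s(j := X)) k" "\<forall>k\<in>set js. s' k \<subseteq> M" "sat M R e \<phi> s'"
      unfolding Cons by blast
    have "s' j \<subseteq> M" using s'(1,2) X(1) by (cases "j \<in> set js") auto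
    then show "\<exists>s'. (\<forall>k. k \<notin> set (j # js) \<longrightarrow> s' k = s k) \<and> (\<forall>k\<in>set (j # js). s' k \<subseteq> M) \<and> sat M R e \<phi> s'"
      using s' by (intro exI[of _ s']) auto
  next
    assume "\<exists>s'. (\<forall>k. k \<notin> set (j # js) \<longrightarrow> s' k = s k) \<and> (\<forall>k\<in>set (j # js). s' k \<subseteq> M) \<and> sat M R e \<phi> s'"
    then obtain s' where s': "\<forall>k. k \<notin> set (j # js) \<longrightarrow> s' k = s k" "\<forall>k\<in>set (j # js). s' k \<subseteq> M" "sat M R e \<phi> s'" by blast
    have "sat M R e (foldr ExS js \<phi>) (s(j := s' j))"
      unfolding Cons using s' by (intro exI[of _ s']) auto
    then show "sat M R e (foldr ExS (j # js) \<phi>) s" using s'(2) by auto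
  qed
qed

text \<open>At \<xi> = \<zeta> + 1, witnesses of the existential block are taken in the whole
  structure, and the matrix of Pi level \<zeta> is reflected with them as parameters. At a limit,
  the true disjunct has some Sigma level \<eta>, hence Pi level \<eta> + 1; it is put at this index
  of a conjunction of level \<xi> whose other conjuncts are true.\<close>

proposition reflects_Sigma:
  fixes \<kappa> A \<xi> :: "'k hset"
  assumes w: "world \<kappa> A" and S: "S \<subseteq> PP \<kappa> A" "indescribable \<xi> \<kappa> A S" "\<xi> \<in> elts \<kappa>"
    and gS: "\<And>x. x \<in> S \<Longrightarrow> gd \<kappa> A x \<and> \<xi> \<in> elts (kap \<kappa> x)"
    and \<phi>: "is_Sigma \<xi> \<phi>" "fv \<phi> = {}"
  shows "reflects \<kappa> A S \<phi>"
proof -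
  have sub: "elts \<zeta> \<subseteq> WW \<mu> B" "Nat0 \<subseteq> WW \<mu> B" if w: "world \<mu> B" and z: "\<zeta> \<in> elts \<mu>" for \<mu> B \<zeta> :: "'k hset"
  proof -
    have mB: "elts \<mu> \<subseteq> WW \<mu> B" using w WW_base[OF w] unfolding world_def by blast
    show "elts \<zeta> \<subseteq> WW \<mu> B" using world_trans[OF w z] mB by blast
    have "Nat0 \<subseteq> elts \<mu>" unfolding Nat0_def
      using limit_succn[OF world_limit[OF w] is_limit_zero_in[OF world_limit[OF w]]] by blast
    then show "Nat0 \<subseteq> WW \<mu> B" using mB by blast
  qed
  have O: "Ord \<xi>" by (rule is_Pi_Ord(2)[OF \<phi>(1)])
  note rP = reflects_Pi[OF w S(1,2)]
  show ?thesis using O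
  proof (cases rule: Ord_cases)
    case 0
    then obtain \<theta> where "\<phi> = FO \<theta>" using \<phi>(1) is_Pi_zeroD(2) by blast
    then have "is_Pi \<xi> \<phi>" using 0 by (simp add: Pi_0)
    then show ?thesis by (rule rP[OF _ \<phi>(2)])
  next
    case (succ \<zeta>)
    then obtain js \<psi> where p: "\<phi> = foldr ExS js \<psi>" "is_Pi \<zeta> \<psi>" using \<phi>(1) is_Pi_succD(2) by blast
    have f: "fv \<psi> = {}" using p(1) \<phi>(2) by simp
    have zk: "\<zeta> \<in> elts \<kappa>" using S(3) succ Ord_trans[OF world_Ord[OF w], of \<zeta> \<xi>] by (simp add: elts_succ)
    have zx: "world (kap \<kappa> x) x" "\<zeta> \<in> elts (kap \<kappa> x)" if "x \<in> S" for x
      using gS[OF that] gd_world[OF w, of x] Ord_trans[OF Cardinal_Ord[OF Cardinal_kap(1)], of \<zeta> \<xi> \<kappa> x] succ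
      by (auto simp: elts_succ)
    have r: "reflects \<kappa> A S \<psi>"
      by (rule reflects_lower[OF _ _ _ _ _ p(2) f]) (use rP succ sub[OF w zk] sub[OF zx] in auto)
    show ?thesis
      unfolding reflects_def
    proof (intro allI impI)
      fix R P e assume h: "R \<subseteq> WW \<kappa> A" "\<forall>j. P j \<subseteq> WW \<kappa> A" "sat (WW \<kappa> A) R e \<phi> P"
      obtain P' where P': "\<forall>j. j \<notin> set js \<longrightarrow> P' j = P j" "\<forall>j\<in>set js. P' j \<subseteq> WW \<kappa> A" "sat (WW \<kappa> A) R e \<psi> P'"
        using h(3) unfolding p(1) sat_foldr_ExS by blast
      have "P' j \<subseteq> WW \<kappa> A" for j using P'(1,2) h(2) by (cases "j \<in> set js") auto
      from reflectsD[OF r h(1) this P'(3)] obtain x where x: "x \<in> S" "sat (MM \<kappa> x) (R \<inter> MM \<kappa> x) e \<psi> (\<lambda>j. P' j \<inter> MM \<kappa> x)"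
        by blast
      have "sat (MM \<kappa> x) (R \<inter> MM \<kappa> x) e \<phi> (\<lambda>j. P j \<inter> MM \<kappa> x)"
        unfolding p(1) sat_foldr_ExS by (rule exI[of _ "\<lambda>j. P' j \<inter> MM \<kappa> x"]) (use P'(1) x(2) in auto)
      then show "\<exists>x\<in>S. sat (MM \<kappa> x) (R \<inter> MM \<kappa> x) e \<phi> (\<lambda>j. P j \<inter> MM \<kappa> x)" using x(1) by blast
    qed
  next
    case limit
    obtain \<psi> where p: "\<phi> = Disj \<xi> \<psi>" "\<forall>\<eta>\<in>elts \<xi>. is_Sigma \<eta> (\<psi> \<eta>)" "finite (fsv (Disj \<xi> \<psi>))"
      using is_Pi_limitD(2)[OF limit \<phi>(1)] by blast
    have "reflects \<kappa> A S (\<psi> \<eta>)" if e: "\<eta> \<in> elts \<xi>" for \<eta>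
    proof -
      have "\<forall>\<rho>\<in>elts \<xi>. \<exists>\<chi> :: 'k so. is_Pi \<rho> \<chi> \<and> fsv \<chi> \<subseteq> fo_fsv (All 0 (Eq 0 0)) \<and>
          fv \<chi> \<subseteq> fo_fv (All 0 (Eq 0 0)) \<and> bsv \<chi> = {} \<and> (\<forall>M R e s. sat M R e \<chi> s = fo_sat M R e s (All 0 (Eq 0 0)))"
        by (rule ballI) (rule conjunct1[OF lift_FO[OF Ord_elt[OF O]]])
      from bchoice[OF this] obtain tt :: "'k hset \<Rightarrow> 'k so" where 
        tt: "\<forall>\<rho>\<in>elts \<xi>. is_Pi \<rho> (tt \<rho>) \<and> fsv (tt \<rho>) \<subseteq> fo_fsv (All 0 (Eq 0 0)) \<and>
          fv (tt \<rho>) \<subseteq> fo_fv (All 0 (Eq 0 0)) \<and> bsv (tt \<rho>) = {} \<and> (\<forall>M R e s. sat M R e (tt \<rho>) s = fo_sat M R e s (All 0 (Eq 0 0)))" ..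
      define \<chi> where "\<chi> \<rho> = (if \<rho> = succ \<eta> then \<psi> \<eta> else tt \<rho>)" for \<rho>
      have se: "succ \<eta> \<in> elts \<xi>" using limit e by (simp add: is_limit_def)
      have f: "fsv (\<chi> \<rho>) \<subseteq> fsv (\<psi> \<eta>)" "fv (\<chi> \<rho>) = {}" "is_Pi \<rho> (\<chi> \<rho>)" if "\<rho> \<in> elts \<xi>" for \<rho>
        using tt that p(1,2) \<phi>(2) e Sigma_Pi[of \<eta> "\<psi> \<eta>"] by (auto simp: \<chi>_def)
      have "fsv (Conj \<xi> \<chi>) \<subseteq> fsv (\<psi> \<eta>)" using f(1) by auto
      moreover have "finite (fsv (\<psi> \<eta>))" using is_Pi_finite_fsv p(2) e by blast
      ultimately have "is_Pi \<xi> (Conj \<xi> \<chi>)" by (intro Pi_limit[OF limit _ finite_subset]) (use f(3) in auto)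
      then have "reflects \<kappa> A S (Conj \<xi> \<chi>)" by (rule rP) (use f(2) in simp)
      moreover have "sat M R e (Conj \<xi> \<chi>) s = sat M R e (\<psi> \<eta>) s" for M R e s
        using tt se by (auto simp: \<chi>_def)
      ultimately show ?thesis unfolding reflects_def by metis
    qed
    then show ?thesis unfolding reflects_def p(1) sat.simps by metis
  qed
qed

section \<open>Clubs and the indescribability ideal\<close>

lemma Ord_sub: "Ord j \<Longrightarrow> i \<in> elts j \<Longrightarrow> elts i \<subseteq> elts j"
  by (simp add: Ord_def)

definition nice :: "'k hset \<Rightarrow> 'k hset \<Rightarrow> 'k hset \<Rightarrow> bool" where
  "nice \<kappa> A x \<longleftrightarrow> gd \<kappa> A x \<and> regular_uncountable (kap \<kappa> x)"

lemma indescribable_mono: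
  assumes "indescribable \<xi> \<kappa> A S" "S \<subseteq> S'"
  shows "indescribable \<xi> \<kappa> A S'"
  unfolding indescribable_def
proof (intro allI impI)
  fix R \<phi>
  assume "R \<subseteq> WW \<kappa> A \<and> is_Pi \<xi> \<phi> \<and> sentence \<phi> \<and> models (WW \<kappa> A) R \<phi>"
  then obtain x where "x \<in> S" "elts x \<inter> elts \<kappa> = elts (kap \<kappa> x) \<and> models (MM \<kappa> x) (R \<inter> MM \<kappa> x) \<phi>"
    using indescribableD[OF assms(1), of R \<phi>] by blast
  then show "\<exists>x\<in>S'. elts x \<inter> elts \<kappa> = elts (kap \<kappa> x) \<and> models (MM \<kappa> x) (R \<inter> MM \<kappa> x) \<phi>"
    using assms(2) by blast
qed

locale two_cardinal =
  fixes \<kappa> A \<xi> :: "'k hset"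
  assumes regular: "regular_uncountable \<kappa>" and wrld: "world \<kappa> A" and \<xi>: "\<xi> \<in> elts \<kappa>"
begin

lemma Card: "Cardinal \<kappa>" using regular by (simp add: regular_uncountable_def)
lemma regC: "regularCard (ord_rel \<kappa>)" using regular by (simp add: regular_uncountable_def)
lemma Ord_\<xi>: "Ord \<xi>" by (rule Ord_elt[OF world_Ord[OF wrld] \<xi>])
lemma inf_\<kappa>: "infinite (elts \<kappa>)" by (rule world_inf[OF wrld])
lemma kA: "elts \<kappa> \<subseteq> elts A" using wrld by (simp add: world_def)
lemma kW: "elts \<kappa> \<subseteq> WW \<kappa> A" using kA WW_base[OF wrld] by blast
lemma zero_W: "zero \<in> WW \<kappa> A" using codable_WW[OF wrld] by (simp add: codable_def)

lemma UN_less: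
  assumes "|I| <o |elts \<kappa>|" "\<And>i. i \<in> I \<Longrightarrow> |f i| <o |elts \<kappa>|"
  shows "|\<Union>i\<in>I. f i| <o |elts \<kappa>|"
proof -
  note iso = Card_of_Cardinal[OF Card]
  have st: "stable (ord_rel \<kappa>)"
    by (rule regularCard_stable) (use Card regC inf_\<kappa> in \<open>auto simp: Cardinal_def Field_ord_rel\<close>)
  have "|\<Union>i\<in>I. f i| <o ord_rel \<kappa>"
    by (rule stable_UNION[OF st])
      (use ordLess_ordIso_trans[OF assms(1) ordIso_symmetric[OF iso]] 
        ordLess_ordIso_trans[OF assms(2) ordIso_symmetric[OF iso]] in auto)
  then show ?thesis by (rule ordLess_ordIso_trans[OF _ iso])
qed

lemma finite_less: "finite X \<Longrightarrow> |X| <o |elts \<kappa>|"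
  by (rule finite_less_card[OF inf_\<kappa>])

lemma countable_less: "|range (f :: nat \<Rightarrow> 'a)| <o |elts \<kappa>|"
  by (rule ordLeq_ordLess_trans[OF card_of_image]) (use wrld in \<open>simp add: world_def\<close>)

lemma less_small: "|X| <o |elts \<kappa>| \<Longrightarrow> small (X :: 'k hset set)"
  by (rule small_ordLeq[OF ordLess_imp_ordLeq])

lemma W_closed: "X \<subseteq> WW \<kappa> A \<Longrightarrow> |X| <o |elts \<kappa>| \<Longrightarrow> set_of X \<in> WW \<kappa> A"
  using WW_regular[OF wrld regC, of "set_of X"] elts_set_of[OF less_small, of X] by simp

text \<open>In this form the property is closed under finite intersections by its definition, and
  the operators preserve it (\<open>good_op\<close>).\<close>

definition thick :: "'k hset set \<Rightarrow> bool" where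
  "thick B \<longleftrightarrow> (\<forall>S. S \<subseteq> PP \<kappa> A \<longrightarrow> indescribable \<xi> \<kappa> A S \<longrightarrow> indescribable \<xi> \<kappa> A (S \<inter> B))"

lemma thickD: "thick B \<Longrightarrow> S \<subseteq> PP \<kappa> A \<Longrightarrow> indescribable \<xi> \<kappa> A S \<Longrightarrow> indescribable \<xi> \<kappa> A (S \<inter> B)"
  by (simp add: thick_def)

lemma thick_mono: "thick B \<Longrightarrow> B \<subseteq> B' \<Longrightarrow> thick B'"
  unfolding thick_def using indescribable_mono[of \<xi> \<kappa> A] by (metis Int_mono order_refl)

lemma thick_Int:
  assumes "thick B" "thick B'" shows "thick (B \<inter> B')"
  unfolding thick_def
proof (intro allI impI)
  fix S assume "S \<subseteq> PP \<kappa> A" "indescribable \<xi> \<kappa> A S"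
  then have "indescribable \<xi> \<kappa> A (S \<inter> B \<inter> B')" using thickD[OF assms(2)] thickD[OF assms(1)] by (simp add: le_infI1)
  then show "indescribable \<xi> \<kappa> A (S \<inter> (B \<inter> B'))" by (simp add: Int_assoc)
qed

lemma indescribable_nonempty:
  assumes "indescribable \<xi> \<kappa> A S" shows "S \<noteq> {}"
proof -
  obtain \<phi> :: "'k so" where "is_Pi \<xi> \<phi> \<and> fsv \<phi> \<subseteq> {} \<and> fv \<phi> \<subseteq> {} \<and> bsv \<phi> = {} \<and> (\<forall>M R e s. sat M R e \<phi> s)"
    using lift_FO[OF Ord_\<xi>, of "All 0 (Eq 0 0)"] by auto
  then have "is_Pi \<xi> \<phi>" "sentence \<phi>" "models (WW \<kappa> A) {} \<phi>" by (auto simp: sentence_def models_def)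
  from indescribableD[OF assms _ this] show ?thesis by auto
qed

lemma MM_upair:
  assumes "gd \<kappa> A x" "upair a b \<in> MM \<kappa> x"
  shows "a \<in> MM \<kappa> x" "b \<in> MM \<kappa> x"
  using MM_trans(1)[OF wrld assms finite_less] by auto

lemma gd_less: "gd \<kappa> A x \<Longrightarrow> |elts (kap \<kappa> x)| <o |elts \<kappa>|"
  by (rule ordLeq_ordLess_trans[OF kap_le]) (simp add: gd_def Psub_def)

text \<open>Closure under \<open>F\<close> is reflected together with closure under a map
  \<open>G\<close> that bounds the part of a small set inside \<kappa>. A subset of
  \<open>kap \<kappa> x\<close> of smaller size is an element of the local structure at
  \<open>x\<close>; its bound under \<open>G\<close> is an ordinal of the local structure below
  \<kappa>, hence below \<open>kap \<kappa> x\<close>. This gives regularity.\<close>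

lemma thick_closed:
  assumes F: "closed_under F (WW \<kappa> A)"
  shows "thick {x. nice \<kappa> A x \<and> closed_under F (MM \<kappa> x)}" (is "thick ?B")
  unfolding thick_def
proof (intro allI impI)
  fix S assume S: "S \<subseteq> PP \<kappa> A" "indescribable \<xi> \<kappa> A S"
  have "\<forall>v :: 'k hset. |elts v| <o |elts \<kappa>| \<longrightarrow> (\<exists>b\<in>elts \<kappa>. elts v \<inter> elts \<kappa> \<subseteq> elts b)"
  proof (intro allI impI)
    fix v :: "'k hset" assume v: "|elts v| <o |elts \<kappa>|"
    show "\<exists>b\<in>elts \<kappa>. elts v \<inter> elts \<kappa> \<subseteq> elts b"
      by (rule regularCard_bounded[OF Card regC _ _ inf_\<kappa>])
        (auto intro: ordLeq_ordLess_trans[OF card_of_mono1 v])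
  qed
  then obtain b where b: "\<And>v. |elts v| <o |elts \<kappa>| \<Longrightarrow> b v \<in> elts \<kappa> \<and> elts v \<inter> elts \<kappa> \<subseteq> elts (b v)" by metis
  define G where "G v = (if |elts v| <o |elts \<kappa>| then b v else zero)" for v
  \<comment> \<open>Two functions are combined into one by an unordered pair;
    \<open>MM_upair\<close> recovers both values at a point.\<close>
  define F' where "F' v = upair (F v) (G v)" for v
  have "closed_under F' (WW \<kappa> A)"
    unfolding closed_under_def
  proof
    fix v assume v: "v \<in> WW \<kappa> A"
    have "G v \<in> WW \<kappa> A" unfolding G_def using b kW zero_W by auto
    moreover have "F v \<in> WW \<kappa> A" using F v by (simp add: closed_under_def)
    ultimately show "F' v \<in> WW \<kappa> A" using codable_WW[OF wrld] by (simp add: F'_def codable_def)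
  qed
  note refl = reflection[OF wrld S this]
  show "indescribable \<xi> \<kappa> A (S \<inter> ?B)"
    unfolding indescribable_def
  proof (intro allI impI)
    fix R \<phi> assume h: "R \<subseteq> WW \<kappa> A \<and> is_Pi \<xi> \<phi> \<and> sentence \<phi> \<and> models (WW \<kappa> A) R \<phi>"
    have "sat (WW \<kappa> A) R (\<lambda>_. zero) \<phi> (\<lambda>_. {})" using h by (simp add: models_def)
    then obtain x where x: "x \<in> S" "gd \<kappa> A x" "closed_under F' (MM \<kappa> x)"
        "sat (MM \<kappa> x) (R \<inter> MM \<kappa> x) (\<lambda>_. zero) \<phi> (\<lambda>_. {} \<inter> MM \<kappa> x)"
      using refl[of \<phi> R "\<lambda>_. {}" "\<lambda>_. zero"] h by (auto simp: sentence_def)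
    have cl: "F v \<in> MM \<kappa> x" "G v \<in> MM \<kappa> x" if "v \<in> MM \<kappa> x" for v
      using MM_upair[OF x(2), of "F v" "G v"] x(3) that by (auto simp: closed_under_def F'_def)
    have "regular_uncountable (kap \<kappa> x)"
    proof (rule regular_uncountableI[OF Cardinal_kap(1)])
      show "|UNIV :: nat set| <o |elts (kap \<kappa> x)|" using x(2) by (simp add: gd_def)
      fix u assume u: "u \<subseteq> elts (kap \<kappa> x)" "|u| <o |elts (kap \<kappa> x)|"
      have ul: "|u| <o |elts \<kappa>|" by (rule ordLess_transitive[OF u(2) gd_less[OF x(2)]])
      have e: "elts (set_of u) = u" by (rule elts_set_of[OF less_small[OF ul]])
      have ux: "u \<subseteq> elts x" "u \<subseteq> elts \<kappa>" using u(1) x(2) by (auto simp: gd_def)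
      have "set_of u \<in> PP (kap \<kappa> x) x" using e u(2) ux by (simp add: Psub_def)
      then have "set_of u \<in> MM \<kappa> x" using WW_PP[OF gd_world[OF wrld x(2)]] by blast
      then have "G (set_of u) \<in> MM \<kappa> x" by (rule cl)
      moreover have g: "G (set_of u) \<in> elts \<kappa>" "u \<subseteq> elts (G (set_of u))"
        using b[of "set_of u"] ul e ux by (auto simp: G_def)
      moreover have "Ord (G (set_of u))" by (rule Ord_elt[OF world_Ord[OF wrld] g(1)])
      ultimately have "G (set_of u) \<in> elts x" using gd_Ord_in[OF wrld x(2)] by blast
      then have "G (set_of u) \<in> elts (kap \<kappa> x)" using g(1) x(2) by (auto simp: gd_def)
      then show "\<exists>b\<in>elts (kap \<kappa> x). u \<subseteq> elts b" using g(2) by blast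
    qed
    then have "x \<in> ?B" using x(2) cl(1) by (simp add: nice_def closed_under_def)
    moreover have "models (MM \<kappa> x) (R \<inter> MM \<kappa> x) \<phi>"
      using x(4) models_iff[of \<phi> "MM \<kappa> x" "R \<inter> MM \<kappa> x" "\<lambda>_. zero" "\<lambda>_. {} \<inter> MM \<kappa> x"] h by blast
    ultimately show "\<exists>x\<in>S \<inter> ?B. elts x \<inter> elts \<kappa> = elts (kap \<kappa> x) \<and> models (MM \<kappa> x) (R \<inter> MM \<kappa> x) \<phi>"
      using x(1,2) by (auto simp: gd_def)
  qed
qed

lemma thick_nice: "thick {x. nice \<kappa> A x}"
  by (rule thick_mono[OF thick_closed[of id]]) (auto simp: closed_under_def)

text \<open>Closure under the constant function with value \<open>y\<close> puts \<open>y\<close>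
  into the local structure, which is not empty.\<close>

lemma thick_mem: "y \<in> WW \<kappa> A \<Longrightarrow> thick {x. nice \<kappa> A x \<and> y \<in> MM \<kappa> x}"
proof -
  assume "y \<in> WW \<kappa> A"
  then have "thick {x. nice \<kappa> A x \<and> closed_under (\<lambda>_. y) (MM \<kappa> x)}" by (intro thick_closed) (simp add: closed_under_def)
  then show ?thesis
  proof (rule thick_mono, intro subsetI)
    fix x assume x: "x \<in> {x. nice \<kappa> A x \<and> closed_under (\<lambda>_. y) (MM \<kappa> x)}"
    then have "zero \<in> MM \<kappa> x" using codable_WW[OF gd_world[OF wrld, of x]] by (simp add: nice_def codable_def)
    then show "x \<in> {x. nice \<kappa> A x \<and> y \<in> MM \<kappa> x}" using x by (auto simp: closed_under_def)
  qed
qed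

lemma nice_PP: "nice \<kappa> A x \<Longrightarrow> y \<in> PP \<kappa> A \<Longrightarrow> sq_less \<kappa> y x \<longleftrightarrow> y \<in> MM \<kappa> x"
  using MM_PP[OF wrld, of x] sq_less_iff[of \<kappa> y x] unfolding nice_def by blast

lemma thick_above: "y \<in> PP \<kappa> A \<Longrightarrow> thick {x. nice \<kappa> A x \<and> sq_less \<kappa> y x}"
  by (rule thick_mono[OF thick_mem[of y]]) (use WW_PP[OF wrld] nice_PP in auto)

text \<open>Recursion along inclusion: \<open>g p\<close> is chosen in the club above
  \<open>p\<close> and above the finitely many values at proper subsets. This begins the classical
  argument that a club contains all sets closed under some function on finite sets.\<close>

lemma ex_finite_mono:
  assumes C: "club \<kappa> A C"
  obtains g where "\<And>p. finite p \<Longrightarrow> p \<subseteq> elts A \<Longrightarrow> g p \<in> C \<and> p \<subseteq> elts (g p)"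
    "\<And>p q. finite p \<Longrightarrow> p \<subseteq> elts A \<Longrightarrow> q \<subseteq> p \<Longrightarrow> elts (g q) \<subseteq> elts (g p)"
proof -
  define H where "H g p = (SOME c. c \<in> C \<and> p \<union> (\<Union>q\<in>{q. q \<subset> p}. elts (g q)) \<subseteq> elts c)"
    for g :: "'k hset set \<Rightarrow> 'k hset" and p
  define g where "g = wfrec finite_psubset H"
  have unf: "g p = H g p" if "finite p" for p
  proof -
    have "g p = H (cut g finite_psubset p) p" unfolding g_def by (rule wfrec[OF wf_finite_psubset])
    also have "\<dots> = H g p" unfolding H_def
      by (intro arg_cong[of _ _ Eps] ext conj_cong refl arg_cong2[of _ _ _ _ "(\<subseteq>)"] arg_cong2[of _ _ _ _ "(\<union>)"] SUP_cong)
        (use that in \<open>auto simp: cut_def finite_psubset_def\<close>)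
    finally show ?thesis .
  qed
  have CP: "C \<subseteq> PP \<kappa> A" using C by (simp add: club_def)
  have main: "g p \<in> C \<and> p \<union> (\<Union>q\<in>{q. q \<subset> p}. elts (g q)) \<subseteq> elts (g p)" if "finite p" "p \<subseteq> elts A" for p
    using that
  proof (induction p rule: finite_psubset_induct)
    case (psubset p)
    let ?X = "p \<union> (\<Union>q\<in>{q. q \<subset> p}. elts (g q))"
    have IH: "g q \<in> PP \<kappa> A" if "q \<subset> p" for q using psubset(2)[OF that] that psubset(3) CP by blast
    have fin: "finite {q. q \<subset> p}" by (rule finite_subset[of _ "Pow p"]) (use psubset(1) in auto)
    have "|\<Union>q\<in>{q. q \<subset> p}. elts (g q)| <o |elts \<kappa>|"
      by (rule UN_less[OF finite_less[OF fin]]) (use IH in \<open>auto simp: Psub_def\<close>)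
    then have l: "|?X| <o |elts \<kappa>|"
      by (intro card_of_Un_ordLess_infinite[OF inf_\<kappa> finite_less[OF psubset(1)]])
    have e: "elts (set_of ?X) = ?X" by (rule elts_set_of[OF less_small[OF l]])
    have "?X \<subseteq> elts A" using psubset(3) IH by (auto simp: Psub_def)
    then have "set_of ?X \<in> PP \<kappa> A" using l e by (simp add: Psub_def)
    then obtain c where "c \<in> C" "elts (set_of ?X) \<subseteq> elts c" using C unfolding club_def by blast
    then have "\<exists>c. c \<in> C \<and> ?X \<subseteq> elts c" using e by auto
    from someI_ex[OF this] show ?case unfolding unf[OF psubset(1)] by (simp add: H_def)
  qed
  show thesis
  proof (rule that[of g])
    show "g p \<in> C \<and> p \<subseteq> elts (g p)" if "finite p" "p \<subseteq> elts A" for p using main[OF that] by blast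
    show "elts (g q) \<subseteq> elts (g p)" if "finite p" "p \<subseteq> elts A" "q \<subseteq> p" for p q
      using main[OF that(1,2)] that(3) by (cases "q = p") auto
  qed
qed

text \<open>Clubs are closed under unions of chains, whereas the finite subsets of \<open>B\<close>
  are merely directed. An infinite \<open>B\<close> is enumerated in the order type of its cardinal;
  the directed union over \<open>B\<close> is then the union of the chain of directed unions over
  the proper initial segments, which have smaller size.\<close>

lemma club_union:
  assumes C: "club \<kappa> A C" and g: "\<And>p. finite p \<Longrightarrow> p \<subseteq> elts A \<Longrightarrow> g p \<in> C \<and> p \<subseteq> elts (g p)"
    "\<And>p q. finite p \<Longrightarrow> p \<subseteq> elts A \<Longrightarrow> q \<subseteq> p \<Longrightarrow> elts (g q) \<subseteq> elts (g p)"
  defines "U \<equiv> \<lambda>B. \<Union>p\<in>{p. finite p \<and> p \<subseteq> B}. elts (g p)"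
  shows "B \<subseteq> elts A \<Longrightarrow> |B| <o |elts \<kappa>| \<Longrightarrow> set_of (U B) \<in> C"
proof (induction "hcard B" arbitrary: B rule: hset_induct)
  case (1 B)
  have CP: "C \<subseteq> PP \<kappa> A" using C by (simp add: club_def)
  have UA: "U B \<subseteq> elts A" if "B \<subseteq> elts A" for B using that g(1) CP unfolding U_def Psub_def by blast
  have Umono: "U B \<subseteq> U B'" if "B \<subseteq> B'" for B B'
    unfolding U_def by (rule UN_mono) (use that in auto)
  have eU: "elts (set_of (U B)) = U B" if "B \<subseteq> elts A" for B
    by (rule elts_set_of[OF small_mono[OF small_elts UA[OF that]]])
  show ?case
  proof (cases "finite B")
    case True
    have "U B = elts (g B)" using g(2)[OF True 1(2)] True unfolding U_def by blast
    then show ?thesis using g(1)[OF True 1(2)] by simp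
  next
    case False
    define m where "m = hcard B"
    have m: "Cardinal m" "|elts m| =o |B|" unfolding m_def by (rule hcard[OF less_small[OF 1(3)]])+
    then obtain h where h: "bij_betw h (elts m) B" using card_of_ordIso by blast
    have mk: "m \<in> elts \<kappa>"
      by (rule Cardinal_lessD[OF Card Cardinal_Ord[OF m(1)] ordIso_ordLess_trans[OF m(2) 1(3)]])
    have infm: "infinite (elts m)" using False card_of_ordIso_finite[OF m(2)] by blast
    note lim = Cardinal_is_limit[OF m(1) infm]
    define s where "s i = set_of (U (h ` elts i))" for i
    have hi: "h ` elts i \<subseteq> B" if "i \<in> elts m" for i
      using h Ord_sub[OF is_limit_Ord[OF lim] that] unfolding bij_betw_def by blast
    have sC: "s i \<in> C" if i: "i \<in> elts m" for i
    proof -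
      have l: "|h ` elts i| <o |elts m|" by (rule ordLeq_ordLess_trans[OF card_of_image Cardinal_lessI[OF m(1) i]])
      have l': "|h ` elts i| <o |elts \<kappa>|" by (rule ordLess_transitive[OF l Cardinal_lessI[OF Card mk]])
      note c = hcard[OF less_small[OF l']]
      have "hcard (h ` elts i) \<in> elts m"
        by (rule Cardinal_lessD[OF m(1) Cardinal_Ord[OF c(1)] ordIso_ordLess_trans[OF c(2) l]])
      then show ?thesis unfolding s_def m_def using 1(1) hi[OF i] 1(2) l' by blast
    qed
    have es: "elts (s i) = U (h ` elts i)" if "i \<in> elts m" for i
      unfolding s_def by (rule eU) (use hi[OF that] 1(2) in blast)
    have mono: "elts (s i) \<subseteq> elts (s j)" if j: "j \<in> elts m" "i \<in> elts j" for i j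
    proof -
      have im: "i \<in> elts m" using Ord_trans[OF is_limit_Ord[OF lim] j(2,1)] .
      have "elts i \<subseteq> elts j" by (rule Ord_sub[OF Ord_elt[OF is_limit_Ord[OF lim] j(1)] j(2)])
      then have "h ` elts i \<subseteq> h ` elts j" by (rule image_mono)
      then have "U (h ` elts i) \<subseteq> U (h ` elts j)" by (rule Umono)
      then show ?thesis using es[OF im] es[OF j(1)] by simp
    qed
    have "(\<Union>i\<in>elts m. elts (s i)) = U B"
    proof
      show "(\<Union>i\<in>elts m. elts (s i)) \<subseteq> U B"
      proof (rule UN_least)
        fix i assume i: "i \<in> elts m"
        have "U (h ` elts i) \<subseteq> U B" using hi[OF i] by (rule Umono)
        then show "elts (s i) \<subseteq> U B" using es[OF i] by simp
      qed
      show "U B \<subseteq> (\<Union>i\<in>elts m. elts (s i))"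
      proof
        fix a assume "a \<in> U B"
        then obtain p where p: "finite p" "p \<subseteq> B" "a \<in> elts (g p)" unfolding U_def by blast
        obtain p' where p': "finite p'" "p' \<subseteq> elts m" "p = h ` p'"
          using finite_subset_image[of p h "elts m"] p(1,2) h unfolding bij_betw_def by auto
        have "\<exists>i\<in>elts m. p' \<subseteq> elts i" using p'(1,2)
        proof (induction p' rule: finite_induct)
          case empty
          then show ?case using is_limit_zero_in[OF lim] by auto
        next
          case (insert v p')
          then obtain i where i: "i \<in> elts m" "p' \<subseteq> elts i" by auto
          have v: "v \<in> elts m" using insert by auto
          have Om: "Ord m" by (rule is_limit_Ord[OF lim])
          have s: "succ i \<in> elts m" "succ v \<in> elts m" using lim i v by (auto simp: is_limit_def)
          consider "v \<in> elts i" | "v = i" | "i \<in> elts v" using Ord_linear[OF Ord_elt[OF Om v] Ord_elt[OF Om i(1)]] by blast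
          then show ?case
          proof cases
            case 3
            then have "elts i \<subseteq> elts v" by (intro Ord_sub[OF Ord_elt[OF Om v]])
            then show ?thesis using s(2) i(2) by (intro bexI[of _ "succ v"]) (auto simp: elts_succ)
          qed (use s(1) i in \<open>auto intro!: bexI[of _ "succ i"] simp: elts_succ\<close>)
        qed
        then obtain i where i: "i \<in> elts m" "p' \<subseteq> elts i" by blast
        then have "a \<in> U (h ` elts i)" using p p' unfolding U_def by blast
        then show "a \<in> (\<Union>i\<in>elts m. elts (s i))" using es i(1) by blast
      qed
    qed
    moreover have "set_of (\<Union>i\<in>elts m. elts (s i)) \<in> C"
    proof -
      have "elts m \<noteq> {}" using infm by auto
      then show ?thesis using C mk sC mono unfolding club_def by simp
    qed
    ultimately show ?thesis by simp
  qed
qed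

text \<open>Finite subsets of \<open>A\<close> are elements of the structure, so \<open>g\<close>
  acts on it. If the local structure at \<open>x\<close> is closed under \<open>g\<close>, then
  \<open>x\<close> is the union of the sets \<open>g p\<close> for finite subsets \<open>p\<close>
  of \<open>x\<close>.\<close>

lemma club_closed:
  assumes C: "club \<kappa> A C"
  shows "\<exists>F. closed_under F (WW \<kappa> A) \<and> (\<forall>x. nice \<kappa> A x \<longrightarrow> closed_under F (MM \<kappa> x) \<longrightarrow> x \<in> C)"
proof -
  obtain g where g: "\<And>p. finite p \<Longrightarrow> p \<subseteq> elts A \<Longrightarrow> g p \<in> C \<and> p \<subseteq> elts (g p)"
    "\<And>p q. finite p \<Longrightarrow> p \<subseteq> elts A \<Longrightarrow> q \<subseteq> p \<Longrightarrow> elts (g q) \<subseteq> elts (g p)"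
    using ex_finite_mono[OF C] by blast
  have CP: "C \<subseteq> PP \<kappa> A" using C by (simp add: club_def)
  define F where "F v = (if finite (elts v) \<and> elts v \<subseteq> elts A then g (elts v) else zero)" for v
  have "closed_under F (WW \<kappa> A)"
    unfolding closed_under_def F_def using g(1) CP WW_PP[OF wrld] zero_W by auto
  moreover have "x \<in> C" if x: "nice \<kappa> A x" "closed_under F (MM \<kappa> x)" for x
  proof -
    have gx: "gd \<kappa> A x" using x(1) by (simp add: nice_def)
    have xA: "elts x \<subseteq> elts A" "|elts x| <o |elts \<kappa>|" using gx by (auto simp: gd_def Psub_def)
    note wx = gd_world[OF wrld gx]
    have "(\<Union>p\<in>{p. finite p \<and> p \<subseteq> elts x}. elts (g p)) = elts x"
    proof
      show "elts x \<subseteq> (\<Union>p\<in>{p. finite p \<and> p \<subseteq> elts x}. elts (g p))"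
      proof
        fix a assume a: "a \<in> elts x"
        then have "a \<in> elts (g {a})" using g(1)[of "{a}"] xA by auto
        then show "a \<in> (\<Union>p\<in>{p. finite p \<and> p \<subseteq> elts x}. elts (g p))" using a by (intro UN_I[of "{a}"]) auto
      qed
      show "(\<Union>p\<in>{p. finite p \<and> p \<subseteq> elts x}. elts (g p)) \<subseteq> elts x"
      proof (rule UN_least)
        fix p assume p: "p \<in> {p. finite p \<and> p \<subseteq> elts x}"
        then have pM: "p \<subseteq> MM \<kappa> x" using WW_base[OF wx] by blast
        note f = WW_finite[OF wx _ pM]
        have "set_of p \<in> MM \<kappa> x" "elts (set_of p) = p" using f p by auto
        then have "g p \<in> MM \<kappa> x" using x(2) p xA(1) unfolding closed_under_def F_def by (metis (no_types, lifting) mem_Collect_eq subset_trans)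
        then have "g p \<in> MM \<kappa> x \<inter> PP \<kappa> A" using g(1)[of p] p xA(1) CP by blast
        then show "elts (g p) \<subseteq> elts x" unfolding MM_PP[OF wrld gx] by (simp add: Psub_def)
      qed
    qed
    then show "x \<in> C" using club_union[OF C g xA] by simp
  qed
  ultimately show ?thesis by blast
qed

lemma thick_club: "club \<kappa> A C \<Longrightarrow> thick C"
  using club_closed[of C] thick_closed thick_mono by (metis (no_types, lifting) mem_Collect_eq subsetI)

text \<open>Countably many functions are merged by sending \<open>v\<close> to the set of all values
  \<open>F n v\<close>. This set is an element of the structure because \<kappa> is regular and
  uncountable, and a local structure contains its elements because it is smaller than
  \<kappa>.\<close>

lemma clubs_meet:
  assumes C: "\<And>n :: nat. club \<kappa> A (C n)" and S: "S \<subseteq> PP \<kappa> A" "indescribable \<xi> \<kappa> A S"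
  shows "\<exists>x\<in>S. \<forall>n. x \<in> C n"
proof -
  have "\<forall>n. \<exists>F. closed_under F (WW \<kappa> A) \<and> (\<forall>x. nice \<kappa> A x \<longrightarrow> closed_under F (MM \<kappa> x) \<longrightarrow> x \<in> C n)"
    using club_closed[OF C] by blast
  from choice[OF this] obtain F where F: "\<forall>n. closed_under (F n) (WW \<kappa> A) \<and> (\<forall>x. nice \<kappa> A x \<longrightarrow> closed_under (F n) (MM \<kappa> x) \<longrightarrow> x \<in> C n)" ..
  define G where "G v = set_of (range (\<lambda>n. F n v))" for v
  have "closed_under G (WW \<kappa> A)"
    unfolding closed_under_def G_def using F by (auto intro!: W_closed countable_less simp: closed_under_def)
  then have "indescribable \<xi> \<kappa> A (S \<inter> {x. nice \<kappa> A x \<and> closed_under G (MM \<kappa> x)})"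
    by (rule thickD[OF thick_closed S])
  then obtain x where x: "x \<in> S" "nice \<kappa> A x" "closed_under G (MM \<kappa> x)" using indescribable_nonempty by blast
  have gx: "gd \<kappa> A x" using x(2) by (simp add: nice_def)
  have "closed_under (F n) (MM \<kappa> x)" for n
    unfolding closed_under_def
  proof
    fix v assume "v \<in> MM \<kappa> x"
    then have G: "G v \<in> MM \<kappa> x" using x(3) by (simp add: closed_under_def)
    have e: "elts (G v) = range (\<lambda>n. F n v)" unfolding G_def by (rule elts_set_of[OF small_countable])
    have "elts (G v) \<subseteq> MM \<kappa> x" by (rule MM_trans(1)[OF wrld gx G]) (simp add: e countable_less)
    then show "F n v \<in> MM \<kappa> x" using e by blast
  qed
  then show ?thesis using F x by blast
qed

end

section \<open>Operators and their iterates\<close>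

lemma iterate_induct:
  assumes "P I" "\<And>J. P J \<Longrightarrow> P (F J)" "\<And>\<J>. \<J> \<noteq> {} \<Longrightarrow> (\<And>J. J \<in> \<J> \<Longrightarrow> P J) \<Longrightarrow> P (\<Union>\<J>)"
  shows "P (iterate I F \<gamma>)"
proof (induction \<gamma> rule: hset_induct)
  case (1 \<gamma>)
  consider "elts \<gamma> = {}" | \<delta> where "\<gamma> = succ \<delta>" | "elts \<gamma> \<noteq> {}" "\<nexists>\<delta>. \<gamma> = succ \<delta>" by blast
  then show ?case
  proof cases
    case 1
    then show ?thesis using assms(1) by (simp add: iterate_0)
  next
    case 2
    then have "P (iterate I F \<delta>)" using 1 by (simp add: elts_succ)
    then show ?thesis unfolding 2 iterate_succ by (rule assms(2))
  next
    case 3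
    then have e: "iterate I F \<gamma> = \<Union> (iterate I F ` elts \<gamma>)" by (subst iterate.simps) auto
    show ?thesis unfolding e by (rule assms(3)) (use 3 1 in auto)
  qed
qed

definition downward :: "'k hset \<Rightarrow> 'k hset \<Rightarrow> 'k hset set set \<Rightarrow> bool" where
  "downward \<kappa> A J \<longleftrightarrow> J \<subseteq> Pow (PP \<kappa> A) \<and> (\<forall>S\<in>J. \<forall>S'. S' \<subseteq> S \<longrightarrow> S' \<in> J)"

lemma positive_mono:
  "downward \<kappa> A J \<Longrightarrow> S \<in> positive \<kappa> A J \<Longrightarrow> S \<subseteq> S' \<Longrightarrow> S' \<subseteq> PP \<kappa> A \<Longrightarrow> S' \<in> positive \<kappa> A J"
  unfolding downward_def positive_def by blast

lemma downward_Pi: "downward \<kappa> A (Pi_ideal \<xi> \<kappa> A)"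
  unfolding downward_def Pi_ideal_def by (auto dest: indescribable_mono)

lemma positive_ineff: "S \<in> positive \<kappa> A (ineff_op \<kappa> A J) \<longleftrightarrow> S \<subseteq> PP \<kappa> A \<and>
   (\<forall>L. is_list \<kappa> S L \<longrightarrow> (\<exists>H\<in>positive \<kappa> A J. H \<subseteq> S \<and> homogeneous_list \<kappa> L H))"
  by (subst positive_def) (auto simp: ineff_op_def)

lemma positive_ramsey: "S \<in> positive \<kappa> A (ramsey_op \<kappa> A J) \<longleftrightarrow> S \<subseteq> PP \<kappa> A \<and>
   (\<forall>f. regressive \<kappa> A S f \<longrightarrow> (\<exists>H\<in>positive \<kappa> A J. H \<subseteq> S \<and> homogeneous_fun \<kappa> f H))"
  by (subst positive_def) (auto simp: ramsey_op_def)

lemma tuples_mono: "S \<subseteq> S' \<Longrightarrow> tuples \<kappa> S m \<subseteq> tuples \<kappa> S' m"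
  unfolding tuples_def by blast

lemma regressive_mono: "regressive \<kappa> A S' f \<Longrightarrow> S \<subseteq> S' \<Longrightarrow> regressive \<kappa> A S f"
  unfolding regressive_def using tuples_mono[of S S' \<kappa>] by (meson subsetD)

lemma downwardI_positive:
  assumes "J \<subseteq> Pow (PP \<kappa> A)" "\<And>S S'. S' \<in> positive \<kappa> A J \<Longrightarrow> S' \<subseteq> S \<Longrightarrow> S \<subseteq> PP \<kappa> A \<Longrightarrow> S \<in> positive \<kappa> A J"
  shows "downward \<kappa> A J"
  unfolding downward_def
proof (intro conjI ballI allI impI)
  fix S S' assume S: "S \<in> J" "S' \<subseteq> S"
  then have "S \<notin> positive \<kappa> A J" "S \<subseteq> PP \<kappa> A" using assms(1) by (auto simp: positive_def)
  then have "S' \<notin> positive \<kappa> A J" using assms(2)[of S' S] S(2) by blast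
  then show "S' \<in> J" using S(2) \<open>S \<subseteq> PP \<kappa> A\<close> unfolding positive_def by blast
qed (rule assms(1))

abbreviation ops :: "('k hset \<Rightarrow> 'k hset \<Rightarrow> 'k hset set set \<Rightarrow> 'k hset set set) set" where
  "ops \<equiv> {ineff_op, ramsey_op}"

lemma downward_op:
  assumes "Op \<in> ops"
  shows "downward \<kappa> A (Op \<kappa> A J)"
proof (rule downwardI_positive)
  show "Op \<kappa> A J \<subseteq> Pow (PP \<kappa> A)" using assms by (auto simp: ineff_op_def ramsey_op_def)
  fix S S' assume S: "S' \<in> positive \<kappa> A (Op \<kappa> A J)" "S' \<subseteq> S" "S \<subseteq> PP \<kappa> A"
  consider "Op = ineff_op" | "Op = ramsey_op" using assms by blast
  then show "S \<in> positive \<kappa> A (Op \<kappa> A J)"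
  proof cases
    case 1
    have "is_list \<kappa> S' L" if "is_list \<kappa> S L" for L using that S(2) by (auto simp: is_list_def)
    then show ?thesis using S unfolding 1 positive_ineff by (meson order_trans)
  next
    case 2
    show ?thesis using S regressive_mono[OF _ S(2)] unfolding 2 positive_ramsey by (meson order_trans)
  qed
qed

lemma card_Un_le: "infinite C \<Longrightarrow> |A| \<le>o |C| \<Longrightarrow> |B| \<le>o |C| \<Longrightarrow> |A \<union> B| \<le>o |C|"
  by (rule card_of_Un_ordLeq_infinite_Field[of "|C|"]) (simp_all add: Field_card_of card_of_card_order_on)

lemma empty_less: "X \<noteq> {} \<Longrightarrow> |{}| <o |X|"
  using card_of_empty3[of X] not_ordLeq_iff_ordLess[OF card_of_Well_order card_of_Well_order] by blast

text \<open>The list with empty entries and the function with constant value the empty set are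
  admissible, so a set that is positive for the operator has a subset that is positive for the
  ideal.\<close>

lemma op_extends:
  assumes "Op \<in> ops" "downward \<kappa> A J" "elts \<kappa> \<noteq> {}"
  shows "J \<subseteq> Op \<kappa> A J"
proof
  fix S assume S: "S \<in> J"
  show "S \<in> Op \<kappa> A J"
  proof (rule ccontr)
    assume n: "S \<notin> Op \<kappa> A J"
    have SP: "S \<subseteq> PP \<kappa> A" using S assms(2) by (auto simp: downward_def)
    then have p: "S \<in> positive \<kappa> A (Op \<kappa> A J)" using n by (simp add: positive_def)
    have "\<exists>H\<in>positive \<kappa> A J. H \<subseteq> S"
    proof (cases "Op = ineff_op")
      case True
      have "is_list \<kappa> S (\<lambda>_. {})" by (simp add: is_list_def)
      then show ?thesis using p unfolding True positive_ineff by blast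
    next
      case False
      then have r: "Op = ramsey_op" using assms(1) by blast
      have "regressive \<kappa> A S (\<lambda>_. zero)"
        by (auto simp: regressive_def Psub_def sq_less_def assms(3) intro!: empty_less)
      then show ?thesis using p unfolding r positive_ramsey by blast
    qed
    then have "S \<in> positive \<kappa> A J" using positive_mono[OF assms(2) _ _ SP] by blast
    then show False using S by (simp add: positive_def)
  qed
qed

abbreviation II :: "('k hset \<Rightarrow> 'k hset \<Rightarrow> 'k hset set set \<Rightarrow> 'k hset set set) \<Rightarrow> 'k hset \<Rightarrow> 'k hset \<Rightarrow> 'k hset \<Rightarrow> 'k hset \<Rightarrow> 'k hset set set" where
  "II Op \<xi> \<kappa> A \<gamma> \<equiv> iterate (Pi_ideal \<xi> \<kappa> A) (Op \<kappa> A) \<gamma>"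

lemma downward_II:
  assumes "Op \<in> ops"
  shows "downward \<kappa> A (II Op \<xi> \<kappa> A \<gamma>)"
proof (rule iterate_induct[where P = "downward \<kappa> A"])
  fix \<J> :: "'a hset set set set" assume "\<And>J. J \<in> \<J> \<Longrightarrow> downward \<kappa> A J"
  then show "downward \<kappa> A (\<Union>\<J>)" unfolding downward_def by blast
qed (rule downward_Pi, rule downward_op[OF assms])

lemma II_mono:
  assumes "Op \<in> ops" "elts \<kappa> \<noteq> {}"
  shows "Ord \<gamma> \<Longrightarrow> \<delta> \<in> elts \<gamma> \<Longrightarrow> II Op \<xi> \<kappa> A \<delta> \<subseteq> II Op \<xi> \<kappa> A \<gamma>"
proof (induction \<gamma> rule: Ord_induct3)
  case (succ \<gamma>)
  have "II Op \<xi> \<kappa> A \<delta> \<subseteq> II Op \<xi> \<kappa> A \<gamma>" using succ by (auto simp: elts_succ)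
  also have "\<dots> \<subseteq> II Op \<xi> \<kappa> A (succ \<gamma>)" unfolding iterate_succ
    by (rule op_extends[OF assms(1) downward_II[OF assms(1)] assms(2)])
  finally show ?case .
next
  case (limit \<gamma>)
  show ?case unfolding iterate_limit[OF limit(1)] by (rule UN_upper) (rule limit(3))
qed simp

section \<open>Ideals stable under restriction to thick sets\<close>

context two_cardinal
begin

text \<open>What the induction asks of every iterate: positive sets are indescribable, hence
  non-empty, and remain positive when restricted to a thick set.\<close>

definition good :: "'k hset set set \<Rightarrow> bool" where
  "good J \<longleftrightarrow> downward \<kappa> A J \<and> Pi_ideal \<xi> \<kappa> A \<subseteq> J \<and>
     (\<forall>S B. S \<in> positive \<kappa> A J \<longrightarrow> thick B \<longrightarrow> S \<inter> B \<in> positive \<kappa> A J)"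

lemma good_thick: "good J \<Longrightarrow> S \<in> positive \<kappa> A J \<Longrightarrow> thick B \<Longrightarrow> S \<inter> B \<in> positive \<kappa> A J"
  by (simp add: good_def)

lemma good_indescribable: "good J \<Longrightarrow> S \<in> positive \<kappa> A J \<Longrightarrow> S \<subseteq> PP \<kappa> A \<and> indescribable \<xi> \<kappa> A S"
  unfolding good_def positive_def Pi_ideal_def by auto

lemma good_ne: "good J \<Longrightarrow> S \<in> positive \<kappa> A J \<Longrightarrow> S \<noteq> {}"
  using good_indescribable indescribable_nonempty by blast

lemma kne: "elts \<kappa> \<noteq> {}" using inf_\<kappa> by auto

lemma zero_PP: "zero \<in> PP \<kappa> A"
  using empty_less[OF kne] by (simp add: Psub_def)

lemma zero_sq: "elts x \<inter> elts \<kappa> \<noteq> {} \<Longrightarrow> sq_less \<kappa> zero x"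
  using empty_less[of "elts x \<inter> elts \<kappa>"] by (simp add: sq_less_def)

lemma good_Pi: "good (Pi_ideal \<xi> \<kappa> A)"
  unfolding good_def using downward_Pi thickD by (auto simp: positive_def Pi_ideal_def)

text \<open>A list or a function on the intersection with \<open>B\<close> is extended to
  \<open>S\<close> by a default value, homogenized there, and restricted again; the homogeneous set
  loses only points outside \<open>B\<close>, which the ideal \<open>J\<close> tolerates.\<close>

lemma good_op:
  assumes "Op \<in> ops" "good J"
  shows "good (Op \<kappa> A J)"
proof -
  have "J \<subseteq> Op \<kappa> A J" by (rule op_extends[OF assms(1) _ kne]) (use assms(2) in \<open>simp add: good_def\<close>)
  then have "Pi_ideal \<xi> \<kappa> A \<subseteq> Op \<kappa> A J" using assms(2) by (auto simp: good_def)
  moreover have "S \<inter> B \<in> positive \<kappa> A (Op \<kappa> A J)" if S: "S \<in> positive \<kappa> A (Op \<kappa> A J)" and B: "thick B" for S B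
  proof (cases "Op = ineff_op")
    case True
    show ?thesis
      unfolding True positive_ineff
    proof (intro conjI allI impI)
      show "S \<inter> B \<subseteq> PP \<kappa> A" using S by (auto simp: positive_def)
      fix L assume L: "is_list \<kappa> (S \<inter> B) L"
      define L' where "L' x = (if x \<in> B then L x else {})" for x
      have "is_list \<kappa> S L'" using L by (auto simp: is_list_def L'_def)
      then obtain H where H: "H \<in> positive \<kappa> A J" "H \<subseteq> S" "homogeneous_list \<kappa> L' H"
        using S[unfolded True positive_ineff] by metis
      have "homogeneous_list \<kappa> L (H \<inter> B)"
        unfolding homogeneous_list_def
      proof (intro ballI impI)
        fix x y assume xy: "x \<in> H \<inter> B" "y \<in> H \<inter> B" "sq_less \<kappa> x y"
        then have "L' x = L' y \<inter> PP (kap \<kappa> x) x" using H(3) by (simp add: homogeneous_list_def)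
        then show "L x = L y \<inter> PP (kap \<kappa> x) x" using xy by (simp add: L'_def)
      qed
      then show "\<exists>H\<in>positive \<kappa> A J. H \<subseteq> S \<inter> B \<and> homogeneous_list \<kappa> L H"
        by (intro bexI[OF _ good_thick[OF assms(2) H(1) B]]) (use H(2) in auto)
    qed
  next
    case False
    then have r: "Op = ramsey_op" using assms(1) by blast
    show ?thesis
      unfolding r positive_ramsey
    proof (intro conjI allI impI)
      show "S \<inter> B \<subseteq> PP \<kappa> A" using S by (auto simp: positive_def)
      fix f assume f: "regressive \<kappa> A (S \<inter> B) f"
      define f' where "f' xs = (if set xs \<subseteq> B then f xs else zero)" for xs
      have "regressive \<kappa> A S f'"
        unfolding regressive_def
      proof (intro allI impI ballI)
        fix m :: nat and xs assume m: "1 \<le> m" "xs \<in> tuples \<kappa> S m"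
        show "f' xs \<in> PP \<kappa> A \<and> (elts (hd xs) \<inter> elts \<kappa> \<noteq> {} \<longrightarrow> sq_less \<kappa> (f' xs) (hd xs))"
        proof (cases "set xs \<subseteq> B")
          case True
          then have "xs \<in> tuples \<kappa> (S \<inter> B) m" using m(2) by (auto simp: tuples_def)
          then show ?thesis using f m(1) True unfolding regressive_def f'_def by auto
        next
          case False
          then show ?thesis using zero_PP zero_sq by (auto simp: f'_def)
        qed
      qed
      then obtain H where H: "H \<in> positive \<kappa> A J" "H \<subseteq> S" "homogeneous_fun \<kappa> f' H"
        using S[unfolded r positive_ramsey] by metis
      have "homogeneous_fun \<kappa> f (H \<inter> B)"
        unfolding homogeneous_fun_def
      proof (intro allI impI ballI)
        fix m :: nat and xs ys assume m: "1 \<le> m" and t: "xs \<in> tuples \<kappa> (H \<inter> B) m" "ys \<in> tuples \<kappa> (H \<inter> B) m"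
        then have "f' xs = f' ys" using H(3) tuples_mono[of "H \<inter> B" H \<kappa> m] unfolding homogeneous_fun_def by blast
        then show "f xs = f ys" using t by (simp add: f'_def tuples_def)
      qed
      then show "\<exists>H\<in>positive \<kappa> A J. H \<subseteq> S \<inter> B \<and> homogeneous_fun \<kappa> f H"
        by (intro bexI[OF _ good_thick[OF assms(2) H(1) B]]) (use H(2) in auto)
    qed
  qed
  ultimately show ?thesis unfolding good_def using downward_op[OF assms(1)] by blast
qed

lemma good_II:
  assumes "Op \<in> ops"
  shows "good (II Op \<xi> \<kappa> A \<gamma>)"
proof (rule iterate_induct[where P = good])
  fix \<J> :: "'k hset set set set" assume J: "\<J> \<noteq> {}" "\<And>J. J \<in> \<J> \<Longrightarrow> good J"
  show "good (\<Union>\<J>)"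
    unfolding good_def
  proof (intro conjI allI impI)
    show "downward \<kappa> A (\<Union>\<J>)" using J(2) unfolding downward_def good_def by blast
    show "Pi_ideal \<xi> \<kappa> A \<subseteq> \<Union>\<J>" using J unfolding good_def by blast
    fix S B assume S: "S \<in> positive \<kappa> A (\<Union>\<J>)" "thick B"
    have "S \<inter> B \<in> positive \<kappa> A J" if "J \<in> \<J>" for J
      by (rule good_thick[OF J(2)[OF that] _ S(2)]) (use S(1) that in \<open>auto simp: positive_def\<close>)
    then show "S \<inter> B \<in> positive \<kappa> A (\<Union>\<J>)" using S(1) unfolding positive_def by blast
  qed
qed (rule good_Pi, rule good_op[OF assms])

section \<open>The cardinality of the structure\<close>

lemma A_le_PP: "|elts A| \<le>o |PP \<kappa> A|"
proof (rule card_of_ordLeqI[of sg])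
  show "sg a \<in> PP \<kappa> A" if "a \<in> elts A" for a
    using that finite_less[of "{a}"] by (simp add: Psub_def)
qed (simp add: inj_on_def)

lemma inf_A: "infinite (elts A)" using kA inf_\<kappa> finite_subset by blast

lemma inf_PP: "infinite (PP \<kappa> A)"
  using A_le_PP inf_A card_of_ordLeq_infinite by blast

lemma k_le_A: "|elts \<kappa>| \<le>o |elts A|" by (rule card_of_mono1[OF kA])

text \<open>Along an injection of \<open>X\<close> into \<open>PP \<kappa> A\<close>, a small subset
  of \<open>X\<close> becomes a family of fewer than \<kappa> small subsets of \<open>A\<close>. It
  is coded by one small subset of a product with \<kappa>: the row \<open>e Y y\<close> lists the
  elements of \<open>i y\<close>, and the entry \<open>None\<close> marks the rows in use, so that
  an empty member is not lost. The decoding depends on the rows but not on their order.\<close>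

lemma Psub_le:
  assumes "|X| \<le>o |PP \<kappa> A|"
  shows "|Psub \<kappa> X| \<le>o |PP \<kappa> A|"
proof -
  obtain i where i: "inj_on i X" "i ` X \<subseteq> PP \<kappa> A" using assms card_of_ordLeq[of X "PP \<kappa> A"] by blast
  define A' where "A' = insert None (Some ` elts A)"
  have "|{None} \<union> Some ` elts A| \<le>o |elts A|"
    by (rule card_Un_le[OF inf_A card_of_singl_ordLeq card_of_image]) (use inf_A in auto)
  then have "|A'| \<le>o |elts A|" by (simp add: A'_def)
  then have "|elts \<kappa> \<times> A'| \<le>o |elts A|"
    by (intro card_of_Times_ordLeq_infinite_Field) (auto simp: Field_card_of inf_A k_le_A card_of_card_order_on)
  then obtain q where q: "inj_on q (elts \<kappa> \<times> A')" "q ` (elts \<kappa> \<times> A') \<subseteq> elts A"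
    using card_of_ordLeq[of "elts \<kappa> \<times> A'" "elts A"] by blast
  have "\<forall>Y\<in>Psub \<kappa> X. \<exists>e. inj_on e (elts Y) \<and> e ` elts Y \<subseteq> elts \<kappa>"
    unfolding card_of_ordLeq Psub_def using ordLess_imp_ordLeq by blast
  then obtain e where e: "\<And>Y. Y \<in> Psub \<kappa> X \<Longrightarrow> inj_on (e Y) (elts Y) \<and> e Y ` elts Y \<subseteq> elts \<kappa>" by metis
  define P where "P Y = (\<Union>y\<in>elts Y. {e Y y} \<times> insert None (Some ` elts (i y)))" for Y
  have YX: "elts Y \<subseteq> X" if "Y \<in> Psub \<kappa> X" for Y using that by (simp add: Psub_def)
  have iy: "i y \<in> PP \<kappa> A" if "Y \<in> Psub \<kappa> X" "y \<in> elts Y" for y Y using i(2) YX that by blast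
  have Psub: "P Y \<subseteq> elts \<kappa> \<times> A'" if Y: "Y \<in> Psub \<kappa> X" for Y
    using e[OF Y] iy[OF Y] unfolding P_def A'_def Psub_def by blast
  have PA: "q ` P Y \<subseteq> elts A" if Y: "Y \<in> Psub \<kappa> X" for Y using Psub[OF Y] q(2) by blast
  have Pl: "|P Y| <o |elts \<kappa>|" if Y: "Y \<in> Psub \<kappa> X" for Y
    unfolding P_def
  proof (rule UN_less)
    show "|elts Y| <o |elts \<kappa>|" using Y by (simp add: Psub_def)
    fix y assume y: "y \<in> elts Y"
    have "|Some ` elts (i y)| <o |elts \<kappa>|"
      by (rule ordLeq_ordLess_trans[OF card_of_image]) (use iy[OF Y y] in \<open>simp add: Psub_def\<close>)
    then have l: "|{None} \<union> Some ` elts (i y)| <o |elts \<kappa>|"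
      by (intro card_of_Un_ordLess_infinite[OF inf_\<kappa> finite_less]) auto
    have "|Pair (e Y y) ` ({None} \<union> Some ` elts (i y))| <o |elts \<kappa>|"
      by (rule ordLeq_ordLess_trans[OF card_of_image l])
    moreover have "Pair (e Y y) ` ({None} \<union> Some ` elts (i y)) = {e Y y} \<times> insert None (Some ` elts (i y))" by auto
    ultimately show "|{e Y y} \<times> insert None (Some ` elts (i y))| <o |elts \<kappa>|" by simp
  qed
  have qPl: "|q ` P Y| <o |elts \<kappa>|" if "Y \<in> Psub \<kappa> X" for Y
    by (rule ordLeq_ordLess_trans[OF card_of_image Pl[OF that]])
  have es: "elts (set_of (q ` P Y)) = q ` P Y" if "Y \<in> Psub \<kappa> X" for Y
    by (rule elts_set_of[OF less_small[OF qPl[OF that]]])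
  have dec: "i ` elts Y = {z. \<exists>j. (j, None) \<in> P Y \<and> elts z = {a. (j, Some a) \<in> P Y}}" if Y: "Y \<in> Psub \<kappa> X" for Y
  proof -
    have "{a. (e Y y, Some a) \<in> P Y} = elts (i y)" if "y \<in> elts Y" for y
      using that e[OF Y] unfolding P_def inj_on_def by fastforce
    moreover have "(j, None) \<in> P Y \<longleftrightarrow> j \<in> e Y ` elts Y" for j unfolding P_def by auto
    ultimately show ?thesis by (auto intro: hset_ext)
  qed
  show ?thesis
  proof (rule card_of_ordLeqI[of "\<lambda>Y. set_of (q ` P Y)"])
    show "set_of (q ` P Y) \<in> PP \<kappa> A" if "Y \<in> Psub \<kappa> X" for Y
      using es[OF that] PA[OF that] qPl[OF that] by (simp add: Psub_def)
    show "inj_on (\<lambda>Y. set_of (q ` P Y)) (Psub \<kappa> X)"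
    proof (rule inj_onI)
      fix Y Z assume YZ: "Y \<in> Psub \<kappa> X" "Z \<in> Psub \<kappa> X" "set_of (q ` P Y) = set_of (q ` P Z)"
      then have "q ` P Y = q ` P Z" using es by metis
      then have "P Y = P Z" using inj_on_image_eq_iff[OF q(1) Psub[OF YZ(1)] Psub[OF YZ(2)]] by blast
      then have "i ` elts Y = i ` elts Z" using dec YZ(1,2) by simp
      then have "elts Y = elts Z" using inj_on_image_eq_iff[OF i(1) YX[OF YZ(1)] YX[OF YZ(2)]] by blast
      then show "Y = Z" by (rule hset_ext)
    qed
  qed
qed

lemma VV_le: "Ord \<gamma> \<Longrightarrow> elts \<gamma> \<subseteq> elts \<kappa> \<Longrightarrow> |VV \<kappa> A \<gamma>| \<le>o |PP \<kappa> A|"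
proof (induction \<gamma> rule: hset_induct)
  case (1 \<gamma>)
  have e: "VV \<kappa> A \<gamma> = elts A \<union> (\<Union>\<delta>\<in>elts \<gamma>. Psub \<kappa> (VV \<kappa> A \<delta>))"
    by (rule set_eqI) (simp add: VV_iff[OF 1(2)])
  have "|\<Union>\<delta>\<in>elts \<gamma>. Psub \<kappa> (VV \<kappa> A \<delta>)| \<le>o |PP \<kappa> A|"
  proof (rule card_of_UNION_ordLeq_infinite[OF inf_PP])
    show "|elts \<gamma>| \<le>o |PP \<kappa> A|"
      by (rule ordLeq_transitive[OF card_of_mono1[OF 1(3)] ordLeq_transitive[OF k_le_A A_le_PP]])
    show "\<forall>\<delta>\<in>elts \<gamma>. |Psub \<kappa> (VV \<kappa> A \<delta>)| \<le>o |PP \<kappa> A|"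
    proof
      fix \<delta> assume d: "\<delta> \<in> elts \<gamma>"
      show "|Psub \<kappa> (VV \<kappa> A \<delta>)| \<le>o |PP \<kappa> A|"
        by (rule Psub_le[OF 1(1)[OF d Ord_elt[OF 1(2) d]]]) (use Ord_sub[OF 1(2) d] 1(3) in blast)
    qed
  qed
  then show ?case unfolding e
    by (rule card_Un_le[OF inf_PP A_le_PP])
qed

text \<open>The empty set is kept out of the range, as it serves as the colour for the absence of a
  difference in the Ramsey case of \<open>homogenize_coherent\<close>.\<close>

lemma ex_coding:
  obtains b where "inj_on b (WW \<kappa> A)" "b ` WW \<kappa> A \<subseteq> PP \<kappa> A - {zero}"
proof -
  have "|WW \<kappa> A| \<le>o |PP \<kappa> A|" by (rule VV_le[OF world_Ord[OF wrld]]) simp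
  moreover have "|PP \<kappa> A| \<le>o |PP \<kappa> A - {zero}|"
  proof -
    have "infinite (PP \<kappa> A - {zero})" using inf_PP by simp
    then have "PP \<kappa> A - {zero} \<noteq> {}" by (metis finite.emptyI)
    have "|(PP \<kappa> A - {zero}) \<union> {zero}| \<le>o |PP \<kappa> A - {zero}|"
      by (rule card_Un_le[OF \<open>infinite (PP \<kappa> A - {zero})\<close> ordIso_imp_ordLeq[OF card_of_refl] card_of_singl_ordLeq[OF \<open>PP \<kappa> A - {zero} \<noteq> {}\<close>]])
    moreover have "(PP \<kappa> A - {zero}) \<union> {zero} = PP \<kappa> A" using zero_PP by blast
    ultimately show ?thesis by simp
  qed
  ultimately have "|WW \<kappa> A| \<le>o |PP \<kappa> A - {zero}|" by (rule ordLeq_transitive)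
  then show thesis using card_of_ordLeq[of "WW \<kappa> A" "PP \<kappa> A - {zero}"] that by blast
qed

end

section \<open>Homogenization\<close>

context two_cardinal
begin

lemma good_above:
  assumes "good J" "H \<in> positive \<kappa> A J" "y \<in> PP \<kappa> A"
  shows "\<exists>x\<in>H. sq_less \<kappa> y x"
proof -
  have "H \<inter> {x. nice \<kappa> A x \<and> sq_less \<kappa> y x} \<in> positive \<kappa> A J" by (rule good_thick[OF assms(1,2) thick_above[OF assms(3)]])
  from good_ne[OF assms(1) this] show ?thesis by blast
qed

lemma sq_less_mono: "sq_less \<kappa> y x \<Longrightarrow> elts z \<subseteq> elts y \<Longrightarrow> sq_less \<kappa> z x"
  unfolding sq_less_def by (blast intro: ordLeq_ordLess_trans card_of_mono1)

lemma good_above2: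
  assumes "good J" "H \<in> positive \<kappa> A J" "x \<in> PP \<kappa> A" "y \<in> PP \<kappa> A"
  shows "\<exists>z\<in>H. sq_less \<kappa> x z \<and> sq_less \<kappa> y z"
proof -
  let ?u = "set_of (elts x \<union> elts y)"
  have l: "|elts x \<union> elts y| <o |elts \<kappa>|"
    by (rule card_of_Un_ordLess_infinite[OF inf_\<kappa>]) (use assms(3,4) in \<open>auto simp: Psub_def\<close>)
  have e: "elts ?u = elts x \<union> elts y" by (rule elts_set_of[OF less_small[OF l]])
  have "?u \<in> PP \<kappa> A" using e l assms(3,4) by (auto simp: Psub_def)
  then obtain z where z: "z \<in> H" "sq_less \<kappa> ?u z" using good_above[OF assms(1,2)] by blast
  have "sq_less \<kappa> x z" "sq_less \<kappa> y z" by (rule sq_less_mono[OF z(2)], simp add: e)+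
  then show ?thesis using z(1) by blast
qed

lemma sq_less_trans: "sq_less \<kappa> x y \<Longrightarrow> sq_less \<kappa> y z \<Longrightarrow> sq_less \<kappa> x z"
  by (erule sq_less_mono) (simp add: sq_less_def)

lemma MM_sq: "sq_less \<kappa> x y \<Longrightarrow> MM \<kappa> x \<subseteq> MM \<kappa> y"
  by (rule MM_mono) (simp add: sq_less_def)

lemma MM_W: "x \<in> PP \<kappa> A \<Longrightarrow> MM \<kappa> x \<subseteq> WW \<kappa> A"
  by (rule MM_sub_WW[OF Card])

text \<open>
  An injection of the whole structure into \<open>PP \<kappa> A\<close> turns subsets of \<open>MM \<kappa> x\<close> into list entries. For the
  Ramsey operator, colour a pair by an element on which \<open>T x\<close> and \<open>T y\<close> differ: along three increasing
  points a constant difference is impossible, as membership takes only two values.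
\<close>

lemma homogenize_coherent:
  assumes Op: "Op \<in> ops" and J: "good J" and S: "S \<in> positive \<kappa> A (Op \<kappa> A J)"
    and T: "\<And>x. x \<in> S \<Longrightarrow> T x \<subseteq> MM \<kappa> x"
  shows "\<exists>H. H \<subseteq> S \<and> H \<in> positive \<kappa> A J \<and> (\<forall>x\<in>H. nice \<kappa> A x) \<and>
    (\<forall>x\<in>H. \<forall>y\<in>H. sq_less \<kappa> x y \<longrightarrow> T x = T y \<inter> MM \<kappa> x)"
proof -
  obtain b where b: "inj_on b (WW \<kappa> A)" "b ` WW \<kappa> A \<subseteq> PP \<kappa> A - {zero}" by (rule ex_coding)
  \<comment> \<open>The inverse of \<open>b\<close> with a default value. Closure under
    \<open>b\<close> and \<open>b'\<close> makes \<open>v\<close> and \<open>b v\<close> visible at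
    the same points.\<close>
  define b' where "b' u = (if u \<in> b ` WW \<kappa> A then inv_into (WW \<kappa> A) b u else zero)" for u
  have SP: "S \<subseteq> PP \<kappa> A" using S by (simp add: positive_def)
  have bW: "b v \<in> WW \<kappa> A" if "v \<in> WW \<kappa> A" for v using b(2) WW_PP[OF wrld] that by blast
  have "closed_under b (WW \<kappa> A)" "closed_under b' (WW \<kappa> A)"
    using bW zero_W unfolding closed_under_def b'_def by (auto simp: inv_into_into)
  then have tB: "thick ({x. nice \<kappa> A x \<and> closed_under b (MM \<kappa> x)} \<inter> {x. nice \<kappa> A x \<and> closed_under b' (MM \<kappa> x)})"
    (is "thick ?B") by (intro thick_Int thick_closed)
  have bM: "b v \<in> MM \<kappa> x \<longleftrightarrow> v \<in> MM \<kappa> x" if "x \<in> ?B" "v \<in> WW \<kappa> A" for x v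
  proof
    assume "b v \<in> MM \<kappa> x"
    then have "b' (b v) \<in> MM \<kappa> x" using that(1) by (auto simp: closed_under_def)
    then show "v \<in> MM \<kappa> x" using that(2) b(1) by (simp add: b'_def)
  qed (use that(1) in \<open>auto simp: closed_under_def\<close>)
  have bP: "b v \<in> PP (kap \<kappa> x) x \<longleftrightarrow> v \<in> MM \<kappa> x" if "x \<in> ?B" "v \<in> WW \<kappa> A" for x v
  proof -
    have g: "gd \<kappa> A x" using that(1) by (simp add: nice_def)
    have "b v \<in> PP \<kappa> A" using b(2) that(2) by blast
    then show ?thesis using bM[OF that] MM_PP[OF wrld g] by blast
  qed
  have TW: "T x \<subseteq> WW \<kappa> A" if "x \<in> S" for x using T[OF that] MM_W that SP by blast
  consider "Op = ineff_op" | "Op = ramsey_op" using Op by blast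
  then show ?thesis
  proof cases
    case 1
    define L where "L x = (if x \<in> ?B then b ` T x else {})" for x
    have "L x \<subseteq> PP (kap \<kappa> x) x" if x: "x \<in> S" for x
    proof (cases "x \<in> ?B")
      case True
      have "b v \<in> PP (kap \<kappa> x) x" if "v \<in> T x" for v using bP[OF True, of v] T[OF x] TW[OF x] that by blast
      then show ?thesis using True by (auto simp: L_def)
    qed (auto simp: L_def)
    then have "is_list \<kappa> S L" by (simp add: is_list_def)
    then obtain H where H: "H \<in> positive \<kappa> A J" "H \<subseteq> S" "homogeneous_list \<kappa> L H"
      using S[unfolded 1 positive_ineff] by metis
    have "T x = T y \<inter> MM \<kappa> x" if xy: "x \<in> H \<inter> ?B" "y \<in> H \<inter> ?B" "sq_less \<kappa> x y" for x y
    proof -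
      have xS: "x \<in> S" "y \<in> S" and xB: "x \<in> ?B" "y \<in> ?B" using xy H(2) by blast+
      have "L x = L y \<inter> PP (kap \<kappa> x) x" using H(3) xy unfolding homogeneous_list_def by blast
      then have e: "b ` T x = b ` T y \<inter> PP (kap \<kappa> x) x" using xB unfolding L_def by (simp only: if_True)
      have "v \<in> T x \<longleftrightarrow> v \<in> T y \<and> v \<in> MM \<kappa> x" if v: "v \<in> WW \<kappa> A" for v
      proof -
        have "v \<in> T x \<longleftrightarrow> b v \<in> b ` T x" using inj_on_image_mem_iff[OF b(1) v TW[OF xS(1)]] by simp
        also have "\<dots> \<longleftrightarrow> b v \<in> b ` T y \<and> b v \<in> PP (kap \<kappa> x) x" unfolding e by simp
        also have "\<dots> \<longleftrightarrow> v \<in> T y \<and> v \<in> MM \<kappa> x"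
          using inj_on_image_mem_iff[OF b(1) v TW[OF xS(2)]] bP[OF xB(1) v] by simp
        finally show ?thesis .
      qed
      then show ?thesis using TW[OF xS(1)] TW[OF xS(2)] by blast
    qed
    moreover have "\<forall>x\<in>H \<inter> ?B. nice \<kappa> A x" by blast
    ultimately show ?thesis
      using good_thick[OF J H(1) tB] H(2) by (intro exI[of _ "H \<inter> ?B"]) blast
  next
    case 2
    define D where "D x y = {v \<in> MM \<kappa> x. v \<in> WW \<kappa> A \<and> (v \<in> T x) \<noteq> (v \<in> T y)}" for x y
    \<comment> \<open>All other tuples get the value \<open>zero\<close>, which is not a value of
      \<open>b\<close>, so homogeneity carries the presence of a difference from one pair to every
      other pair.\<close>
    define f where "f xs = (if length xs = 2 \<and> set xs \<subseteq> ?B \<and> D (xs ! 0) (xs ! 1) \<noteq> {} then b (SOME v. v \<in> D (xs ! 0) (xs ! 1)) else zero)" for xs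
    have "regressive \<kappa> A S f"
      unfolding regressive_def
    proof (intro allI impI ballI)
      fix m :: nat and xs assume m: "1 \<le> m" "xs \<in> tuples \<kappa> S m"
      show "f xs \<in> PP \<kappa> A \<and> (elts (hd xs) \<inter> elts \<kappa> \<noteq> {} \<longrightarrow> sq_less \<kappa> (f xs) (hd xs))"
      proof (cases "length xs = 2 \<and> set xs \<subseteq> ?B \<and> D (xs ! 0) (xs ! 1) \<noteq> {}")
        case True
        then obtain x y where xs: "xs = [x, y]" by (auto simp: length_Suc_conv numeral_2_eq_2)
        have ne: "D x y \<noteq> {}" and xB: "x \<in> ?B" using True xs by (auto simp del: mem_Collect_eq Int_iff)
        define v where "v = (SOME v. v \<in> D x y)"
        have v: "v \<in> D x y" unfolding v_def using ne some_in_eq by blast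
        have fv: "f xs = b v" using True xs unfolding f_def v_def by simp
        have "v \<in> WW \<kappa> A" "v \<in> MM \<kappa> x" using v by (auto simp: D_def)
        then have "b v \<in> PP \<kappa> A" "b v \<in> PP (kap \<kappa> x) x" using b(2) bP[OF xB] by blast+
        then show ?thesis using fv xs by (simp add: sq_less_iff)
      next
        case False
        then have "f xs = zero" unfolding f_def by (rule if_not_P)
        then show ?thesis using zero_PP zero_sq by simp
      qed
    qed
    then obtain H where H: "H \<in> positive \<kappa> A J" "H \<subseteq> S" "homogeneous_fun \<kappa> f H"
      using S[unfolded 2 positive_ramsey] by metis
    let ?H = "H \<inter> ?B"
    have HJ: "?H \<in> positive \<kappa> A J" by (rule good_thick[OF J H(1) tB])
    have HP: "?H \<subseteq> PP \<kappa> A" using H(2) SP by blast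
    have tup: "[x, y] \<in> tuples \<kappa> H 2" if "x \<in> ?H" "y \<in> ?H" "sq_less \<kappa> x y" for x y
      using that by (simp add: tuples_def)
    have fD: "f [x, y] = (if D x y \<noteq> {} then b (SOME v. v \<in> D x y) else zero)" if "x \<in> ?H" "y \<in> ?H" for x y
      using that unfolding f_def by auto
    have DW: "(SOME v. v \<in> D x y) \<in> D x y" if "D x y \<noteq> {}" for x y using that some_in_eq by blast
    have key: "D x y = {}" if xy: "x \<in> ?H" "y \<in> ?H" "sq_less \<kappa> x y" for x y
    proof (rule ccontr)
      assume ne: "D x y \<noteq> {}"
      define v where "v = (SOME v. v \<in> D x y)"
      have v: "v \<in> D x y" unfolding v_def by (rule DW[OF ne])
      have vW: "v \<in> WW \<kappa> A" using v by (simp add: D_def)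
      have fv: "f [x, y] = b v" using fD[OF xy(1,2)] ne by (simp add: v_def)
      have diff: "(v \<in> T x') \<noteq> (v \<in> T y')" if p: "x' \<in> ?H" "y' \<in> ?H" "sq_less \<kappa> x' y'" for x' y'
      proof -
        have "f [x', y'] = f [x, y]"
          using H(3) tup[OF p] tup[OF xy] unfolding homogeneous_fun_def by (metis one_le_numeral)
        then have e: "f [x', y'] = b v" using fv by simp
        have "b v \<noteq> zero" using b(2) vW by blast
        then have ne': "D x' y' \<noteq> {}" using e fD[OF p(1,2)] by metis
        define v' where "v' = (SOME v. v \<in> D x' y')"
        have v': "v' \<in> D x' y'" unfolding v'_def by (rule DW[OF ne'])
        have "b v' = b v" using e fD[OF p(1,2)] ne' by (simp add: v'_def)
        then have "v' = v" using b(1) vW v' unfolding inj_on_def D_def by blast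
        then show ?thesis using v' by (simp add: D_def)
      qed
      obtain z where z: "z \<in> ?H" "sq_less \<kappa> y z" using good_above[OF J HJ, of y] xy(2) HP by blast
      show False using diff[OF xy] diff[OF xy(2) z] diff[OF xy(1) z(1) sq_less_trans[OF xy(3) z(2)]] by blast
    qed
    have "T x = T y \<inter> MM \<kappa> x" if xy: "x \<in> ?H" "y \<in> ?H" "sq_less \<kappa> x y" for x y
    proof -
      have "x \<in> S" "y \<in> S" using xy H(2) by blast+
      then show ?thesis using key[OF xy] T[of x] TW[of x] TW[of y] unfolding D_def by blast
    qed
    moreover have "\<forall>x\<in>?H. nice \<kappa> A x" by blast
    ultimately show ?thesis using HJ H(2) by (intro exI[of _ ?H]) blast
  qed
qed

text \<open>Any two points of \<open>H\<close> have a common upper bound in \<open>H\<close>. An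
  element contributed to the union by \<open>T y\<close> is therefore compared with
  \<open>T x\<close> at a point above both, where coherence applies twice.\<close>

proposition homogenize:
  assumes Op: "Op \<in> ops" and J: "good J" and S: "S \<in> positive \<kappa> A (Op \<kappa> A J)"
    and T: "\<And>x. x \<in> S \<Longrightarrow> T x \<subseteq> MM \<kappa> x"
  obtains H T' where "H \<subseteq> S" "H \<in> positive \<kappa> A J" "\<And>x. x \<in> H \<Longrightarrow> nice \<kappa> A x"
    "T' \<subseteq> WW \<kappa> A" "\<And>x. x \<in> H \<Longrightarrow> T x = T' \<inter> MM \<kappa> x" "T' = (\<Union>x\<in>H. T x)"
proof -
  obtain H where H: "H \<subseteq> S" "H \<in> positive \<kappa> A J" "\<forall>x\<in>H. nice \<kappa> A x"
    "\<And>x y. x \<in> H \<Longrightarrow> y \<in> H \<Longrightarrow> sq_less \<kappa> x y \<Longrightarrow> T x = T y \<inter> MM \<kappa> x"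
    using homogenize_coherent[OF assms] by blast
  have SP: "S \<subseteq> PP \<kappa> A" using S by (simp add: positive_def)
  have HP: "x \<in> PP \<kappa> A" if "x \<in> H" for x using that H(1) SP by blast
  define T' where "T' = (\<Union>x\<in>H. T x)"
  have T'W: "T' \<subseteq> WW \<kappa> A" unfolding T'_def
  proof (rule UN_least)
    fix x assume x: "x \<in> H"
    then show "T x \<subseteq> WW \<kappa> A" using T[of x] MM_W[OF HP[OF x]] H(1) by blast
  qed
  have T'x: "T x = T' \<inter> MM \<kappa> x" if x: "x \<in> H" for x
  proof
    show "T x \<subseteq> T' \<inter> MM \<kappa> x" using x T[of x] H(1) unfolding T'_def by blast
    show "T' \<inter> MM \<kappa> x \<subseteq> T x"
    proof
      fix v assume v: "v \<in> T' \<inter> MM \<kappa> x"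
      then obtain y where y: "y \<in> H" "v \<in> T y" unfolding T'_def by blast
      obtain z where z: "z \<in> H" "sq_less \<kappa> x z" "sq_less \<kappa> y z"
        using good_above2[OF J H(2) HP[OF x] HP[OF y(1)]] by blast
      have "v \<in> T z" using H(4)[OF y(1) z(1,3)] y(2) by blast
      then show "v \<in> T x" using H(4)[OF x z(1,2)] v by blast
    qed
  qed
  show thesis by (rule that[of H T', OF H(1,2) bspec[OF H(3)] T'W T'x T'_def])
qed

end

section \<open>Canonical functions\<close>

lemma Restr_ord_rel: "Ord \<beta> \<Longrightarrow> \<delta> \<in> elts \<beta> \<Longrightarrow> Restr (ord_rel \<beta>) (underS (ord_rel \<beta>) \<delta>) = ord_rel \<delta>"
  using underS_ord_rel[of \<beta> \<delta>] Ord_sub[of \<beta> \<delta>] unfolding ord_rel_def by auto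

lemma ord_rel_less: "Ord \<beta> \<Longrightarrow> \<delta> \<in> elts \<beta> \<Longrightarrow> ord_rel \<delta> <o ord_rel \<beta>"
proof -
  assume h: "Ord \<beta>" "\<delta> \<in> elts \<beta>"
  note w = Well_order_ord_rel[OF Ord_elt[OF h]]
  have "\<exists>a\<in>Field (ord_rel \<beta>). ord_rel \<delta> =o Restr (ord_rel \<beta>) (underS (ord_rel \<beta>) a)"
    by (rule bexI[of _ \<delta>]) (simp_all add: Restr_ord_rel[OF h] ordIso_reflexive[OF w] Field_ord_rel h)
  then show ?thesis using ordLess_iff_ordIso_Restr[OF Well_order_ord_rel[OF h(1)] w] by blast
qed

section \<open>Ranks in a well-founded relation\<close>

lemma rank_ord_facts:
  assumes "infinite (UNIV :: 'a set)"
  shows "Well_order (rank_ord :: 'a set rel)" "wo_rel (rank_ord :: 'a set rel)"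
    "Card_order (rank_ord :: 'a set rel)" "infinite (Field (rank_ord :: 'a set rel))" "regularCard (rank_ord :: 'a set rel)"
proof -
  let ?r = "|UNIV :: 'a set|"
  show c: "Card_order (rank_ord :: 'a set rel)" by (rule cardSuc_Card_order[OF card_of_Card_order])
  then show w: "Well_order (rank_ord :: 'a set rel)" by (rule card_order_on_well_order_on)
  then show "wo_rel (rank_ord :: 'a set rel)" by (simp add: wo_rel_def)
  show "infinite (Field (rank_ord :: 'a set rel))"
    using cardSuc_finite[OF card_of_Card_order, of "UNIV :: 'a set"] assms by (simp add: Field_card_of)
  show "regularCard (rank_ord :: 'a set rel)"
    by (rule infinite_cardSuc_regularCard) (use assms in \<open>simp_all add: Field_card_of card_of_card_order_on\<close>)
qed

text \<open>A successor cardinal is regular, so the ranks of the predecessors of a point are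
  bounded, and the least strict upper bound in the definition of \<open>rank\<close> exists.\<close>

lemma AboveS_ne:
  assumes inf: "infinite (UNIV :: 'a set)" and B: "B \<subseteq> Field (rank_ord :: 'a set rel)" "|B| \<le>o |UNIV :: 'a set|"
  shows "AboveS rank_ord B \<noteq> {}"
proof -
  let ?K = "rank_ord :: 'a set rel"
  note F = rank_ord_facts[OF inf]
  have "|B| <o ?K" by (rule ordLeq_ordLess_trans[OF B(2) cardSuc_greater[OF card_of_Card_order]])
  then have "\<not> |B| =o ?K" using not_ordLess_ordIso by blast
  then have "\<not> cofinal B ?K" using F(5) B(1) unfolding regularCard_def by blast
  then obtain a where a: "a \<in> Field ?K" "\<And>b. b \<in> B \<Longrightarrow> a = b \<or> (a, b) \<notin> ?K" unfolding cofinal_def by blast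
  obtain a' where a': "a' \<in> Field ?K" "a \<noteq> a'" "(a, a') \<in> ?K" using infinite_Card_order_limit[OF F(3,4) a(1)] by blast
  have "b \<noteq> a' \<and> (b, a') \<in> ?K" if b: "b \<in> B" for b
  proof -
    have "b \<in> Field ?K" using b B(1) by blast
    then have ba: "(b, a) \<in> ?K"
      using a(2)[OF b] wo_rel.TOTALS[OF F(2)] wo_rel.REFL[OF F(2)] a(1) unfolding refl_on_def by metis
    have "(b, a') \<in> ?K" using wo_rel.TRANS[OF F(2)] ba a'(3) by (rule transD)
    moreover have "b \<noteq> a'" using ba a'(2,3) wo_rel.ANTISYM[OF F(2)] unfolding antisym_def by blast
    ultimately show ?thesis by blast
  qed
  then show ?thesis unfolding AboveS_def using a'(1) by blast
qed

context
  fixes r :: "'a rel"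
  assumes inf: "infinite (UNIV :: 'a set)" and wf: "wf r"
begin

abbreviation "K \<equiv> rank_ord :: 'a set rel"

lemmas KF = rank_ord_facts[OF inf]

lemma rank_eq: "rank r x = wo_rel.suc K (rank r ` {y. (y, x) \<in> r})"
proof -
  have "rank r x = wo_rel.suc K (cut (rank r) r x ` {y. (y, x) \<in> r})"
    unfolding rank_def by (subst wfrec[OF wf]) simp
  also have "cut (rank r) r x ` {y. (y, x) \<in> r} = rank r ` {y. (y, x) \<in> r}"
    by (rule image_cong) (auto simp: cut_def)
  finally show ?thesis .
qed

lemma rank_Field: "rank r x \<in> Field K"
  using wf
proof (induction x rule: wf_induct_rule)
  case (less x)
  have B: "rank r ` {y. (y, x) \<in> r} \<subseteq> Field K" using less by blast
  have "|rank r ` {y. (y, x) \<in> r}| \<le>o |UNIV :: 'a set|"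
    by (rule ordLeq_transitive[OF card_of_image card_of_mono1]) simp
  from wo_rel.suc_inField[OF KF(2) B AboveS_ne[OF inf B this]] show ?case by (subst rank_eq)
qed

lemma rank_less: "(y, x) \<in> r \<Longrightarrow> rank r y \<in> underS K (rank r x)"
proof -
  assume yx: "(y, x) \<in> r"
  have B: "rank r ` {y. (y, x) \<in> r} \<subseteq> Field K" using rank_Field by blast
  have l: "|rank r ` {y. (y, x) \<in> r}| \<le>o |UNIV :: 'a set|"
    by (rule ordLeq_transitive[OF card_of_image card_of_mono1]) simp
  have "wo_rel.suc K (rank r ` {y. (y, x) \<in> r}) \<noteq> rank r y \<and> (rank r y, wo_rel.suc K (rank r ` {y. (y, x) \<in> r})) \<in> K"
    by (rule wo_rel.suc_greater[OF KF(2) B AboveS_ne[OF inf B l]]) (use yx in blast)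
  then show ?thesis unfolding underS_def rank_eq[of x, symmetric] by auto
qed

lemma K_total: "a \<in> Field K \<Longrightarrow> b \<in> Field K \<Longrightarrow> a \<in> underS K b \<or> (b, a) \<in> K"
  using wo_rel.TOTALS[OF KF(2)] wo_rel.REFL[OF KF(2)] unfolding underS_def refl_on_def by blast

lemma K_antisym: "a \<in> underS K b \<Longrightarrow> (b, a) \<notin> K"
  using wo_rel.ANTISYM[OF KF(2)] unfolding underS_def antisym_def by blast

lemma K_trans1: "(a, b) \<in> K \<Longrightarrow> b \<in> underS K c \<Longrightarrow> a \<in> underS K c"
proof -
  assume h: "(a, b) \<in> K" "b \<in> underS K c"
  have "(a, c) \<in> K" using wo_rel.TRANS[OF KF(2)] h unfolding underS_def trans_def by blast
  moreover have "a \<noteq> c" using K_antisym[OF h(2)] h(1) by blast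
  ultimately show ?thesis by (simp add: underS_def)
qed

text \<open>Otherwise \<open>b\<close> would be a strict upper bound of the ranks of all
  predecessors of \<open>x\<close>, below the least such bound.\<close>

lemma rank_attained:
  assumes "b \<in> underS K (rank r x)" shows "\<exists>y. (y, x) \<in> r \<and> (b, rank r y) \<in> K"
proof (rule ccontr)
  assume n: "\<nexists>y. (y, x) \<in> r \<and> (b, rank r y) \<in> K"
  have b: "b \<in> Field K" using assms unfolding underS_def Field_def by blast
  have "rank r y \<in> underS K b" if "(y, x) \<in> r" for y
    using K_total[OF rank_Field[of y] b] n that by blast
  then have "b \<in> AboveS K (rank r ` {y. (y, x) \<in> r})" using b unfolding AboveS_def underS_def by auto
  then have "(rank r x, b) \<in> K" unfolding rank_eq[of x] by (rule wo_rel.suc_least_AboveS[OF KF(2)])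
  then show False using K_antisym[OF assms] by blast
qed

lemma seg_less: "a \<in> underS K b \<Longrightarrow> Restr K (underS K a) <o Restr K (underS K b)"
proof -
  assume a: "a \<in> underS K b"
  have "underS K a \<subseteq> underS K b" using K_trans1[OF _ a] by (auto simp: underS_def)
  moreover have "a \<notin> underS K a" by (simp add: underS_def)
  ultimately have "underS K a < underS K b" using a by blast
  then show ?thesis
    using ofilter_subset_ordLess[OF KF(1) wo_rel.underS_ofilter[OF KF(2)] wo_rel.underS_ofilter[OF KF(2)]] by blast
qed

lemma has_rank_less:
  assumes "has_rank r x \<delta>" "has_rank r y \<beta>" "\<delta> \<in> elts \<beta>"
  shows "rank r x \<in> underS K (rank r y)"
proof (rule ccontr)
  assume "rank r x \<notin> underS K (rank r y)"
  then have "(rank r y, rank r x) \<in> K" using K_total[OF rank_Field rank_Field] by blast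
  then have "underS K (rank r y) \<subseteq> underS K (rank r x)"
    using wo_rel.TRANS[OF KF(2)] wo_rel.ANTISYM[OF KF(2)] unfolding underS_def trans_def antisym_def by blast
  then have l: "Restr K (underS K (rank r y)) \<le>o Restr K (underS K (rank r x))"
    using ofilter_subset_ordLeq[OF KF(1) wo_rel.underS_ofilter[OF KF(2)] wo_rel.underS_ofilter[OF KF(2)]] by blast
  have xy: "Restr K (underS K (rank r x)) =o ord_rel \<delta>" "Restr K (underS K (rank r y)) =o ord_rel \<beta>" "Ord \<beta>"
    using assms by (auto simp: has_rank_def)
  have "ord_rel \<beta> \<le>o ord_rel \<delta>"
    by (rule ordIso_ordLeq_trans[OF ordIso_symmetric[OF xy(2)] ordLeq_ordIso_trans[OF l xy(1)]])
  then show False using ord_rel_less[OF xy(3) assms(3)] not_ordLess_ordLeq by blast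
qed

text \<open>A rank of \<open>z\<close> below that of \<open>y\<close> would have some order type
  \<delta> in \<beta>, but \<open>z\<close> has a larger rank than \<open>F \<delta>\<close>. In
  this way competitors in the definition of \<open>canonical\<close> are shown to have sufficiently
  large rank.\<close>

lemma has_rank_le:
  assumes y: "has_rank r y \<beta>" and F: "\<And>\<delta>. \<delta> \<in> elts \<beta> \<Longrightarrow> has_rank r (F \<delta>) \<delta>"
    and z: "\<And>\<delta>. \<delta> \<in> elts \<beta> \<Longrightarrow> rank r (F \<delta>) \<in> underS K (rank r z)"
  shows "(rank r y, rank r z) \<in> K"
proof (rule ccontr)
  assume "(rank r y, rank r z) \<notin> K"
  then have zy: "rank r z \<in> underS K (rank r y)" using K_total[OF rank_Field rank_Field] by blast
  have yb: "Restr K (underS K (rank r y)) =o ord_rel \<beta>" and O: "Ord \<beta>" using y by (auto simp: has_rank_def)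
  have "Restr K (underS K (rank r z)) <o ord_rel \<beta>" by (rule ordLess_ordIso_trans[OF seg_less[OF zy] yb])
  then obtain \<delta> where d: "\<delta> \<in> elts \<beta>" "Restr K (underS K (rank r z)) =o ord_rel \<delta>"
    using ordLess_iff_ordIso_Restr[OF Well_order_ord_rel[OF O] Well_order_Restr[OF KF(1)]] Restr_ord_rel[OF O]
    unfolding Field_ord_rel by metis
  have "Restr K (underS K (rank r (F \<delta>))) =o ord_rel \<delta>" using F[OF d(1)] by (simp add: has_rank_def)
  then have "Restr K (underS K (rank r z)) =o Restr K (underS K (rank r (F \<delta>)))"
    by (rule ordIso_transitive[OF d(2) ordIso_symmetric])
  then show False using seg_less[OF z[OF d(1)]] not_ordLess_ordIso ordIso_symmetric by blast
qed

end

lemma Ord_UN: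
  assumes "\<And>a. a \<in> I \<Longrightarrow> Ord (o' a)" "elts z = (\<Union>a\<in>I. elts (o' a))"
  shows "Ord z"
  unfolding Ord_def
proof (intro conjI ballI)
  fix b assume "b \<in> elts z"
  then obtain a where a: "a \<in> I" "b \<in> elts (o' a)" using assms(2) by blast
  show "elts b \<subseteq> elts z" using Ord_sub[OF assms(1)[OF a(1)] a(2)] a(1) assms(2) by blast
  fix c assume "c \<in> elts b"
  then show "elts c \<subseteq> elts b" by (rule Ord_sub[OF Ord_elt[OF assms(1)[OF a(1)] a(2)]])
qed

lemma infinite_hset_fun: "infinite (UNIV :: ('k hset \<Rightarrow> 'k hset) set)"
proof
  assume "finite (UNIV :: ('k hset \<Rightarrow> 'k hset) set)"
  then have "finite (range (\<lambda>n (_ :: 'k hset). (succ ^^ n) (zero :: 'k hset)))"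
    by (rule finite_subset[rotated]) simp
  moreover have "inj (\<lambda>n (_ :: 'k hset). (succ ^^ n) (zero :: 'k hset))"
    by (auto simp: inj_def fun_eq_iff succn_inject)
  ultimately have "finite (UNIV :: nat set)" by (rule finite_imageD)
  then show False by simp
qed

section \<open>The order of functions on \<open>PP \<kappa> A\<close>\<close>

context two_cardinal
begin

text \<open>A descending sequence of functions descends pointwise on countably many clubs. At a
  point common to all of them, its values form an infinite descending membership chain.\<close>

lemma wf_fun_less:
  assumes S: "S \<subseteq> PP \<kappa> A" "indescribable \<xi> \<kappa> A S"
  shows "wf (fun_less \<kappa> A)"
  unfolding wf_iff_no_infinite_down_chain
proof
  assume "\<exists>f. \<forall>i. (f (Suc i), f i) \<in> fun_less \<kappa> A"
  then obtain f where f: "\<forall>i. (f (Suc i), f i) \<in> fun_less \<kappa> A" by blast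
  then have "\<forall>i. \<exists>C. club \<kappa> A C \<and> C \<subseteq> {x \<in> PP \<kappa> A. f (Suc i) x \<in> elts (f i x)}" by (simp add: fun_less_def)
  from choice[OF this] obtain C where C: "\<forall>i. club \<kappa> A (C i) \<and> C i \<subseteq> {x \<in> PP \<kappa> A. f (Suc i) x \<in> elts (f i x)}" ..
  then obtain x where x: "\<forall>n. x \<in> C n" using clubs_meet[OF _ S, of C] by blast
  then have "\<forall>i. (f (Suc i) x, f i x) \<in> {(a, b). a \<in> elts b}" using C by blast
  then have "\<exists>g. \<forall>i. (g (Suc i), g i) \<in> {(a, b :: 'k hset). a \<in> elts b}" by (intro exI[of _ "\<lambda>i. f i x"]) simp
  then show False by (rule wf_elts[unfolded wf_iff_no_infinite_down_chain, THEN notE])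
qed

lemma fun_less_thick: "(f, g) \<in> fun_less \<kappa> A \<Longrightarrow> thick {x. f x \<in> elts (g x)}"
  unfolding fun_less_def by (auto intro: thick_mono[OF thick_club])

lemma fun_le_thick: "(f, g) \<in> fun_le \<kappa> A \<Longrightarrow> thick {x. elts (f x) \<subseteq> elts (g x)}"
  unfolding fun_le_def by (auto intro: thick_mono[OF thick_club])

lemma club_above:
  assumes "a \<in> elts A" shows "club \<kappa> A {x \<in> PP \<kappa> A. a \<in> elts x}"
  unfolding club_def
proof (intro conjI ballI allI impI)
  fix y assume y: "y \<in> PP \<kappa> A"
  have l: "|{a} \<union> elts y| <o |elts \<kappa>|"
    by (rule card_of_Un_ordLess_infinite[OF inf_\<kappa> finite_less]) (use y in \<open>auto simp: Psub_def\<close>)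
  have e: "elts (set_of ({a} \<union> elts y)) = {a} \<union> elts y" by (rule elts_set_of[OF less_small[OF l]])
  show "\<exists>x\<in>{x \<in> PP \<kappa> A. a \<in> elts x}. elts y \<subseteq> elts x"
    by (rule bexI[of _ "set_of ({a} \<union> elts y)"]) (use e l y assms in \<open>auto simp: Psub_def\<close>)
next
  fix \<delta> s assume d: "\<delta> \<in> elts \<kappa>"
    and h: "elts \<delta> \<noteq> {} \<and> (\<forall>i\<in>elts \<delta>. s i \<in> {x \<in> PP \<kappa> A. a \<in> elts x}) \<and>
       (\<forall>j\<in>elts \<delta>. \<forall>i\<in>elts j. elts (s i) \<subseteq> elts (s j))"
  have l: "|\<Union>i\<in>elts \<delta>. elts (s i)| <o |elts \<kappa>|"
    by (rule UN_less[OF Cardinal_lessI[OF Card d]]) (use h in \<open>auto simp: Psub_def\<close>)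
  have e: "elts (set_of (\<Union>i\<in>elts \<delta>. elts (s i))) = (\<Union>i\<in>elts \<delta>. elts (s i))" by (rule elts_set_of[OF less_small[OF l]])
  show "set_of (\<Union>i\<in>elts \<delta>. elts (s i)) \<in> {x \<in> PP \<kappa> A. a \<in> elts x}"
    using h l by (auto simp: Psub_def e)
qed auto

end

text \<open>The set \<open>S\<^sub>0\<close> is the indescribable set that makes the order of
  functions well-founded; in the end it is \<open>PP \<kappa> A\<close>.\<close>

locale canonical_two_cardinal = two_cardinal \<kappa> A \<xi> for \<kappa> A \<xi> :: "'k hset" +
  fixes f S\<^sub>0
  assumes can: "canonical_sequence \<kappa> A f" and S\<^sub>0: "S\<^sub>0 \<subseteq> PP \<kappa> A" "indescribable \<xi> \<kappa> A S\<^sub>0"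
begin

lemma wfl: "wf (fun_less \<kappa> A)" by (rule wf_fun_less[OF S\<^sub>0])

lemmas ranks = infinite_hset_fun wfl

lemma canD:
  assumes "lt_card_suc \<beta> A"
  shows "has_rank (fun_less \<kappa> A) (f \<beta>) \<beta>" "ord_valued \<kappa> A (f \<beta>)"
    "ord_valued \<kappa> A g \<Longrightarrow> (rank (fun_less \<kappa> A) (f \<beta>), rank (fun_less \<kappa> A) g) \<in> rank_ord \<Longrightarrow> (f \<beta>, g) \<in> fun_le \<kappa> A"
  using can assms unfolding canonical_sequence_def canonical_def by blast+

lemma lt_Ord: "lt_card_suc \<beta> A \<Longrightarrow> Ord \<beta>" by (simp add: lt_card_suc_def)

lemma lt_sub:
  assumes "lt_card_suc \<beta> A" "\<delta> \<in> elts \<beta>" shows "lt_card_suc \<delta> A"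
  using ordLess_transitive[OF ord_rel_less[OF lt_Ord[OF assms(1)] assms(2)]] assms Ord_elt[OF lt_Ord[OF assms(1)] assms(2)]
  unfolding lt_card_suc_def by blast

lemma can_zero:
  assumes "lt_card_suc zero A" shows "thick {x. f zero x = zero}"
proof -
  have "(rank (fun_less \<kappa> A) (f zero), rank (fun_less \<kappa> A) (\<lambda>_. zero)) \<in> rank_ord"
    by (rule has_rank_le[OF ranks canD(1)[OF assms]]) auto
  then have "(f zero, \<lambda>_. zero) \<in> fun_le \<kappa> A" by (intro canD(3)[OF assms]) (simp add: ord_valued_def)
  from fun_le_thick[OF this] show ?thesis by (rule thick_mono) (auto intro: eq_zero)
qed

text \<open>By the definition of rank, some \<open>h\<close> strictly below \<open>f \<beta>\<close>
  has rank at least \<delta>. Canonicity of \<open>f \<delta>\<close> gives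
  \<open>f \<delta> \<le> h\<close>, which combines with \<open>h < f \<beta>\<close>.\<close>

lemma can_less:
  assumes b: "lt_card_suc \<beta> A" and d: "\<delta> \<in> elts \<beta>"
  shows "thick {x. f \<delta> x \<in> elts (f \<beta> x) \<and> Ord (f \<beta> x)}"
proof -
  note d' = lt_sub[OF b d]
  have "rank (fun_less \<kappa> A) (f \<delta>) \<in> underS rank_ord (rank (fun_less \<kappa> A) (f \<beta>))"
    by (rule has_rank_less[OF ranks canD(1)[OF d'] canD(1)[OF b] d])
  from rank_attained[OF ranks this] obtain h where h: "(h, f \<beta>) \<in> fun_less \<kappa> A"
    "(rank (fun_less \<kappa> A) (f \<delta>), rank (fun_less \<kappa> A) h) \<in> rank_ord" by blast
  have "ord_valued \<kappa> A h" using h(1) by (simp add: fun_less_def)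
  then have "(f \<delta>, h) \<in> fun_le \<kappa> A" by (rule canD(3)[OF d' _ h(2)])
  then have t: "thick ({x. elts (f \<delta> x) \<subseteq> elts (h x)} \<inter> {x. h x \<in> elts (f \<beta> x)} \<inter> {x. nice \<kappa> A x})"
    by (intro thick_Int fun_le_thick fun_less_thick[OF h(1)] thick_nice)
  show ?thesis
  proof (rule thick_mono[OF t], intro subsetI)
    fix x assume x: "x \<in> {x. elts (f \<delta> x) \<subseteq> elts (h x)} \<inter> {x. h x \<in> elts (f \<beta> x)} \<inter> {x. nice \<kappa> A x}"
    then have xP: "x \<in> PP \<kappa> A" by (simp add: nice_def gd_def)
    have O: "Ord (f \<beta> x)" "Ord (f \<delta> x)" "Ord (h x)"
      using canD(2)[OF b] canD(2)[OF d'] \<open>ord_valued \<kappa> A h\<close> xP by (auto simp: ord_valued_def)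
    have "f \<delta> x \<in> elts (h x) \<or> f \<delta> x = h x" using Ord_subset_iff[OF O(2,3)] x by blast
    moreover have "h x \<in> elts (f \<beta> x)" using x by simp
    ultimately have "f \<delta> x \<in> elts (f \<beta> x)" using Ord_trans[OF O(1), of "f \<delta> x" "h x"] by auto
    then show "x \<in> {x. f \<delta> x \<in> elts (f \<beta> x) \<and> Ord (f \<beta> x)}" using O(1) by blast
  qed
qed

lemma fun_lessI:
  assumes "ord_valued \<kappa> A h" "ord_valued \<kappa> A g" "a \<in> elts A" "\<And>x. x \<in> PP \<kappa> A \<Longrightarrow> a \<in> elts x \<Longrightarrow> h x \<in> elts (g x)"
  shows "(h, g) \<in> fun_less \<kappa> A"
  unfolding fun_less_def using assms club_above[OF assms(3)] by blast

text \<open>The pointwise successor of \<open>f \<delta>\<close> is strictly above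
  \<open>f \<delta>\<close> and thus has rank at least \<delta> + 1, so canonicity of
  \<open>f (succ \<delta>)\<close> gives one inequality. The other one is
  \<open>can_less\<close>.\<close>

lemma can_succ:
  assumes b: "lt_card_suc (succ \<delta>) A"
  shows "thick {x. f (succ \<delta>) x = succ (f \<delta> x)}"
proof -
  have ds: "\<delta> \<in> elts (succ \<delta>)" by (simp add: elts_succ)
  note d = lt_sub[OF b ds]
  let ?g = "\<lambda>x. succ (f \<delta> x)"
  have og: "ord_valued \<kappa> A ?g" using canD(2)[OF d] by (simp add: ord_valued_def)
  obtain a where a: "a \<in> elts A" using inf_A by (metis finite.emptyI ex_in_conv)
  have "(f \<delta>, ?g) \<in> fun_less \<kappa> A" by (rule fun_lessI[OF canD(2)[OF d] og a]) (simp add: elts_succ)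
  then have l: "rank (fun_less \<kappa> A) (f \<delta>) \<in> underS rank_ord (rank (fun_less \<kappa> A) ?g)" by (rule rank_less[OF ranks])
  have "(rank (fun_less \<kappa> A) (f (succ \<delta>)), rank (fun_less \<kappa> A) ?g) \<in> rank_ord"
  proof (rule has_rank_le[OF ranks canD(1)[OF b], of f])
    fix \<epsilon> assume e: "\<epsilon> \<in> elts (succ \<delta>)"
    show he: "has_rank (fun_less \<kappa> A) (f \<epsilon>) \<epsilon>" by (rule canD(1)[OF lt_sub[OF b e]])
    show "rank (fun_less \<kappa> A) (f \<epsilon>) \<in> underS rank_ord (rank (fun_less \<kappa> A) ?g)"
    proof (cases "\<epsilon> = \<delta>")
      case False
      then have "\<epsilon> \<in> elts \<delta>" using e by (simp add: elts_succ)
      then have "rank (fun_less \<kappa> A) (f \<epsilon>) \<in> underS rank_ord (rank (fun_less \<kappa> A) (f \<delta>))"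
        by (rule has_rank_less[OF ranks he canD(1)[OF d]])
      then show ?thesis by (intro K_trans1[OF ranks _ l]) (simp add: underS_def)
    qed (simp add: l)
  qed
  then have "(f (succ \<delta>), ?g) \<in> fun_le \<kappa> A" by (rule canD(3)[OF b og])
  from thick_Int[OF fun_le_thick[OF this] can_less[OF b ds]] show ?thesis
  proof (rule thick_mono, intro subsetI)
    fix x assume x: "x \<in> {x. elts (f (succ \<delta>) x) \<subseteq> elts (succ (f \<delta> x))} \<inter> {x. f \<delta> x \<in> elts (f (succ \<delta>) x) \<and> Ord (f (succ \<delta>) x)}"
    then have "elts (f \<delta> x) \<subseteq> elts (f (succ \<delta>) x)" using Ord_sub by blast
    then have "elts (f (succ \<delta>) x) = elts (succ (f \<delta> x))" using x by (auto simp: elts_succ)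
    then show "x \<in> {x. f (succ \<delta>) x = succ (f \<delta> x)}" using hset_ext by blast
  qed
qed

lemma can_limit:
  assumes b: "lt_card_suc \<beta> A" and e: "e ` elts A = elts \<beta>"
  shows "thick {x. elts (f \<beta> x) \<subseteq> (\<Union>a\<in>elts x. elts (succ (f (e a) x)))}"
proof -
  let ?g = "\<lambda>x. set_of (\<Union>a\<in>elts x. elts (succ (f (e a) x)))"
  have eg: "elts (?g x) = (\<Union>a\<in>elts x. elts (succ (f (e a) x)))" for x
    by (rule elts_set_of) (rule small_UN[OF small_elts small_elts])
  have ltx: "lt_card_suc (e a) A" if "a \<in> elts A" for a using lt_sub[OF b] e that by blast
  have og: "ord_valued \<kappa> A ?g"
    unfolding ord_valued_def
  proof
    fix x assume x: "x \<in> PP \<kappa> A"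
    have "Ord (succ (f (e a) x))" if "a \<in> elts x" for a
    proof -
      have "a \<in> elts A" using x that by (auto simp: Psub_def)
      from canD(2)[OF ltx[OF this]] show ?thesis using x by (simp add: ord_valued_def)
    qed
    then show "Ord (?g x)" by (rule Ord_UN[OF _ eg])
  qed
  have "(rank (fun_less \<kappa> A) (f \<beta>), rank (fun_less \<kappa> A) ?g) \<in> rank_ord"
  proof (rule has_rank_le[OF ranks canD(1)[OF b], of f])
    fix \<delta> assume d: "\<delta> \<in> elts \<beta>"
    note ld = lt_sub[OF b d]
    show he: "has_rank (fun_less \<kappa> A) (f \<delta>) \<delta>" by (rule canD(1)[OF ld])
    obtain a where a: "a \<in> elts A" "\<delta> = e a" using d e by blast
    \<comment> \<open>The inequality holds at every \<open>x\<close> containing the element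
      \<open>a\<close> that \<open>e\<close> sends to \<delta>, and these points form a
      club.\<close>
    have "(f \<delta>, ?g) \<in> fun_less \<kappa> A"
      by (rule fun_lessI[OF canD(2)[OF ld] og a(1)]) (unfold eg, use a(2) in \<open>auto simp: elts_succ\<close>)
    then show "rank (fun_less \<kappa> A) (f \<delta>) \<in> underS rank_ord (rank (fun_less \<kappa> A) ?g)" by (rule rank_less[OF ranks])
  qed
  then have "(f \<beta>, ?g) \<in> fun_le \<kappa> A" by (rule canD(3)[OF b og])
  from fun_le_thick[OF this] show ?thesis unfolding eg .
qed

end

section \<open>The base case\<close>

lemma card_Pow_mono:
  assumes "|X| \<le>o |Y|" shows "|Pow X| \<le>o |Pow Y|"
proof -
  obtain f where f: "inj_on f X" "f ` X \<subseteq> Y" using assms card_of_ordLeq[of X Y] by blast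
  show ?thesis
    by (rule card_of_ordLeqI[of "image f"]) (use inj_on_image_Pow[OF f(1)] f(2) in auto)
qed

lemma card_Times_le:
  "infinite C \<Longrightarrow> |A| \<le>o |C| \<Longrightarrow> |B| \<le>o |C| \<Longrightarrow> |A \<times> B| \<le>o |C|"
  by (rule card_of_Times_ordLeq_infinite_Field[of "|C|"]) (simp_all add: Field_card_of card_of_card_order_on)

primrec enc :: "fo \<Rightarrow> nat" where
  "enc (Mem i j) = prod_encode (0, prod_encode (i, j))"
| "enc (Eq i j) = prod_encode (1, prod_encode (i, j))"
| "enc (Pred i) = prod_encode (2, i)"
| "enc (In i j) = prod_encode (3, prod_encode (i, j))"
| "enc (Neg \<phi>) = prod_encode (4, enc \<phi>)"
| "enc (And \<phi> \<psi>) = prod_encode (5, prod_encode (enc \<phi>, enc \<psi>))"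
| "enc (All i \<phi>) = prod_encode (6, prod_encode (i, enc \<phi>))"

lemma enc_inject: "enc \<phi> = enc \<psi> \<longleftrightarrow> \<phi> = \<psi>"
proof (induction \<phi> arbitrary: \<psi>)
  case (Mem i j) show ?case by (cases \<psi>) auto
next
  case (Eq i j) show ?case by (cases \<psi>) auto
next
  case (Pred i) show ?case by (cases \<psi>) auto
next
  case (In i j) show ?case by (cases \<psi>) auto
next
  case (Neg \<phi>) then show ?case by (cases \<psi>) auto
next
  case (And \<phi>1 \<phi>2) then show ?case by (cases \<psi>) auto
next
  case (All i \<phi>) then show ?case by (cases \<psi>) auto
qed

text \<open>Meanings are counted instead of formulas: the family in a conjunction or disjunction is
  defined on all of \<open>hset\<close>, and formulas that differ only outside the index set have
  the same meaning.\<close>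

type_synonym 'k sem = "'k hset set \<Rightarrow> 'k hset set \<Rightarrow> (nat \<Rightarrow> 'k hset) \<Rightarrow> (nat \<Rightarrow> 'k hset set) \<Rightarrow> bool"

definition sem :: "'k so \<Rightarrow> 'k sem" where "sem \<phi> M R e s = sat M R e \<phi> s"

definition qA :: "nat \<Rightarrow> 'k sem \<Rightarrow> 'k sem" where "qA j c M R e s \<longleftrightarrow> (\<forall>X. X \<subseteq> M \<longrightarrow> c M R e (s(j := X)))"
definition qE :: "nat \<Rightarrow> 'k sem \<Rightarrow> 'k sem" where "qE j c M R e s \<longleftrightarrow> (\<exists>X. X \<subseteq> M \<and> c M R e (s(j := X)))"

lemma sem_foldr: "sem (foldr AllS js \<phi>) = foldr qA js (sem \<phi>)" "sem (foldr ExS js \<phi>) = foldr qE js (sem \<phi>)"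
  by (induction js) (auto simp: sem_def qA_def qE_def fun_eq_iff)

definition classes :: "'k hset \<Rightarrow> 'k sem set" where
  "classes \<zeta> = sem ` {\<phi>. is_Pi \<zeta> \<phi>} \<union> sem ` {\<phi>. is_Sigma \<zeta> \<phi>}"

text \<open>At a successor, a meaning is given by a finite list of variables and a meaning one level
  down. At a limit it is given by a function from \<gamma> to earlier meanings. These are coded by
  subsets of \<open>B\<close>, and so the function by a subset of the product of \<gamma> and
  \<open>B\<close>, which is no larger than \<open>B\<close>. The bound thus stays the same at all
  levels up to \<xi>.\<close>

lemma card_classes:
  fixes \<xi> :: "'k hset"
  defines "B \<equiv> (UNIV :: nat set) <+> elts \<xi>"
  shows "Ord \<zeta> \<Longrightarrow> elts \<zeta> \<subseteq> elts \<xi> \<Longrightarrow> |classes \<zeta>| \<le>o |Pow B|"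
proof (induction \<zeta> rule: Ord_induct3)
  have infB: "infinite B" by (simp add: B_def finite_Plus_iff)
  have natB: "|UNIV :: nat set| \<le>o |B|" unfolding B_def by (rule card_of_Plus1)
  have BP: "|B| \<le>o |Pow B|" by (rule ordLess_imp_ordLeq[OF card_of_Pow])
  have infP: "infinite (Pow B)" using infB by (simp add: finite_Pow_iff)
  have natP: "|UNIV :: nat set| \<le>o |Pow B|" by (rule ordLeq_transitive[OF natB BP])
  {
    case 0
    have "classes zero \<subseteq> range (\<lambda>\<theta>. sem (FO \<theta>) :: 'k sem)"
      unfolding classes_def using is_Pi_zeroD by blast
    then have 1: "|classes zero :: 'k sem set| \<le>o |range (\<lambda>\<theta>. sem (FO \<theta>) :: 'k sem)|" by (rule card_of_mono1)
    have 2: "|UNIV :: fo set| \<le>o |UNIV :: nat set|" by (rule card_of_ordLeqI[of enc]) (auto simp: inj_on_def enc_inject)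
    show ?case by (rule ordLeq_transitive[OF 1 ordLeq_transitive[OF card_of_image ordLeq_transitive[OF 2 natP]]])
  next
    case (succ \<zeta>)
    have IH: "|classes \<zeta>| \<le>o |Pow B|" using succ by (auto simp: elts_succ)
    have 1: "|UNIV :: nat list set| \<le>o |Pow B|"
      by (rule ordLeq_transitive[OF _ natP], rule card_of_ordLeqI[OF inj_list_encode]) simp
    have t: "|(UNIV :: nat list set) \<times> classes \<zeta>| \<le>o |Pow B|" by (rule card_Times_le[OF infP 1 IH])
    have sub: "classes (succ \<zeta>) \<subseteq> (\<lambda>(js, c). foldr qA js c) ` (UNIV \<times> classes \<zeta>) \<union> (\<lambda>(js, c). foldr qE js c) ` (UNIV \<times> classes \<zeta>)"
    proof
      fix c :: "'k sem" assume "c \<in> classes (succ \<zeta>)"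
      then consider \<phi> where "c = sem \<phi>" "is_Pi (succ \<zeta>) \<phi>" | \<phi> where "c = sem \<phi>" "is_Sigma (succ \<zeta>) \<phi>"
        unfolding classes_def by blast
      then show "c \<in> (\<lambda>(js, c). foldr qA js c) ` (UNIV \<times> classes \<zeta>) \<union> (\<lambda>(js, c). foldr qE js c) ` (UNIV \<times> classes \<zeta>)"
      proof cases
        case 1
        then obtain js \<psi> where "\<phi> = foldr AllS js \<psi>" "is_Sigma \<zeta> \<psi>" using is_Pi_succD(1) by blast
        then have "c = (\<lambda>(js, c). foldr qA js c) (js, sem \<psi>)" "(js, sem \<psi>) \<in> UNIV \<times> classes \<zeta>"
          using 1 by (auto simp: sem_foldr classes_def)
        then show ?thesis by blast
      next
        case 2
        then obtain js \<psi> where "\<phi> = foldr ExS js \<psi>" "is_Pi \<zeta> \<psi>" using is_Pi_succD(2) by blast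
        then have "c = (\<lambda>(js, c). foldr qE js c) (js, sem \<psi>)" "(js, sem \<psi>) \<in> UNIV \<times> classes \<zeta>"
          using 2 by (auto simp: sem_foldr classes_def)
        then show ?thesis by blast
      qed
    qed
    show ?case
      by (rule ordLeq_transitive[OF card_of_mono1[OF sub]], rule card_Un_le[OF infP];
          rule ordLeq_transitive[OF card_of_image t])
  next
    case (limit \<gamma>)
    define D where "D = (\<Union>\<eta>\<in>elts \<gamma>. classes \<eta> :: 'k sem set)"
    have gB: "|elts \<gamma>| \<le>o |B|"
      unfolding B_def by (rule ordLeq_transitive[OF card_of_mono1[OF limit(3)] card_of_Plus2])
    have "|D| \<le>o |Pow B|" unfolding D_def
    proof (rule card_of_UNION_ordLeq_infinite[OF infP ordLeq_transitive[OF gB BP]], rule ballI)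
      fix \<eta> assume e: "\<eta> \<in> elts \<gamma>"
      show "|classes \<eta> :: 'k sem set| \<le>o |Pow B|"
        by (rule limit(2)[OF e]) (use Ord_sub[OF is_limit_Ord[OF limit(1)] e] limit(3) in blast)
    qed
    then obtain d where d: "inj_on d D" "d ` D \<subseteq> Pow B" using card_of_ordLeq[of D "Pow B"] by blast
    define val where "val P \<eta> = inv_into D d {b. (\<eta>, b) \<in> P}" for P :: "('k hset \<times> (nat + 'k hset)) set" and \<eta>
    define cA where "cA P M R e s \<longleftrightarrow> (\<forall>\<eta>\<in>elts \<gamma>. val P \<eta> M R e s)" for P M R e s
    define cE where "cE P M R e s \<longleftrightarrow> (\<exists>\<eta>\<in>elts \<gamma>. val P \<eta> M R e s)" for P M R e s
    have tB: "|elts \<gamma> \<times> B| \<le>o |B|" by (rule card_Times_le[OF infB gB ordIso_imp_ordLeq[OF card_of_refl]])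
    have tP: "|Pow (elts \<gamma> \<times> B)| \<le>o |Pow B|" by (rule card_Pow_mono[OF tB])
    have code: "\<exists>P\<in>Pow (elts \<gamma> \<times> B). \<forall>\<eta>\<in>elts \<gamma>. val P \<eta> = k \<eta>" if k: "\<And>\<eta>. \<eta> \<in> elts \<gamma> \<Longrightarrow> k \<eta> \<in> D" for k
    proof -
      let ?P = "{(\<eta>, b). \<eta> \<in> elts \<gamma> \<and> b \<in> d (k \<eta>)}"
      have "val ?P \<eta> = k \<eta>" if "\<eta> \<in> elts \<gamma>" for \<eta>
        using that inv_into_f_f[OF d(1) k[OF that]] by (simp add: val_def)
      moreover have "?P \<in> Pow (elts \<gamma> \<times> B)" using d(2) k by auto
      ultimately show ?thesis by blast
    qed
    have sub: "classes \<gamma> \<subseteq> cA ` Pow (elts \<gamma> \<times> B) \<union> cE ` Pow (elts \<gamma> \<times> B)"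
    proof
      fix c :: "'k sem" assume "c \<in> classes \<gamma>"
      then consider \<phi> where "c = sem \<phi>" "is_Pi \<gamma> \<phi>" | \<phi> where "c = sem \<phi>" "is_Sigma \<gamma> \<phi>"
        unfolding classes_def by blast
      then show "c \<in> cA ` Pow (elts \<gamma> \<times> B) \<union> cE ` Pow (elts \<gamma> \<times> B)"
      proof cases
        case 1
        then obtain \<psi> where p: "\<phi> = Conj \<gamma> \<psi>" "\<forall>\<eta>\<in>elts \<gamma>. is_Pi \<eta> (\<psi> \<eta>)" using is_Pi_limitD(1)[OF limit(1)] by blast
        have "sem (\<psi> \<eta>) \<in> D" if "\<eta> \<in> elts \<gamma>" for \<eta> using that p(2) unfolding D_def classes_def by blast
        from code[OF this] obtain P where P: "P \<in> Pow (elts \<gamma> \<times> B)" "\<forall>\<eta>\<in>elts \<gamma>. val P \<eta> = sem (\<psi> \<eta>)" by (rule bexE)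
        have "c = cA P" unfolding 1(1) p(1) using P(2) by (simp add: sem_def cA_def fun_eq_iff)
        then show ?thesis using P(1) by blast
      next
        case 2
        then obtain \<psi> where p: "\<phi> = Disj \<gamma> \<psi>" "\<forall>\<eta>\<in>elts \<gamma>. is_Sigma \<eta> (\<psi> \<eta>)" using is_Pi_limitD(2)[OF limit(1)] by blast
        have "sem (\<psi> \<eta>) \<in> D" if "\<eta> \<in> elts \<gamma>" for \<eta> using that p(2) unfolding D_def classes_def by blast
        from code[OF this] obtain P where P: "P \<in> Pow (elts \<gamma> \<times> B)" "\<forall>\<eta>\<in>elts \<gamma>. val P \<eta> = sem (\<psi> \<eta>)" by (rule bexE)
        have "c = cE P" unfolding 2(1) p(1) using P(2) by (simp add: sem_def cE_def fun_eq_iff)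
        then show ?thesis using P(1) by blast
      qed
    qed
    show ?case
      by (rule ordLeq_transitive[OF card_of_mono1[OF sub]], rule card_Un_le[OF infP];
          rule ordLeq_transitive[OF card_of_image tP])
  }
qed

section \<open>The strong limit property of \<kappa> and the case \<beta> = 0\<close>

context two_cardinal
begin

text \<open>Otherwise some \<open>g\<close> maps the subsets of \<open>m\<close> onto \<kappa>. Take
  a point \<open>x\<close> with \<open>m\<close> in its local structure and closure under
  \<open>g\<close>. Every subset of \<open>m\<close> is small there and belongs to the local
  structure, so closure puts all of \<kappa> into \<open>x\<close>, contrary to the size of
  \<open>x\<close>.\<close>

lemma strong_limit:
  assumes S: "S \<subseteq> PP \<kappa> A" "indescribable \<xi> \<kappa> A S" and m: "m \<in> elts \<kappa>"
  shows "|Pow (elts m)| <o |elts \<kappa>|"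
proof (rule ccontr)
  assume "\<not> |Pow (elts m)| <o |elts \<kappa>|"
  then have "|elts \<kappa>| \<le>o |Pow (elts m)|"
    using not_ordLess_iff_ordLeq[OF card_of_Well_order card_of_Well_order] by blast
  then obtain g where g: "g ` Pow (elts m) = elts \<kappa>" using card_of_ordLeq2[OF kne, of "Pow (elts m)"] by blast
  define F where "F v = (if elts v \<subseteq> elts m then g (elts v) else zero)" for v
  have "closed_under F (WW \<kappa> A)" unfolding closed_under_def F_def using g kW zero_W by auto
  then have "thick ({x. nice \<kappa> A x \<and> closed_under F (MM \<kappa> x)} \<inter> {x. nice \<kappa> A x \<and> m \<in> MM \<kappa> x})"
    using m kW by (intro thick_Int thick_closed thick_mem) auto
  from indescribable_nonempty[OF thickD[OF this S]]
  obtain x where x: "x \<in> S" "nice \<kappa> A x" "closed_under F (MM \<kappa> x)" "m \<in> MM \<kappa> x" by blast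
  have gx: "gd \<kappa> A x" using x(2) by (simp add: nice_def)
  note mt = MM_trans[OF wrld gx x(4) Cardinal_lessI[OF Card m]]
  have Om: "Ord m" by (rule Ord_elt[OF world_Ord[OF wrld] m])
  have mx: "elts m \<subseteq> elts x" using gd_Ord_in[OF wrld gx] Ord_elt[OF Om] mt(1) by blast
  have "\<beta> \<in> elts x" if b: "\<beta> \<in> elts \<kappa>" for \<beta>
  proof -
    have "\<beta> \<in> g ` Pow (elts m)" using b unfolding g .
    then obtain u where u: "u \<subseteq> elts m" "g u = \<beta>" by auto
    have e: "elts (set_of u) = u" by (rule elts_set_of[OF small_mono[OF small_elts u(1)]])
    have "|u| <o |elts (kap \<kappa> x)|" by (rule ordLeq_ordLess_trans[OF card_of_mono1[OF u(1)] mt(2)])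
    then have "set_of u \<in> PP (kap \<kappa> x) x" using e u(1) mx by (auto simp: Psub_def)
    then have "set_of u \<in> MM \<kappa> x" using WW_PP[OF gd_world[OF wrld gx]] by blast
    then have "F (set_of u) \<in> MM \<kappa> x" using x(3) by (simp add: closed_under_def)
    then have "\<beta> \<in> MM \<kappa> x" using e u by (simp add: F_def)
    then show ?thesis by (rule gd_Ord_in[OF wrld gx Ord_elt[OF world_Ord[OF wrld] b]])
  qed
  then have "|elts \<kappa>| \<le>o |elts x|" by (intro card_of_mono1) blast
  then show False using gx not_ordLess_ordLeq unfolding gd_def Psub_def by blast
qed

lemma classes_less:
  assumes S: "S \<subseteq> PP \<kappa> A" "indescribable \<xi> \<kappa> A S"
  shows "|classes \<xi> :: 'k sem set| <o |elts \<kappa>|"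
proof -
  let ?B = "(UNIV :: nat set) <+> elts \<xi>"
  have "|?B| <o |elts \<kappa>|"
    by (rule card_of_Plus_ordLess_infinite[OF inf_\<kappa>]) (use wrld Cardinal_lessI[OF Card \<xi>] in \<open>simp_all add: world_def\<close>)
  \<comment> \<open>The index set is copied into \<kappa>, so that its cardinal is an ordinal
    \<open>m\<close> below \<kappa> to which \<open>strong_limit\<close> applies.\<close>
  moreover obtain h where h: "inj_on h ?B" "h ` ?B \<subseteq> elts \<kappa>"
    using card_of_ordLeq[of ?B "elts \<kappa>"] ordLess_imp_ordLeq[OF calculation] by blast
  define m where "m = hcard (h ` ?B)"
  have l: "|h ` ?B| <o |elts \<kappa>|" by (rule ordLeq_ordLess_trans[OF card_of_image calculation])
  have m: "Cardinal m" "|elts m| =o |h ` ?B|" unfolding m_def by (rule hcard[OF less_small[OF l]])+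
  have mk: "m \<in> elts \<kappa>" by (rule Cardinal_lessD[OF Card Cardinal_Ord[OF m(1)] ordIso_ordLess_trans[OF m(2) l]])
  have "|?B| \<le>o |h ` ?B|" by (rule card_of_ordLeqI[OF h(1)]) auto
  then have "|?B| \<le>o |elts m|" by (rule ordLeq_ordIso_trans[OF _ ordIso_symmetric[OF m(2)]])
  then have "|Pow ?B| <o |elts \<kappa>|" by (rule ordLeq_ordLess_trans[OF card_Pow_mono strong_limit[OF S mk]])
  then show ?thesis by (rule ordLeq_ordLess_trans[OF card_classes[OF Ord_\<xi> order_refl]])
qed

proposition base_case:
  assumes Op: "Op \<in> ops" and S: "S \<in> positive \<kappa> A (Op \<kappa> A (Pi_ideal \<xi> \<kappa> A))"
    and X: "X \<in> positive \<kappa> A (Pi_ideal \<xi> \<kappa> A)"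
    and SX: "\<And>x. x \<in> S \<Longrightarrow> X \<inter> PP (kap \<kappa> x) x \<in> Pi_ideal \<xi> (kap \<kappa> x) x"
  shows False
proof -
  note gI = good_Pi
  have SP: "S \<subseteq> PP \<kappa> A" "indescribable \<xi> \<kappa> A S" using good_indescribable[OF good_op[OF Op gI] S] by auto
  have XP: "X \<subseteq> PP \<kappa> A" "indescribable \<xi> \<kappa> A X" using good_indescribable[OF gI X] by auto
  obtain c :: "'k sem \<Rightarrow> 'k hset" where c: "inj_on c (classes \<xi>)" "c ` classes \<xi> \<subseteq> elts \<kappa>"
    using card_of_ordLeq[of "classes \<xi>" "elts \<kappa>"] ordLess_imp_ordLeq[OF classes_less[OF SP]] by blast
  \<comment> \<open>The set of the names of all meanings has size below \<kappa>. Once it is an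
    element of the local structure, so is every name.\<close>
  define r where "r = set_of (c ` classes \<xi>)"
  have rl: "|c ` classes \<xi>| <o |elts \<kappa>|" by (rule ordLeq_ordLess_trans[OF card_of_image classes_less[OF SP]])
  have er: "elts r = c ` classes \<xi>" unfolding r_def by (rule elts_set_of[OF less_small[OF rl]])
  have rP: "r \<in> PP \<kappa> A" using er rl c(2) kA by (auto simp: Psub_def)
  have tB: "thick ({x. nice \<kappa> A x \<and> r \<in> MM \<kappa> x} \<inter> {x. nice \<kappa> A x \<and> \<xi> \<in> MM \<kappa> x})" (is "thick ?B")
    by (intro thick_Int thick_mem) (use rP WW_PP[OF wrld] \<xi> kW in auto)
  define S1 where "S1 = S \<inter> ?B"
  have S1: "S1 \<in> positive \<kappa> A (Op \<kappa> A (Pi_ideal \<xi> \<kappa> A))"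
    unfolding S1_def by (rule good_thick[OF good_op[OF Op gI] S tB])
  have gd: "gd \<kappa> A x" if "x \<in> ?B" for x using that by (simp add: nice_def)
  have "\<exists>R \<phi>. R \<subseteq> MM \<kappa> x \<and> is_Pi \<xi> \<phi> \<and> sentence \<phi> \<and> models (MM \<kappa> x) R \<phi> \<and>
      (\<forall>y\<in>X. sq_less \<kappa> y x \<longrightarrow> elts y \<inter> elts \<kappa> = elts (kap \<kappa> y) \<longrightarrow> \<not> models (MM \<kappa> y) (R \<inter> MM \<kappa> y) \<phi>)"
    if x: "x \<in> S1" for x
  proof -
    have xS: "x \<in> S" and xB: "x \<in> ?B" using x by (auto simp: S1_def)
    have g: "elts x \<inter> elts \<kappa> = elts (kap \<kappa> x)" using gd[OF xB] by (simp add: gd_def)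
    have "\<not> indescribable \<xi> (kap \<kappa> x) x (X \<inter> PP (kap \<kappa> x) x)" using SX[OF xS] by (simp add: Pi_ideal_def)
    then obtain R \<phi> where h: "R \<subseteq> MM \<kappa> x" "is_Pi \<xi> \<phi>" "sentence \<phi>" "models (MM \<kappa> x) R \<phi>"
      "\<not> (\<exists>y\<in>X \<inter> PP (kap \<kappa> x) x. elts y \<inter> elts (kap \<kappa> x) = elts (kap (kap \<kappa> x) y) \<and>
         models (MM (kap \<kappa> x) y) (R \<inter> MM (kap \<kappa> x) y) \<phi>)"
      unfolding indescribable_def by blast
    have "\<not> models (MM \<kappa> y) (R \<inter> MM \<kappa> y) \<phi>"
      if y: "y \<in> X" "sq_less \<kappa> y x" "elts y \<inter> elts \<kappa> = elts (kap \<kappa> y)" for y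
    proof -
      have yP: "y \<in> PP (kap \<kappa> x) x" using y(2) by (simp add: sq_less_iff)
      have yx: "elts y \<subseteq> elts x" using y(2) by (simp add: sq_less_def)
      have k: "kap (kap \<kappa> x) y = kap \<kappa> y" by (rule kap_kap[OF g yx])
      have "elts y \<inter> elts (kap \<kappa> x) = elts (kap \<kappa> y)" using g y(3) yx by blast
      then have "models (MM \<kappa> y) (R \<inter> MM \<kappa> y) \<phi> \<Longrightarrow> elts y \<inter> elts (kap \<kappa> x) = elts (kap (kap \<kappa> x) y) \<and>
          models (MM (kap \<kappa> x) y) (R \<inter> MM (kap \<kappa> x) y) \<phi>" unfolding k by simp
      then show ?thesis using h(5) y(1) yP by blast
    qed
    then show ?thesis using h(1-4) by blast
  qed
  then have "\<forall>x\<in>S1. \<exists>p. fst p \<subseteq> MM \<kappa> x \<and> is_Pi \<xi> (snd p) \<and> sentence (snd p) \<and> models (MM \<kappa> x) (fst p) (snd p) \<and>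
      (\<forall>y\<in>X. sq_less \<kappa> y x \<longrightarrow> elts y \<inter> elts \<kappa> = elts (kap \<kappa> y) \<longrightarrow> \<not> models (MM \<kappa> y) (fst p \<inter> MM \<kappa> y) (snd p))"
    by (metis fst_conv snd_conv)
  from bchoice[OF this] obtain p where p: "\<forall>x\<in>S1. fst (p x) \<subseteq> MM \<kappa> x \<and> is_Pi \<xi> (snd (p x)) \<and> sentence (snd (p x)) \<and>
      models (MM \<kappa> x) (fst (p x)) (snd (p x)) \<and>
      (\<forall>y\<in>X. sq_less \<kappa> y x \<longrightarrow> elts y \<inter> elts \<kappa> = elts (kap \<kappa> y) \<longrightarrow> \<not> models (MM \<kappa> y) (fst (p x) \<inter> MM \<kappa> y) (snd (p x)))" ..
  define R where "R x = fst (p x)" for x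
  define \<phi> where "\<phi> x = snd (p x)" for x
  have R\<phi>: "R x \<subseteq> MM \<kappa> x" "is_Pi \<xi> (\<phi> x)" "sentence (\<phi> x)" "models (MM \<kappa> x) (R x) (\<phi> x)"
    "\<And>y. y \<in> X \<Longrightarrow> sq_less \<kappa> y x \<Longrightarrow> elts y \<inter> elts \<kappa> = elts (kap \<kappa> y) \<Longrightarrow> \<not> models (MM \<kappa> y) (R x \<inter> MM \<kappa> y) (\<phi> x)"
    if "x \<in> S1" for x
    using bspec[OF p that] unfolding R_def \<phi>_def by auto
  have cl: "sem (\<phi> x) \<in> classes \<xi>" if "x \<in> S1" for x using R\<phi>(2)[OF that] by (simp add: classes_def)
  \<comment> \<open>Tag 0 carries the predicate of the counterexample at \<open>x\<close>, tag 1 the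
    name of the meaning of its sentence.\<close>
  define T where "T x = cd 0 ` R x \<union> {cd 1 (c (sem (\<phi> x)))}" for x
  have cod: "codable (MM \<kappa> x)" if "x \<in> S1" for x
    using that codable_WW[OF gd_world[OF wrld gd]] by (simp add: S1_def)
  have TM: "T x \<subseteq> MM \<kappa> x" if x: "x \<in> S1" for x
  proof -
    have xB: "x \<in> ?B" using x by (simp add: S1_def)
    have "elts r \<subseteq> MM \<kappa> x" by (rule MM_trans(1)[OF wrld gd[OF xB]]) (use xB rP in \<open>auto simp: Psub_def\<close>)
    then have "c (sem (\<phi> x)) \<in> MM \<kappa> x" using er cl[OF x] by blast
    then show ?thesis unfolding T_def using codable_cd[OF cod[OF x]] R\<phi>(1)[OF x] by blast
  qed
  obtain H T' where H: "H \<subseteq> S1" "H \<in> positive \<kappa> A (Pi_ideal \<xi> \<kappa> A)" "\<And>x. x \<in> H \<Longrightarrow> nice \<kappa> A x"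
    "T' \<subseteq> WW \<kappa> A" "\<And>x. x \<in> H \<Longrightarrow> T x = T' \<inter> MM \<kappa> x" "T' = (\<Union>x\<in>H. T x)"
    using homogenize[OF Op gI S1 TM] by metis
  have HP: "H \<subseteq> PP \<kappa> A" "indescribable \<xi> \<kappa> A H" using good_indescribable[OF gI H(2)] by auto
  obtain x0 where x0: "x0 \<in> H" using good_ne[OF gI H(2)] by blast
  have same: "sem (\<phi> x) = sem (\<phi> x0)" if x: "x \<in> H" for x
  proof -
    obtain z where z: "z \<in> H" "sq_less \<kappa> x z" "sq_less \<kappa> x0 z"
      using good_above2[OF gI H(2), of x x0] HP x x0 by blast
    have "T y \<subseteq> T z" if "y \<in> H" "sq_less \<kappa> y z" for y
      using H(5)[OF that(1)] H(5)[OF z(1)] MM_sq[OF that(2)] by blast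
    then have "cd 1 (c (sem (\<phi> x))) \<in> T z" "cd 1 (c (sem (\<phi> x0))) \<in> T z" using x x0 z unfolding T_def by blast+
    then have "c (sem (\<phi> x)) = c (sem (\<phi> z))" "c (sem (\<phi> x0)) = c (sem (\<phi> z))" unfolding T_def by (auto simp: cd_inject)
    then show ?thesis using c(1) cl x x0 H(1) unfolding inj_on_def by (metis subsetD)
  qed
  have mods: "models M Q (\<phi> x) \<longleftrightarrow> models M Q (\<phi> x0)" if "x \<in> H" for x M Q
    using same[OF that] unfolding models_def sem_def fun_eq_iff by blast
  define RR where "RR = (\<Union>x\<in>H. R x)"
  have RRx: "R x = RR \<inter> MM \<kappa> x" if x: "x \<in> H" for x
  proof
    show "R x \<subseteq> RR \<inter> MM \<kappa> x" using R\<phi>(1) x H(1) unfolding RR_def by blast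
    show "RR \<inter> MM \<kappa> x \<subseteq> R x"
    proof
      fix v assume v: "v \<in> RR \<inter> MM \<kappa> x"
      then obtain y where y: "y \<in> H" "v \<in> R y" unfolding RR_def by blast
      then have "cd 0 v \<in> T'" unfolding H(6) T_def by blast
      moreover have "cd 0 v \<in> MM \<kappa> x" using codable_cd[OF cod] v x H(1) by blast
      ultimately have "cd 0 v \<in> T x" using H(5)[OF x] by blast
      then show "v \<in> R x" unfolding T_def by (auto simp: cd_inject)
    qed
  qed
  have RRW: "RR \<subseteq> WW \<kappa> A"
    unfolding RR_def
  proof (rule UN_least)
    fix x assume x: "x \<in> H"
    then show "R x \<subseteq> WW \<kappa> A" using R\<phi>(1)[of x] MM_W[of x] H(1) HP(1) by blast
  qed
  have x0S: "x0 \<in> S1" using x0 H(1) by blast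
  show False
  proof (cases "models (WW \<kappa> A) RR (\<phi> x0)")
    case True
    from indescribableD[OF XP(2) RRW R\<phi>(2,3)[OF x0S] True]
    obtain y where y: "y \<in> X" "elts y \<inter> elts \<kappa> = elts (kap \<kappa> y)" "models (MM \<kappa> y) (RR \<inter> MM \<kappa> y) (\<phi> x0)" by blast
    \<comment> \<open>A point of \<open>H\<close> above \<open>y\<close> has the glued predicate at
      \<open>y\<close> as its own, so the counterexample chosen at that point fails.\<close>
    obtain x where x: "x \<in> H" "sq_less \<kappa> y x" using good_above[OF gI H(2), of y] y(1) XP(1) by blast
    have "R x \<inter> MM \<kappa> y = RR \<inter> MM \<kappa> y" using RRx[OF x(1)] MM_sq[OF x(2)] by blast
    then have "models (MM \<kappa> y) (R x \<inter> MM \<kappa> y) (\<phi> x)" using y(3) mods[OF x(1)] by simp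
    then show False using R\<phi>(5)[OF _ y(1) x(2) y(2)] x(1) H(1) by blast
  next
    case False
    let ?e = "\<lambda>_::nat. zero :: 'k hset" and ?s = "\<lambda>_::nat. {} :: 'k hset set"
    note mi = models_iff[OF R\<phi>(3)[OF x0S], where e = ?e and s = ?s]
    have "reflects \<kappa> A H (neg (\<phi> x0))"
    proof (rule reflects_Sigma[OF wrld HP \<xi> _ is_Pi_neg(1)[OF R\<phi>(2)[OF x0S]]])
      fix x assume x: "x \<in> H"
      then have xB: "x \<in> ?B" using H(1) by (auto simp: S1_def)
      have "\<xi> \<in> elts x" using gd_Ord_in[OF wrld gd[OF xB] Ord_\<xi>] xB by blast
      then have "\<xi> \<in> elts (kap \<kappa> x)" using \<xi> gd[OF xB] by (auto simp: gd_def)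
      then show "gd \<kappa> A x \<and> \<xi> \<in> elts (kap \<kappa> x)" using gd[OF xB] by blast
    next
      show "fv (neg (\<phi> x0)) = {}" using R\<phi>(3)[OF x0S] by (simp add: sentence_def)
    qed
    moreover have "sat (WW \<kappa> A) RR ?e (neg (\<phi> x0)) ?s" using False mi by simp
    ultimately obtain x where x: "x \<in> H" "sat (MM \<kappa> x) (RR \<inter> MM \<kappa> x) ?e (neg (\<phi> x0)) (\<lambda>j. ?s j \<inter> MM \<kappa> x)"
      using reflectsD[of \<kappa> A H "neg (\<phi> x0)" RR ?s ?e] RRW by blast
    then have "\<not> models (MM \<kappa> x) (R x) (\<phi> x0)" using mi RRx[OF x(1)] by simp
    then show False using mods[OF x(1)] R\<phi>(4)[of x] x(1) H(1) by blast
  qed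
qed

end

section \<open>Reflection of positivity\<close>

text \<open>Tuples as iterated pairs, so that a function on tuples becomes a subset of the local
  structure.\<close>

primrec el :: "'k hset list \<Rightarrow> 'k hset" where
  "el [] = zero"
| "el (y # ys) = kp y (el ys)"

lemma el_inject: "el xs = el ys \<longleftrightarrow> xs = ys"
proof (induction xs arbitrary: ys)
  case Nil
  show ?case by (cases ys) auto
next
  case (Cons x xs)
  then show ?case by (cases ys) auto
qed

lemma codable_kp: "codable M \<Longrightarrow> a \<in> M \<Longrightarrow> b \<in> M \<Longrightarrow> kp a b \<in> M"
  unfolding kp_def sg_def codable_def by blast

lemma codable_el: "codable M \<Longrightarrow> set ys \<subseteq> M \<Longrightarrow> el ys \<in> M"
  by (induction ys) (auto simp: codable_kp, simp add: codable_def)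

lemma sq_less_kap:
  assumes "elts x \<inter> elts \<kappa> = elts (kap \<kappa> x)" "elts z \<subseteq> elts x"
  shows "sq_less (kap \<kappa> x) y z \<longleftrightarrow> sq_less \<kappa> y z"
proof -
  have "elts z \<inter> elts (kap \<kappa> x) = elts z \<inter> elts \<kappa>" using assms by blast
  then show ?thesis by (simp add: sq_less_def)
qed

lemma tuples_kap:
  assumes "elts x \<inter> elts \<kappa> = elts (kap \<kappa> x)" "\<And>y. y \<in> Y \<Longrightarrow> elts y \<subseteq> elts x"
  shows "tuples (kap \<kappa> x) Y m = tuples \<kappa> Y m"
proof -
  have key: "sq_less (kap \<kappa> x) y z \<longleftrightarrow> sq_less \<kappa> y z" if "z \<in> Y" for y z
    by (rule sq_less_kap[OF assms(1) assms(2)[OF that]])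
  have "sorted_wrt (sq_less (kap \<kappa> x)) xs \<longleftrightarrow> sorted_wrt (sq_less \<kappa>) xs" if "set xs \<subseteq> Y" for xs
    using that by (induction xs) (auto simp: key subset_iff)
  then show ?thesis unfolding tuples_def by auto
qed

lemma ineff_witness: "P \<in> ineff_op \<kappa> A J \<Longrightarrow>
    \<exists>L. is_list \<kappa> P L \<and> (\<forall>H\<in>positive \<kappa> A J. H \<subseteq> P \<longrightarrow> \<not> homogeneous_list \<kappa> L H)"
  unfolding ineff_op_def by auto

lemma ramsey_witness: "P \<in> ramsey_op \<kappa> A J \<Longrightarrow>
    \<exists>g. regressive \<kappa> A P g \<and> (\<forall>H\<in>positive \<kappa> A J. H \<subseteq> P \<longrightarrow> \<not> homogeneous_fun \<kappa> g H)"
  unfolding ramsey_op_def by auto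

lemma positive_ineffD: "S \<in> positive \<kappa> A (ineff_op \<kappa> A J) \<Longrightarrow> is_list \<kappa> S L \<Longrightarrow>
    \<exists>H. H \<in> positive \<kappa> A J \<and> H \<subseteq> S \<and> homogeneous_list \<kappa> L H"
  by (auto simp only: positive_ineff)

lemma positive_ramseyD: "S \<in> positive \<kappa> A (ramsey_op \<kappa> A J) \<Longrightarrow> regressive \<kappa> A S g \<Longrightarrow>
    \<exists>H. H \<in> positive \<kappa> A J \<and> H \<subseteq> S \<and> homogeneous_fun \<kappa> g H"
  by (auto simp only: positive_ramsey)

text \<open>The value of a canonical function of limit rank need not be a limit at \<open>x\<close>.
  If it is zero or a successor, it is itself at most some \<open>succ (o' a)\<close>; if it is a
  limit, \<open>P\<close> already occurs at a smaller stage, and that stage is covered.\<close>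

lemma II_bound:
  assumes Op: "Op \<in> ops" and k: "elts \<kappa> \<noteq> {}" and \<zeta>: "Ord \<zeta>" and P: "P \<in> II Op \<xi> \<kappa> A \<zeta>"
    and sub: "elts \<zeta> \<subseteq> (\<Union>a\<in>I. elts (succ (o' a)))" and O: "\<And>a. a \<in> I \<Longrightarrow> Ord (o' a)" and I: "I \<noteq> {}"
  shows "\<exists>a\<in>I. P \<in> II Op \<xi> \<kappa> A (succ (o' a))"
proof -
  note mono = II_mono[OF Op k, THEN subsetD]
  show ?thesis using \<zeta>
  proof (cases rule: Ord_cases)
    case 0
    obtain a where a: "a \<in> I" using I by blast
    have "zero \<in> elts (succ (o' a))" by (rule zero_in_Ord[OF Ord_succ[OF O[OF a]] succ_neq_zero])
    then show ?thesis using mono[OF Ord_succ[OF O[OF a]], of zero P \<xi> A] P 0 a by blast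
  next
    case (succ \<eta>)
    then have "\<eta> \<in> elts \<zeta>" by (simp add: elts_succ)
    then obtain a where a: "a \<in> I" "\<eta> \<in> elts (succ (o' a))" using sub by blast
    have "succ \<eta> \<in> elts (succ (o' a)) \<or> succ \<eta> = succ (o' a)" by (rule Ord_succ_mem[OF Ord_succ[OF O[OF a(1)]] a(2)])
    then show ?thesis using mono[OF Ord_succ[OF O[OF a(1)]], of "succ \<eta>" P \<xi> A] P succ(1) a(1) by auto
  next
    case limit
    then obtain \<eta> where e: "\<eta> \<in> elts \<zeta>" "P \<in> II Op \<xi> \<kappa> A \<eta>" using P iterate_limit[OF limit, of "Pi_ideal \<xi> \<kappa> A" "Op \<kappa> A"] by auto
    then obtain a where a: "a \<in> I" "\<eta> \<in> elts (succ (o' a))" using sub by blast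
    then show ?thesis using mono[OF Ord_succ[OF O[OF a(1)]] a(2) e(2)] by blast
  qed
qed

section \<open>The successor step for both operators\<close>

context two_cardinal
begin

lemma good_diff: "good J \<Longrightarrow> H \<in> positive \<kappa> A J \<Longrightarrow> B \<in> J \<Longrightarrow> \<exists>x. x \<in> H \<and> x \<notin> B"
proof -
  assume h: "good J" "H \<in> positive \<kappa> A J" "B \<in> J"
  have "H \<in> J" if "H \<subseteq> B" using h(1,3) that by (simp add: good_def downward_def)
  then show ?thesis using h(2) by (auto simp: positive_def)
qed

lemma good_above_list:
  assumes "good J" "H \<in> positive \<kappa> A J" "set ys \<subseteq> PP \<kappa> A"
  shows "\<exists>x\<in>H. \<forall>y\<in>set ys. sq_less \<kappa> y x"
proof -
  let ?u = "set_of (\<Union>y\<in>set ys. elts y)"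
  have l: "|\<Union>y\<in>set ys. elts y| <o |elts \<kappa>|"
    by (rule UN_less[OF finite_less]) (use assms(3) in \<open>auto simp: Psub_def\<close>)
  have e: "elts ?u = (\<Union>y\<in>set ys. elts y)" by (rule elts_set_of[OF less_small[OF l]])
  have "?u \<in> PP \<kappa> A" using e l assms(3) by (auto simp: Psub_def)
  then obtain x where x: "x \<in> H" "sq_less \<kappa> ?u x" using good_above[OF assms(1,2)] by blast
  have "sq_less \<kappa> y x" if "y \<in> set ys" for y by (rule sq_less_mono[OF x(2)]) (use e that in auto)
  then show ?thesis using x(1) by blast
qed

lemma PP_kap_sub: "gd \<kappa> A x \<Longrightarrow> y \<in> PP (kap \<kappa> x) x \<Longrightarrow> z \<in> PP (kap \<kappa> y) y \<Longrightarrow> z \<in> PP (kap \<kappa> x) x"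
proof -
  assume h: "gd \<kappa> A x" "y \<in> PP (kap \<kappa> x) x" "z \<in> PP (kap \<kappa> y) y"
  have yx: "elts y \<subseteq> elts x" using h(2) by (simp add: Psub_def)
  have "|elts z| <o |elts (kap \<kappa> x)|"
    by (rule ordLess_ordLeq_trans[OF _ kap_mono[OF yx]]) (use h(3) in \<open>simp add: Psub_def\<close>)
  then show ?thesis using h(3) yx by (auto simp: Psub_def)
qed

lemma PP_MM: "gd \<kappa> A x \<Longrightarrow> PP (kap \<kappa> x) x \<subseteq> MM \<kappa> x"
  by (rule WW_PP[OF gd_world[OF wrld]])

text \<open>A list on the part of \<open>X\<close> below \<open>x\<close> is stored as the set of
  pairs of a point and a member of its entry; these pairs lie in the local structure because the
  entries consist of points below \<open>x\<close>. In the application \<open>J\<close> is the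
  iterate \<delta>, \<open>J'\<close> the iterate \<delta> + 1, and \<open>Jx x\<close> the iterate
  \<open>f \<delta> x\<close> at \<open>x\<close>.\<close>

lemma ineff_step:
  assumes J: "good J'" and S: "S \<in> positive \<kappa> A (ineff_op \<kappa> A J')" and X: "X \<in> positive \<kappa> A (ineff_op \<kappa> A J)"
    and nice: "\<And>x. x \<in> S \<Longrightarrow> nice \<kappa> A x" and SX: "\<And>x. x \<in> S \<Longrightarrow> X \<inter> PP (kap \<kappa> x) x \<in> ineff_op (kap \<kappa> x) x (Jx x)"
    and IH: "\<And>Y. Y \<in> positive \<kappa> A J \<Longrightarrow> {x \<in> PP \<kappa> A. Y \<inter> PP (kap \<kappa> x) x \<in> Jx x} \<in> J'"
  shows False
proof -
  have gd: "gd \<kappa> A x" "elts x \<inter> elts \<kappa> = elts (kap \<kappa> x)" if "x \<in> S" for x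
    using nice[OF that] by (auto simp: nice_def gd_def)
  have kk: "kap (kap \<kappa> x) y = kap \<kappa> y" if "x \<in> S" "y \<in> PP (kap \<kappa> x) x" for x y
    by (rule kap_kap[OF gd(2)[OF that(1)]]) (use that(2) in \<open>simp add: Psub_def\<close>)
  have "\<forall>x\<in>S. \<exists>L. is_list (kap \<kappa> x) (X \<inter> PP (kap \<kappa> x) x) L \<and>
     (\<forall>H\<in>positive (kap \<kappa> x) x (Jx x). H \<subseteq> X \<inter> PP (kap \<kappa> x) x \<longrightarrow> \<not> homogeneous_list (kap \<kappa> x) L H)"
    using ineff_witness[OF SX] by (rule ballI)
  from bchoice[OF this] obtain L where L: "\<forall>x\<in>S. is_list (kap \<kappa> x) (X \<inter> PP (kap \<kappa> x) x) (L x) \<and>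
     (\<forall>H\<in>positive (kap \<kappa> x) x (Jx x). H \<subseteq> X \<inter> PP (kap \<kappa> x) x \<longrightarrow> \<not> homogeneous_list (kap \<kappa> x) (L x) H)" ..
  have Lsub: "L x y \<subseteq> PP (kap \<kappa> y) y" if "x \<in> S" "y \<in> X \<inter> PP (kap \<kappa> x) x" for x y
  proof -
    have "is_list (kap \<kappa> x) (X \<inter> PP (kap \<kappa> x) x) (L x)" by (rule conjunct1[OF bspec[OF L that(1)]])
    then have "L x y \<subseteq> PP (kap (kap \<kappa> x) y) y" unfolding is_list_def by (rule bspec[OF _ that(2)])
    then show ?thesis using kk[OF that(1), of y] that(2) by simp
  qed
  define T where "T x = {kp y z | y z. y \<in> X \<inter> PP (kap \<kappa> x) x \<and> z \<in> L x y}" for x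
  have kpM: "kp y z \<in> MM \<kappa> x" if "x \<in> S" "y \<in> PP (kap \<kappa> x) x" "z \<in> PP (kap \<kappa> y) y" for x y z
    using codable_kp[OF codable_WW[OF gd_world[OF wrld gd(1)[OF that(1)]]]] PP_MM[OF gd(1)[OF that(1)]]
      PP_kap_sub[OF gd(1)[OF that(1)] that(2,3)] that(2) by blast
  have TM: "T x \<subseteq> MM \<kappa> x" if "x \<in> S" for x using kpM[OF that] Lsub[OF that] unfolding T_def by blast
  obtain H T' where H: "H \<subseteq> S" "H \<in> positive \<kappa> A J'" "\<And>x. x \<in> H \<Longrightarrow> nice \<kappa> A x"
    "T' \<subseteq> WW \<kappa> A" "\<And>x. x \<in> H \<Longrightarrow> T x = T' \<inter> MM \<kappa> x" "T' = (\<Union>x\<in>H. T x)"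
    using homogenize[OF insertI1 J S TM] by metis
  define L' where "L' y = {z \<in> PP (kap \<kappa> y) y. kp y z \<in> T'}" for y
  have L'L: "L' y = L x y" if x: "x \<in> H" and y: "y \<in> X \<inter> PP (kap \<kappa> x) x" for x y
  proof -
    have xS: "x \<in> S" using x H(1) by blast
    have "kp y z \<in> T' \<longleftrightarrow> z \<in> L x y" if z: "z \<in> PP (kap \<kappa> y) y" for z
    proof -
      have "kp y z \<in> T' \<longleftrightarrow> kp y z \<in> T x" using H(5)[OF x] kpM[OF xS _ z] y by blast
      then show ?thesis using y unfolding T_def by auto
    qed
    then show ?thesis using Lsub[OF xS y] unfolding L'_def by blast
  qed
  have "is_list \<kappa> X L'" by (auto simp: is_list_def L'_def)
  from positive_ineffD[OF X this]
  obtain Y where Y: "Y \<in> positive \<kappa> A J" "Y \<subseteq> X" "homogeneous_list \<kappa> L' Y"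
    by (elim exE conjE) (rule that)
  obtain x where x: "x \<in> H" "x \<notin> {x \<in> PP \<kappa> A. Y \<inter> PP (kap \<kappa> x) x \<in> Jx x}"
    using good_diff[OF J H(2) IH[OF Y(1)]] by (elim exE conjE) (rule that)
  have xS: "x \<in> S" using x(1) H(1) by blast
  have "x \<in> PP \<kappa> A" using gd(1)[OF xS] by (simp add: gd_def)
  then have pos: "Y \<inter> PP (kap \<kappa> x) x \<in> positive (kap \<kappa> x) x (Jx x)" using x(2) by (simp add: positive_def)
  have "homogeneous_list (kap \<kappa> x) (L x) (Y \<inter> PP (kap \<kappa> x) x)"
    unfolding homogeneous_list_def
  proof (intro ballI impI)
    fix y z assume yz: "y \<in> Y \<inter> PP (kap \<kappa> x) x" "z \<in> Y \<inter> PP (kap \<kappa> x) x" "sq_less (kap \<kappa> x) y z"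
    have "elts z \<subseteq> elts x" using yz(2) by (simp add: Psub_def)
    then have "sq_less \<kappa> y z" using yz(3) sq_less_kap[OF gd(2)[OF xS]] by blast
    then have "L' y = L' z \<inter> PP (kap \<kappa> y) y" using Y(3) yz unfolding homogeneous_list_def by blast
    moreover have "L' y = L x y" "L' z = L x z" using L'L[OF x(1)] yz Y(2) by blast+
    ultimately show "L x y = L x z \<inter> PP (kap (kap \<kappa> x) y) y" using kk[OF xS, of y] yz(1) by simp
  qed
  then show False using conjunct2[OF bspec[OF L xS], rule_format, OF pos] Y(2) by blast
qed

text \<open>Functions are stored as graphs on coded tuples. The glued graph is single-valued: two of
  its pairs come from two points of \<open>H\<close>, and at a common upper bound in
  \<open>H\<close> both belong to the graph of one function.\<close>

lemma ramsey_step: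
  assumes J: "good J'" and S: "S \<in> positive \<kappa> A (ramsey_op \<kappa> A J')" and X: "X \<in> positive \<kappa> A (ramsey_op \<kappa> A J)"
    and nice: "\<And>x. x \<in> S \<Longrightarrow> nice \<kappa> A x" and SX: "\<And>x. x \<in> S \<Longrightarrow> X \<inter> PP (kap \<kappa> x) x \<in> ramsey_op (kap \<kappa> x) x (Jx x)"
    and IH: "\<And>Y. Y \<in> positive \<kappa> A J \<Longrightarrow> {x \<in> PP \<kappa> A. Y \<inter> PP (kap \<kappa> x) x \<in> Jx x} \<in> J'"
  shows False
proof -
  have gd: "gd \<kappa> A x" "elts x \<inter> elts \<kappa> = elts (kap \<kappa> x)" if "x \<in> S" for x
    using nice[OF that] by (auto simp: nice_def gd_def)
  have XP: "X \<subseteq> PP \<kappa> A" using X by (simp add: positive_def)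
  have tup: "tuples (kap \<kappa> x) (Y \<inter> PP (kap \<kappa> x) x) m = tuples \<kappa> (Y \<inter> PP (kap \<kappa> x) x) m" if "x \<in> S" for x Y m
    by (rule tuples_kap[OF gd(2)[OF that]]) (auto simp: Psub_def)
  have "\<forall>x\<in>S. \<exists>g. regressive (kap \<kappa> x) x (X \<inter> PP (kap \<kappa> x) x) g \<and>
     (\<forall>H\<in>positive (kap \<kappa> x) x (Jx x). H \<subseteq> X \<inter> PP (kap \<kappa> x) x \<longrightarrow> \<not> homogeneous_fun (kap \<kappa> x) g H)"
    using ramsey_witness[OF SX] by (rule ballI)
  from bchoice[OF this] obtain g where g: "\<forall>x\<in>S. regressive (kap \<kappa> x) x (X \<inter> PP (kap \<kappa> x) x) (g x) \<and>
     (\<forall>H\<in>positive (kap \<kappa> x) x (Jx x). H \<subseteq> X \<inter> PP (kap \<kappa> x) x \<longrightarrow> \<not> homogeneous_fun (kap \<kappa> x) (g x) H)" ..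
  have reg: "g x ys \<in> PP (kap \<kappa> x) x \<and> (elts (hd ys) \<inter> elts (kap \<kappa> x) \<noteq> {} \<longrightarrow> sq_less (kap \<kappa> x) (g x ys) (hd ys))"
    if "x \<in> S" "1 \<le> m" "ys \<in> tuples \<kappa> (X \<inter> PP (kap \<kappa> x) x) m" for x m ys
  proof -
    have "regressive (kap \<kappa> x) x (X \<inter> PP (kap \<kappa> x) x) (g x)" by (rule conjunct1[OF bspec[OF g that(1)]])
    moreover have "ys \<in> tuples (kap \<kappa> x) (X \<inter> PP (kap \<kappa> x) x) m" using that(3) tup[OF that(1), of X m] by simp
    ultimately show ?thesis using that(2) unfolding regressive_def by blast
  qed
  define T where "T x = {kp (el ys) (g x ys) | ys. \<exists>m\<ge>1. ys \<in> tuples \<kappa> (X \<inter> PP (kap \<kappa> x) x) m}" for x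
  have TM: "T x \<subseteq> MM \<kappa> x" if x: "x \<in> S" for x
  proof
    fix v assume "v \<in> T x"
    then obtain ys m where ys: "v = kp (el ys) (g x ys)" "1 \<le> m" "ys \<in> tuples \<kappa> (X \<inter> PP (kap \<kappa> x) x) m"
      unfolding T_def by blast
    note PM = PP_MM[OF gd(1)[OF x]]
    note cod = codable_WW[OF gd_world[OF wrld gd(1)[OF x]]]
    have "set ys \<subseteq> MM \<kappa> x" using ys(3) PM by (auto simp: tuples_def)
    then have "el ys \<in> MM \<kappa> x" by (rule codable_el[OF cod])
    moreover have "g x ys \<in> MM \<kappa> x" using reg[OF x ys(2,3)] PM by blast
    ultimately show "v \<in> MM \<kappa> x" unfolding ys(1) by (rule codable_kp[OF cod])
  qed
  obtain H T' where H: "H \<subseteq> S" "H \<in> positive \<kappa> A J'" "\<And>x. x \<in> H \<Longrightarrow> nice \<kappa> A x"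
    "T' \<subseteq> WW \<kappa> A" "\<And>x. x \<in> H \<Longrightarrow> T x = T' \<inter> MM \<kappa> x" "T' = (\<Union>x\<in>H. T x)"
    using homogenize[OF insertI2[OF insertI1] J S TM] by metis
  have HP: "x \<in> PP \<kappa> A" if "x \<in> H" for x using gd(1) H(1) that by (auto simp: gd_def)
  define F where "F ys = (SOME z. kp (el ys) z \<in> T')" for ys
  have Fg: "F ys = g x ys" if x: "x \<in> H" and ys: "1 \<le> m" "ys \<in> tuples \<kappa> (X \<inter> PP (kap \<kappa> x) x) m" for x ys m
    unfolding F_def
  proof (rule some_equality)
    have in_T: "kp (el ys) (g x ys) \<in> T x" using ys unfolding T_def by blast
    then show "kp (el ys) (g x ys) \<in> T'" using x unfolding H(6) by blast
    fix z assume "kp (el ys) z \<in> T'"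
    then obtain y where y: "y \<in> H" "kp (el ys) z \<in> T y" unfolding H(6) by blast
    obtain u where u: "u \<in> H" "sq_less \<kappa> x u" "sq_less \<kappa> y u"
      using good_above2[OF J H(2) HP[OF x] HP[OF y(1)]] by blast
    have "T w \<subseteq> T u" if "w \<in> H" "sq_less \<kappa> w u" for w
      using H(5)[OF that(1)] H(5)[OF u(1)] MM_sq[OF that(2)] by blast
    then have "kp (el ys) (g x ys) \<in> T u" "kp (el ys) z \<in> T u" using in_T y x u by blast+
    then show "z = g x ys" unfolding T_def by (auto simp: el_inject)
  qed
  have "regressive \<kappa> A X F"
    unfolding regressive_def
  proof (intro allI impI ballI)
    fix m :: nat and ys assume ys: "1 \<le> m" "ys \<in> tuples \<kappa> X m"
    then have "set ys \<subseteq> PP \<kappa> A" using XP by (auto simp: tuples_def)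
    \<comment> \<open>At a point of \<open>H\<close> above the whole tuple the glued function agrees
      with \<open>g x\<close>, from which it inherits regressiveness.\<close>
    then obtain x where x: "x \<in> H" "\<forall>y\<in>set ys. sq_less \<kappa> y x" using good_above_list[OF J H(2)] by blast
    have xS: "x \<in> S" using x(1) H(1) by blast
    have t: "ys \<in> tuples \<kappa> (X \<inter> PP (kap \<kappa> x) x) m" using ys(2) x(2) by (auto simp: tuples_def sq_less_iff)
    note r = reg[OF xS ys(1) t]
    have "ys \<noteq> []" using ys by (auto simp: tuples_def)
    then have "hd ys \<in> PP (kap \<kappa> x) x" using t by (auto simp: tuples_def)
    then have h: "elts (hd ys) \<subseteq> elts x" by (simp add: Psub_def)
    have "elts (hd ys) \<inter> elts (kap \<kappa> x) = elts (hd ys) \<inter> elts \<kappa>" using h gd(2)[OF xS] by blast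
    then have "elts (hd ys) \<inter> elts \<kappa> \<noteq> {} \<longrightarrow> sq_less \<kappa> (g x ys) (hd ys)"
      using r sq_less_kap[OF gd(2)[OF xS] h] by simp
    moreover have "g x ys \<in> PP \<kappa> A" using r MM_PP[OF wrld gd(1)[OF xS]] by blast
    ultimately show "F ys \<in> PP \<kappa> A \<and> (elts (hd ys) \<inter> elts \<kappa> \<noteq> {} \<longrightarrow> sq_less \<kappa> (F ys) (hd ys))"
      using Fg[OF x(1) ys(1) t] by simp
  qed
  from positive_ramseyD[OF X this]
  obtain Y where Y: "Y \<in> positive \<kappa> A J" "Y \<subseteq> X" "homogeneous_fun \<kappa> F Y"
    by (elim exE conjE) (rule that)
  obtain x where x: "x \<in> H" "x \<notin> {x \<in> PP \<kappa> A. Y \<inter> PP (kap \<kappa> x) x \<in> Jx x}"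
    using good_diff[OF J H(2) IH[OF Y(1)]] by (elim exE conjE) (rule that)
  have xS: "x \<in> S" using x(1) H(1) by blast
  have pos: "Y \<inter> PP (kap \<kappa> x) x \<in> positive (kap \<kappa> x) x (Jx x)" using x(2) HP[OF x(1)] by (simp add: positive_def)
  have "homogeneous_fun (kap \<kappa> x) (g x) (Y \<inter> PP (kap \<kappa> x) x)"
    unfolding homogeneous_fun_def tup[OF xS]
  proof (intro allI impI ballI)
    fix m :: nat and ys zs assume m: "1 \<le> m" and t: "ys \<in> tuples \<kappa> (Y \<inter> PP (kap \<kappa> x) x) m" "zs \<in> tuples \<kappa> (Y \<inter> PP (kap \<kappa> x) x) m"
    have "tuples \<kappa> (Y \<inter> PP (kap \<kappa> x) x) m \<subseteq> tuples \<kappa> (X \<inter> PP (kap \<kappa> x) x) m" by (rule tuples_mono) (use Y(2) in blast)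
    then have "F ys = g x ys" "F zs = g x zs" using Fg[OF x(1) m] t by blast+
    moreover have "tuples \<kappa> (Y \<inter> PP (kap \<kappa> x) x) m \<subseteq> tuples \<kappa> Y m" by (rule tuples_mono) simp
    then have "F ys = F zs" using Y(3) m t unfolding homogeneous_fun_def by blast
    ultimately show "g x ys = g x zs" by simp
  qed
  then show False using conjunct2[OF bspec[OF g xS], rule_format, OF pos] Y(2) by blast
qed

end

section \<open>The induction on \<beta>\<close>

context canonical_two_cardinal
begin

proposition reflection_of_positivity:
  assumes Op: "Op \<in> ops"
  shows "lt_card_suc \<beta> A \<Longrightarrow> X \<in> positive \<kappa> A (II Op \<xi> \<kappa> A \<beta>) \<Longrightarrow>
    {x \<in> PP \<kappa> A. X \<inter> PP (kap \<kappa> x) x \<in> II Op \<xi> (kap \<kappa> x) x (f \<beta> x)} \<in> II Op \<xi> \<kappa> A (succ \<beta>)"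
proof (induction \<beta> arbitrary: X rule: hset_induct)
  case (1 \<beta>)
  note IH = "1.IH" and lt = "1.prems"(1) and X = "1.prems"(2)
  let ?J = "II Op \<xi> \<kappa> A \<beta>"
  define S where "S = {x \<in> PP \<kappa> A. X \<inter> PP (kap \<kappa> x) x \<in> II Op \<xi> (kap \<kappa> x) x (f \<beta> x)}"
  note gJ = good_II[OF Op, of \<beta>]
  note gOJ = good_op[OF Op gJ]
  have False if n: "S \<notin> II Op \<xi> \<kappa> A (succ \<beta>)"
  proof -
    have S: "S \<in> positive \<kappa> A (Op \<kappa> A ?J)" using n unfolding iterate_succ positive_def S_def by blast
    have O: "Ord \<beta>" by (rule lt_Ord[OF lt])
    show False using O
    proof (cases rule: Ord_cases)
      case 0
      define S1 where "S1 = S \<inter> {x. f zero x = zero}"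
      have I0: "II Op \<xi> \<mu> B zero = Pi_ideal \<xi> \<mu> B" for \<mu> B by (simp add: iterate_0)
      have S1: "S1 \<in> positive \<kappa> A (Op \<kappa> A (Pi_ideal \<xi> \<kappa> A))"
        unfolding S1_def using good_thick[OF gOJ S can_zero] lt unfolding 0 I0 by blast
      show False
      proof (rule base_case[OF Op S1])
        show "X \<in> positive \<kappa> A (Pi_ideal \<xi> \<kappa> A)" using X unfolding 0 I0 .
        show "X \<inter> PP (kap \<kappa> x) x \<in> Pi_ideal \<xi> (kap \<kappa> x) x" if x: "x \<in> S1" for x
        proof -
          have "X \<inter> PP (kap \<kappa> x) x \<in> II Op \<xi> (kap \<kappa> x) x (f zero x)" using x unfolding S1_def S_def 0 by blast
          moreover have "f zero x = zero" using x by (simp add: S1_def)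
          ultimately show ?thesis using I0 by simp
        qed
      qed
    next
      case (succ \<delta>)
      have db: "\<delta> \<in> elts \<beta>" using succ(1) by (simp add: elts_succ)
      define S1 where "S1 = S \<inter> ({x. f (succ \<delta>) x = succ (f \<delta> x)} \<inter> {x. nice \<kappa> A x})"
      have S1: "S1 \<in> positive \<kappa> A (Op \<kappa> A ?J)"
        unfolding S1_def by (rule good_thick[OF gOJ S]) (intro thick_Int can_succ thick_nice lt[unfolded succ(1)])
      have X': "X \<in> positive \<kappa> A (Op \<kappa> A (II Op \<xi> \<kappa> A \<delta>))" using X unfolding succ(1) iterate_succ .
      have nice: "nice \<kappa> A x" if "x \<in> S1" for x using that by (simp add: S1_def)
      have SX: "X \<inter> PP (kap \<kappa> x) x \<in> Op (kap \<kappa> x) x (II Op \<xi> (kap \<kappa> x) x (f \<delta> x))" if x: "x \<in> S1" for x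
      proof -
        have "X \<inter> PP (kap \<kappa> x) x \<in> II Op \<xi> (kap \<kappa> x) x (f (succ \<delta>) x)" using x unfolding S1_def S_def succ(1) by blast
        moreover have "f (succ \<delta>) x = succ (f \<delta> x)" using x by (simp add: S1_def)
        ultimately show ?thesis by (simp add: iterate_succ)
      qed
      have IH': "{x \<in> PP \<kappa> A. Y \<inter> PP (kap \<kappa> x) x \<in> II Op \<xi> (kap \<kappa> x) x (f \<delta> x)} \<in> ?J"
        if "Y \<in> positive \<kappa> A (II Op \<xi> \<kappa> A \<delta>)" for Y
        using IH[OF db lt_sub[OF lt db] that] unfolding succ(1) .
      consider "Op = ineff_op" | "Op = ramsey_op" using Op by blast
      then show False
      proof cases
        case 1
        show False
          by (rule ineff_step[OF gJ[unfolded 1] S1[unfolded 1] X'[unfolded 1] nice SX[unfolded 1] IH'[unfolded 1]])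
      next
        case 2
        show False
          by (rule ramsey_step[OF gJ[unfolded 2] S1[unfolded 2] X'[unfolded 2] nice SX[unfolded 2] IH'[unfolded 2]])
      qed
    next
      case limit
      have "|elts \<beta>| \<le>o |elts A|"
      proof -
        have "ord_rel \<beta> <o cardSuc |elts A|" using lt by (simp add: lt_card_suc_def)
        then have "|elts \<beta>| <o cardSuc |elts A|"
          using card_of_least[of "elts \<beta>" "ord_rel \<beta>"] Well_order_ord_rel[OF O] ordLeq_ordLess_trans
          unfolding Field_ord_rel by blast
        then show ?thesis using cardSuc_ordLess_ordLeq cardSuc_ordLeq_ordLess[OF card_of_Card_order card_of_Card_order] by blast
      qed
      moreover have "elts \<beta> \<noteq> {}" using is_limit_zero_in[OF limit] by blast
      ultimately obtain e where e: "e ` elts A = elts \<beta>" using card_of_ordLeq2[of "elts \<beta>" "elts A"] by blast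
      define S1 where "S1 = S \<inter> ({x. elts (f \<beta> x) \<subseteq> (\<Union>a\<in>elts x. elts (succ (f (e a) x)))} \<inter> {x. nice \<kappa> A x})"
      have S1: "S1 \<in> positive \<kappa> A (Op \<kappa> A ?J)"
        unfolding S1_def by (rule good_thick[OF gOJ S]) (intro thick_Int can_limit[OF lt e] thick_nice)
      have gd: "gd \<kappa> A x" if "x \<in> S1" for x using that by (simp add: S1_def nice_def)
      have "\<exists>a\<in>elts x. X \<inter> PP (kap \<kappa> x) x \<in> II Op \<xi> (kap \<kappa> x) x (succ (f (e a) x))" if x: "x \<in> S1" for x
      proof (rule II_bound[OF Op])
        have xP: "x \<in> PP \<kappa> A" using gd[OF x] by (simp add: gd_def)
        have kx: "infinite (elts (kap \<kappa> x))" by (rule world_inf[OF gd_world[OF wrld gd[OF x]]])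
        then show "elts (kap \<kappa> x) \<noteq> {}" by auto
        show "elts x \<noteq> {}" using kx gd[OF x] by (auto simp: gd_def)
        show "Ord (f \<beta> x)" using canD(2)[OF lt] xP by (simp add: ord_valued_def)
        show "X \<inter> PP (kap \<kappa> x) x \<in> II Op \<xi> (kap \<kappa> x) x (f \<beta> x)" using x unfolding S1_def S_def by blast
        show "elts (f \<beta> x) \<subseteq> (\<Union>a\<in>elts x. elts (succ (f (e a) x)))" using x unfolding S1_def by blast
        fix a assume "a \<in> elts x"
        then have "e a \<in> elts \<beta>" using xP e by (auto simp: Psub_def)
        then show "Ord (f (e a) x)" using canD(2)[OF lt_sub[OF lt]] xP by (simp add: ord_valued_def)
      qed
      then have "\<forall>x\<in>S1. \<exists>a. a \<in> elts x \<and> X \<inter> PP (kap \<kappa> x) x \<in> II Op \<xi> (kap \<kappa> x) x (succ (f (e a) x))" by blast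
      from bchoice[OF this] obtain a where a: "\<forall>x\<in>S1. a x \<in> elts x \<and> X \<inter> PP (kap \<kappa> x) x \<in> II Op \<xi> (kap \<kappa> x) x (succ (f (e (a x)) x))" ..
      \<comment> \<open>Homogenizing singletons takes the place of a pressing-down argument: two
        points of \<open>H\<close> have a common upper bound in \<open>H\<close>, whose singleton
        contains both choices.\<close>
      define T where "T x = {a x}" for x
      have TM: "T x \<subseteq> MM \<kappa> x" if x: "x \<in> S1" for x
        using bspec[OF a x] WW_base[OF gd_world[OF wrld gd[OF x]]] unfolding T_def by blast
      obtain H T' where H: "H \<subseteq> S1" "H \<in> positive \<kappa> A ?J" "\<And>x. x \<in> H \<Longrightarrow> nice \<kappa> A x"
        "T' \<subseteq> WW \<kappa> A" "\<And>x. x \<in> H \<Longrightarrow> T x = T' \<inter> MM \<kappa> x" "T' = (\<Union>x\<in>H. T x)"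
        using homogenize[OF Op gJ S1 TM] by metis
      have HP: "x \<in> PP \<kappa> A" if "x \<in> H" for x using gd H(1) that by (auto simp: gd_def)
      obtain x0 where x0: "x0 \<in> H" using good_ne[OF gJ H(2)] by blast
      have same: "a x = a x0" if x: "x \<in> H" for x
      proof -
        obtain z where z: "z \<in> H" "sq_less \<kappa> x z" "sq_less \<kappa> x0 z"
          using good_above2[OF gJ H(2) HP[OF x] HP[OF x0]] by blast
        have "T y \<subseteq> T z" if "y \<in> H" "sq_less \<kappa> y z" for y
          using H(5)[OF that(1)] H(5)[OF z(1)] MM_sq[OF that(2)] by blast
        then have "a x \<in> T z" "a x0 \<in> T z" using x x0 z unfolding T_def by blast+
        then show ?thesis by (simp add: T_def)
      qed
      define \<delta> where "\<delta> = e (a x0)"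
      have "a x0 \<in> elts A" using bspec[OF a, of x0] x0 H(1) HP[OF x0] by (auto simp: Psub_def)
      then have db: "\<delta> \<in> elts \<beta>" using e unfolding \<delta>_def by blast
      \<comment> \<open>The induction hypothesis for \<delta> + 1 yields a member of the iterate
        \<delta> + 2, so both successors have to lie below \<beta>.\<close>
      then have sb: "succ \<delta> \<in> elts \<beta>" "succ (succ \<delta>) \<in> elts \<beta>" using limit by (auto simp: is_limit_def)
      note ls = lt_sub[OF lt sb(1)]
      let ?B = "{x. f (succ \<delta>) x = succ (f \<delta> x)}"
      have HB: "H \<inter> ?B \<in> positive \<kappa> A ?J" by (rule good_thick[OF gJ H(2) can_succ[OF ls]])
      have "X \<in> positive \<kappa> A (II Op \<xi> \<kappa> A (succ \<delta>))"
        using X II_mono[OF Op kne O sb(1), of \<xi> A] unfolding positive_def by blast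
      from IH[OF sb(1) ls this] II_mono[OF Op kne O sb(2), of \<xi> A]
      have b: "{x \<in> PP \<kappa> A. X \<inter> PP (kap \<kappa> x) x \<in> II Op \<xi> (kap \<kappa> x) x (f (succ \<delta>) x)} \<in> ?J" by blast
      have "H \<inter> ?B \<subseteq> {x \<in> PP \<kappa> A. X \<inter> PP (kap \<kappa> x) x \<in> II Op \<xi> (kap \<kappa> x) x (f (succ \<delta>) x)}"
      proof
        fix x assume x: "x \<in> H \<inter> ?B"
        then have "x \<in> S1" "a x = a x0" using H(1) same by blast+
        then have "X \<inter> PP (kap \<kappa> x) x \<in> II Op \<xi> (kap \<kappa> x) x (succ (f \<delta> x))" using bspec[OF a] unfolding \<delta>_def by metis
        then show "x \<in> {x \<in> PP \<kappa> A. X \<inter> PP (kap \<kappa> x) x \<in> II Op \<xi> (kap \<kappa> x) x (f (succ \<delta>) x)}"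
          using x HP by simp
      qed
      then have "H \<inter> ?B \<in> ?J" using b downward_II[OF Op, of \<kappa> A \<xi> \<beta>] unfolding downward_def by blast
      then show False using HB by (simp add: positive_def)
    qed
  qed
  then show ?case unfolding S_def by blast
qed

end

theorem theorem3p13:
  fixes \<kappa> A \<xi> \<alpha> :: "'k hset"
    and f :: "'k hset \<Rightarrow> 'k hset \<Rightarrow> 'k hset"
    and Op :: "'k hset \<Rightarrow> 'k hset \<Rightarrow> 'k hset set set \<Rightarrow> 'k hset set set"
  assumes "regular_uncountable \<kappa>"
    and "\<forall>a\<in>elts A. Ord a"
    and "|elts \<kappa>| \<le>o |elts A|"
    and "canonical_sequence \<kappa> A f"
    and "\<xi> \<in> elts \<kappa>"
    and "lt_card_suc \<alpha> A"
    and "Op \<in> {ineff_op, ramsey_op}"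
    and "PP \<kappa> A \<in> positive \<kappa> A (iterate (Pi_ideal \<xi> \<kappa> A) (Op \<kappa> A) (succ \<alpha>))"
  shows "\<forall>\<beta>\<in>elts (succ \<alpha>). \<forall>X\<in>positive \<kappa> A (iterate (Pi_ideal \<xi> \<kappa> A) (Op \<kappa> A) \<beta>).
    {x \<in> PP \<kappa> A. X \<inter> PP (kap \<kappa> x) x
        \<in> positive (kap \<kappa> x) x (iterate (Pi_ideal \<xi> (kap \<kappa> x) x) (Op (kap \<kappa> x) x) (f \<beta> x))}
      \<in> dual \<kappa> A (iterate (Pi_ideal \<xi> \<kappa> A) (Op \<kappa> A) (succ \<beta>))"
proof (intro ballI)
  fix \<beta> X assume b: "\<beta> \<in> elts (succ \<alpha>)" and X: "X \<in> positive \<kappa> A (II Op \<xi> \<kappa> A \<beta>)"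
  have C: "Cardinal \<kappa>" using assms(1) by (simp add: regular_uncountable_def)
  have O\<alpha>: "Ord \<alpha>" using assms(6) by (simp add: lt_card_suc_def)
  have O\<xi>: "Ord \<xi>" by (rule Ord_elt[OF Cardinal_Ord[OF C] assms(5)])
  have "zero \<in> elts (succ \<alpha>)" by (rule zero_in_Ord[OF Ord_succ[OF O\<alpha>] succ_neq_zero])
  then have "II Op \<xi> \<kappa> A zero \<subseteq> II Op \<xi> \<kappa> A (succ \<alpha>)"
    by (intro II_mono[OF assms(7) _ Ord_succ[OF O\<alpha>]]) (use assms(5) in auto)
  then have "PP \<kappa> A \<notin> Pi_ideal \<xi> \<kappa> A" using assms(8) by (auto simp: iterate_0 positive_def)
  then have ind: "indescribable \<xi> \<kappa> A (PP \<kappa> A)" by (simp add: Pi_ideal_def)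
  \<comment> \<open>The inclusion of \<kappa> in \<open>A\<close>, which is part of
    \<open>world\<close>, comes from the indescribability of \<open>PP \<kappa> A\<close>.\<close>
  have "world \<kappa> A"
    unfolding world_def using C regular_uncountable_nat[OF assms(1)] assms(2) indescribable_sub[OF C order_refl ind O\<xi>] by blast
  then interpret canonical_two_cardinal \<kappa> A \<xi> f "PP \<kappa> A"
    using assms(1,4,5) ind by unfold_locales auto
  have lt: "lt_card_suc \<beta> A" using b lt_sub[OF assms(6)] assms(6) by (auto simp: elts_succ)
  let ?D = "{x \<in> PP \<kappa> A. X \<inter> PP (kap \<kappa> x) x \<in> positive (kap \<kappa> x) x (II Op \<xi> (kap \<kappa> x) x (f \<beta> x))}"
  have "PP \<kappa> A - ?D = {x \<in> PP \<kappa> A. X \<inter> PP (kap \<kappa> x) x \<in> II Op \<xi> (kap \<kappa> x) x (f \<beta> x)}"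
    by (auto simp: positive_def)
  then show "?D \<in> dual \<kappa> A (II Op \<xi> \<kappa> A (succ \<beta>))"
    using reflection_of_positivity[OF assms(7) lt X] by (auto simp: dual_def)
qed

end
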